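(* Let $$E_c:=\sup\big\{E>0:\ \forall\vec u\in\mathcal H(B^c),\ \mathscr E(\vec u)\le E\implies\mathscr S_N(\cdot)\vec u\in L^5(\mathbb R,L^{10}(B^c))\big\}.$$ If $E_c<+\infty$, then there exists $\vec u_c\in\mathcal H(B^c)$, $\vec u_c\ne\vec0$, such that $\{\vec{\mathscr S}_N(t)\vec u_c:\ t\in\mathbb R\}$ has compact closure in $\mathcal H(B^c)$.
   Context: $B^c=\mathbb R^3\setminus B(0,1)$; $\mathcal H(B^c)$ is the space of radial pairs $(f,g)$ with $f\in L^6(B^c)$, $\nabla f\in L^2(B^c)$, $g\in L^2(B^c)$, normed by $(\int_{B^c}|\nabla f|^2+g^2)^{1/2}$. $\mathscr S_N$ is the (global) nonlinear flow of the defocusing equation $\partial_t^2u-\Delta u+u^5=0$ on $B^c$ with Neumann boundary condition $\partial_ru=0$ at $r=1$, and $\vec{\mathscr S}_N=(\mathscr S_N,\partial_t\mathscr S_N)$. For $\vec u=(u_0,u_1)$, $\mathscr E(\vec u)=\frac12\|\vec u\|^2_{\mathcal H(B^c)}+\frac16\|u_0\|^6_{L^6(B^c)}$. *)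

theory Defs
  imports "HOL-Analysis.Analysis"
begin

text \<open>Radial functions on the exterior domain B^c = {x in R^3. |x| >= 1} are represented
  by their radial profiles r \<mapsto> f r, r >= 1.  Integrals over B^c of radial functions are
  written in polar coordinates: the integral over B^c of h(|x|) dx equals
  4 pi times the integral over [1,oo) of h(r) r^2 dr.\<close>

type_synonym rfun = "real \<Rightarrow> real"
type_synonym hpair = "rfun \<times> rfun"

definition rint :: "rfun \<Rightarrow> ennreal" where
  "rint h = (\<integral>\<^sup>+ r. ennreal (4 * pi * r\<^sup>2 * h r) * indicator {1..} r \<partial>lborel)"

text \<open>f' is a (weak) radial derivative of f on [1,oo): f is locally absolutely continuous
  with derivative f'.\<close>
definition radial_deriv :: "rfun \<Rightarrow> rfun \<Rightarrow> bool" where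
  "radial_deriv f f' \<longleftrightarrow> (\<forall>r\<ge>1. (f' has_integral (f r - f 1)) {1..r})"

definition Dr :: "rfun \<Rightarrow> rfun" where
  "Dr f = (SOME f'. radial_deriv f f')"

definition in_H :: "hpair \<Rightarrow> bool" where
  "in_H U \<longleftrightarrow> (\<exists>f'. radial_deriv (fst U) f' \<and> rint (\<lambda>r. (f' r)\<^sup>2) < \<infinity>)
     \<and> rint (\<lambda>r. \<bar>fst U r\<bar> ^ 6) < \<infinity>
     \<and> snd U \<in> borel_measurable lborel \<and> rint (\<lambda>r. (snd U r)\<^sup>2) < \<infinity>"

definition Hnorm :: "hpair \<Rightarrow> real" where
  "Hnorm U = sqrt (enn2real (rint (\<lambda>r. (Dr (fst U) r)\<^sup>2)) + enn2real (rint (\<lambda>r. (snd U r)\<^sup>2)))"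

definition Hdiff :: "hpair \<Rightarrow> hpair \<Rightarrow> hpair" where
  "Hdiff U W = ((\<lambda>r. fst U r - fst W r), (\<lambda>r. snd U r - snd W r))"

definition energy :: "hpair \<Rightarrow> real" where
  "energy U = (1/2) * (Hnorm U)\<^sup>2 + (1/6) * enn2real (rint (\<lambda>r. \<bar>fst U r\<bar> ^ 6))"

definition in_L5L10 :: "real set \<Rightarrow> (real \<Rightarrow> rfun) \<Rightarrow> bool" where
  "in_L5L10 I u \<longleftrightarrow>
     (AE t in lborel. t \<in> I \<longrightarrow> rint (\<lambda>r. \<bar>u t r\<bar> ^ 10) < \<infinity>) \<and>
     (\<integral>\<^sup>+ t. indicator I t * ennreal (sqrt (enn2real (rint (\<lambda>r. \<bar>u t r\<bar> ^ 10)))) \<partial>lborel) < \<infinity>"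

text \<open>Radial C^1 test functions on R x [1,oo) with compact support (not required to vanish
  at the boundary r = 1: this encodes the Neumann condition weakly).\<close>
definition test_fun :: "(real \<Rightarrow> rfun) \<Rightarrow> (real \<Rightarrow> rfun) \<Rightarrow> (real \<Rightarrow> rfun) \<Rightarrow> bool" where
  "test_fun \<psi> \<psi>t \<psi>r \<longleftrightarrow>
     (\<forall>t r. ((\<lambda>(s,x). \<psi> s x) has_derivative (\<lambda>(a,b). \<psi>t t r * a + \<psi>r t r * b)) (at (t, r))) \<and>
     continuous_on UNIV (\<lambda>(t,r). \<psi>t t r) \<and> continuous_on UNIV (\<lambda>(t,r). \<psi>r t r) \<and>
     (\<exists>R. \<forall>t r. \<bar>t\<bar> > R \<or> \<bar>r\<bar> > R \<longrightarrow> \<psi> t r = 0)"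

text \<open>Finite-energy (Strichartz) solution of u_tt - Delta u + u^5 = 0 on B^c with Neumann
  boundary condition, radial, with initial data U0; v is the time derivative of u.\<close>
definition NLW_sol :: "(real \<Rightarrow> rfun) \<Rightarrow> (real \<Rightarrow> rfun) \<Rightarrow> hpair \<Rightarrow> bool" where
  "NLW_sol u v U0 \<longleftrightarrow>
     (\<forall>t. in_H (u t, v t)) \<and>
     (\<forall>t. ((\<lambda>s. Hnorm (Hdiff (u s, v s) (u t, v t))) \<longlongrightarrow> 0) (at t)) \<and>
     Hnorm (Hdiff (u 0, v 0) U0) = 0 \<and>
     (\<forall>a b. in_L5L10 {a..b} u) \<and>
     (\<exists>ux. (\<forall>t. radial_deriv (u t) (ux t)) \<and>
        (\<forall>\<psi> \<psi>t \<psi>r. test_fun \<psi> \<psi>t \<psi>r \<longrightarrow>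
           integrable (lborel :: (real \<times> real) measure)
              (\<lambda>(t,r). indicator {1..} r * r\<^sup>2 * (u t r * \<psi>t t r + v t r * \<psi> t r)) \<and>
           (\<integral>(t,r). indicator {1..} r * r\<^sup>2 * (u t r * \<psi>t t r + v t r * \<psi> t r) \<partial>lborel) = 0 \<and>
           integrable (lborel :: (real \<times> real) measure)
              (\<lambda>(t,r). indicator {1..} r * r\<^sup>2 *
                 (- v t r * \<psi>t t r + ux t r * \<psi>r t r + (u t r) ^ 5 * \<psi> t r)) \<and>
           (\<integral>(t,r). indicator {1..} r * r\<^sup>2 *
                 (- v t r * \<psi>t t r + ux t r * \<psi>r t r + (u t r) ^ 5 * \<psi> t r) \<partial>lborel) = 0))"

definition NLW_Neumann_flow :: "(real \<Rightarrow> hpair \<Rightarrow> hpair) \<Rightarrow> bool" where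
  "NLW_Neumann_flow S \<longleftrightarrow>
     (\<forall>U. in_H U \<longrightarrow> NLW_sol (\<lambda>t. fst (S t U)) (\<lambda>t. snd (S t U)) U)"

definition critical_energy :: "(real \<Rightarrow> hpair \<Rightarrow> hpair) \<Rightarrow> ereal" where
  "critical_energy S = Sup (ereal ` {E. E > 0 \<and>
      (\<forall>U. in_H U \<and> energy U \<le> E \<longrightarrow> in_L5L10 UNIV (\<lambda>t. fst (S t U)))})"

end

theory Submission
  imports Defs
begin

text \<open>Every finite-energy radial solution scatters, whatever its size, so that \<open>E\<^sub>c = \<infinity>\<close>.
  Put \<open>w = r u\<close>; then \<open>w\<^sub>t\<^sub>t - w\<^sub>r\<^sub>r + w\<^sup>5 / r\<^sup>4 = 0\<close> for \<open>r > 1\<close> and \<open>w\<^sub>r = w\<close> at \<open>r = 1\<close>.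
  The Morawetz multiplier \<open>(1 - 1/r) w\<^sub>r + w / (2 r\<^sup>2)\<close> controls
  \<open>\<integral>\<integral> w\<^sup>6 / r\<^sup>5\<close>, that is \<open>\<integral>\<integral> u\<^sup>6 r\<close>, and \<open>\<integral> w(t, 1)\<^sup>2 dt\<close> by the energy.
  Integrating along characteristics bounds \<open>\<bar>w(t, r)\<bar>\<close> by the integral over \<open>[t - r, t + r]\<close> of a fixed
  function in \<open>L\<^sup>2\<close>, and a Hardy inequality then bounds \<open>\<integral> sup\<^sub>r u\<^sup>4 r dt\<close>. Since
  \<open>(\<integral> u\<^sup>1\<^sup>0 r\<^sup>2 dr)\<^sup>1\<^sup>/\<^sup>2 \<le> sup\<^sub>r u\<^sup>4 r + \<integral> u\<^sup>6 r dr\<close>, the \<open>L\<^sup>5L\<^sup>1\<^sup>0\<close> norm is finite.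
  Multipliers need \<open>C\<^sup>2\<close> functions: mollifying in time alone makes a weak solution \<open>C\<^sup>2\<close> in both
  variables, because the equation then expresses \<open>w\<^sub>r\<^sub>r\<close> through time derivatives, at the price of a small
  error in the nonlinearity.\<close>

section \<open>Hardy inequalities\<close>

text \<open>The function in \<open>L^2\<close> behind the pointwise bound has the following origin.
  Along an incoming ray \<open>t + r = const\<close> the combination \<open>w_t + w_r\<close>
  changes only through \<open>w^5 / r^4\<close>, and at the foot of the ray the Robin condition
  makes it \<open>w_t + w\<close>. So \<open>w_t + w_r\<close> is controlled by a function of
  \<open>t + r\<close> alone, made of the boundary traces of \<open>w\<close> and \<open>w_t\<close>
  and of the source integrated along the ray. The trace of \<open>w_t\<close> requires a second
  multiplier, \<open>w_r\<close>, which does not vanish on \<open>r = 1\<close>; the source is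
  handled by Cauchy-Schwarz against the Morawetz bulk together with a Hardy inequality on the ray.
  The sign in \<open>w_r = w\<close> is decisive: the conserved energy is that of the half-line plus
  \<open>w(t, 1)^2 / 2\<close>, a sum of nonnegative terms. The regularised equation holds with a
  uniformly small error only on bounded sets, so every estimate is made on the triangle
  \<open>0 \<le> t\<close>, \<open>1 \<le> r\<close>, \<open>t + r \<le> X\<close>, whose third side
  is characteristic and carries a nonnegative energy flux; nothing has to be known at infinity. All
  constants are independent of \<open>X\<close>, and negative times are reached by
  reflection.\<close>

lemma borel_measurable_indicator_Icc [measurable (raw)]:
  fixes f g h :: "'a \<Rightarrow> real"
  assumes [measurable]: "f \<in> borel_measurable M" "g \<in> borel_measurable M" "h \<in> borel_measurable M"
  shows "(\<lambda>x. indicator {f x..g x} (h x) :: ennreal) \<in> borel_measurable M"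
    and "(\<lambda>x. indicator {f x..} (h x) :: ennreal) \<in> borel_measurable M"
    and "(\<lambda>x. indicator {..g x} (h x) :: ennreal) \<in> borel_measurable M"
  unfolding indicator_def of_bool_def atLeastAtMost_iff atLeast_iff atMost_iff by measurable

lemma nn_integral_inverse_sqrt_le:
  assumes "x \<ge> 0"
  shows "(\<integral>\<^sup>+y. ennreal (1 / sqrt (1 + y)) * indicator {0..x} y \<partial>lborel) \<le> ennreal (2 * sqrt (1 + x))"
proof -
  have "(\<integral>\<^sup>+y. ennreal (1 / sqrt (1 + y)) * indicator {0..x} y \<partial>lborel)
      = ennreal (2 * sqrt (1 + x) - 2 * sqrt (1 + 0))"
    using assms
    by (intro nn_integral_FTC_Icc) (auto intro!: derivative_eq_intros simp: divide_simps)
  also have "\<dots> \<le> ennreal (2 * sqrt (1 + x))"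
    by (intro ennreal_leI) auto
  finally show ?thesis .
qed

lemma nn_integral_tail_sqrt:
  assumes "y \<ge> 0"
  shows "(\<integral>\<^sup>+x. ennreal (2 * sqrt (1 + x) / (1 + x)\<^sup>2) * indicator {y..} x \<partial>lborel) = ennreal (4 / sqrt (1 + y))"
proof -
  have "(\<integral>\<^sup>+x. ennreal (2 * sqrt (1 + x) / (1 + x)\<^sup>2) * indicator {y..} x \<partial>lborel)
      = ennreal (0 - (- 4 / sqrt (1 + y)))"
  proof (intro nn_integral_FTC_atLeast)
    fix x assume "y \<le> x"
    with assms have x: "0 < 1 + x" by simp
    define q where "q = sqrt (1 + x)"
    from x have q: "q > 0" "1 + x = q * q" by (simp_all add: q_def)
    have "2 / (q * (q * q)) = 2 * q / (1 + x)\<^sup>2"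
      using q by (simp add: power2_eq_square divide_simps)
    then have s: "4 * (inverse (sqrt (1 + x)) / 2) / (sqrt (1 + x) * sqrt (1 + x)) = 2 * sqrt (1 + x) / (1 + x)\<^sup>2"
      by (simp add: q_def divide_simps)
    have "((\<lambda>x. - 4 / sqrt (1 + x)) has_real_derivative 4 * (inverse (sqrt (1 + x)) / 2) / (sqrt (1 + x) * sqrt (1 + x))) (at x)"
      using x by (auto intro!: derivative_eq_intros)
    then show "((\<lambda>x. - 4 / sqrt (1 + x)) has_real_derivative 2 * sqrt (1 + x) / (1 + x)\<^sup>2) (at x)"
      unfolding s .
    from x show "0 \<le> 2 * sqrt (1 + x) / (1 + x)\<^sup>2" by auto
  next
    show "((\<lambda>x::real. - 4 / sqrt (1 + x)) \<longlongrightarrow> 0) at_top"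
      by (intro tendsto_divide_0[OF tendsto_const] filterlim_at_top_imp_at_infinity
            filterlim_compose[OF sqrt_at_top] filterlim_tendsto_add_at_top[OF tendsto_const] filterlim_ident)
  qed auto
  then show ?thesis by simp
qed

text \<open>Schur test with the weight \<open>sqrt (1 + y)\<close>: Cauchy-Schwarz in the inner
  integral costs the factor \<open>2 * sqrt (1 + x)\<close>, and after exchanging the integrals the
  tail in \<open>x\<close> equals \<open>4 / sqrt (1 + y)\<close>, which cancels the weight and
  leaves the constant 4.\<close>

lemma Hardy_inequality_shifted:
  fixes G :: "real \<Rightarrow> ennreal"
  assumes [measurable]: "G \<in> borel_measurable borel"
  shows "(\<integral>\<^sup>+x. (\<integral>\<^sup>+y. G y * indicator {0..x} y \<partial>lborel)\<^sup>2 * ennreal (1 / (1 + x)\<^sup>2) * indicator {0..} x \<partial>lborel)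
    \<le> 4 * (\<integral>\<^sup>+y. (G y)\<^sup>2 * indicator {0..} y \<partial>lborel)"
proof -
  \<comment> \<open>The squares of \<open>a\<close> and \<open>b\<close> are the weight and its
    reciprocal; \<open>max 0\<close> keeps \<open>a y * b y = 1\<close> valid for every real
    \<open>y\<close>.\<close>
  define a where "a y = ennreal (sqrt (sqrt (1 + max 0 y)))" for y
  define b where "b y = ennreal (1 / sqrt (sqrt (1 + max 0 y)))" for y
  have ab: "a y * b y = 1" for y
    by (simp add: a_def b_def ennreal_mult[symmetric])
  have a2: "(a y)\<^sup>2 = ennreal (sqrt (1 + y))" and b2: "(b y)\<^sup>2 = ennreal (1 / sqrt (1 + y))" if "y \<ge> 0" for y
    using that by (simp_all add: a_def b_def ennreal_power power_divide)
  have [measurable]: "a \<in> borel_measurable borel" "b \<in> borel_measurable borel"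
    unfolding a_def b_def by measurable
  have cs: "(\<integral>\<^sup>+y. G y * indicator {0..x} y \<partial>lborel)\<^sup>2
      \<le> (\<integral>\<^sup>+y. (G y)\<^sup>2 * (a y)\<^sup>2 * indicator {0..x} y \<partial>lborel) * ennreal (2 * sqrt (1 + x))" if "x \<ge> 0" for x
  proof -
    have "(\<integral>\<^sup>+y. G y * indicator {0..x} y \<partial>lborel)
       = (\<integral>\<^sup>+y. (G y * a y * indicator {0..x} y) * (b y * indicator {0..x} y) \<partial>lborel)"
      by (intro nn_integral_cong) (auto simp: indicator_def ab mult.assoc)
    also have "\<dots>\<^sup>2 \<le> (\<integral>\<^sup>+y. (G y * a y * indicator {0..x} y)\<^sup>2 \<partial>lborel) * (\<integral>\<^sup>+y. (b y * indicator {0..x} y)\<^sup>2 \<partial>lborel)"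
      by (intro Cauchy_Schwarz_nn_integral) measurable
    also have "(\<integral>\<^sup>+y. (b y * indicator {0..x} y)\<^sup>2 \<partial>lborel) = (\<integral>\<^sup>+y. ennreal (1 / sqrt (1 + y)) * indicator {0..x} y \<partial>lborel)"
      by (intro nn_integral_cong) (auto simp: indicator_def b2)
    also have "(\<integral>\<^sup>+y. (G y * a y * indicator {0..x} y)\<^sup>2 \<partial>lborel) = (\<integral>\<^sup>+y. (G y)\<^sup>2 * (a y)\<^sup>2 * indicator {0..x} y \<partial>lborel)"
      by (intro nn_integral_cong) (auto simp: indicator_def power_mult_distrib)
    finally show ?thesis
      using nn_integral_inverse_sqrt_le[OF that] by (meson dual_order.trans mult_left_mono zero_le)
  qed
  have "(\<integral>\<^sup>+x. (\<integral>\<^sup>+y. G y * indicator {0..x} y \<partial>lborel)\<^sup>2 * ennreal (1 / (1 + x)\<^sup>2) * indicator {0..} x \<partial>lborel)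
    \<le> (\<integral>\<^sup>+x. (\<integral>\<^sup>+y. (G y)\<^sup>2 * (a y)\<^sup>2 * indicator {0..x} y \<partial>lborel) * ennreal (2 * sqrt (1 + x) / (1 + x)\<^sup>2) * indicator {0..} x \<partial>lborel)"
  proof (intro nn_integral_mono)
    fix x :: real
    show "(\<integral>\<^sup>+y. G y * indicator {0..x} y \<partial>lborel)\<^sup>2 * ennreal (1 / (1 + x)\<^sup>2) * indicator {0..} x
      \<le> (\<integral>\<^sup>+y. (G y)\<^sup>2 * (a y)\<^sup>2 * indicator {0..x} y \<partial>lborel) * ennreal (2 * sqrt (1 + x) / (1 + x)\<^sup>2) * indicator {0..} x"
    proof (cases "x \<ge> 0")
      case True
      have "ennreal (2 * sqrt (1 + x) / (1 + x)\<^sup>2) = ennreal (2 * sqrt (1 + x)) * ennreal (1 / (1 + x)\<^sup>2)"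
        using True by (simp add: ennreal_mult[symmetric])
      then show ?thesis
        using mult_right_mono[OF cs[OF True], of "ennreal (1 / (1 + x)\<^sup>2)"] True by (simp add: mult.assoc)
    qed (auto simp: indicator_def)
  qed
  also have "\<dots> = (\<integral>\<^sup>+x. (\<integral>\<^sup>+y. (G y)\<^sup>2 * (a y)\<^sup>2 * (ennreal (2 * sqrt (1 + x) / (1 + x)\<^sup>2) * indicator {0..x} y) \<partial>lborel) \<partial>lborel)"
    by (subst nn_integral_multc[symmetric], measurable, subst nn_integral_multc[symmetric], measurable)
       (auto intro!: nn_integral_cong simp: indicator_def)
  also have "\<dots> = (\<integral>\<^sup>+y. (\<integral>\<^sup>+x. (G y)\<^sup>2 * (a y)\<^sup>2 * (ennreal (2 * sqrt (1 + x) / (1 + x)\<^sup>2) * indicator {0..x} y) \<partial>lborel) \<partial>lborel)"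
    by (intro lborel_pair.Fubini') measurable
  also have "\<dots> = (\<integral>\<^sup>+y. 4 * ((G y)\<^sup>2 * indicator {0..} y) \<partial>lborel)"
  proof (intro nn_integral_cong)
    fix y :: real
    have "(\<integral>\<^sup>+x. (G y)\<^sup>2 * (a y)\<^sup>2 * (ennreal (2 * sqrt (1 + x) / (1 + x)\<^sup>2) * indicator {0..x} y) \<partial>lborel)
      = (G y)\<^sup>2 * (a y)\<^sup>2 * indicator {0..} y * (\<integral>\<^sup>+x. ennreal (2 * sqrt (1 + x) / (1 + x)\<^sup>2) * indicator {y..} x \<partial>lborel)"
      by (subst nn_integral_cmult[symmetric]) (auto intro!: nn_integral_cong simp: indicator_def)
    also have "\<dots> = 4 * ((G y)\<^sup>2 * indicator {0..} y)"
    proof (cases "y \<ge> 0")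
      case True
      have "(a y)\<^sup>2 * ennreal (4 / sqrt (1 + y)) = 4"
        using True by (simp add: a2 ennreal_mult[symmetric])
      then show ?thesis using True
        unfolding nn_integral_tail_sqrt[OF True] by (simp add: mult.assoc) (simp add: mult.commute)
    qed auto
    finally show "(\<integral>\<^sup>+x. (G y)\<^sup>2 * (a y)\<^sup>2 * (ennreal (2 * sqrt (1 + x) / (1 + x)\<^sup>2) * indicator {0..x} y) \<partial>lborel)
       = 4 * ((G y)\<^sup>2 * indicator {0..} y)" .
  qed
  also have "\<dots> = 4 * (\<integral>\<^sup>+y. (G y)\<^sup>2 * indicator {0..} y \<partial>lborel)"
    by (subst nn_integral_cmult) auto
  finally show ?thesis .
qed


lemma Hardy_inequality_right:
  fixes G :: "real \<Rightarrow> ennreal"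
  assumes [measurable]: "G \<in> borel_measurable borel"
  shows "(\<integral>\<^sup>+x. (\<integral>\<^sup>+y. G y * indicator {s..x} y \<partial>lborel)\<^sup>2 * ennreal (1 / (1 + (x - s))\<^sup>2) * indicator {s..} x \<partial>lborel)
    \<le> 4 * (\<integral>\<^sup>+y. (G y)\<^sup>2 \<partial>lborel)"
proof -
  have "(\<integral>\<^sup>+x. (\<integral>\<^sup>+y. G y * indicator {s..x} y \<partial>lborel)\<^sup>2 * ennreal (1 / (1 + (x - s))\<^sup>2) * indicator {s..} x \<partial>lborel)
    = (\<integral>\<^sup>+x. (\<integral>\<^sup>+y. G (s + 1 * y) * indicator {s..s + 1 * x} (s + 1 * y) \<partial>lborel)\<^sup>2 * ennreal (1 / (1 + (s + 1 * x - s))\<^sup>2) * indicator {s..} (s + 1 * x) \<partial>lborel)"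
    by (subst nn_integral_real_affine[where c = 1 and t = s], measurable, simp,
        subst nn_integral_real_affine[where c = 1 and t = s]) auto
  also have "\<dots> = (\<integral>\<^sup>+x. (\<integral>\<^sup>+y. G (s + y) * indicator {0..x} y \<partial>lborel)\<^sup>2 * ennreal (1 / (1 + x)\<^sup>2) * indicator {0..} x \<partial>lborel)"
    by (intro nn_integral_cong arg_cong2[where f = "(*)"] arg_cong[where f = "\<lambda>x. x\<^sup>2"]) (auto simp: indicator_def)
  also have "\<dots> \<le> 4 * (\<integral>\<^sup>+y. (G (s + y))\<^sup>2 * indicator {0..} y \<partial>lborel)"
    by (intro Hardy_inequality_shifted) measurable
  also have "\<dots> \<le> 4 * (\<integral>\<^sup>+y. (G (s + 1 * y))\<^sup>2 \<partial>lborel)"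
    by (intro mult_left_mono nn_integral_mono) (auto simp: indicator_def)
  also have "\<dots> = 4 * (\<integral>\<^sup>+y. (G y)\<^sup>2 \<partial>lborel)"
    by (subst (2) nn_integral_real_affine[where c = 1 and t = s]) auto
  finally show ?thesis .
qed

lemma Hardy_inequality_left:
  fixes G :: "real \<Rightarrow> ennreal"
  assumes [measurable]: "G \<in> borel_measurable borel"
  shows "(\<integral>\<^sup>+x. (\<integral>\<^sup>+y. G y * indicator {x..s} y \<partial>lborel)\<^sup>2 * ennreal (1 / (1 + (s - x))\<^sup>2) * indicator {..s} x \<partial>lborel)
    \<le> 4 * (\<integral>\<^sup>+y. (G y)\<^sup>2 \<partial>lborel)"
proof -
  have "(\<integral>\<^sup>+x. (\<integral>\<^sup>+y. G y * indicator {x..s} y \<partial>lborel)\<^sup>2 * ennreal (1 / (1 + (s - x))\<^sup>2) * indicator {..s} x \<partial>lborel)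
    = (\<integral>\<^sup>+x. (\<integral>\<^sup>+y. G (s + (-1) * y) * indicator {s + (-1) * x..s} (s + (-1) * y) \<partial>lborel)\<^sup>2 * ennreal (1 / (1 + (s - (s + (-1) * x)))\<^sup>2) * indicator {..s} (s + (-1) * x) \<partial>lborel)"
    by (subst nn_integral_real_affine[where c = "-1" and t = s], measurable, simp,
        subst nn_integral_real_affine[where c = "-1" and t = s]) auto
  also have "\<dots> = (\<integral>\<^sup>+x. (\<integral>\<^sup>+y. G (s - y) * indicator {0..x} y \<partial>lborel)\<^sup>2 * ennreal (1 / (1 + x)\<^sup>2) * indicator {0..} x \<partial>lborel)"
    by (intro nn_integral_cong arg_cong2[where f = "(*)"] arg_cong[where f = "\<lambda>x. x\<^sup>2"]) (auto simp: indicator_def)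
  also have "\<dots> \<le> 4 * (\<integral>\<^sup>+y. (G (s - y))\<^sup>2 * indicator {0..} y \<partial>lborel)"
    by (intro Hardy_inequality_shifted) measurable
  also have "\<dots> \<le> 4 * (\<integral>\<^sup>+y. (G (s + (-1) * y))\<^sup>2 \<partial>lborel)"
    by (intro mult_left_mono nn_integral_mono) (auto simp: indicator_def)
  also have "\<dots> = 4 * (\<integral>\<^sup>+y. (G y)\<^sup>2 \<partial>lborel)"
    by (subst (2) nn_integral_real_affine[where c = "-1" and t = s]) auto
  finally show ?thesis .
qed

lemma ennreal_sum_power2_le: "((a::ennreal) + b)\<^sup>2 \<le> 2 * a\<^sup>2 + 2 * b\<^sup>2"
proof (cases "a = \<infinity> \<or> b = \<infinity>")
  case False
  then obtain x y where xy: "a = ennreal x" "b = ennreal y" "x \<ge> 0" "y \<ge> 0"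
    by (metis ennreal_cases infinity_ennreal_def)
  have "0 \<le> (x - y)\<^sup>2" by simp
  then have "(x + y)\<^sup>2 \<le> 2 * x\<^sup>2 + 2 * y\<^sup>2"
    by (simp add: power2_eq_square algebra_simps)
  then have "ennreal ((x + y)\<^sup>2) \<le> ennreal (2 * x\<^sup>2 + 2 * y\<^sup>2)"
    by (rule ennreal_leI)
  also have "\<dots> = 2 * a\<^sup>2 + 2 * b\<^sup>2"
    using xy by (simp add: ennreal_power ennreal_mult)
  also have "ennreal ((x + y)\<^sup>2) = (a + b)\<^sup>2"
    using xy by (simp flip: ennreal_power)
  finally show ?thesis .
qed (auto simp: ennreal_mult_top ennreal_top_mult power2_eq_square)

text \<open>The integration starts at \<open>max 1 (x / 2)\<close>, which is at least
  \<open>(1 + x) / 3\<close> because the latter is a convex combination of \<open>1\<close> and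
  \<open>x / 2\<close>. This converts the primitive \<open>1 / (2 * m^2)\<close> into the Hardy
  weight with constant 9/2.\<close>

lemma nn_integral_inverse_cube_le:
  assumes "x \<ge> 0"
  shows "(\<integral>\<^sup>+r. ennreal (1 / r ^ 3) * (indicator {1..} r * indicator {..2 * r} x) \<partial>lborel) \<le> ennreal (9 / 2) * ennreal (1 / (1 + x)\<^sup>2)"
proof -
  define m where "m = max 1 (x / 2)"
  have m: "m \<ge> 1" "(1 + x) / 3 \<le> m" using assms by (auto simp: m_def)
  have "(\<integral>\<^sup>+r. ennreal (1 / r ^ 3) * (indicator {1..} r * indicator {..2 * r} x) \<partial>lborel)
     = (\<integral>\<^sup>+r. ennreal (1 / r ^ 3) * indicator {m..} r \<partial>lborel)"
    by (intro nn_integral_cong) (auto simp: indicator_def m_def)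
  also have "\<dots> = ennreal (0 - (- 1 / (2 * m\<^sup>2)))"
  proof (intro nn_integral_FTC_atLeast)
    fix r assume "m \<le> r"
    with m have "r > 0" by simp
    then show "((\<lambda>r. - 1 / (2 * r\<^sup>2)) has_real_derivative 1 / r ^ 3) (at r)"
      by (auto intro!: derivative_eq_intros simp: field_simps power2_eq_square power3_eq_cube power4_eq_xxxx)
    show "0 \<le> 1 / r ^ 3" using \<open>r > 0\<close> by simp
  next
    have "((\<lambda>r::real. - (1 / 2) * (inverse r)\<^sup>2) \<longlongrightarrow> - (1 / 2) * 0\<^sup>2) at_top"
      by (intro tendsto_intros tendsto_inverse_0_at_top filterlim_ident)
    then show "((\<lambda>r::real. - 1 / (2 * r\<^sup>2)) \<longlongrightarrow> 0) at_top"
      by (simp add: field_simps)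
  qed auto
  also have "\<dots> \<le> ennreal ((9 / 2) * (1 / (1 + x)\<^sup>2))"
  proof (intro ennreal_leI)
    have "((1 + x) / 3)\<^sup>2 \<le> m\<^sup>2" using m assms by (intro power_mono) auto
    then have "(1 + x)\<^sup>2 \<le> 9 * m\<^sup>2" by (simp add: power_divide)
    then show "0 - (- 1 / (2 * m\<^sup>2)) \<le> (9 / 2) * (1 / (1 + x)\<^sup>2)"
      using m assms by (simp add: field_simps)
  qed
  also have "\<dots> = ennreal (9 / 2) * ennreal (1 / (1 + x)\<^sup>2)"
    by (rule ennreal_mult) auto
  finally show ?thesis .
qed


lemma nn_integral_shift:
  fixes a :: real
  assumes "f \<in> borel_measurable borel"
  shows "(\<integral>\<^sup>+x. f (x + a) \<partial>lborel) = (\<integral>\<^sup>+x. f x \<partial>lborel)"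
  using nn_integral_real_affine[OF assms, of 1 a] by (simp add: add.commute)

text \<open>For fixed \<open>r\<close> the substitution \<open>x = t + r\<close> makes the squared
  integral depend on \<open>x\<close> alone, so \<open>r\<close> can be integrated first: the mass
  of \<open>1 / r ^ 3\<close> over those \<open>r\<close> whose interval
  \<open>[x - 2 * r, x]\<close> contains \<open>s\<close> is bounded by the Hardy weight at distance
  \<open>x - s\<close>. The constant is \<open>(9 / 2) * 4\<close>.\<close>

lemma Hardy_cone_right:
  fixes G :: "real \<Rightarrow> ennreal"
  assumes [measurable]: "G \<in> borel_measurable borel"
  shows "(\<integral>\<^sup>+r. (\<integral>\<^sup>+t. (\<integral>\<^sup>+y. G y * indicator {s..t + r} y \<partial>lborel)\<^sup>2 *
      (ennreal (1 / r ^ 3) * indicator {1..} r * indicator {t - r..t + r} s) \<partial>lborel) \<partial>lborel)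
     \<le> 18 * (\<integral>\<^sup>+y. (G y)\<^sup>2 \<partial>lborel)"
proof -
  let ?A = "\<lambda>x. (\<integral>\<^sup>+y. G y * indicator {s..x} y \<partial>lborel)\<^sup>2"
  have "(\<integral>\<^sup>+r. (\<integral>\<^sup>+t. ?A (t + r) * (ennreal (1 / r ^ 3) * indicator {1..} r * indicator {t - r..t + r} s) \<partial>lborel) \<partial>lborel)
    = (\<integral>\<^sup>+r. (\<integral>\<^sup>+x. ?A x * (ennreal (1 / r ^ 3) * indicator {1..} r * indicator {x - 2 * r..x} s) \<partial>lborel) \<partial>lborel)"
  proof (rule nn_integral_cong)
    fix r :: real
    show "(\<integral>\<^sup>+t. ?A (t + r) * (ennreal (1 / r ^ 3) * indicator {1..} r * indicator {t - r..t + r} s) \<partial>lborel)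
      = (\<integral>\<^sup>+x. ?A x * (ennreal (1 / r ^ 3) * indicator {1..} r * indicator {x - 2 * r..x} s) \<partial>lborel)"
      by (subst nn_integral_shift[symmetric, where a = r and f = "\<lambda>x. ?A x * (ennreal (1 / r ^ 3) * indicator {1..} r * indicator {x - 2 * r..x} s)"])
        simp_all
  qed
  also have "\<dots> = (\<integral>\<^sup>+x. (\<integral>\<^sup>+r. ?A x * (ennreal (1 / r ^ 3) * indicator {1..} r * indicator {x - 2 * r..x} s) \<partial>lborel) \<partial>lborel)"
    by (intro lborel_pair.Fubini') measurable
  also have "\<dots> \<le> (\<integral>\<^sup>+x. ennreal (9 / 2) * (?A x * ennreal (1 / (1 + (x - s))\<^sup>2) * indicator {s..} x) \<partial>lborel)"
  proof (intro nn_integral_mono)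
    fix x :: real
    have "(\<integral>\<^sup>+r. ?A x * (ennreal (1 / r ^ 3) * indicator {1..} r * indicator {x - 2 * r..x} s) \<partial>lborel)
       = ?A x * indicator {s..} x * (\<integral>\<^sup>+r. ennreal (1 / r ^ 3) * (indicator {1..} r * indicator {..2 * r} (x - s)) \<partial>lborel)"
      by (subst nn_integral_cmult[symmetric]) (auto intro!: nn_integral_cong simp: indicator_def)
    also have "\<dots> \<le> ennreal (9 / 2) * (?A x * ennreal (1 / (1 + (x - s))\<^sup>2) * indicator {s..} x)"
    proof (cases "s \<le> x")
      case True
      then show ?thesis
        using mult_left_mono[OF nn_integral_inverse_cube_le[of "x - s"], of "?A x"]
        by (simp add: mult_ac)
    qed auto
    finally show "(\<integral>\<^sup>+r. ?A x * (ennreal (1 / r ^ 3) * indicator {1..} r * indicator {x - 2 * r..x} s) \<partial>lborel)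
      \<le> ennreal (9 / 2) * (?A x * ennreal (1 / (1 + (x - s))\<^sup>2) * indicator {s..} x)" .
  qed
  also have "\<dots> = ennreal (9 / 2) * (\<integral>\<^sup>+x. ?A x * ennreal (1 / (1 + (x - s))\<^sup>2) * indicator {s..} x \<partial>lborel)"
    by (intro nn_integral_cmult) measurable
  also have "\<dots> \<le> ennreal (9 / 2) * (4 * (\<integral>\<^sup>+y. (G y)\<^sup>2 \<partial>lborel))"
    by (intro mult_left_mono Hardy_inequality_right) auto
  also have "\<dots> = 18 * (\<integral>\<^sup>+y. (G y)\<^sup>2 \<partial>lborel)"
  proof -
    have "ennreal (9 / 2) * ennreal 4 = ennreal (9 / 2 * 4)"
      by (intro ennreal_mult[symmetric]) auto
    then have "ennreal (9 / 2) * 4 = 18" by simp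
    then show ?thesis by (simp add: mult.assoc[symmetric])
  qed
  finally show ?thesis .
qed

text \<open>The same computation at the lower endpoint, with \<open>x = t - r\<close>.\<close>

lemma Hardy_cone_left:
  fixes G :: "real \<Rightarrow> ennreal"
  assumes [measurable]: "G \<in> borel_measurable borel"
  shows "(\<integral>\<^sup>+r. (\<integral>\<^sup>+t. (\<integral>\<^sup>+y. G y * indicator {t - r..s} y \<partial>lborel)\<^sup>2 *
      (ennreal (1 / r ^ 3) * indicator {1..} r * indicator {t - r..t + r} s) \<partial>lborel) \<partial>lborel)
     \<le> 18 * (\<integral>\<^sup>+y. (G y)\<^sup>2 \<partial>lborel)"
proof -
  let ?A = "\<lambda>x. (\<integral>\<^sup>+y. G y * indicator {x..s} y \<partial>lborel)\<^sup>2"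
  have "(\<integral>\<^sup>+r. (\<integral>\<^sup>+t. ?A (t - r) * (ennreal (1 / r ^ 3) * indicator {1..} r * indicator {t - r..t + r} s) \<partial>lborel) \<partial>lborel)
    = (\<integral>\<^sup>+r. (\<integral>\<^sup>+x. ?A x * (ennreal (1 / r ^ 3) * indicator {1..} r * indicator {x..x + 2 * r} s) \<partial>lborel) \<partial>lborel)"
  proof (rule nn_integral_cong)
    fix r :: real
    show "(\<integral>\<^sup>+t. ?A (t - r) * (ennreal (1 / r ^ 3) * indicator {1..} r * indicator {t - r..t + r} s) \<partial>lborel)
      = (\<integral>\<^sup>+x. ?A x * (ennreal (1 / r ^ 3) * indicator {1..} r * indicator {x..x + 2 * r} s) \<partial>lborel)"
      by (subst nn_integral_shift[symmetric, where a = "- r" and f = "\<lambda>x. ?A x * (ennreal (1 / r ^ 3) * indicator {1..} r * indicator {x..x + 2 * r} s)"])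
        (simp_all add: algebra_simps)
  qed
  also have "\<dots> = (\<integral>\<^sup>+x. (\<integral>\<^sup>+r. ?A x * (ennreal (1 / r ^ 3) * indicator {1..} r * indicator {x..x + 2 * r} s) \<partial>lborel) \<partial>lborel)"
    by (intro lborel_pair.Fubini') measurable
  also have "\<dots> \<le> (\<integral>\<^sup>+x. ennreal (9 / 2) * (?A x * ennreal (1 / (1 + (s - x))\<^sup>2) * indicator {..s} x) \<partial>lborel)"
  proof (intro nn_integral_mono)
    fix x :: real
    have "(\<integral>\<^sup>+r. ?A x * (ennreal (1 / r ^ 3) * indicator {1..} r * indicator {x..x + 2 * r} s) \<partial>lborel)
       = ?A x * indicator {..s} x * (\<integral>\<^sup>+r. ennreal (1 / r ^ 3) * (indicator {1..} r * indicator {..2 * r} (s - x)) \<partial>lborel)"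
      by (subst nn_integral_cmult[symmetric]) (auto intro!: nn_integral_cong simp: indicator_def)
    also have "\<dots> \<le> ennreal (9 / 2) * (?A x * ennreal (1 / (1 + (s - x))\<^sup>2) * indicator {..s} x)"
    proof (cases "x \<le> s")
      case True
      then show ?thesis
        using mult_left_mono[OF nn_integral_inverse_cube_le[of "s - x"], of "?A x"]
        by (simp add: mult_ac)
    qed auto
    finally show "(\<integral>\<^sup>+r. ?A x * (ennreal (1 / r ^ 3) * indicator {1..} r * indicator {x..x + 2 * r} s) \<partial>lborel)
      \<le> ennreal (9 / 2) * (?A x * ennreal (1 / (1 + (s - x))\<^sup>2) * indicator {..s} x)" .
  qed
  also have "\<dots> = ennreal (9 / 2) * (\<integral>\<^sup>+x. ?A x * ennreal (1 / (1 + (s - x))\<^sup>2) * indicator {..s} x \<partial>lborel)"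
    by (intro nn_integral_cmult) measurable
  also have "\<dots> \<le> ennreal (9 / 2) * (4 * (\<integral>\<^sup>+y. (G y)\<^sup>2 \<partial>lborel))"
    by (intro mult_left_mono Hardy_inequality_left) auto
  also have "\<dots> = 18 * (\<integral>\<^sup>+y. (G y)\<^sup>2 \<partial>lborel)"
  proof -
    have "ennreal (9 / 2) * ennreal 4 = ennreal (9 / 2 * 4)"
      by (intro ennreal_mult[symmetric]) auto
    then have "ennreal (9 / 2) * 4 = 18" by simp
    then show ?thesis by (simp add: mult.assoc[symmetric])
  qed
  finally show ?thesis .
qed

section \<open>Integrals over the intervals \<open>[t - r, t + r]\<close> cut out by light
  cones\<close>

definition cone_integral :: "(real \<Rightarrow> ennreal) \<Rightarrow> real \<Rightarrow> real \<Rightarrow> ennreal" where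
  "cone_integral G t r = (\<integral>\<^sup>+y. G y * indicator {t - r..t + r} y \<partial>lborel)"

lemma cone_integral_measurable [measurable (raw)]:
  assumes [measurable]: "G \<in> borel_measurable borel" "f \<in> borel_measurable M" "g \<in> borel_measurable M"
  shows "(\<lambda>x. cone_integral G (f x) (g x)) \<in> borel_measurable M"
  unfolding cone_integral_def by measurable

lemma cone_integral_power2_le:
  assumes [measurable]: "G \<in> borel_measurable borel" and r: "r \<ge> 0"
  shows "(cone_integral G t r)\<^sup>2 \<le> ennreal (2 * r) * (\<integral>\<^sup>+y. (G y)\<^sup>2 * indicator {t - r..t + r} y \<partial>lborel)"
proof -
  have 1: "cone_integral G t r = (\<integral>\<^sup>+y. (G y * indicator {t - r..t + r} y) * indicator {t - r..t + r} y \<partial>lborel)"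
    unfolding cone_integral_def by (intro nn_integral_cong) (simp split: split_indicator)
  have "(\<integral>\<^sup>+y. (indicator {t - r..t + r} y)\<^sup>2 \<partial>lborel) = (\<integral>\<^sup>+y. indicator {t - r..t + r} y \<partial>lborel)"
    by (intro nn_integral_cong) (simp split: split_indicator)
  then have 2: "(\<integral>\<^sup>+y. (indicator {t - r..t + r} y)\<^sup>2 \<partial>lborel) = ennreal (2 * r)"
    using r by simp
  have 3: "(\<integral>\<^sup>+y. (G y * indicator {t - r..t + r} y)\<^sup>2 \<partial>lborel) = (\<integral>\<^sup>+y. (G y)\<^sup>2 * indicator {t - r..t + r} y \<partial>lborel)"
    by (intro nn_integral_cong) (simp split: split_indicator)
  have "(cone_integral G t r)\<^sup>2 \<le> (\<integral>\<^sup>+y. (G y * indicator {t - r..t + r} y)\<^sup>2 \<partial>lborel) * (\<integral>\<^sup>+y. (indicator {t - r..t + r} y)\<^sup>2 \<partial>lborel)"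
    unfolding 1 by (intro Cauchy_Schwarz_nn_integral) measurable
  then show ?thesis unfolding 2 3 by (simp only: mult.commute)
qed

text \<open>The point \<open>s\<close> splits the interval in two, and each half falls under a
  one-sided Hardy inequality; 72 is \<open>2 * 18 + 2 * 18\<close>, the factors 2 coming from the
  square of a sum.\<close>

lemma cone_integral_Hardy:
  assumes [measurable]: "G \<in> borel_measurable borel"
  shows "(\<integral>\<^sup>+r. (\<integral>\<^sup>+t. (cone_integral G t r)\<^sup>2 *
      (ennreal (1 / r ^ 3) * indicator {1..} r * indicator {t - r..t + r} s) \<partial>lborel) \<partial>lborel)
     \<le> 72 * (\<integral>\<^sup>+y. (G y)\<^sup>2 \<partial>lborel)"
proof -
  let ?A = "\<lambda>t r. \<integral>\<^sup>+y. G y * indicator {s..t + r} y \<partial>lborel"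
  let ?B = "\<lambda>t r. \<integral>\<^sup>+y. G y * indicator {t - r..s} y \<partial>lborel"
  let ?k = "\<lambda>t r. ennreal (1 / r ^ 3) * indicator {1..} r * indicator {t - r..t + r} s"
  have "(\<integral>\<^sup>+r. (\<integral>\<^sup>+t. (cone_integral G t r)\<^sup>2 * ?k t r \<partial>lborel) \<partial>lborel)
    \<le> (\<integral>\<^sup>+r. (\<integral>\<^sup>+t. 2 * ((?A t r)\<^sup>2 * ?k t r) + 2 * ((?B t r)\<^sup>2 * ?k t r) \<partial>lborel) \<partial>lborel)"
  proof (intro nn_integral_mono)
    fix t r :: real
    show "(cone_integral G t r)\<^sup>2 * ?k t r \<le> 2 * ((?A t r)\<^sup>2 * ?k t r) + 2 * ((?B t r)\<^sup>2 * ?k t r)"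
    proof (cases "s \<in> {t - r..t + r}")
      case True
      have "cone_integral G t r \<le> (\<integral>\<^sup>+y. G y * indicator {s..t + r} y + G y * indicator {t - r..s} y \<partial>lborel)"
        unfolding cone_integral_def using True by (intro nn_integral_mono) (auto simp: indicator_def)
      also have "\<dots> = ?A t r + ?B t r"
        by (intro nn_integral_add) measurable
      finally have "(cone_integral G t r)\<^sup>2 \<le> (?A t r + ?B t r)\<^sup>2"
        by (intro power_mono) auto
      also have "\<dots> \<le> 2 * (?A t r)\<^sup>2 + 2 * (?B t r)\<^sup>2"
        by (rule ennreal_sum_power2_le)
      finally have "(cone_integral G t r)\<^sup>2 * ?k t r \<le> (2 * (?A t r)\<^sup>2 + 2 * (?B t r)\<^sup>2) * ?k t r"
        by (rule mult_right_mono) auto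
      then show ?thesis by (simp add: distrib_right mult.assoc)
    qed auto
  qed
  also have "\<dots> = 2 * (\<integral>\<^sup>+r. (\<integral>\<^sup>+t. (?A t r)\<^sup>2 * ?k t r \<partial>lborel) \<partial>lborel) + 2 * (\<integral>\<^sup>+r. (\<integral>\<^sup>+t. (?B t r)\<^sup>2 * ?k t r \<partial>lborel) \<partial>lborel)"
    by (simp add: nn_integral_add nn_integral_cmult)
  also have "\<dots> \<le> 2 * (18 * (\<integral>\<^sup>+y. (G y)\<^sup>2 \<partial>lborel)) + 2 * (18 * (\<integral>\<^sup>+y. (G y)\<^sup>2 \<partial>lborel))"
    by (intro add_mono mult_left_mono Hardy_cone_left Hardy_cone_right) auto
  also have "\<dots> = 72 * (\<integral>\<^sup>+y. (G y)\<^sup>2 \<partial>lborel)"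
    by (simp add: mult.assoc[symmetric] distrib_right[symmetric])
  finally show ?thesis .
qed

text \<open>A quartic bound out of a quadratic inequality: two of the four factors are estimated by
  Cauchy-Schwarz, which costs \<open>2 * r\<close> and sets free an integral of
  \<open>(G s)^2\<close> over the cone interval. For each fixed \<open>s\<close> the other two
  factors, now with the weight \<open>1 / r ^ 3\<close>, are bounded by
  \<open>cone_integral_Hardy\<close>, so the constant is \<open>2 * 72\<close>.\<close>

lemma cone_integral_spacetime_bound:
  assumes [measurable]: "G \<in> borel_measurable borel"
  shows "(\<integral>\<^sup>+t. (\<integral>\<^sup>+r. (cone_integral G t r) ^ 4 * ennreal (1 / r ^ 4) * indicator {1..} r \<partial>lborel) \<partial>lborel)
    \<le> 144 * (\<integral>\<^sup>+y. (G y)\<^sup>2 \<partial>lborel)\<^sup>2"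
proof -
  let ?I = "cone_integral G"
  let ?k = "\<lambda>t r s. ennreal (1 / r ^ 3) * indicator {1..} r * indicator {t - r..t + r} s"
  have "(\<integral>\<^sup>+t. (\<integral>\<^sup>+r. (?I t r) ^ 4 * ennreal (1 / r ^ 4) * indicator {1..} r \<partial>lborel) \<partial>lborel)
    \<le> (\<integral>\<^sup>+t. (\<integral>\<^sup>+r. (\<integral>\<^sup>+s. 2 * ((G s)\<^sup>2 * ((?I t r)\<^sup>2 * ?k t r s)) \<partial>lborel) \<partial>lborel) \<partial>lborel)"
  proof (intro nn_integral_mono)
    fix t r :: real
    show "(?I t r) ^ 4 * ennreal (1 / r ^ 4) * indicator {1..} r \<le> (\<integral>\<^sup>+s. 2 * ((G s)\<^sup>2 * ((?I t r)\<^sup>2 * ?k t r s)) \<partial>lborel)"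
    proof (cases "r \<ge> 1")
      case True
      have c: "ennreal (2 * r) * ennreal (1 / r ^ 4) = 2 * ennreal (1 / r ^ 3)"
        using True proof -
        have "ennreal (2 * r) * ennreal (1 / r ^ 4) = ennreal (2 * r * (1 / r ^ 4))"
          using True by (intro ennreal_mult[symmetric]) auto
        also have "2 * r * (1 / r ^ 4) = 2 * (1 / r ^ 3)"
          using True by (simp add: field_simps power4_eq_xxxx power3_eq_cube)
        also have "ennreal \<dots> = 2 * ennreal (1 / r ^ 3)"
          using True by (subst ennreal_mult) auto
        finally show ?thesis .
      qed
      have "(?I t r) ^ 4 * ennreal (1 / r ^ 4) = (?I t r)\<^sup>2 * ennreal (1 / r ^ 4) * (?I t r)\<^sup>2"
        by (simp add: power4_eq_xxxx power2_eq_square mult_ac)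
      also have "\<dots> \<le> (?I t r)\<^sup>2 * ennreal (1 / r ^ 4) * (ennreal (2 * r) * (\<integral>\<^sup>+y. (G y)\<^sup>2 * indicator {t - r..t + r} y \<partial>lborel))"
        using True by (intro mult_left_mono cone_integral_power2_le) auto
      also have "\<dots> = (?I t r)\<^sup>2 * (ennreal (2 * r) * ennreal (1 / r ^ 4)) * (\<integral>\<^sup>+y. (G y)\<^sup>2 * indicator {t - r..t + r} y \<partial>lborel)"
        by (simp add: mult_ac)
      also have "\<dots> = (\<integral>\<^sup>+s. 2 * ((G s)\<^sup>2 * ((?I t r)\<^sup>2 * ?k t r s)) \<partial>lborel)"
        unfolding c using True by (subst nn_integral_cmult[symmetric]) (auto intro!: nn_integral_cong simp: mult_ac)
      finally show ?thesis using True by simp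
    qed auto
  qed
  also have "\<dots> = (\<integral>\<^sup>+t. (\<integral>\<^sup>+s. (\<integral>\<^sup>+r. 2 * ((G s)\<^sup>2 * ((?I t r)\<^sup>2 * ?k t r s)) \<partial>lborel) \<partial>lborel) \<partial>lborel)"
    by (intro nn_integral_cong lborel_pair.Fubini') measurable
  also have "\<dots> = (\<integral>\<^sup>+s. (\<integral>\<^sup>+t. (\<integral>\<^sup>+r. 2 * ((G s)\<^sup>2 * ((?I t r)\<^sup>2 * ?k t r s)) \<partial>lborel) \<partial>lborel) \<partial>lborel)"
    by (intro lborel_pair.Fubini') measurable
  also have "\<dots> = (\<integral>\<^sup>+s. (\<integral>\<^sup>+r. (\<integral>\<^sup>+t. 2 * ((G s)\<^sup>2 * ((?I t r)\<^sup>2 * ?k t r s)) \<partial>lborel) \<partial>lborel) \<partial>lborel)"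
    by (intro nn_integral_cong lborel_pair.Fubini') measurable
  also have "\<dots> = (\<integral>\<^sup>+s. 2 * (G s)\<^sup>2 * (\<integral>\<^sup>+r. (\<integral>\<^sup>+t. ((?I t r)\<^sup>2 * ?k t r s) \<partial>lborel) \<partial>lborel) \<partial>lborel)"
    by (intro nn_integral_cong) (simp add: nn_integral_cmult mult.assoc)
  also have "\<dots> \<le> (\<integral>\<^sup>+s. 2 * (G s)\<^sup>2 * (72 * (\<integral>\<^sup>+y. (G y)\<^sup>2 \<partial>lborel)) \<partial>lborel)"
    by (intro nn_integral_mono mult_left_mono cone_integral_Hardy) auto
  also have "\<dots> = (\<integral>\<^sup>+s. 144 * (\<integral>\<^sup>+y. (G y)\<^sup>2 \<partial>lborel) * (G s)\<^sup>2 \<partial>lborel)"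
  proof -
    have "2 * a * (72 * b) = 144 * b * a" for a b :: ennreal
    proof -
      have "2 * a * (72 * b) = (2 * 72) * b * a" by (simp only: mult_ac)
      then show ?thesis by simp
    qed
    then show ?thesis by simp
  qed
  also have "\<dots> = 144 * (\<integral>\<^sup>+y. (G y)\<^sup>2 \<partial>lborel)\<^sup>2"
    by (subst nn_integral_cmult) (auto simp: power2_eq_square[of "integral\<^sup>N _ _"] mult.assoc)
  finally show ?thesis .
qed

text \<open>The cone integral increases with \<open>r\<close>, and \<open>1 / r ^ 3\<close> is three
  times the tail integral of \<open>1 / x ^ 4\<close>; hence a supremum in \<open>r\<close> is
  dominated by an integral in \<open>r\<close>.\<close>

lemma cone_integral_sup_le:
  assumes [measurable]: "G \<in> borel_measurable borel" and r: "r \<ge> 1"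
  shows "(cone_integral G t r) ^ 4 * ennreal (1 / r ^ 3)
    \<le> 3 * (\<integral>\<^sup>+x. (cone_integral G t x) ^ 4 * ennreal (1 / x ^ 4) * indicator {1..} x \<partial>lborel)"
proof -
  have "(\<integral>\<^sup>+x. ennreal (1 / x ^ 4) * indicator {r..} x \<partial>lborel) = ennreal (0 - (- (1 / 3) * inverse r ^ 3))"
  proof (intro nn_integral_FTC_atLeast)
    fix x assume "r \<le> x"
    with r have x: "x > 0" by simp
    have "((\<lambda>x. - (1 / 3) * inverse x ^ 3) has_real_derivative inverse x ^ 4) (at x)"
    proof -
      have "((\<lambda>x. inverse x ^ 3) has_real_derivative real 3 * (- (inverse x ^ Suc (Suc 0)) * inverse x ^ (3 - Suc 0))) (at x)"
        using x by (intro DERIV_power DERIV_inverse) auto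
      from DERIV_cmult[OF this, of "- (1 / 3)"]
      show ?thesis by (simp add: eval_nat_numeral mult_ac)
    qed
    moreover have "1 / x ^ 4 = inverse x ^ 4" using x by (simp add: field_simps)
    ultimately show "((\<lambda>x. - (1 / 3) * inverse x ^ 3) has_real_derivative 1 / x ^ 4) (at x)"
      by (simp only:)
    show "0 \<le> 1 / x ^ 4" using x by simp
  next
    have "((\<lambda>r::real. - (1 / 3) * (inverse r) ^ 3) \<longlongrightarrow> - (1 / 3) * 0 ^ 3) at_top"
      by (intro tendsto_intros tendsto_inverse_0_at_top filterlim_ident)
    then show "((\<lambda>r::real. - (1 / 3) * inverse r ^ 3) \<longlongrightarrow> 0) at_top"
      by simp
  qed auto
  moreover have "3 * ennreal (0 - (- (1 / 3) * inverse r ^ 3)) = ennreal (1 / r ^ 3)"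
  proof -
    have "3 * ennreal (0 - (- (1 / 3) * inverse r ^ 3)) = ennreal (3 * (1 / 3 * inverse r ^ 3))"
      using r by (subst ennreal_mult) auto
    also have "3 * (1 / 3 * inverse r ^ 3) = 1 / r ^ 3"
      using r by (simp add: field_simps)
    finally show ?thesis .
  qed
  ultimately have "(cone_integral G t r) ^ 4 * ennreal (1 / r ^ 3)
      = (cone_integral G t r) ^ 4 * (3 * (\<integral>\<^sup>+x. ennreal (1 / x ^ 4) * indicator {r..} x \<partial>lborel))"
    by (simp only:)
  also have "\<dots> = 3 * ((cone_integral G t r) ^ 4 * (\<integral>\<^sup>+x. ennreal (1 / x ^ 4) * indicator {r..} x \<partial>lborel))"
    by (simp only: mult_ac)
  also have "(cone_integral G t r) ^ 4 * (\<integral>\<^sup>+x. ennreal (1 / x ^ 4) * indicator {r..} x \<partial>lborel)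
      = (\<integral>\<^sup>+x. (cone_integral G t r) ^ 4 * (ennreal (1 / x ^ 4) * indicator {r..} x) \<partial>lborel)"
    by (rule nn_integral_cmult[symmetric]) measurable
  also have "3 * (\<integral>\<^sup>+x. (cone_integral G t r) ^ 4 * (ennreal (1 / x ^ 4) * indicator {r..} x) \<partial>lborel)
      \<le> 3 * (\<integral>\<^sup>+x. (cone_integral G t x) ^ 4 * ennreal (1 / x ^ 4) * indicator {1..} x \<partial>lborel)"
  proof (intro mult_left_mono nn_integral_mono)
    fix x :: real
    have "cone_integral G t r \<le> cone_integral G t x" if "r \<le> x"
      unfolding cone_integral_def using that by (intro nn_integral_mono) (auto simp: indicator_def)
    then show "(cone_integral G t r) ^ 4 * (ennreal (1 / x ^ 4) * indicator {r..} x)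
       \<le> (cone_integral G t x) ^ 4 * ennreal (1 / x ^ 4) * indicator {1..} x"
      using r by (auto simp: indicator_def intro!: mult_right_mono power_mono)
  qed auto
  finally show ?thesis .
qed

section \<open>Integration over space-time regions\<close>

lemma lborel_prod_integral_swap:
  fixes h :: "real \<times> real \<Rightarrow> real"
  assumes "integrable lborel h"
  shows "(LINT z|lborel. h (snd z, fst z)) = (LINT z|lborel. h z)"
    and "integrable lborel (\<lambda>z. h (snd z, fst z))"
proof -
  have h: "integrable (lborel \<Otimes>\<^sub>M lborel) h" using assms by (simp add: lborel_prod)
  have "integrable (lborel \<Otimes>\<^sub>M lborel) (\<lambda>(x, y). h (y, x))"
    by (rule lborel_pair.integrable_product_swap[OF h])
  then show "integrable lborel (\<lambda>z. h (snd z, fst z))"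
    by (simp add: lborel_prod split_beta')
  have "integral\<^sup>L (lborel \<Otimes>\<^sub>M lborel) (\<lambda>(x, y). h (y, x)) = integral\<^sup>L (lborel \<Otimes>\<^sub>M lborel) h"
    using h by (intro lborel_pair.integral_product_swap) auto
  then show "(LINT z|lborel. h (snd z, fst z)) = (LINT z|lborel. h z)"
    by (simp add: lborel_prod split_beta')
qed

lemma lborel_prod_integral_fst:
  fixes h :: "real \<times> real \<Rightarrow> real"
  assumes "integrable lborel h"
  shows "(LINT z|lborel. h z) = (LINT x|lborel. LINT y|lborel. h (x, y))"
    and "integrable lborel (\<lambda>x. LINT y|lborel. h (x, y))"
proof -
  have h: "integrable (lborel \<Otimes>\<^sub>M lborel) h" using assms by (simp add: lborel_prod)
  show "(LINT z|lborel. h z) = (LINT x|lborel. LINT y|lborel. h (x, y))"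
    using lborel_pair.integral_fst'[OF h] by (simp add: lborel_prod)
  show "integrable lborel (\<lambda>x. LINT y|lborel. h (x, y))"
    using lborel_pair.integrable_fst'[OF h] by simp
qed

text \<open>Fubini reduces the unit Jacobian of the shear to translation invariance in one variable.
  The shear is what replaces the time coordinate by \<open>t + r\<close>.\<close>

lemma lborel_prod_integral_shear:
  fixes h :: "real \<times> real \<Rightarrow> real"
  assumes "integrable lborel h" "integrable lborel (\<lambda>z. h (fst z, snd z - fst z))"
  shows "(LINT z|lborel. h (fst z, snd z - fst z)) = (LINT z|lborel. h z)"
proof -
  have "(LINT y|lborel. h (x, y - x)) = (LINT y|lborel. h (x, y))" for x
    using lborel_integral_real_affine[of 1 "\<lambda>y. h (x, y)" "-x"] by simp
  then show ?thesis
    unfolding lborel_prod_integral_fst(1)[OF assms(1)] lborel_prod_integral_fst(1)[OF assms(2)] by simp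
qed

lemma integral_Icc_lborel:
  fixes f :: "real \<Rightarrow> real"
  assumes "continuous_on {a..b} f"
  shows "(LINT x|lborel. indicator {a..b} x * f x) = integral {a..b} f"
proof -
  have "set_integrable lborel {a..b} f"
    using borel_integrable_compact[OF compact_Icc assms] by (simp add: set_integrable_def)
  from set_borel_integral_eq_integral(2)[OF this] show ?thesis
    by (simp add: set_lebesgue_integral_def)
qed

text \<open>Extending the integrand by zero reduces this to Fubini on the plane; a section over a
  point outside \<open>{a..b}\<close> is empty and contributes nothing.\<close>

lemma integral_region_iterated:
  fixes F :: "real \<times> real \<Rightarrow> real"
  assumes R: "compact R" "continuous_on R F"
    and sec: "\<And>x y. (x, y) \<in> R \<longleftrightarrow> x \<in> {a..b} \<and> y \<in> {c x..d x}"
  shows "((\<lambda>x. integral {c x..d x} (\<lambda>y. F (x, y))) has_integral (LINT z|lborel. indicator R z * F z)) {a..b}"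
proof -
  have int: "integrable lborel (\<lambda>z. indicator R z * F z)"
    using borel_integrable_compact[OF R] by simp
  have inner: "(LINT y|lborel. indicator R (x, y) * F (x, y))
      = (if x \<in> {a..b} then integral {c x..d x} (\<lambda>y. F (x, y)) else 0)" for x
  proof (cases "x \<in> {a..b}")
    case True
    have cF: "continuous_on {c x..d x} (\<lambda>y. F (x, y))"
      by (intro continuous_on_compose2[OF R(2)] continuous_intros) (use True sec in auto)
    then show ?thesis
    proof -
      have "indicator R (x, y) = (indicator {c x..d x} y :: real)" for y
        using True by (simp add: sec indicator_def)
      then show ?thesis
        using integral_Icc_lborel[OF cF] True by simp
    qed
  next
    case False
    then have "(x, y) \<notin> R" for y using sec[of x y] by auto
    then have "indicator R (x, y) * F (x, y) = 0" for y by simp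
    then have "(LINT y|lborel. indicator R (x, y) * F (x, y)) = 0" by (simp only: Bochner_Integration.integral_zero)
    with False show ?thesis by auto
  qed
  have "((\<lambda>x. LINT y|lborel. indicator R (x, y) * F (x, y)) has_integral (LINT z|lborel. indicator R z * F z)) UNIV"
    using has_integral_integral_lborel[OF lborel_prod_integral_fst(2)[OF int]]
      lborel_prod_integral_fst(1)[OF int] by simp
  then show ?thesis
    unfolding inner has_integral_restrict_UNIV .
qed

section \<open>The triangle below an incoming light ray\<close>

definition tri :: "real \<Rightarrow> (real \<times> real) set" where
  "tri X = {(t, r). 0 \<le> t \<and> 1 \<le> r \<and> t + r \<le> X}"

lemma tri_mem: "(t, r) \<in> tri X \<longleftrightarrow> 0 \<le> t \<and> 1 \<le> r \<and> t + r \<le> X"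
  by (simp add: tri_def)

definition tri_int :: "(real \<Rightarrow> real \<Rightarrow> real) \<Rightarrow> real \<Rightarrow> real" where
  "tri_int f X = (LINT z|lborel. indicator (tri X) z * f (fst z) (snd z))"

text \<open>Continuity up to the boundary \<open>r = 1\<close>. All real times are included because
  a time average near 0 also sees negative times.\<close>

definition cont2 :: "(real \<Rightarrow> real \<Rightarrow> real) \<Rightarrow> bool" where
  "cont2 f \<longleftrightarrow> continuous_on (UNIV \<times> {1..}) (\<lambda>z. f (fst z) (snd z))"

lemma cont2_compose:
  assumes "cont2 f" "continuous_on S g" "continuous_on S h" "\<And>x. x \<in> S \<Longrightarrow> h x \<ge> 1"
  shows "continuous_on S (\<lambda>x. f (g x) (h x))"
proof -
  have "continuous_on S (\<lambda>x. (g x, h x))" using assms(2,3) by (intro continuous_intros)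
  from continuous_on_compose2[OF assms(1)[unfolded cont2_def] this] assms(4) show ?thesis by auto
qed

lemma compact_tri: "compact (tri X)"
proof -
  have "closed (tri X)"
    unfolding tri_def split_beta' by (intro closed_Collect_conj closed_Collect_le continuous_intros)
  moreover have "tri X \<subseteq> cbox (0, 1) (X, X)"
    by (auto simp: tri_def cbox_Pair_eq)
  ultimately show ?thesis
    using bounded_subset[OF bounded_cbox] compact_eq_bounded_closed by blast
qed

lemma tri_integrable:
  assumes "cont2 f"
  shows "integrable lborel (\<lambda>z. indicator (tri X) z * f (fst z) (snd z))"
proof -
  have "continuous_on (tri X) (\<lambda>z. f (fst z) (snd z))"
    by (intro cont2_compose[OF assms] continuous_intros) (auto simp: tri_def)
  from borel_integrable_compact[OF compact_tri this] show ?thesis by simp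
qed

lemma tri_int_t:
  assumes "cont2 f"
  shows "((\<lambda>t. integral {1..X - t} (\<lambda>r. f t r)) has_integral tri_int f X) {0..X - 1}"
proof -
  have "continuous_on (tri X) (\<lambda>z. f (fst z) (snd z))"
    by (intro cont2_compose[OF assms] continuous_intros) (auto simp: tri_def)
  from integral_region_iterated[OF compact_tri this, of 0 "X - 1" "\<lambda>_. 1" "\<lambda>t. X - t"]
  have "((\<lambda>t. integral {1..X - t} (\<lambda>r. f t r)) has_integral (LINT z|lborel. indicator (tri X) z * f (fst z) (snd z))) {0..X - 1}"
    by (fastforce simp: tri_mem)
  then show ?thesis by (simp add: tri_int_def)
qed

lemma compact_swap:
  fixes S :: "(real \<times> real) set"
  assumes "compact S" shows "compact ((\<lambda>z. (snd z, fst z)) ` S)"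
  by (intro compact_continuous_image assms continuous_intros)

lemma tri_int_r:
  assumes "cont2 f"
  shows "((\<lambda>r. integral {0..X - r} (\<lambda>t. f t r)) has_integral tri_int f X) {1..X}"
proof -
  let ?R = "(\<lambda>z. (snd z, fst z)) ` tri X"
  have R: "(r, t) \<in> ?R \<longleftrightarrow> (t, r) \<in> tri X" for r t by force
  have "continuous_on ?R (\<lambda>z. f (snd z) (fst z))"
    by (intro cont2_compose[OF assms] continuous_intros) (auto simp: tri_def)
  from integral_region_iterated[OF compact_swap[OF compact_tri] this, of 1 X "\<lambda>_. 0" "\<lambda>r. X - r"]
  have "((\<lambda>r. integral {0..X - r} (\<lambda>t. f t r)) has_integral (LINT z|lborel. indicator ?R z * f (snd z) (fst z))) {1..X}"
    by (fastforce simp: R tri_mem)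
  also have "(LINT z|lborel. indicator ?R z * f (snd z) (fst z)) = tri_int f X"
    using lborel_prod_integral_swap(1)[OF tri_integrable[OF assms], of X]
    by (simp add: tri_int_def) (auto intro!: Bochner_Integration.integral_cong simp: indicator_def R[symmetric])
  finally show ?thesis .
qed

text \<open>The incoming characteristics \<open>t + r = x\<close> foliate the triangle, and the
  change from \<open>(t, r)\<close> to \<open>(t + r, r)\<close> preserves area. This is how a bulk
  bound becomes an integral over \<open>x\<close> of ray integrals.\<close>

lemma tri_int_ray:
  assumes "cont2 f"
  shows "((\<lambda>x. integral {1..x} (\<lambda>r. f (x - r) r)) has_integral tri_int f X) {1..X}"
proof -
  let ?R = "(\<lambda>z. (fst z + snd z, snd z)) ` tri X"
  have R: "(x, r) \<in> ?R \<longleftrightarrow> (x - r, r) \<in> tri X" for r x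
    by (force simp: image_iff)
  have cR: "compact ?R"
    by (intro compact_continuous_image compact_tri continuous_intros)
  have cont: "continuous_on ?R (\<lambda>z. f (fst z - snd z) (snd z))"
    by (intro cont2_compose[OF assms] continuous_intros) (auto simp: tri_def)
  from integral_region_iterated[OF cR this, of 1 X "\<lambda>_. 1" "\<lambda>r. r"]
  have *: "((\<lambda>x. integral {1..x} (\<lambda>r. f (x - r) r)) has_integral (LINT z|lborel. indicator ?R z * f (fst z - snd z) (snd z))) {1..X}"
    by (fastforce simp: R tri_mem)
  let ?h = "\<lambda>z. indicator (tri X) (snd z, fst z) * f (snd z) (fst z)"
  have i1: "integrable lborel ?h"
    using lborel_prod_integral_swap(2)[OF tri_integrable[OF assms], of X] by simp
  have i2: "integrable lborel (\<lambda>z. indicator ?R z * f (fst z - snd z) (snd z))"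
    using borel_integrable_compact[OF cR cont] by simp
  have e: "(\<lambda>z. indicator ?R (snd z, fst z) * f (snd z - fst z) (fst z)) = (\<lambda>z. ?h (fst z, snd z - fst z))"
    by (auto simp: fun_eq_iff indicator_def R)
  have "(LINT z|lborel. indicator ?R z * f (fst z - snd z) (snd z))
      = (LINT z|lborel. ?h (fst z, snd z - fst z))"
    using lborel_prod_integral_swap(1)[OF i2] e by simp
  also have "\<dots> = (LINT z|lborel. ?h z)"
    by (rule lborel_prod_integral_shear[OF i1]) (use lborel_prod_integral_swap(2)[OF i2] e in simp)
  also have "\<dots> = tri_int f X"
    using lborel_prod_integral_swap(1)[OF tri_integrable[OF assms], of X] by (simp add: tri_int_def)
  finally show ?thesis using * by simp
qed

lemma tri_int_add:
  assumes "cont2 f" "cont2 g"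
  shows "tri_int (\<lambda>t r. f t r + g t r) X = tri_int f X + tri_int g X"
  using Bochner_Integration.integral_add[OF tri_integrable[OF assms(1), of X] tri_integrable[OF assms(2), of X]]
  by (simp add: tri_int_def distrib_left)

lemma tri_int_cmult: "tri_int (\<lambda>t r. c * f t r) X = c * tri_int f X"
  unfolding tri_int_def by (subst integral_mult_right_zero[symmetric]) (simp add: mult_ac)

lemma tri_int_mono:
  assumes "cont2 f" "cont2 g" "\<And>t r. 0 \<le> t \<Longrightarrow> 1 \<le> r \<Longrightarrow> t + r \<le> X \<Longrightarrow> f t r \<le> g t r"
  shows "tri_int f X \<le> tri_int g X"
  unfolding tri_int_def using assms(3)
  by (intro integral_mono tri_integrable assms(1,2)) (auto simp: indicator_def tri_def)

lemma tri_int_const_le: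
  assumes "X \<ge> 1" "c \<ge> 0"
  shows "tri_int (\<lambda>t r. c) X \<le> c * X\<^sup>2"
proof -
  have c: "cont2 (\<lambda>t r. c)" by (simp add: cont2_def)
  have "tri_int (\<lambda>t r. c) X \<le> X * (c * X)"
  proof (rule order_trans)
    show "tri_int (\<lambda>t r. c) X \<le> integral {0..X - 1} (\<lambda>t. c * X)"
    proof (rule has_integral_le[OF tri_int_t[OF c]])
      show "((\<lambda>t. c * X) has_integral integral {0..X - 1} (\<lambda>t. c * X)) {0..X - 1}"
        by (intro integrable_integral integrable_continuous_real continuous_intros)
      fix t assume "t \<in> {0..X - 1}"
      then show "integral {1..X - t} (\<lambda>r. c) \<le> c * X"
        using assms mult_left_mono[of "X - t - 1" X c] by (simp add: mult.commute)
    qed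
    show "integral {0..X - 1} (\<lambda>t. c * X) \<le> X * (c * X)"
      using assms mult_right_mono[of "X - 1" X "c * X"] by (simp add: mult_ac)
  qed
  then show ?thesis by (simp add: power2_eq_square mult_ac)
qed

lemma integral_reflect_shift:
  fixes f :: "real \<Rightarrow> real"
  assumes "continuous_on {0..x - 1} f"
  shows "integral {0..x - 1} f = integral {1..x} (\<lambda>r. f (x - r))"
proof -
  have "continuous_on {1..x} (\<lambda>r. f (x - r))"
    by (intro continuous_on_compose2[OF assms] continuous_intros) auto
  then have "integral {1..x} (\<lambda>r. f (x - r)) = (LINT r|lborel. indicator {1..x} r * f (x - r))"
    by (simp add: integral_Icc_lborel)
  also have "\<dots> = (LINT t|lborel. indicator {0..x - 1} t * f t)"
    by (subst (2) lborel_integral_real_affine[of "-1" _ x])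
      (auto intro!: Bochner_Integration.integral_cong simp: indicator_def)
  finally show ?thesis using assms by (simp add: integral_Icc_lborel)
qed

lemma FTC_within:
  fixes f :: "real \<Rightarrow> real"
  assumes "a \<le> b" "{a..b} \<subseteq> S" "\<And>x. x \<in> {a..b} \<Longrightarrow> (f has_real_derivative f' x) (at x within S)"
  shows "(f' has_integral (f b - f a)) {a..b}"
  using assms by (intro fundamental_theorem_of_calculus)
    (auto simp: has_real_derivative_iff_has_vector_derivative[symmetric] intro: DERIV_subset)

text \<open>Divergence theorem: slices in \<open>t\<close> and slices in \<open>r\<close> both end
  on the hypotenuse, and with \<open>r\<close> as parameter there \<open>P\<close> and
  \<open>Q\<close> enter with the same coefficient. For an energy density and its momentum their sum
  is the flux through a characteristic.\<close>

lemma Green_tri: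
  assumes cont: "cont2 P" "cont2 Q" "cont2 Pt" "cont2 Qr"
    and dP: "\<And>t r. 0 \<le> t \<Longrightarrow> t \<le> X \<Longrightarrow> 1 \<le> r \<Longrightarrow> ((\<lambda>t. P t r) has_real_derivative Pt t r) (at t within {0..X})"
    and dQ: "\<And>t r. 0 \<le> t \<Longrightarrow> t \<le> X \<Longrightarrow> 1 \<le> r \<Longrightarrow> ((\<lambda>r. Q t r) has_real_derivative Qr t r) (at r within {1..})"
    and x: "1 \<le> x" "x \<le> X"
  shows "tri_int (\<lambda>t r. Pt t r + Qr t r) x = integral {1..x} (\<lambda>r. P (x - r) r + Q (x - r) r)
     - integral {1..x} (\<lambda>r. P 0 r) - integral {0..x - 1} (\<lambda>t. Q t 1)"
proof -
  have cP: "continuous_on {1..x} (\<lambda>r. P (x - r) r)" "continuous_on {1..x} (\<lambda>r. P 0 r)"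
    by (intro cont2_compose[OF cont(1)] continuous_intros; simp)+
  have cQ: "continuous_on {1..x} (\<lambda>r. Q (x - r) r)" "continuous_on {0..x - 1} (\<lambda>t. Q t 1)"
      "continuous_on {0..x - 1} (\<lambda>t. Q t (x - t))"
    by (intro cont2_compose[OF cont(2)] continuous_intros; simp)+
  have "integral {0..x - r} (\<lambda>t. Pt t r) = P (x - r) r - P 0 r" if "r \<in> {1..x}" for r
    using that x by (intro integral_unique FTC_within[where S = "{0..X}"] dP) auto
  then have "((\<lambda>r. P (x - r) r - P 0 r) has_integral tri_int Pt x) {1..x}"
    by (intro has_integral_eq[OF _ tri_int_r[OF cont(3)]]) auto
  from integral_unique[OF this] have 1: "tri_int Pt x = integral {1..x} (\<lambda>r. P (x - r) r) - integral {1..x} (\<lambda>r. P 0 r)"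
    by (subst (asm) integral_diff) (auto intro!: integrable_continuous_real cP)
  have "integral {1..x - t} (\<lambda>r. Qr t r) = Q t (x - t) - Q t 1" if "t \<in> {0..x - 1}" for t
    using that x by (intro integral_unique FTC_within[where S = "{1..}"] dQ) auto
  then have "((\<lambda>t. Q t (x - t) - Q t 1) has_integral tri_int Qr x) {0..x - 1}"
    by (intro has_integral_eq[OF _ tri_int_t[OF cont(4)]]) auto
  from integral_unique[OF this] have "tri_int Qr x = integral {0..x - 1} (\<lambda>t. Q t (x - t)) - integral {0..x - 1} (\<lambda>t. Q t 1)"
    by (subst (asm) integral_diff) (auto intro!: integrable_continuous_real cQ)
  also have "integral {0..x - 1} (\<lambda>t. Q t (x - t)) = integral {1..x} (\<lambda>r. Q (x - r) r)"
    by (subst integral_reflect_shift[OF cQ(3)]) simp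
  finally show ?thesis
    using 1 by (simp add: tri_int_add[OF cont(3,4)]) (subst integral_add, auto intro!: integrable_continuous_real cP cQ)
qed

section \<open>Approximate waves\<close>

text \<open>Chain rule along curves that may touch the edges of
  \<open>{0..X} \<times> {1..}\<close>, where only derivatives within that set exist. Continuity of
  the partial derivative \<open>fr\<close> supplies the total differentiability.\<close>

lemma has_real_derivative_ray:
  assumes cont: "cont2 fr"
    and dt: "\<And>t r. 0 \<le> t \<Longrightarrow> t \<le> X \<Longrightarrow> 1 \<le> r \<Longrightarrow> ((\<lambda>t. f t r) has_real_derivative ft t r) (at t within {0..X})"
    and dr: "\<And>t r. 0 \<le> t \<Longrightarrow> t \<le> X \<Longrightarrow> 1 \<le> r \<Longrightarrow> ((\<lambda>r. f t r) has_real_derivative fr t r) (at r within {1..})"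
    and g: "(g has_real_derivative g') (at y within S)" and h: "(h has_real_derivative h') (at y within S)"
    and ran: "\<And>y. y \<in> S \<Longrightarrow> 0 \<le> g y \<and> g y \<le> X \<and> 1 \<le> h y" and y: "y \<in> S"
  shows "((\<lambda>y. f (g y) (h y)) has_real_derivative (ft (g y) (h y) * g' + fr (g y) (h y) * h')) (at y within S)"
proof -
  have "((\<lambda>(x, y). f x y) has_derivative (\<lambda>(tx, ty). ft (g y) (h y) * tx + blinfun_apply (blinfun_mult_right (fr (g y) (h y))) ty))
      (at (g y, h y) within {0..X} \<times> {1..})"
  proof (rule has_derivative_partialsI[where fy = "\<lambda>x y. blinfun_mult_right (fr x y)"])
    show "((\<lambda>x. f x (h y)) has_derivative (*) (ft (g y) (h y))) (at (g y) within {0..X})"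
      using dt[of "g y" "h y"] ran[OF y] by (simp add: has_field_derivative_def)
    show "((\<lambda>y. f x y) has_derivative blinfun_apply (blinfun_mult_right (fr x y))) (at y within {1..})"
      if "x \<in> {0..X}" "y \<in> {1..}" for x y
      using dr[of x y] that by (simp add: has_field_derivative_def)
    have "continuous_on ({0..X} \<times> {1..}) (\<lambda>z. blinfun_mult_right (fr (fst z) (snd z)))"
      by (intro bounded_linear.continuous_on[OF bounded_linear_blinfun_mult_right] cont2_compose[OF cont] continuous_intros) auto
    then show "continuous (at (g y, h y) within {0..X} \<times> {1..}) (\<lambda>(x, y). blinfun_mult_right (fr x y))"
      using ran[OF y] by (auto simp: continuous_on_eq_continuous_within split_beta')
  qed (use ran[OF y] in auto)
  moreover have "((\<lambda>y. (g y, h y)) has_derivative (\<lambda>x. (g' * x, h' * x))) (at y within S)"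
    using g h by (intro has_derivative_Pair) (auto simp: has_field_derivative_def)
  moreover have "(\<lambda>y. (g y, h y)) ` S \<subseteq> {0..X} \<times> {1..}"
    using ran by auto
  ultimately have "((\<lambda>(x, y). f x y) \<circ> (\<lambda>y. (g y, h y)) has_derivative
      (\<lambda>(tx, ty). ft (g y) (h y) * tx + blinfun_apply (blinfun_mult_right (fr (g y) (h y))) ty) \<circ> (\<lambda>x. (g' * x, h' * x))) (at y within S)"
    by (intro diff_chain_within) (auto intro: has_derivative_subset)
  moreover have "(\<lambda>(tx, ty). ft (g y) (h y) * tx + blinfun_apply (blinfun_mult_right (fr (g y) (h y))) ty) \<circ> (\<lambda>x. (g' * x, h' * x))
      = (*) (ft (g y) (h y) * g' + fr (g y) (h y) * h')"
    by (auto simp: fun_eq_iff algebra_simps)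
  ultimately show ?thesis
    unfolding has_field_derivative_def by (simp add: o_def)
qed

text \<open>Discriminant argument. If \<open>?C = 0\<close>, an affine function of \<open>l\<close>
  stays nonnegative, so its slope \<open>?B\<close> vanishes; otherwise \<open>l = - ?B / ?C\<close>
  is the minimiser.\<close>

lemma integral_Cauchy_Schwarz:
  fixes f g :: "real \<Rightarrow> real"
  assumes f: "continuous_on {a..b} f" and g: "continuous_on {a..b} g"
  shows "(integral {a..b} (\<lambda>x. f x * g x))\<^sup>2 \<le> integral {a..b} (\<lambda>x. (f x)\<^sup>2) * integral {a..b} (\<lambda>x. (g x)\<^sup>2)"
proof -
  let ?A = "integral {a..b} (\<lambda>x. (f x)\<^sup>2)" and ?B = "integral {a..b} (\<lambda>x. f x * g x)" and ?C = "integral {a..b} (\<lambda>x. (g x)\<^sup>2)"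
  note int = integrable_continuous_real continuous_intros f g
  have key: "0 \<le> ?A + 2 * l * ?B + l\<^sup>2 * ?C" for l
  proof -
    have "0 \<le> integral {a..b} (\<lambda>x. (f x + l * g x)\<^sup>2)"
      by (intro integral_nonneg int) auto
    also have "(\<lambda>x. (f x + l * g x)\<^sup>2) = (\<lambda>x. ((f x)\<^sup>2 + 2 * l * (f x * g x)) + l\<^sup>2 * (g x)\<^sup>2)"
      by (auto simp: fun_eq_iff power2_eq_square algebra_simps)
    also have "integral {a..b} \<dots> = integral {a..b} (\<lambda>x. (f x)\<^sup>2 + 2 * l * (f x * g x)) + integral {a..b} (\<lambda>x. l\<^sup>2 * (g x)\<^sup>2)"
      by (intro integral_add int)
    also have "integral {a..b} (\<lambda>x. (f x)\<^sup>2 + 2 * l * (f x * g x)) = ?A + integral {a..b} (\<lambda>x. 2 * l * (f x * g x))"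
      by (intro integral_add int)
    finally show ?thesis by simp
  qed
  have C0: "?C \<ge> 0" by (intro integral_nonneg int) auto
  show ?thesis
  proof (cases "?C = 0")
    case True
    have "?B = 0"
    proof (rule ccontr)
      assume B: "?B \<noteq> 0"
      have "?A + 2 * (- (?A + 1) / (2 * ?B)) * ?B = -1" using B by (simp add: field_simps)
      with key[of "- (?A + 1) / (2 * ?B)"] True show False by simp
    qed
    then show ?thesis using True by simp
  next
    case False
    with C0 have C: "?C > 0" by simp
    have "?A + 2 * (- ?B / ?C) * ?B + (- ?B / ?C)\<^sup>2 * ?C = ?A - ?B\<^sup>2 / ?C"
      using C by (simp add: field_simps power2_eq_square)
    with key[of "- ?B / ?C"] have "?B\<^sup>2 / ?C \<le> ?A" by simp
    then show ?thesis using C by (simp add: field_simps)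
  qed
qed

lemma integral_power2_le:
  fixes f :: "real \<Rightarrow> real"
  assumes "continuous_on {a..b} f" "a \<le> b"
  shows "(integral {a..b} f)\<^sup>2 \<le> (b - a) * integral {a..b} (\<lambda>x. (f x)\<^sup>2)"
  using integral_Cauchy_Schwarz[OF assms(1) continuous_on_const[of _ 1]] assms(2)
  by (simp add: mult.commute)

text \<open>The equation holds up to \<open>\<delta>^2\<close> on the triangle only, whereas the
  boundary condition is exact. The field \<open>wtr\<close> is the common mixed derivative. The
  boundary term \<open>w^2 / 2\<close> in the initial energy comes from the Robin condition, and
  \<open>\<delta> * X^2 \<le> 1\<close> keeps the accumulated errors bounded independently of
  \<open>X\<close>.\<close>

locale approx_wave =
  fixes w wt wr wtt wtr wrr :: "real \<Rightarrow> real \<Rightarrow> real" and X \<delta> C0 :: real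
  assumes cont: "cont2 w" "cont2 wt" "cont2 wr" "cont2 wtt" "cont2 wtr" "cont2 wrr"
    and w_t: "\<And>t r. 0 \<le> t \<Longrightarrow> t \<le> X \<Longrightarrow> 1 \<le> r \<Longrightarrow> ((\<lambda>t. w t r) has_real_derivative wt t r) (at t within {0..X})"
    and wt_t: "\<And>t r. 0 \<le> t \<Longrightarrow> t \<le> X \<Longrightarrow> 1 \<le> r \<Longrightarrow> ((\<lambda>t. wt t r) has_real_derivative wtt t r) (at t within {0..X})"
    and wr_t: "\<And>t r. 0 \<le> t \<Longrightarrow> t \<le> X \<Longrightarrow> 1 \<le> r \<Longrightarrow> ((\<lambda>t. wr t r) has_real_derivative wtr t r) (at t within {0..X})"
    and w_r: "\<And>t r. 0 \<le> t \<Longrightarrow> t \<le> X \<Longrightarrow> 1 \<le> r \<Longrightarrow> ((\<lambda>r. w t r) has_real_derivative wr t r) (at r within {1..})"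
    and wt_r: "\<And>t r. 0 \<le> t \<Longrightarrow> t \<le> X \<Longrightarrow> 1 \<le> r \<Longrightarrow> ((\<lambda>r. wt t r) has_real_derivative wtr t r) (at r within {1..})"
    and wr_r: "\<And>t r. 0 \<le> t \<Longrightarrow> t \<le> X \<Longrightarrow> 1 \<le> r \<Longrightarrow> ((\<lambda>r. wr t r) has_real_derivative wrr t r) (at r within {1..})"
    and robin: "\<And>t. 0 \<le> t \<Longrightarrow> t \<le> X \<Longrightarrow> wr t 1 = w t 1"
    and X: "X \<ge> 2" and \<delta>: "0 < \<delta>" "\<delta> * X\<^sup>2 \<le> 1"
    and eqn: "\<And>t r. 0 \<le> t \<Longrightarrow> 1 \<le> r \<Longrightarrow> t + r \<le> X \<Longrightarrow> \<bar>wtt t r - wrr t r + (w t r) ^ 5 * inverse r ^ 4\<bar> \<le> \<delta>\<^sup>2"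
    and init: "(w 0 1)\<^sup>2 / 2 + integral {1..X} (\<lambda>r. ((wt 0 r)\<^sup>2 + (wr 0 r)\<^sup>2) / 2 + (w 0 r) ^ 6 * inverse r ^ 4 / 6) \<le> C0"
begin

definition e where "e t r = wtt t r - wrr t r + (w t r) ^ 5 * inverse r ^ 4"
definition PE where "PE t r = ((wt t r)\<^sup>2 + (wr t r)\<^sup>2) / 2 + (w t r) ^ 6 * inverse r ^ 4 / 6"
text \<open>This is \<open>PE t r - wt t r * wr t r\<close>, the energy flux through an incoming
  characteristic.\<close>

definition flux where "flux t r = (wt t r - wr t r)\<^sup>2 / 2 + (w t r) ^ 6 * inverse r ^ 4 / 6"
text \<open>The 3 bounds \<open>exp (\<delta> * t)\<close> for \<open>t \<le> X\<close>, and the 1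
  pays for the error of the equation integrated over the triangle.\<close>

definition K where "K = 3 * (C0 + 1)"

lemmas cont' = cont[unfolded cont2_def]

lemma cont_inverse: "continuous_on (UNIV \<times> {1..}) (\<lambda>z. inverse (snd z :: real))"
  by (intro continuous_intros) auto

lemma c_e: "cont2 e" and c_PE: "cont2 PE" and c_flux: "cont2 flux"
  unfolding cont2_def e_def PE_def flux_def by (intro continuous_intros cont' cont_inverse; simp)+

lemma c_bulk: "cont2 (\<lambda>t r. (w t r) ^ 6 * inverse r ^ 5)"
  unfolding cont2_def by (intro continuous_intros cont' cont_inverse)

lemma PE_nonneg: "PE t r \<ge> 0" if "r \<ge> 1"
  using that by (simp add: PE_def)

lemma flux_nonneg: "flux t r \<ge> 0" if "r \<ge> 1"
  using that by (simp add: flux_def)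

lemma e_bound: "0 \<le> t \<Longrightarrow> 1 \<le> r \<Longrightarrow> t + r \<le> X \<Longrightarrow> \<bar>e t r\<bar> \<le> \<delta>\<^sup>2"
  unfolding e_def by (rule eqn)

lemma \<delta>_le: "\<delta> \<le> 1" "\<delta> * X \<le> 1"
proof -
  have "1 * X \<le> X\<^sup>2" using X by (simp add: power2_eq_square)
  then have "\<delta> * (1 * X) \<le> \<delta> * X\<^sup>2" using \<delta>(1) by (intro mult_left_mono) auto
  then show "\<delta> * X \<le> 1" using \<delta>(2) by linarith
  moreover have "\<delta> * 1 \<le> \<delta> * X" using X \<delta> by (intro mult_left_mono) auto
  ultimately show "\<delta> \<le> 1" by simp
qed

lemma exp_bound: "0 \<le> t \<Longrightarrow> t \<le> X \<Longrightarrow> 1 / 3 \<le> exp (- (\<delta> * t))" "0 \<le> t \<Longrightarrow> exp (- (\<delta> * t)) \<le> 1"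
proof -
  assume t: "0 \<le> t" "t \<le> X"
  have "\<delta> * t \<le> \<delta> * X" using t \<delta> by (intro mult_left_mono) auto
  then have "exp (\<delta> * t) \<le> exp 1" using \<delta>_le by simp
  also have "exp 1 \<le> (3::real)" using exp_le by simp
  finally show "1 / 3 \<le> exp (- (\<delta> * t))" by (simp add: exp_minus field_simps)
next
  assume "0 \<le> t"
  then show "exp (- (\<delta> * t)) \<le> 1" using \<delta> by simp
qed

lemma C0_nonneg: "C0 \<ge> 0" and K_ge: "K \<ge> 3"
proof -
  have "0 \<le> integral {1..X} (\<lambda>r. ((wt 0 r)\<^sup>2 + (wr 0 r)\<^sup>2) / 2 + (w 0 r) ^ 6 * inverse r ^ 4 / 6)"
    by (intro integral_nonneg integrable_continuous_real continuous_intros cont2_compose[OF cont(1)] cont2_compose[OF cont(2)] cont2_compose[OF cont(3)]) auto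
  then show "C0 \<ge> 0" using init by (smt (verit) divide_nonneg_nonneg zero_le_power2)
  then show "K \<ge> 3" by (simp add: K_def)
qed

lemma init_le:
  assumes "1 \<le> x" "x \<le> X"
  shows "(w 0 1)\<^sup>2 / 2 + integral {1..x} (\<lambda>r. PE 0 r) \<le> C0"
proof -
  have i: "(\<lambda>r. PE 0 r) integrable_on {1..y}" for y
    by (intro integrable_continuous_real cont2_compose[OF c_PE] continuous_intros) auto
  have "integral {1..x} (\<lambda>r. PE 0 r) \<le> integral {1..X} (\<lambda>r. PE 0 r)"
    using assms by (intro integral_subset_le i) (auto simp: PE_nonneg)
  then show ?thesis using init unfolding PE_def by simp
qed

lemma ray_cont:
  assumes "cont2 f"
  shows "continuous_on {1..x} (\<lambda>r. f (x - r) r)" "continuous_on {1..x} (\<lambda>r. f 0 r)" "continuous_on {0..x} (\<lambda>t. f t 1)"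
  by (intro cont2_compose[OF assms] continuous_intros; simp)+

lemmas ray_int = ray_cont[THEN integrable_continuous_real]

text \<open>The energy identity is weighted with \<open>exp (- (\<delta> * t))\<close>.
  Differentiating the weight produces \<open>- \<delta> * PE\<close> in the bulk, which absorbs the
  error term \<open>wt * e\<close>, of size at most \<open>\<bar>wt\<bar> * \<delta>^2\<close>, and
  still leaves a space-time bound for \<open>\<delta> * PE\<close>. This surplus later controls the
  errors of the other multipliers.\<close>

lemma energy_flux:
  assumes x: "1 \<le> x" "x \<le> X"
  shows "integral {1..x} (\<lambda>r. flux (x - r) r) + (w (x - 1) 1)\<^sup>2 / 2 + \<delta> / 2 * tri_int PE x \<le> K"
proof -
  define E where "E t = exp (- (\<delta> * t))" for t
  have E_deriv: "(E has_real_derivative - \<delta> * E t) (at t within S)" for t S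
    unfolding E_def by (auto intro!: derivative_eq_intros)
  have cE: "continuous_on S (\<lambda>z. E (f z))" if "continuous_on S f" for S :: "'b::topological_space set" and f
    unfolding E_def using that by (intro continuous_intros)
  let ?P = "\<lambda>t r. E t * PE t r" and ?Q = "\<lambda>t r. - (E t * (wt t r * wr t r))"
  let ?Pt = "\<lambda>t r. E t * (wt t r * wtt t r + wr t r * wtr t r + (w t r) ^ 5 * inverse r ^ 4 * wt t r - \<delta> * PE t r)"
  let ?Qr = "\<lambda>t r. - (E t * (wtr t r * wr t r + wt t r * wrr t r))"
  have cP: "cont2 ?P" "cont2 ?Q" "cont2 ?Pt" "cont2 ?Qr"
    unfolding cont2_def by (intro continuous_intros cont' cont_inverse cE c_PE[unfolded cont2_def]; simp)+
  have dP: "((\<lambda>t. ?P t r) has_real_derivative ?Pt t r) (at t within {0..X})" if "0 \<le> t" "t \<le> X" "1 \<le> r" for t r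
    unfolding PE_def
    by (auto intro!: derivative_eq_intros E_deriv w_t[OF that] wt_t[OF that] wr_t[OF that])
      (simp add: algebra_simps power2_eq_square)
  have dQ: "((\<lambda>r. ?Q t r) has_real_derivative ?Qr t r) (at r within {1..})" if "0 \<le> t" "t \<le> X" "1 \<le> r" for t r
    by (auto intro!: derivative_eq_intros w_r[OF that] wt_r[OF that] wr_r[OF that] simp: algebra_simps)
  note G = Green_tri[OF cP dP dQ x]
  \<comment> \<open>Half of \<open>- \<delta> * PE\<close> absorbs the error; the other half
    survives with at least the fraction 1/3 of the weight, hence
    \<open>\<delta> / 6\<close>.\<close>
  have div: "?Pt t r + ?Qr t r \<le> - (\<delta> / 6) * PE t r + \<delta> ^ 3"
    if tr: "0 \<le> t" "1 \<le> r" "t + r \<le> x" for t r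
  proof -
    have eb: "\<bar>e t r\<bar> \<le> \<delta>\<^sup>2" using tr x by (intro e_bound) auto
    have "?Pt t r + ?Qr t r = E t * (wt t r * e t r - \<delta> * PE t r)"
      by (simp add: e_def algebra_simps)
    also have "wt t r * e t r \<le> \<bar>wt t r\<bar> * \<delta>\<^sup>2"
      by (rule order_trans[OF abs_ge_self]) (simp add: abs_mult mult_left_mono eb)
    also have "\<bar>wt t r\<bar> * \<delta>\<^sup>2 \<le> \<delta> / 2 * PE t r + \<delta> ^ 3"
    proof -
      have "0 \<le> (\<bar>wt t r\<bar> / 2 - \<delta>)\<^sup>2" by simp
      then have "\<bar>wt t r\<bar> * \<delta> \<le> (wt t r)\<^sup>2 / 4 + \<delta>\<^sup>2"
        by (simp add: power2_diff power_divide)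
      also have "(wt t r)\<^sup>2 / 4 \<le> PE t r / 2"
      proof -
        have "0 \<le> (w t r) ^ 6 * inverse r ^ 4" using tr by simp
        moreover have "a / 4 \<le> ((a + b) / 2 + c / 6) / 2" if "0 \<le> a" "0 \<le> b" "0 \<le> c" for a b c :: real
          using that by (simp add: add_divide_distrib)
        ultimately show ?thesis unfolding PE_def by simp
      qed
      finally have "\<delta> * (\<bar>wt t r\<bar> * \<delta>) \<le> \<delta> * (PE t r / 2 + \<delta>\<^sup>2)"
        using \<delta> by (intro mult_left_mono) auto
      then show ?thesis by (simp add: algebra_simps power2_eq_square power3_eq_cube)
    qed
    finally have "?Pt t r + ?Qr t r \<le> E t * (\<delta> ^ 3 - \<delta> / 2 * PE t r)"
      by (simp add: E_def algebra_simps)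
    also have "\<dots> \<le> \<delta> ^ 3 - 1 / 3 * (\<delta> / 2 * PE t r)"
    proof -
      have "E t * \<delta> ^ 3 \<le> 1 * \<delta> ^ 3"
        unfolding E_def using exp_bound(2)[of t] tr \<delta> by (intro mult_right_mono) auto
      moreover have "1 / 3 * (\<delta> / 2 * PE t r) \<le> E t * (\<delta> / 2 * PE t r)"
        unfolding E_def using exp_bound(1)[of t] tr \<delta> x PE_nonneg[of r t] by (intro mult_right_mono) auto
      ultimately show ?thesis by (simp add: right_diff_distrib)
    qed
    finally show ?thesis by simp
  qed
  have "tri_int (\<lambda>t r. ?Pt t r + ?Qr t r) x \<le> tri_int (\<lambda>t r. - (\<delta> / 6) * PE t r + \<delta> ^ 3) x"
  proof (rule tri_int_mono)
    show "cont2 (\<lambda>t r. ?Pt t r + ?Qr t r)"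
      using cP(3,4) unfolding cont2_def by (intro continuous_on_add)
    show "cont2 (\<lambda>t r. - (\<delta> / 6) * PE t r + \<delta> ^ 3)"
      using c_PE unfolding cont2_def by (intro continuous_intros)
  qed (rule div)
  also have "\<dots> = - (\<delta> / 6) * tri_int PE x + tri_int (\<lambda>t r. \<delta> ^ 3) x"
  proof -
    have "cont2 (\<lambda>t r. - (\<delta> / 6) * PE t r)" "cont2 (\<lambda>t r. \<delta> ^ 3)"
      unfolding cont2_def by (intro continuous_intros c_PE[unfolded cont2_def])+
    from tri_int_add[OF this, of x] show ?thesis by (simp only: tri_int_cmult)
  qed
  also have "tri_int (\<lambda>t r. \<delta> ^ 3) x \<le> \<delta> ^ 3 * x\<^sup>2"
    using x \<delta> by (intro tri_int_const_le) auto
  also have "\<delta> ^ 3 * x\<^sup>2 \<le> 1"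
  proof -
    have "\<delta> ^ 3 * x\<^sup>2 \<le> \<delta> * X\<^sup>2"
      using \<delta> \<delta>_le x power_decreasing[of 1 3 \<delta>] by (intro mult_mono power_mono) auto
    then show ?thesis using \<delta> by simp
  qed
  finally have U: "tri_int (\<lambda>t r. ?Pt t r + ?Qr t r) x \<le> - (\<delta> / 6) * tri_int PE x + 1" by simp
  \<comment> \<open>On the hypotenuse \<open>?P + ?Q\<close> is the weight times
    \<open>flux\<close>, and the weight is at least 1/3.\<close>
  have 1: "1 / 3 * integral {1..x} (\<lambda>r. flux (x - r) r) \<le> integral {1..x} (\<lambda>r. ?P (x - r) r + ?Q (x - r) r)"
  proof (subst integral_mult_right[symmetric], rule integral_le)
    show "(\<lambda>r. 1 / 3 * flux (x - r) r) integrable_on {1..x}"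
      by (intro integrable_continuous_real continuous_intros ray_cont c_flux)
    show "(\<lambda>r. ?P (x - r) r + ?Q (x - r) r) integrable_on {1..x}"
      by (intro integrable_add ray_int(1)[OF cP(1)] ray_int(1)[OF cP(2)])
    fix r assume r: "r \<in> {1..x}"
    have "?P (x - r) r + ?Q (x - r) r = E (x - r) * flux (x - r) r"
      by (simp add: PE_def flux_def power2_eq_square algebra_simps add_divide_distrib diff_divide_distrib)
    then show "1 / 3 * flux (x - r) r \<le> ?P (x - r) r + ?Q (x - r) r"
      unfolding E_def using exp_bound(1)[of "x - r"] r x flux_nonneg[of r "x - r"]
      by (simp only:) (intro mult_right_mono, auto)
  qed
  have 2: "integral {1..x} (\<lambda>r. ?P 0 r) + (w 0 1)\<^sup>2 / 2 \<le> C0"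
    using init_le[OF x] by (simp add: E_def)
  \<comment> \<open>With \<open>wr = w\<close> the boundary flux is, up to the weight, the time
    derivative of \<open>- w^2 / 2\<close>; differentiating the weight adds a term of favourable
    sign. Thus the boundary energy at the final time is gained as well.\<close>
  have 3: "integral {0..x - 1} (\<lambda>t. ?Q t 1) \<le> (w 0 1)\<^sup>2 / 2 - 1 / 3 * ((w (x - 1) 1)\<^sup>2 / 2)"
  proof -
    let ?F = "\<lambda>t. - (E t * ((w t 1)\<^sup>2 / 2))" and ?F' = "\<lambda>t. \<delta> * E t * ((w t 1)\<^sup>2 / 2) - E t * (w t 1 * wt t 1)"
    have F: "(?F' has_integral ?F (x - 1) - ?F 0) {0..x - 1}"
    proof (rule FTC_within[where S = "{0..X}"])
      fix t assume "t \<in> {0..x - 1}"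
      then have t: "0 \<le> t" "t \<le> X" using x by auto
      show "(?F has_real_derivative ?F' t) (at t within {0..X})"
        by (auto intro!: derivative_eq_intros E_deriv w_t[OF t] simp: field_simps)
    qed (use x in auto)
    have Qi: "((\<lambda>t. ?Q t 1) has_integral integral {0..x - 1} (\<lambda>t. ?Q t 1)) {0..x - 1}"
      by (intro integrable_integral ray_int(3) cP)
    have "integral {0..x - 1} (\<lambda>t. ?Q t 1) \<le> ?F (x - 1) - ?F 0"
    proof (rule has_integral_le[OF Qi F])
      fix t assume "t \<in> {0..x - 1}"
      then have "wr t 1 = w t 1" using x by (intro robin) auto
      then show "?Q t 1 \<le> ?F' t" using \<delta> by (simp add: E_def mult_ac)
    qed
    moreover have "1 / 3 * ((w (x - 1) 1)\<^sup>2 / 2) \<le> E (x - 1) * ((w (x - 1) 1)\<^sup>2 / 2)"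
      unfolding E_def using exp_bound(1)[of "x - 1"] x by (intro mult_right_mono) auto
    ultimately show ?thesis by (simp add: E_def)
  qed
  from U 1 2 3 G show ?thesis by (simp add: K_def)
qed

lemma tri_PE: "\<delta> * tri_int PE X \<le> 2 * K"
proof -
  have "0 \<le> integral {1..X} (\<lambda>r. flux (X - r) r)"
    by (intro integral_nonneg ray_int c_flux) (auto simp: flux_nonneg)
  moreover have "0 \<le> (w (X - 1) 1)\<^sup>2 / 2" by simp
  moreover have "1 \<le> X" using X by simp
  ultimately show ?thesis using energy_flux[OF \<open>1 \<le> X\<close> order_refl] by linarith
qed

lemma ray_q:
  assumes x: "1 \<le> x" "x \<le> X"
  shows "integral {1..x} (\<lambda>r. (wt (x - r) r - wr (x - r) r)\<^sup>2) / 2 + (w (x - 1) 1)\<^sup>2 / 2 \<le> K"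
proof -
  have "integral {1..x} (\<lambda>r. (wt (x - r) r - wr (x - r) r)\<^sup>2 / 2) \<le> integral {1..x} (\<lambda>r. flux (x - r) r)"
    by (intro integral_le ray_int c_flux integrable_continuous_real continuous_intros ray_cont cont) (auto simp: flux_def)
  moreover have "0 \<le> tri_int PE x"
    unfolding tri_int_def by (intro Bochner_Integration.integral_nonneg) (auto simp: indicator_def tri_def PE_nonneg)
  then have "0 \<le> \<delta> / 2 * tri_int PE x" using \<delta> by simp
  ultimately show ?thesis using energy_flux[OF x] by simp
qed

lemma ray_deriv:
  assumes x: "1 \<le> x" "x \<le> X" and r: "r \<in> {1..x}"
  shows "((\<lambda>r. w (x - r) r) has_real_derivative - (wt (x - r) r - wr (x - r) r)) (at r within {1..x})"
proof -
  have "((\<lambda>r. x - r) has_real_derivative - 1) (at r within {1..x})" "((\<lambda>r. r) has_real_derivative 1) (at r within {1..x})"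
    by (auto intro!: derivative_eq_intros)
  from has_real_derivative_ray[OF cont(3) w_t w_r this] assms show ?thesis by auto
qed

text \<open>Integrate along the incoming ray from its foot on \<open>r = 1\<close>, where
  \<open>w^2\<close> is bounded by the boundary energy. The flux bounds the square integral of the
  ray derivative \<open>wt - wr\<close>, and Cauchy-Schwarz contributes the length
  \<open>r - 1\<close>.\<close>

lemma pointwise:
  assumes tr: "0 \<le> t" "1 \<le> r" "t + r \<le> X"
  shows "(w t r)\<^sup>2 \<le> 4 * K * r"
proof -
  define x where "x = t + r"
  have x: "1 \<le> x" "x \<le> X" "r \<le> x" using tr by (auto simp: x_def)
  let ?q = "\<lambda>r. wt (x - r) r - wr (x - r) r"
  have cq: "continuous_on {1..x} ?q" by (intro continuous_intros ray_cont cont)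
  have "((\<lambda>r. - ?q r) has_integral w (x - r) r - w (x - 1) 1) {1..r}"
    using x tr by (intro FTC_within[where S = "{1..x}"] ray_deriv) auto
  from integral_unique[OF this] have "- integral {1..r} ?q = w (x - r) r - w (x - 1) 1"
    by (simp only: integral_neg)
  then have *: "w t r = w (x - 1) 1 - integral {1..r} ?q"
    by (simp add: x_def)
  have "(w t r)\<^sup>2 \<le> 2 * (w (x - 1) 1)\<^sup>2 + 2 * (integral {1..r} ?q)\<^sup>2"
  proof -
    have "0 \<le> (w (x - 1) 1 + integral {1..r} ?q)\<^sup>2" by simp
    then show ?thesis unfolding * by (simp add: power2_eq_square algebra_simps)
  qed
  also have "(integral {1..r} ?q)\<^sup>2 \<le> (r - 1) * integral {1..r} (\<lambda>r. (?q r)\<^sup>2)"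
    using tr x by (intro integral_power2_le continuous_on_subset[OF cq]) auto
  also have "integral {1..r} (\<lambda>r. (?q r)\<^sup>2) \<le> integral {1..x} (\<lambda>r. (?q r)\<^sup>2)"
    using x by (intro integral_subset_le integrable_continuous_real continuous_intros continuous_on_subset[OF cq]) auto
  finally have "(w t r)\<^sup>2 \<le> 2 * (w (x - 1) 1)\<^sup>2 + 2 * ((r - 1) * integral {1..x} (\<lambda>r. (?q r)\<^sup>2))"
    using tr by (simp add: mult_left_mono)
  also have "\<dots> \<le> 2 * (2 * K) + 2 * ((r - 1) * (2 * K))"
  proof -
    have "0 \<le> integral {1..x} (\<lambda>r. (?q r)\<^sup>2)"
      by (intro integral_nonneg integrable_continuous_real continuous_intros cq) auto
    moreover have "0 \<le> (w (x - 1) 1)\<^sup>2" by simp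
    ultimately have "integral {1..x} (\<lambda>r. (?q r)\<^sup>2) \<le> 2 * K" "(w (x - 1) 1)\<^sup>2 \<le> 2 * K"
      using ray_q[OF x(1,2)] by linarith+
    then show ?thesis using tr by (intro add_mono mult_left_mono) auto
  qed
  finally show ?thesis by (simp add: algebra_simps)
qed

text \<open>Along the ray the derivative of \<open>v^2 / r\<close> is \<open>- v^2 / r^2\<close>
  plus a cross term, which Young's inequality splits so that half of \<open>v^2 / r^2\<close>
  remains. The value at \<open>r = 1\<close> is again controlled by \<open>K\<close>.\<close>

lemma ray_Hardy:
  assumes x: "1 \<le> x" "x \<le> X"
  shows "integral {1..x} (\<lambda>r. (w (x - r) r)\<^sup>2 * inverse r ^ 2) \<le> 8 * K"
proof -
  let ?v = "\<lambda>r. w (x - r) r" and ?q = "\<lambda>r. wt (x - r) r - wr (x - r) r"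
  have cv: "continuous_on {1..x} ?v" and cq: "continuous_on {1..x} ?q" and ci: "continuous_on {1..x} (\<lambda>r::real. inverse r)"
    by (intro continuous_intros ray_cont cont; simp)+
  note int = integrable_continuous_real continuous_intros cv cq ci
  let ?F' = "\<lambda>r. - (2 * ?v r * ?q r * inverse r) - (?v r)\<^sup>2 * inverse r ^ 2"
  have F: "(?F' has_integral (?v x)\<^sup>2 * inverse x - (?v 1)\<^sup>2 * inverse 1) {1..x}"
  proof (rule FTC_within[where S = "{1..x}"])
    fix r assume r: "r \<in> {1..x}"
    show "((\<lambda>r. (?v r)\<^sup>2 * inverse r) has_real_derivative ?F' r) (at r within {1..x})"
      using r by (auto intro!: derivative_eq_intros ray_deriv[OF x r] simp: power2_eq_square algebra_simps)
  qed (use x in auto)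
  have "(?v x)\<^sup>2 * inverse x - (?v 1)\<^sup>2 * inverse 1 \<le> integral {1..x} (\<lambda>r. 2 * (?q r)\<^sup>2 - 1 / 2 * ((?v r)\<^sup>2 * inverse r ^ 2))"
  proof (rule has_integral_le[OF F integrable_integral])
    show "(\<lambda>r. 2 * (?q r)\<^sup>2 - 1 / 2 * ((?v r)\<^sup>2 * inverse r ^ 2)) integrable_on {1..x}"
      by (intro int)
    fix r assume "r \<in> {1..x}"
    have "0 \<le> 2 * (?q r + 1 / 2 * (?v r * inverse r))\<^sup>2" by simp
    then show "?F' r \<le> 2 * (?q r)\<^sup>2 - 1 / 2 * ((?v r)\<^sup>2 * inverse r ^ 2)"
      by (simp add: power2_eq_square algebra_simps)
  qed
  also have "\<dots> = 2 * integral {1..x} (\<lambda>r. (?q r)\<^sup>2) - 1 / 2 * integral {1..x} (\<lambda>r. (?v r)\<^sup>2 * inverse r ^ 2)"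
    by (subst integral_diff) (auto intro!: int)
  finally have fin: "(?v x)\<^sup>2 * inverse x - (?v 1)\<^sup>2 * inverse 1
      \<le> 2 * integral {1..x} (\<lambda>r. (?q r)\<^sup>2) - 1 / 2 * integral {1..x} (\<lambda>r. (?v r)\<^sup>2 * inverse r ^ 2)" .
  have "1 / 2 * integral {1..x} (\<lambda>r. (?v r)\<^sup>2 * inverse r ^ 2) \<le> 2 * integral {1..x} (\<lambda>r. (?q r)\<^sup>2) + (?v 1)\<^sup>2"
  proof -
    have "0 \<le> (?v x)\<^sup>2 * inverse x" using x by simp
    with fin show ?thesis by simp
  qed
  then show ?thesis
    using ray_q[OF x] zero_le_power2[of "?v 1"] by linarith
qed

end

section \<open>The Morawetz estimate\<close>

lemma integral_inverse_power2_le: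
  assumes "1 \<le> (x::real)"
  shows "integral {1..x} (\<lambda>r. inverse r ^ 2) \<le> 1"
proof -
  have "((\<lambda>r. inverse r ^ 2) has_integral - inverse x - (- inverse 1)) {1..x}"
  proof (rule FTC_within[where S = "{1..}"])
    fix r :: real assume "r \<in> {1..x}"
    then show "((\<lambda>r. - inverse r) has_real_derivative inverse r ^ 2) (at r within {1..})"
      by (auto intro!: derivative_eq_intros simp: power2_eq_square)
  qed (use assms in auto)
  from integral_unique[OF this] assms show ?thesis by simp
qed

lemma abs_le_power2: "\<bar>x\<bar> \<le> x\<^sup>2 / 2 + 1 / 2" for x :: real
proof -
  have "0 \<le> (\<bar>x\<bar> - 1)\<^sup>2" by simp
  then show ?thesis by (simp add: power2_diff)
qed

lemma half_sum_squares: "a * b \<le> a\<^sup>2 / 2 + b\<^sup>2 / 2" for a b :: real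
proof -
  have "0 \<le> (a - b)\<^sup>2" by simp
  then show ?thesis by (simp add: power2_diff)
qed

lemma inverse_powers: "(r::real) \<ge> 1 \<Longrightarrow> 0 \<le> inverse r \<and> inverse r \<le> 1 \<and> inverse r ^ 6 \<le> inverse r ^ 5
    \<and> inverse r ^ 4 \<le> inverse r ^ 2 \<and> inverse r ^ 3 \<le> inverse r ^ 2"
  by (intro conjI power_decreasing) (auto simp: inverse_le_1_iff)

text \<open>A polynomial identity with \<open>i\<close> for \<open>1 / r\<close> and the derivatives
  as free variables. Before the correction the zero-order bulk term is
  \<open>3/2 * w^2 * i^4\<close>, of the wrong sign; adding three quarters of the
  \<open>r\<close>-derivative of \<open>w^2 * i^3\<close> turns the quadratic terms into minus a
  square and minus \<open>3/16 * w^2 * i^4\<close>.\<close>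

lemma Morawetz_divergence_identity:
  fixes i w wt wr wtt wtr wrr :: real
  shows "((1 - i) * wtr + i\<^sup>2 / 2 * wt) * wt + ((1 - i) * wr + i\<^sup>2 / 2 * w) * wtt +
     (i\<^sup>2 * (w ^ 6 * i ^ 4 / 6 - wt\<^sup>2 / 2 - wr\<^sup>2 / 2)
      + (1 - i) * (w ^ 5 * wr * i ^ 4 - 2 / 3 * w ^ 6 * i ^ 5 - wt * wtr - wr * wrr)
      + i ^ 3 * w * wr - i\<^sup>2 / 2 * (wr\<^sup>2 + w * wrr) + w * wr * i ^ 3 / 2 - 3 / 4 * w\<^sup>2 * i ^ 4)
    = ((1 - i) * wr + i\<^sup>2 / 2 * w) * (wtt - wrr + w ^ 5 * i ^ 4)
      - ((wr - 3 / 4 * w * i)\<^sup>2 * i\<^sup>2 + 3 / 16 * w\<^sup>2 * i ^ 4 + (2 / 3 * i ^ 5 - 1 / 3 * i ^ 6) * w ^ 6)"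
  by (simp add: field_simps eval_nat_numeral)

text \<open>On the hypotenuse the derivatives enter only through \<open>wt - wr\<close>, the
  derivative along the ray, which the energy flux controls. A general combination of
  \<open>wt\<close> and \<open>wr\<close> would not be bounded there.\<close>

lemma Morawetz_diagonal_identity:
  fixes i w wt wr :: real
  shows "- (((1 - i) * wr + i\<^sup>2 / 2 * w) * wt + ((1 - i) * (w ^ 6 * i ^ 4 / 6 - wt\<^sup>2 / 2 - wr\<^sup>2 / 2) - i\<^sup>2 / 2 * w * wr + w\<^sup>2 * i ^ 3 / 4))
    = (1 - i) / 2 * (wt - wr)\<^sup>2 - i\<^sup>2 / 2 * w * (wt - wr) - w\<^sup>2 * i ^ 3 / 4 - (1 - i) * (w ^ 6 * i ^ 4 / 6)"
  by (simp add: field_simps eval_nat_numeral)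

lemma Morawetz_diagonal_bound:
  fixes i w q :: real
  shows "1 / 2 * q\<^sup>2 - i\<^sup>2 / 2 * w * q \<le> q\<^sup>2 + w\<^sup>2 * i ^ 4"
proof -
  have "0 \<le> 1 / 2 * (q + i\<^sup>2 / 2 * w)\<^sup>2 + 7 / 8 * (i\<^sup>2 * w)\<^sup>2" by simp
  then show ?thesis by (simp add: field_simps eval_nat_numeral)
qed

context approx_wave
begin

text \<open>Here the surplus of the weighted energy estimate is spent:
  \<open>\<delta>^2 * PE\<close> integrates to at most \<open>2 * K\<close> by
  \<open>tri_PE\<close>, and the constant part to at most
  \<open>2 * K * (\<delta> * X) * (\<delta> * X^2)\<close>.\<close>

lemma e_error_tri:
  assumes M: "cont2 M" and M_le: "\<And>t r. 0 \<le> t \<Longrightarrow> 1 \<le> r \<Longrightarrow> t + r \<le> X \<Longrightarrow> \<bar>M t r\<bar> \<le> PE t r + 2 + K * X"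
  shows "tri_int (\<lambda>t r. M t r * e t r) X \<le> 4 * K"
proof -
  have "tri_int (\<lambda>t r. M t r * e t r) X \<le> tri_int (\<lambda>t r. \<delta>\<^sup>2 * PE t r + \<delta>\<^sup>2 * (2 + K * X)) X"
  proof (rule tri_int_mono)
    show "cont2 (\<lambda>t r. M t r * e t r)" using M c_e unfolding cont2_def by (intro continuous_intros)
    show "cont2 (\<lambda>t r. \<delta>\<^sup>2 * PE t r + \<delta>\<^sup>2 * (2 + K * X))" using c_PE unfolding cont2_def by (intro continuous_intros)
    fix t r :: real assume tr: "0 \<le> t" "1 \<le> r" "t + r \<le> X"
    have "M t r * e t r \<le> \<bar>M t r\<bar> * \<bar>e t r\<bar>"
      by (rule order_trans[OF abs_ge_self]) (simp add: abs_mult)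
    also have "\<dots> \<le> (PE t r + 2 + K * X) * \<delta>\<^sup>2"
      using M_le[OF tr] e_bound[OF tr] by (intro mult_mono) auto
    finally show "M t r * e t r \<le> \<delta>\<^sup>2 * PE t r + \<delta>\<^sup>2 * (2 + K * X)" by (simp add: algebra_simps)
  qed
  also have "\<dots> = \<delta>\<^sup>2 * tri_int PE X + tri_int (\<lambda>t r. \<delta>\<^sup>2 * (2 + K * X)) X"
  proof -
    have "cont2 (\<lambda>t r. \<delta>\<^sup>2 * PE t r)" "cont2 (\<lambda>t r. \<delta>\<^sup>2 * (2 + K * X))"
      unfolding cont2_def by (intro continuous_intros c_PE[unfolded cont2_def])+
    from tri_int_add[OF this, of X] show ?thesis by (simp only: tri_int_cmult)
  qed
  also have "tri_int (\<lambda>t r. \<delta>\<^sup>2 * (2 + K * X)) X \<le> \<delta>\<^sup>2 * (2 + K * X) * X\<^sup>2"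
    using X K_ge by (intro tri_int_const_le) auto
  also have "\<delta>\<^sup>2 * (2 + K * X) * X\<^sup>2 \<le> 2 * K"
  proof -
    have "2 + K * X \<le> 2 * K * X"
    proof -
      have "2 \<le> K * X" using X K_ge mult_mono[of 1 K 2 X] by auto
      then have "2 + K * X \<le> 2 * (K * X)" by linarith
      then show ?thesis by (simp only: mult.assoc)
    qed
    then have "\<delta>\<^sup>2 * (2 + K * X) * X\<^sup>2 \<le> \<delta>\<^sup>2 * (2 * K * X) * X\<^sup>2"
      by (intro mult_right_mono mult_left_mono) auto
    also have "\<dots> = 2 * K * ((\<delta> * X) * (\<delta> * X\<^sup>2))"
      by (simp add: power2_eq_square)
    also have "\<dots> \<le> 2 * K * (1 * 1)"
      using \<delta> \<delta>_le X K_ge by (intro mult_left_mono mult_mono) auto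
    finally show ?thesis by simp
  qed
  also have "\<delta>\<^sup>2 * tri_int PE X \<le> 2 * K"
  proof -
    have "\<delta>\<^sup>2 * tri_int PE X = \<delta> * (\<delta> * tri_int PE X)" by (simp add: power2_eq_square)
    also have "\<dots> \<le> \<delta> * (2 * K)" using tri_PE \<delta> by (intro mult_left_mono) auto
    also have "\<dots> \<le> 1 * (2 * K)" using \<delta>_le K_ge by (intro mult_right_mono) auto
    finally show ?thesis by simp
  qed
  finally show ?thesis by simp
qed

lemma init_PE: "integral {1..X} (\<lambda>r. PE 0 r) \<le> K"
proof -
  have "1 \<le> X" using X by simp
  from init_le[OF this order_refl] have "integral {1..X} (\<lambda>r. PE 0 r) \<le> C0"
    by (rule order_trans[rotated]) simp
  also have "C0 \<le> K" using C0_nonneg by (simp add: K_def)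
  finally show ?thesis .
qed

lemma abs_wr_le: "r \<ge> 1 \<Longrightarrow> \<bar>wr t r\<bar> \<le> PE t r + 1 / 2"
proof -
  assume "r \<ge> 1"
  then have "0 \<le> (w t r) ^ 6 * inverse r ^ 4" by simp
  with abs_le_power2[of "wr t r"] show ?thesis
    unfolding PE_def add_divide_distrib by (smt (verit) divide_nonneg_nonneg zero_le_power2)
qed

text \<open>The multiplier is \<open>a u\<^sub>r + b u\<close> in the variable \<open>w\<close> with \<open>a = 1 - 1/r\<close> and \<open>b = a'/2\<close>; since
  \<open>a(1) = 0\<close>, the boundary contributes only \<open>- w\<^sup>2\<close>, and part of it is traded, through the exact
  derivative \<open>(3/4) (w\<^sup>2/r\<^sup>3)\<^sub>r\<close>, for the positivity of the quadratic bulk term.\<close>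

lemma Morawetz:
  "integral {0..X - 1} (\<lambda>t. (w t 1)\<^sup>2) \<le> 100 * K"
  "tri_int (\<lambda>t r. (w t r) ^ 6 * inverse r ^ 5) X \<le> 100 * K"
proof -
  let ?i = "\<lambda>r::real. inverse r"
  let ?M = "\<lambda>t r. (1 - ?i r) * wr t r + ?i r ^ 2 / 2 * w t r"
  let ?P = "\<lambda>t r. ?M t r * wt t r"
  let ?Pt = "\<lambda>t r. ((1 - ?i r) * wtr t r + ?i r ^ 2 / 2 * wt t r) * wt t r + ?M t r * wtt t r"
  let ?Q = "\<lambda>t r. (1 - ?i r) * ((w t r) ^ 6 * ?i r ^ 4 / 6 - (wt t r)\<^sup>2 / 2 - (wr t r)\<^sup>2 / 2)
      - ?i r ^ 2 / 2 * w t r * wr t r + (w t r)\<^sup>2 * ?i r ^ 3 / 4"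
  let ?Qr = "\<lambda>t r. ?i r ^ 2 * ((w t r) ^ 6 * ?i r ^ 4 / 6 - (wt t r)\<^sup>2 / 2 - (wr t r)\<^sup>2 / 2)
      + (1 - ?i r) * ((w t r) ^ 5 * wr t r * ?i r ^ 4 - 2 / 3 * (w t r) ^ 6 * ?i r ^ 5 - wt t r * wtr t r - wr t r * wrr t r)
      + ?i r ^ 3 * w t r * wr t r - ?i r ^ 2 / 2 * ((wr t r)\<^sup>2 + w t r * wrr t r)
      + (w t r) * wr t r * ?i r ^ 3 / 2 - 3 / 4 * (w t r)\<^sup>2 * ?i r ^ 4"
  have cP: "cont2 ?P" "cont2 ?Q" "cont2 ?Pt" "cont2 ?Qr"
    unfolding cont2_def by (intro continuous_intros cont' cont_inverse; simp)+
  have dP: "((\<lambda>t. ?P t r) has_real_derivative ?Pt t r) (at t within {0..X})" if "0 \<le> t" "t \<le> X" "1 \<le> r" for t r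
    by (auto intro!: derivative_eq_intros w_t[OF that] wt_t[OF that] wr_t[OF that] simp: algebra_simps)
  have di: "((\<lambda>r. ?i r) has_real_derivative - (?i r ^ 2)) (at r within {1..})" if "1 \<le> r" for r
    using that by (auto intro!: derivative_eq_intros simp: power2_eq_square)
  have dQ: "((\<lambda>r. ?Q t r) has_real_derivative ?Qr t r) (at r within {1..})" if "0 \<le> t" "t \<le> X" "1 \<le> r" for t r
  proof -
    have "((\<lambda>r. (1 - i r) * ((w t r) ^ 6 * i r ^ 4 / 6 - (wt t r)\<^sup>2 / 2 - (wr t r)\<^sup>2 / 2)
      - i r ^ 2 / 2 * w t r * wr t r + (w t r)\<^sup>2 * i r ^ 3 / 4) has_real_derivative
      i r ^ 2 * ((w t r) ^ 6 * i r ^ 4 / 6 - (wt t r)\<^sup>2 / 2 - (wr t r)\<^sup>2 / 2)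
      + (1 - i r) * ((w t r) ^ 5 * wr t r * i r ^ 4 - 2 / 3 * (w t r) ^ 6 * i r ^ 5 - wt t r * wtr t r - wr t r * wrr t r)
      + i r ^ 3 * w t r * wr t r - i r ^ 2 / 2 * ((wr t r)\<^sup>2 + w t r * wrr t r)
      + (w t r) * wr t r * i r ^ 3 / 2 - 3 / 4 * (w t r)\<^sup>2 * i r ^ 4) (at r within {1..})"
      if di: "(i has_real_derivative - (i r ^ 2)) (at r within {1..})" for i
      by (auto intro!: derivative_eq_intros di w_r[OF \<open>0 \<le> t\<close> \<open>t \<le> X\<close> \<open>1 \<le> r\<close>] wt_r[OF \<open>0 \<le> t\<close> \<open>t \<le> X\<close> \<open>1 \<le> r\<close>] wr_r[OF \<open>0 \<le> t\<close> \<open>t \<le> X\<close> \<open>1 \<le> r\<close>])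
        (simp add: field_simps power2_eq_square power3_eq_cube eval_nat_numeral)
    from this[OF di[OF \<open>1 \<le> r\<close>]] show ?thesis .
  qed
  have X1: "1 \<le> X" using X by simp
  note G = Green_tri[OF cP dP dQ X1 order_refl]
  let ?B = "\<lambda>t r. (w t r) ^ 6 * ?i r ^ 5"
  \<comment> \<open>For \<open>r \<ge> 1\<close> the sixth power of \<open>1 / r\<close> is at most
    the fifth, so the potential term keeps a third of \<open>w^6 / r^5\<close>; the two quadratic
    terms are nonnegative and dropped.\<close>
  have div: "?Pt t r + ?Qr t r \<le> - (1 / 3) * ?B t r + ?M t r * e t r" if "1 \<le> r" for t r
  proof -
    have "?Pt t r + ?Qr t r = ?M t r * e t r
      - ((wr t r - 3 / 4 * w t r * ?i r)\<^sup>2 * ?i r ^ 2 + 3 / 16 * (w t r)\<^sup>2 * ?i r ^ 4 + (2 / 3 * ?i r ^ 5 - 1 / 3 * ?i r ^ 6) * (w t r) ^ 6)"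
      unfolding e_def by (rule Morawetz_divergence_identity)
    moreover have "1 / 3 * ?i r ^ 5 * (w t r) ^ 6 \<le> (2 / 3 * ?i r ^ 5 - 1 / 3 * ?i r ^ 6) * (w t r) ^ 6"
      using inverse_powers[OF that] by (intro mult_right_mono) auto
    moreover have "0 \<le> (wr t r - 3 / 4 * w t r * ?i r)\<^sup>2 * ?i r ^ 2" "0 \<le> 3 / 16 * (w t r)\<^sup>2 * ?i r ^ 4"
      by simp_all
    moreover have "- (1 / 3) * ?B t r = - (1 / 3 * ?i r ^ 5 * (w t r) ^ 6)" by simp
    ultimately show ?thesis by linarith
  qed
  have cM: "cont2 ?M" unfolding cont2_def by (intro continuous_intros cont' cont_inverse) auto
  have "tri_int (\<lambda>t r. ?Pt t r + ?Qr t r) X \<le> tri_int (\<lambda>t r. - (1 / 3) * ?B t r + ?M t r * e t r) X"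
  proof (rule tri_int_mono)
    show "cont2 (\<lambda>t r. ?Pt t r + ?Qr t r)" using continuous_on_add[OF cP(3)[unfolded cont2_def] cP(4)[unfolded cont2_def]] unfolding cont2_def .
    show "cont2 (\<lambda>t r. - (1 / 3) * ?B t r + ?M t r * e t r)"
      unfolding cont2_def by (intro continuous_intros cont' cont_inverse c_e[unfolded cont2_def]; simp)
  qed (rule div)
  also have "\<dots> = - (1 / 3) * tri_int ?B X + tri_int (\<lambda>t r. ?M t r * e t r) X"
  proof -
    have "cont2 (\<lambda>t r. - (1 / 3) * ?B t r)" "cont2 (\<lambda>t r. ?M t r * e t r)"
      unfolding cont2_def by (intro continuous_intros c_bulk[unfolded cont2_def] cM[unfolded cont2_def] c_e[unfolded cont2_def])+
    from tri_int_add[OF this, of X] show ?thesis by (simp only: tri_int_cmult)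
  qed
  also have "tri_int (\<lambda>t r. ?M t r * e t r) X \<le> 4 * K"
  proof (rule e_error_tri[OF cM])
    fix t r assume tr: "0 \<le> t" "1 \<le> r" "t + r \<le> X"
    note i = inverse_powers[OF tr(2)]
    have 1: "\<bar>?M t r\<bar> \<le> \<bar>(1 - ?i r) * wr t r\<bar> + \<bar>?i r ^ 2 / 2 * w t r\<bar>" by (rule abs_triangle_ineq)
    have 2: "\<bar>(1 - ?i r) * wr t r\<bar> \<le> 1 * \<bar>wr t r\<bar>"
      unfolding abs_mult using i by (intro mult_right_mono) auto
    have 3: "\<bar>?i r ^ 2 / 2 * w t r\<bar> \<le> 1 / 2 * \<bar>w t r\<bar>"
      unfolding abs_mult using i power_le_one[of "?i r" 2] by (intro mult_right_mono) auto
    \<comment> \<open>The zero-order part of the multiplier is not bounded by the energy density;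
      the pointwise bound replaces it by a constant of order \<open>K * X\<close>, which
      \<open>e_error_tri\<close> tolerates.\<close>
    have 4: "(w t r)\<^sup>2 \<le> 4 * (K * X)"
    proof -
      have "(w t r)\<^sup>2 \<le> 4 * K * r" by (rule pointwise[OF tr])
      also have "4 * K * r \<le> 4 * K * X" using tr K_ge by (intro mult_left_mono) auto
      finally show ?thesis by simp
    qed
    show "\<bar>?M t r\<bar> \<le> PE t r + 2 + K * X"
      using abs_wr_le[OF tr(2), of t] 1 2 3 4 abs_le_power2[of "w t r"] by linarith
  qed
  finally have U: "tri_int (\<lambda>t r. ?Pt t r + ?Qr t r) X \<le> - (1 / 3) * tri_int ?B X + 4 * K" by simp
  \<comment> \<open>The hypotenuse: \<open>ray_q\<close> contributes \<open>2 * K\<close> and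
    \<open>ray_Hardy\<close> contributes \<open>8 * K\<close>.\<close>
  have 1: "- integral {1..X} (\<lambda>r. ?P (X - r) r + ?Q (X - r) r) \<le> 10 * K"
  proof -
    let ?q = "\<lambda>r. (wt (X - r) r - wr (X - r) r)\<^sup>2" and ?h = "\<lambda>r. (w (X - r) r)\<^sup>2 * ?i r ^ 2"
    have cq: "continuous_on {1..X} ?q" "continuous_on {1..X} ?h"
      by (intro continuous_intros ray_cont cont; simp)+
    have "- integral {1..X} (\<lambda>r. ?P (X - r) r + ?Q (X - r) r) = integral {1..X} (\<lambda>r. - (?P (X - r) r + ?Q (X - r) r))"
      by (rule integral_neg[symmetric])
    also have "\<dots> \<le> integral {1..X} (\<lambda>r. ?q r + ?h r)"
    proof (rule integral_le)
      show "(\<lambda>r. - (?P (X - r) r + ?Q (X - r) r)) integrable_on {1..X}"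
        by (intro integrable_neg integrable_add ray_int(1)[OF cP(1)] ray_int(1)[OF cP(2)])
      show "(\<lambda>r. ?q r + ?h r) integrable_on {1..X}"
        by (intro integrable_add integrable_continuous_real cq)
      fix r assume r: "r \<in> {1..X}"
      then have i: "0 \<le> ?i r" "?i r \<le> 1" "?i r ^ 4 \<le> ?i r ^ 2" using inverse_powers[of r] by auto
      define W where "W = w (X - r) r"
      define q where "q = wt (X - r) r - wr (X - r) r"
      have "- (?P (X - r) r + ?Q (X - r) r) = (1 - ?i r) / 2 * q\<^sup>2 - ?i r ^ 2 / 2 * W * q - W\<^sup>2 * ?i r ^ 3 / 4 - (1 - ?i r) * (W ^ 6 * ?i r ^ 4 / 6)"
        unfolding W_def q_def by (rule Morawetz_diagonal_identity)
      also have "\<dots> \<le> (1 - ?i r) / 2 * q\<^sup>2 - ?i r ^ 2 / 2 * W * q"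
      proof -
        have "0 \<le> W\<^sup>2 * ?i r ^ 3 / 4" "0 \<le> (1 - ?i r) * (W ^ 6 * ?i r ^ 4 / 6)" using i by simp_all
        then show ?thesis by linarith
      qed
      also have "(1 - ?i r) / 2 * q\<^sup>2 \<le> 1 / 2 * q\<^sup>2"
        using i by (intro mult_right_mono) auto
      also have "1 / 2 * q\<^sup>2 - ?i r ^ 2 / 2 * W * q \<le> q\<^sup>2 + W\<^sup>2 * ?i r ^ 4"
        by (rule Morawetz_diagonal_bound)
      also have "W\<^sup>2 * ?i r ^ 4 \<le> W\<^sup>2 * ?i r ^ 2" using i by (intro mult_left_mono) auto
      finally show "- (?P (X - r) r + ?Q (X - r) r) \<le> ?q r + ?h r" by (simp add: W_def q_def)
    qed
    also have "\<dots> = integral {1..X} ?q + integral {1..X} ?h"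
      by (intro integral_add integrable_continuous_real cq)
    also have "integral {1..X} ?q \<le> 2 * K"
      using ray_q[OF X1 order_refl] zero_le_power2[of "w (X - 1) 1"] by linarith
    also have "integral {1..X} ?h \<le> 8 * K" by (rule ray_Hardy[OF X1 order_refl])
    finally show ?thesis by simp
  qed
  \<comment> \<open>On the initial line the part \<open>w / (2 * r^2)\<close> of the multiplier is
    square integrable by the pointwise bound, which gives \<open>B^2 \<le> K / r^3\<close>.\<close>
  have 2: "integral {1..X} (\<lambda>r. ?P 0 r) \<le> 6 * K"
  proof -
    have ci: "continuous_on {1..X} (\<lambda>r. ?i r ^ 2)" by (intro continuous_intros) auto
    have "integral {1..X} (\<lambda>r. ?P 0 r) \<le> integral {1..X} (\<lambda>r. 2 * PE 0 r + 4 * K * ?i r ^ 2)"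
    proof (rule integral_le)
      show "(\<lambda>r. ?P 0 r) integrable_on {1..X}" by (rule ray_int(2)[OF cP(1)])
      show "(\<lambda>r. 2 * PE 0 r + 4 * K * ?i r ^ 2) integrable_on {1..X}"
        by (intro integrable_continuous_real continuous_intros ray_cont(2) c_PE) auto
      fix r assume r: "r \<in> {1..X}"
      then have i: "0 \<le> ?i r" "?i r \<le> 1" "?i r ^ 3 \<le> ?i r ^ 2" using inverse_powers[of r] by auto
      define A where "A = (1 - ?i r) * wr 0 r"
      define B where "B = ?i r ^ 2 / 2 * w 0 r"
      have P: "?P 0 r = A * wt 0 r + B * wt 0 r"
        by (simp add: A_def B_def algebra_simps)
      have "A\<^sup>2 \<le> (wr 0 r)\<^sup>2"
        unfolding A_def using i mult_right_mono[of "1 - ?i r" 1 "\<bar>wr 0 r\<bar>"] by (subst abs_le_square_iff[symmetric]) (simp add: abs_mult)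
      moreover have "B\<^sup>2 \<le> K * ?i r ^ 2"
      proof -
        have "B\<^sup>2 = ?i r ^ 4 / 4 * (w 0 r)\<^sup>2"
          by (simp add: B_def power2_eq_square eval_nat_numeral)
        also have "\<dots> \<le> ?i r ^ 4 / 4 * (4 * K * r)"
          using r by (intro mult_left_mono pointwise) auto
        also have "\<dots> = K * ?i r ^ 3"
          using r by (simp add: field_simps eval_nat_numeral)
        also have "\<dots> \<le> K * ?i r ^ 2" using i K_ge by (intro mult_left_mono) auto
        finally show ?thesis .
      qed
      moreover have "((wt 0 r)\<^sup>2 + (wr 0 r)\<^sup>2) / 2 \<le> PE 0 r" "0 \<le> K * ?i r ^ 2"
        using r K_ge by (auto simp: PE_def)
      ultimately have "A * wt 0 r + B * wt 0 r \<le> 2 * PE 0 r + 4 * (K * ?i r ^ 2)"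
        using half_sum_squares[of A "wt 0 r"] half_sum_squares[of B "wt 0 r"] zero_le_power2[of "wr 0 r"] by argo
      then show "?P 0 r \<le> 2 * PE 0 r + 4 * K * ?i r ^ 2"
        unfolding P by (simp only: mult.assoc)
    qed
    also have "\<dots> = 2 * integral {1..X} (\<lambda>r. PE 0 r) + 4 * K * integral {1..X} (\<lambda>r. ?i r ^ 2)"
    proof -
      have "(\<lambda>r. 2 * PE 0 r) integrable_on {1..X}" "(\<lambda>r. 4 * K * ?i r ^ 2) integrable_on {1..X}"
        by (intro integrable_continuous_real continuous_intros ray_cont(2) c_PE ci; simp)+
      from integral_add[OF this] show ?thesis by simp
    qed
    also have "integral {1..X} (\<lambda>r. PE 0 r) \<le> K" by (rule init_PE)
    also have "4 * K * integral {1..X} (\<lambda>r. ?i r ^ 2) \<le> 4 * K * 1"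
      using K_ge by (intro mult_left_mono integral_inverse_power2_le X1) auto
    finally show ?thesis by simp
  qed
  \<comment> \<open>By the Robin condition \<open>?Q t 1 = - w^2 / 2 + w^2 / 4\<close>, the second
    term being the price of the exact derivative added to the flux.\<close>
  have 3: "integral {0..X - 1} (\<lambda>t. ?Q t 1) = - (1 / 4) * integral {0..X - 1} (\<lambda>t. (w t 1)\<^sup>2)"
  proof -
    have "integral {0..X - 1} (\<lambda>t. ?Q t 1) = integral {0..X - 1} (\<lambda>t. - (1 / 4) * (w t 1)\<^sup>2)"
      by (intro integral_cong) (simp add: robin power2_eq_square)
    then show ?thesis by simp
  qed
  have b: "0 \<le> integral {0..X - 1} (\<lambda>t. (w t 1)\<^sup>2)"
    by (intro integral_nonneg integrable_continuous_real continuous_intros ray_cont(3) cont) auto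
  have B: "0 \<le> tri_int ?B X"
    unfolding tri_int_def by (intro Bochner_Integration.integral_nonneg) (auto simp: indicator_def tri_def)
  \<comment> \<open>The constant is \<open>4 + 10 + 6\<close>, for the error in the bulk, the
    hypotenuse and the initial line.\<close>
  have "1 / 4 * integral {0..X - 1} (\<lambda>t. (w t 1)\<^sup>2) + 1 / 3 * tri_int ?B X \<le> 20 * K"
    using U 1 2 3 G by linarith
  then show "integral {0..X - 1} (\<lambda>t. (w t 1)\<^sup>2) \<le> 100 * K" "tri_int ?B X \<le> 100 * K"
    using b B by linarith+
qed

lemma boundary_power2_le: "0 \<le> t \<Longrightarrow> t \<le> X - 1 \<Longrightarrow> (w t 1)\<^sup>2 \<le> 4 * K"
  using pointwise[of t 1] by simp

text \<open>The multiplier \<open>wr\<close> does not vanish at \<open>r = 1\<close> and therefore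
  exposes \<open>wt^2 / 2\<close> in the boundary flux. The competing term \<open>w^6 / 6\<close>
  there is at most \<open>3 * K^2 * w^2\<close> by the pointwise bound, and \<open>w^2\<close> is
  integrable in time by the Morawetz estimate.\<close>

lemma boundary_derivative:
  "integral {0..X - 1} (\<lambda>t. (wt t 1)\<^sup>2) \<le> 1000 * K ^ 3"
proof -
  let ?i = "\<lambda>r::real. inverse r"
  let ?P = "\<lambda>t r. wr t r * wt t r"
  let ?Pt = "\<lambda>t r. wtr t r * wt t r + wr t r * wtt t r"
  let ?Q = "\<lambda>t r. (w t r) ^ 6 * ?i r ^ 4 / 6 - (wt t r)\<^sup>2 / 2 - (wr t r)\<^sup>2 / 2"
  let ?Qr = "\<lambda>t r. (w t r) ^ 5 * wr t r * ?i r ^ 4 - 2 / 3 * (w t r) ^ 6 * ?i r ^ 5 - wt t r * wtr t r - wr t r * wrr t r"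
  have cP: "cont2 ?P" "cont2 ?Q" "cont2 ?Pt" "cont2 ?Qr"
    unfolding cont2_def by (intro continuous_intros cont' cont_inverse; simp)+
  have dP: "((\<lambda>t. ?P t r) has_real_derivative ?Pt t r) (at t within {0..X})" if "0 \<le> t" "t \<le> X" "1 \<le> r" for t r
    by (auto intro!: derivative_eq_intros w_t[OF that] wt_t[OF that] wr_t[OF that] simp: algebra_simps)
  have dQ: "((\<lambda>r. ?Q t r) has_real_derivative ?Qr t r) (at r within {1..})" if "0 \<le> t" "t \<le> X" "1 \<le> r" for t r
  proof -
    have *: "((\<lambda>r. (w t r) ^ 6 * i r ^ 4 / 6 - (wt t r)\<^sup>2 / 2 - (wr t r)\<^sup>2 / 2) has_real_derivative
       (w t r) ^ 5 * wr t r * i r ^ 4 - 2 / 3 * (w t r) ^ 6 * i r ^ 5 - wt t r * wtr t r - wr t r * wrr t r) (at r within {1..})"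
      if di: "(i has_real_derivative - (i r ^ 2)) (at r within {1..})" for i
      by (auto intro!: derivative_eq_intros di w_r[OF \<open>0 \<le> t\<close> \<open>t \<le> X\<close> \<open>1 \<le> r\<close>] wt_r[OF \<open>0 \<le> t\<close> \<open>t \<le> X\<close> \<open>1 \<le> r\<close>] wr_r[OF \<open>0 \<le> t\<close> \<open>t \<le> X\<close> \<open>1 \<le> r\<close>])
    have "((\<lambda>r. ?i r) has_real_derivative - (?i r ^ 2)) (at r within {1..})"
      using \<open>1 \<le> r\<close> by (auto intro!: derivative_eq_intros simp: power2_eq_square)
    from *[OF this] show ?thesis .
  qed
  have X1: "1 \<le> X" using X by simp
  note G = Green_tri[OF cP dP dQ X1 order_refl]
  \<comment> \<open>The only remaining bulk term, \<open>- 2/3 * w^6 / r^5\<close>, has a favourable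
    sign.\<close>
  have "tri_int (\<lambda>t r. ?Pt t r + ?Qr t r) X \<le> tri_int (\<lambda>t r. wr t r * e t r) X"
  proof (rule tri_int_mono)
    show "cont2 (\<lambda>t r. ?Pt t r + ?Qr t r)" using continuous_on_add[OF cP(3)[unfolded cont2_def] cP(4)[unfolded cont2_def]] unfolding cont2_def .
    show "cont2 (\<lambda>t r. wr t r * e t r)" using cont(3) c_e unfolding cont2_def by (intro continuous_intros)
    fix t r :: real assume "1 \<le> r"
    then have "0 \<le> 2 / 3 * (w t r) ^ 6 * ?i r ^ 5" by simp
    moreover have "?Pt t r + ?Qr t r = wr t r * e t r - 2 / 3 * (w t r) ^ 6 * ?i r ^ 5"
      by (simp add: e_def algebra_simps)
    ultimately show "?Pt t r + ?Qr t r \<le> wr t r * e t r" by linarith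
  qed
  also have "\<dots> \<le> 4 * K"
  proof (rule e_error_tri[OF cont(3)])
    fix t r :: real assume "1 \<le> r"
    have "0 \<le> K * X" using K_ge X by simp
    then show "\<bar>wr t r\<bar> \<le> PE t r + 2 + K * X" using abs_wr_le[OF \<open>1 \<le> r\<close>, of t] by linarith
  qed
  finally have U: "tri_int (\<lambda>t r. ?Pt t r + ?Qr t r) X \<le> 4 * K" .
  have 1: "- integral {1..X} (\<lambda>r. ?P (X - r) r + ?Q (X - r) r) \<le> 2 * K"
  proof -
    let ?q = "\<lambda>r. (wt (X - r) r - wr (X - r) r)\<^sup>2"
    have cq: "continuous_on {1..X} ?q" by (intro continuous_intros ray_cont cont)
    have "- integral {1..X} (\<lambda>r. ?P (X - r) r + ?Q (X - r) r) = integral {1..X} (\<lambda>r. - (?P (X - r) r + ?Q (X - r) r))"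
      by (rule integral_neg[symmetric])
    also have "\<dots> \<le> integral {1..X} ?q"
    proof (rule integral_le)
      show "(\<lambda>r. - (?P (X - r) r + ?Q (X - r) r)) integrable_on {1..X}"
        by (intro integrable_neg integrable_add ray_int(1)[OF cP(1)] ray_int(1)[OF cP(2)])
      show "?q integrable_on {1..X}" by (intro integrable_continuous_real cq)
      fix r assume "r \<in> {1..X}"
      then have "0 \<le> w (X - r) r ^ 6 * ?i r ^ 4 / 6" by simp
      moreover have "- (?P (X - r) r + ?Q (X - r) r) = ?q r / 2 - w (X - r) r ^ 6 * ?i r ^ 4 / 6"
        by (simp add: power2_eq_square algebra_simps add_divide_distrib diff_divide_distrib)
      ultimately show "- (?P (X - r) r + ?Q (X - r) r) \<le> ?q r"
        using zero_le_power2[of "wt (X - r) r - wr (X - r) r"] by linarith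
    qed
    also have "integral {1..X} ?q \<le> 2 * K"
      using ray_q[OF X1 order_refl] zero_le_power2[of "w (X - 1) 1"] by linarith
    finally show ?thesis .
  qed
  have 2: "integral {1..X} (\<lambda>r. ?P 0 r) \<le> K"
  proof -
    have "integral {1..X} (\<lambda>r. ?P 0 r) \<le> integral {1..X} (\<lambda>r. PE 0 r)"
    proof (intro integral_le ray_int(2) cP c_PE)
      fix r assume "r \<in> {1..X}"
      then have "((wt 0 r)\<^sup>2 + (wr 0 r)\<^sup>2) / 2 \<le> PE 0 r" by (simp add: PE_def)
      then show "?P 0 r \<le> PE 0 r"
        using half_sum_squares[of "wr 0 r" "wt 0 r"] by argo
    qed
    also have "\<dots> \<le> K" by (rule init_PE)
    finally show ?thesis .
  qed
  have 3: "- integral {0..X - 1} (\<lambda>t. ?Q t 1) \<ge> 1 / 2 * integral {0..X - 1} (\<lambda>t. (wt t 1)\<^sup>2) - 3 * K\<^sup>2 * integral {0..X - 1} (\<lambda>t. (w t 1)\<^sup>2)"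
  proof -
    have i: "(\<lambda>t. 1 / 2 * (wt t 1)\<^sup>2) integrable_on {0..X - 1}" "(\<lambda>t. 3 * K\<^sup>2 * (w t 1)\<^sup>2) integrable_on {0..X - 1}"
      by (intro integrable_continuous_real continuous_intros ray_cont(3) cont)+
    have "1 / 2 * integral {0..X - 1} (\<lambda>t. (wt t 1)\<^sup>2) - 3 * K\<^sup>2 * integral {0..X - 1} (\<lambda>t. (w t 1)\<^sup>2)
       = integral {0..X - 1} (\<lambda>t. 1 / 2 * (wt t 1)\<^sup>2 - 3 * K\<^sup>2 * (w t 1)\<^sup>2)"
      using integral_diff[OF i] by simp
    also have "\<dots> \<le> integral {0..X - 1} (\<lambda>t. - ?Q t 1)"
    proof (rule integral_le)
      show "(\<lambda>t. 1 / 2 * (wt t 1)\<^sup>2 - 3 * K\<^sup>2 * (w t 1)\<^sup>2) integrable_on {0..X - 1}" by (intro integrable_diff i)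
      show "(\<lambda>t. - ?Q t 1) integrable_on {0..X - 1}" by (intro integrable_neg ray_int(3) cP)
      fix t assume t: "t \<in> {0..X - 1}"
      \<comment> \<open>Four of the six factors are bounded by \<open>(4 * K)^2\<close>, and
        \<open>16 / 6 \<le> 3\<close>.\<close>
      have "((w t 1)\<^sup>2)\<^sup>2 \<le> (4 * K)\<^sup>2" using boundary_power2_le[of t] t by (intro power_mono) auto
      then have "((w t 1)\<^sup>2)\<^sup>2 * (w t 1)\<^sup>2 \<le> (4 * K)\<^sup>2 * (w t 1)\<^sup>2" by (intro mult_right_mono) auto
      then have "(w t 1) ^ 6 \<le> 16 * K\<^sup>2 * (w t 1)\<^sup>2"
        by (simp add: power_mult_distrib flip: power_mult power_add)
      moreover have "0 \<le> K\<^sup>2 * (w t 1)\<^sup>2" by simp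
      ultimately have "(w t 1) ^ 6 / 6 \<le> 3 * K\<^sup>2 * (w t 1)\<^sup>2" by linarith
      then show "1 / 2 * (wt t 1)\<^sup>2 - 3 * K\<^sup>2 * (w t 1)\<^sup>2 \<le> - ?Q t 1"
        using zero_le_power2[of "wr t 1"] by (simp only: inverse_1 power_one mult_1_right)
    qed
    also have "\<dots> = - integral {0..X - 1} (\<lambda>t. ?Q t 1)" by (rule integral_neg)
    finally show ?thesis .
  qed
  have "3 * K\<^sup>2 * integral {0..X - 1} (\<lambda>t. (w t 1)\<^sup>2) \<le> 3 * K\<^sup>2 * (100 * K)"
    by (intro mult_left_mono Morawetz) auto
  also have "\<dots> = 300 * K ^ 3" by (simp add: power2_eq_square power3_eq_cube)
  finally have "1 / 2 * integral {0..X - 1} (\<lambda>t. (wt t 1)\<^sup>2) \<le> 300 * K ^ 3 + 7 * K"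
    using U 1 2 3 G by linarith
  moreover have "K * 1 \<le> K * K\<^sup>2" using K_ge by (intro mult_left_mono) (auto simp: one_le_power)
  then have "K \<le> K ^ 3" by (simp add: power2_eq_square power3_eq_cube)
  ultimately show ?thesis using K_ge by linarith
qed

end

section \<open>The pointwise majorant\<close>

lemma abs_increment_le_nn_integral:
  fixes f f' :: "real \<Rightarrow> real"
  assumes ab: "a \<le> b" and d: "\<And>x. x \<in> {a..b} \<Longrightarrow> (f has_real_derivative f' x) (at x within {a..b})"
    and c: "continuous_on {a..b} f'"
  shows "ennreal \<bar>f b - f a\<bar> \<le> (\<integral>\<^sup>+x. ennreal \<bar>f' x\<bar> * indicator {a..b} x \<partial>lborel)"
proof -
  have ci: "continuous_on {a..b} (\<lambda>x. \<bar>f' x\<bar>)" by (intro continuous_intros c)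
  have i: "(f' has_integral f b - f a) {a..b}"
    by (rule FTC_within[OF ab order_refl d])
  have "\<bar>f b - f a\<bar> \<le> integral {a..b} (\<lambda>x. \<bar>f' x\<bar>)"
    using integral_norm_bound_integral[OF has_integral_integrable[OF i] integrable_continuous_real[OF ci]] integral_unique[OF i]
    by simp
  then have "ennreal \<bar>f b - f a\<bar> \<le> ennreal (integral {a..b} (\<lambda>x. \<bar>f' x\<bar>))" by (rule ennreal_leI)
  also have "\<dots> = (\<integral>\<^sup>+x. ennreal \<bar>f' x\<bar> * indicator {a..b} x \<partial>lborel)"
    by (rule nn_integral_has_integral_lebesgue'[symmetric]) (auto intro!: integrable_integral integrable_continuous_real ci)
  finally show ?thesis .
qed

text \<open>One-dimensional Sobolev inequality: average over \<open>x\<close> the bound of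
  \<open>\<bar>f a\<bar>\<close> by \<open>\<bar>f x\<bar>\<close> plus the total variation on the
  unit interval.\<close>

lemma abs_value_le_nn_integral:
  fixes f f' :: "real \<Rightarrow> real"
  assumes d: "\<And>x. x \<in> {a..a + 1} \<Longrightarrow> (f has_real_derivative f' x) (at x within {a..a + 1})"
    and c: "continuous_on {a..a + 1} f'"
  shows "ennreal \<bar>f a\<bar> \<le> (\<integral>\<^sup>+x. ennreal (\<bar>f x\<bar> + \<bar>f' x\<bar>) * indicator {a..a + 1} x \<partial>lborel)"
proof -
  have cf: "continuous_on {a..a + 1} f"
    using d by (intro DERIV_continuous_on)
  have meas: "(\<lambda>x. ennreal \<bar>g x\<bar> * indicator {a..a + 1} x) \<in> borel_measurable borel"
    if "continuous_on {a..a + 1} g" for g :: "real \<Rightarrow> real"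
  proof -
    have "(\<lambda>x. ennreal (norm (indicator {a..a + 1} x *\<^sub>R g x))) \<in> borel_measurable borel"
      using borel_measurable_continuous_on_indicator[OF _ that] by (intro measurable_compose[OF _ measurable_ennreal] borel_measurable_norm) auto
    also have "(\<lambda>x. ennreal (norm (indicator {a..a + 1} x *\<^sub>R g x))) = (\<lambda>x. ennreal \<bar>g x\<bar> * indicator {a..a + 1} x)"
      by (auto simp: fun_eq_iff indicator_def)
    finally show ?thesis .
  qed
  define J where "J = (\<integral>\<^sup>+x. ennreal \<bar>f' x\<bar> * indicator {a..a + 1} x \<partial>lborel)"
  have "ennreal \<bar>f a\<bar> \<le> ennreal \<bar>f x\<bar> + J" if x: "x \<in> {a..a + 1}" for x
  proof -
    have "ennreal \<bar>f x - f a\<bar> \<le> (\<integral>\<^sup>+y. ennreal \<bar>f' y\<bar> * indicator {a..x} y \<partial>lborel)"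
    proof (rule abs_increment_le_nn_integral)
      show "continuous_on {a..x} f'" using x by (intro continuous_on_subset[OF c]) auto
      show "(f has_real_derivative f' y) (at y within {a..x})" if "y \<in> {a..x}" for y
        using x that by (intro DERIV_subset[OF d]) auto
    qed (use x in auto)
    also have "\<dots> \<le> J" unfolding J_def using x by (intro nn_integral_mono) (auto simp: indicator_def)
    finally have J: "ennreal \<bar>f x - f a\<bar> \<le> J" .
    have "ennreal \<bar>f a\<bar> \<le> ennreal (\<bar>f x\<bar> + \<bar>f x - f a\<bar>)" by (intro ennreal_leI) auto
    also have "\<dots> = ennreal \<bar>f x\<bar> + ennreal \<bar>f x - f a\<bar>" by simp
    also have "\<dots> \<le> ennreal \<bar>f x\<bar> + J" using J by (intro add_left_mono)
    finally show ?thesis .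
  qed
  then have "(\<integral>\<^sup>+x. ennreal \<bar>f a\<bar> * indicator {a..a + 1} x \<partial>lborel) \<le> (\<integral>\<^sup>+x. ennreal \<bar>f x\<bar> * indicator {a..a + 1} x + J * indicator {a..a + 1} x \<partial>lborel)"
    by (intro nn_integral_mono) (auto simp: indicator_def)
  also have "\<dots> = (\<integral>\<^sup>+x. ennreal \<bar>f x\<bar> * indicator {a..a + 1} x \<partial>lborel) + (\<integral>\<^sup>+x. J * indicator {a..a + 1} x \<partial>lborel)"
    by (intro nn_integral_add) (simp_all add: meas[OF cf])
  also have "(\<integral>\<^sup>+x. J * indicator {a..a + 1} x \<partial>lborel) = J"
    by (subst nn_integral_cmult_indicator) auto
  also have "(\<integral>\<^sup>+x. ennreal \<bar>f x\<bar> * indicator {a..a + 1} x \<partial>lborel) + J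
      = (\<integral>\<^sup>+x. ennreal \<bar>f x\<bar> * indicator {a..a + 1} x + ennreal \<bar>f' x\<bar> * indicator {a..a + 1} x \<partial>lborel)"
    unfolding J_def by (intro nn_integral_add[symmetric]) (simp_all add: meas[OF cf] meas[OF c])
  also have "\<dots> = (\<integral>\<^sup>+x. ennreal (\<bar>f x\<bar> + \<bar>f' x\<bar>) * indicator {a..a + 1} x \<partial>lborel)"
    by (intro nn_integral_cong) (auto simp: indicator_def)
  also have "(\<integral>\<^sup>+x. ennreal \<bar>f a\<bar> * indicator {a..a + 1} x \<partial>lborel) = ennreal \<bar>f a\<bar>"
    by (subst nn_integral_cmult_indicator) auto
  finally show ?thesis .
qed

lemma ray_integral_measurable:
  assumes "cont2 f"
  shows "(\<lambda>x. integral {1..x} (\<lambda>r. f (x - r) r)) \<in> borel_measurable borel"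
proof -
  let ?S = "{z :: real \<times> real. 1 \<le> snd z \<and> snd z \<le> fst z}"
  have cl: "closed ?S" by (intro closed_Collect_conj closed_Collect_le continuous_intros)
  have c: "continuous_on ?S (\<lambda>z. f (fst z - snd z) (snd z))"
    by (intro cont2_compose[OF assms] continuous_intros) auto
  have "(\<lambda>z. indicator ?S z *\<^sub>R f (fst z - snd z) (snd z)) \<in> borel_measurable borel"
    by (intro borel_measurable_continuous_on_indicator borel_closed cl c)
  then have "(\<lambda>(x, r). indicator ?S (x, r) *\<^sub>R f (x - r) r) \<in> borel_measurable (borel \<Otimes>\<^sub>M lborel)"
    by (subst measurable_cong_sets[OF sets_pair_measure_cong[OF refl sets_lborel] refl]) (simp add: borel_prod split_beta')
  from lborel.borel_measurable_lebesgue_integral[OF this]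
  have "(\<lambda>x. LINT r|lborel. indicator ?S (x, r) *\<^sub>R f (x - r) r) \<in> borel_measurable borel" .
  also have "(\<lambda>x. LINT r|lborel. indicator ?S (x, r) *\<^sub>R f (x - r) r) = (\<lambda>x. integral {1..x} (\<lambda>r. f (x - r) r))"
  proof
    fix x :: real
    have "continuous_on {1..x} (\<lambda>r. f (x - r) r)" by (intro cont2_compose[OF assms] continuous_intros) auto
    from integral_Icc_lborel[OF this]
    show "(LINT r|lborel. indicator ?S (x, r) *\<^sub>R f (x - r) r) = integral {1..x} (\<lambda>r. f (x - r) r)"
      by (simp add: indicator_def)
  qed
  finally show ?thesis .
qed

lemma abs_cube_power2: "(\<bar>a::real\<bar> ^ 3)\<^sup>2 = a ^ 6"
  by (subst power_mult[symmetric]) (simp add: power_even_abs)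

context approx_wave
begin

definition g where "g x = integral {1..x} (\<lambda>r. \<bar>w (x - r) r\<bar> ^ 5 * inverse r ^ 4)"
text \<open>Bounds \<open>wt + wr\<close> on the whole incoming ray that meets \<open>r = 1\<close>
  at time \<open>s\<close>; the last term is the error of the equation accumulated along the
  ray.\<close>

definition \<Gamma> where "\<Gamma> s = \<bar>w s 1\<bar> + \<bar>wt s 1\<bar> + g (s + 1) + \<delta>\<^sup>2 * X"
text \<open>One real variable serves both edges of the triangle: \<open>s \<ge> 0\<close> is a time
  on the boundary, \<open>s \<le> -1\<close> stands for the point \<open>r = - s\<close> of the
  initial line, and the gap between them carries the value 0.\<close>

definition Gr where "Gr s = indicator {0..X - 1} s * \<Gamma> s + indicator {- X..-1} s * \<bar>wr 0 (- s)\<bar>"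
definition majorant where "majorant s = ennreal (2 * Gr s)"

lemma c_abs5: "cont2 (\<lambda>t r. \<bar>w t r\<bar> ^ 5 * inverse r ^ 4)"
  unfolding cont2_def by (intro continuous_intros cont' cont_inverse; simp)

lemma g_nonneg: "0 \<le> g x"
  unfolding g_def by (intro integral_nonneg ray_int(1)[OF c_abs5]) auto

lemma \<Gamma>_nonneg: "0 \<le> \<Gamma> s" and Gr_nonneg: "0 \<le> Gr s"
  using g_nonneg[of "s + 1"] X by (auto simp: \<Gamma>_def Gr_def)

lemma g_measurable [measurable]: "g \<in> borel_measurable borel"
  unfolding g_def using ray_integral_measurable[OF c_abs5] by simp

lemma boundary_measurable [measurable]: "(\<lambda>s. w s 1) \<in> borel_measurable borel" "(\<lambda>s. wt s 1) \<in> borel_measurable borel"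
  "(\<lambda>s. wr 0 (max 1 s)) \<in> borel_measurable borel"
  by (intro borel_measurable_continuous_onI cont2_compose[OF cont(1)] cont2_compose[OF cont(2)] cont2_compose[OF cont(3)] continuous_intros; simp)+

lemma Gr_measurable [measurable]: "Gr \<in> borel_measurable borel"
proof -
  have "Gr = (\<lambda>s. indicator {0..X - 1} s * \<Gamma> s + indicator {- X..-1} s * \<bar>wr 0 (max 1 (- s))\<bar>)"
    by (auto simp: Gr_def fun_eq_iff indicator_def max_def)
  also have "\<dots> \<in> borel_measurable borel" unfolding \<Gamma>_def by measurable
  finally show ?thesis .
qed

lemma majorant_measurable [measurable]: "majorant \<in> borel_measurable borel"
  unfolding majorant_def by measurable

text \<open>Cauchy-Schwarz with the splitting of \<open>w^5 / r^4\<close> into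
  \<open>w^3 / r^(5/2)\<close> and \<open>w^2 / r^(3/2)\<close>. The first factor gives the Morawetz
  density on the ray; for the second, \<open>w^4 / r^3\<close> is at most
  \<open>4 * K * w^2 / r^2\<close>, and the Hardy inequality on the ray yields
  \<open>4 * K * (8 * K)\<close>.\<close>

lemma g_power2_le:
  assumes x: "1 \<le> x" "x \<le> X"
  shows "(g x)\<^sup>2 \<le> 32 * K\<^sup>2 * integral {1..x} (\<lambda>r. w (x - r) r ^ 6 * inverse r ^ 5)"
proof -
  let ?v = "\<lambda>r. w (x - r) r"
  let ?f = "\<lambda>r. \<bar>?v r\<bar> ^ 3 * sqrt (inverse r ^ 5)" and ?h = "\<lambda>r. \<bar>?v r\<bar> ^ 2 * sqrt (inverse r ^ 3)"
  have cv: "continuous_on {1..x} ?v" by (intro ray_cont cont)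
  have ci: "continuous_on {1..x} (\<lambda>r::real. inverse r)" by (intro continuous_intros) auto
  have cf: "continuous_on {1..x} ?f" "continuous_on {1..x} ?h"
    by (intro continuous_intros cv ci)+
  have gx: "g x = integral {1..x} (\<lambda>r. ?f r * ?h r)"
    unfolding g_def
  proof (rule integral_cong)
    fix r assume "r \<in> {1..x}"
    then have "sqrt (inverse r ^ 5) * sqrt (inverse r ^ 3) = sqrt ((inverse r ^ 4)\<^sup>2)"
      unfolding real_sqrt_mult[symmetric] by (simp only: power_add[symmetric] power_mult[symmetric]) simp
    also have "\<dots> = inverse r ^ 4" using \<open>r \<in> {1..x}\<close> by (subst real_sqrt_abs) simp
    finally have 1: "sqrt (inverse r ^ 5) * sqrt (inverse r ^ 3) = inverse r ^ 4" .
    have 2: "\<bar>?v r\<bar> ^ 3 * \<bar>?v r\<bar> ^ 2 = \<bar>?v r\<bar> ^ 5" by (subst power_add[symmetric]) simp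
    show "\<bar>?v r\<bar> ^ 5 * inverse r ^ 4 = ?f r * ?h r"
      unfolding 1[symmetric] 2[symmetric] by (simp only: mult_ac)
  qed
  have CS: "(g x)\<^sup>2 \<le> integral {1..x} (\<lambda>r. (?f r)\<^sup>2) * integral {1..x} (\<lambda>r. (?h r)\<^sup>2)"
    unfolding gx by (rule integral_Cauchy_Schwarz[OF cf])
  have f2: "integral {1..x} (\<lambda>r. (?f r)\<^sup>2) = integral {1..x} (\<lambda>r. ?v r ^ 6 * inverse r ^ 5)"
    by (rule integral_cong) (simp add: power_mult_distrib abs_cube_power2)
  have "integral {1..x} (\<lambda>r. (?h r)\<^sup>2) \<le> integral {1..x} (\<lambda>r. 4 * K * ((?v r)\<^sup>2 * inverse r ^ 2))"
  proof (rule integral_le)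
    show "(\<lambda>r. (?h r)\<^sup>2) integrable_on {1..x}" "(\<lambda>r. 4 * K * ((?v r)\<^sup>2 * inverse r ^ 2)) integrable_on {1..x}"
      by (intro integrable_continuous_real continuous_intros cf cv ci)+
    fix r assume r: "r \<in> {1..x}"
    have "(?h r)\<^sup>2 = (?v r)\<^sup>2 * ((?v r)\<^sup>2 * inverse r ^ 3)"
      using r by (simp add: power_mult_distrib power2_eq_square[of "(?v r)\<^sup>2"])
    also have "\<dots> \<le> (4 * K * r) * ((?v r)\<^sup>2 * inverse r ^ 3)"
      using r x by (intro mult_right_mono pointwise) auto
    also have "\<dots> = 4 * K * ((?v r)\<^sup>2 * inverse r ^ 2)"
      using r by (simp add: field_simps eval_nat_numeral)
    finally show "(?h r)\<^sup>2 \<le> 4 * K * ((?v r)\<^sup>2 * inverse r ^ 2)" .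
  qed
  also have "\<dots> = 4 * K * integral {1..x} (\<lambda>r. (?v r)\<^sup>2 * inverse r ^ 2)" by simp
  also have "\<dots> \<le> 4 * K * (8 * K)" using K_ge by (intro mult_left_mono ray_Hardy[OF x]) auto
  finally have h2: "integral {1..x} (\<lambda>r. (?h r)\<^sup>2) \<le> 4 * K * (8 * K)" .
  have nn: "0 \<le> integral {1..x} (\<lambda>r. ?v r ^ 6 * inverse r ^ 5)"
    by (intro integral_nonneg ray_int(1)[OF c_bulk]) auto
  have "(g x)\<^sup>2 \<le> integral {1..x} (\<lambda>r. ?v r ^ 6 * inverse r ^ 5) * integral {1..x} (\<lambda>r. (?h r)\<^sup>2)"
    using CS unfolding f2 .
  then have "(g x)\<^sup>2 \<le> integral {1..x} (\<lambda>r. ?v r ^ 6 * inverse r ^ 5) * (4 * K * (8 * K))"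
    using mult_left_mono[OF h2 nn] by (rule order_trans)
  then show ?thesis by (simp only: power2_eq_square mult_ac)
qed

lemma sum4_power2_le: "(a + b + c + d)\<^sup>2 \<le> 4 * (a\<^sup>2 + b\<^sup>2 + c\<^sup>2 + d\<^sup>2)" for a b c d :: real
proof -
  have "0 \<le> (a - b)\<^sup>2 + (a - c)\<^sup>2 + (a - d)\<^sup>2 + (b - c)\<^sup>2 + (b - d)\<^sup>2 + (c - d)\<^sup>2" by simp
  then show ?thesis by (simp add: power2_eq_square algebra_simps)
qed

text \<open>The traces are square integrable by the two multiplier estimates and the initial part by
  the energy. For \<open>g\<close>, the ray integrals of \<open>w^6 / r^5\<close>, integrated over
  all rays, make up the Morawetz bulk on the triangle by \<open>tri_int_ray\<close>.\<close>

lemma majorant_L2: "(\<integral>\<^sup>+s. (majorant s)\<^sup>2 \<partial>lborel) \<le> ennreal (10 ^ 5 * K ^ 3)"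
proof -
  let ?ray = "\<lambda>x. integral {1..x} (\<lambda>r. w (x - r) r ^ 6 * inverse r ^ 5)"
  let ?F = "\<lambda>s. 16 * ((w s 1)\<^sup>2 + (wt s 1)\<^sup>2 + 32 * K\<^sup>2 * ?ray (s + 1) + (\<delta>\<^sup>2 * X)\<^sup>2)"
  let ?H = "\<lambda>y. 4 * (wr 0 y)\<^sup>2"
  have ray_nonneg: "0 \<le> ?ray x" for x
    by (intro integral_nonneg ray_int(1)[OF c_bulk]) auto
  have sh: "((\<lambda>s. ?ray (s + 1)) has_integral tri_int (\<lambda>t r. w t r ^ 6 * inverse r ^ 5) X) {0..X - 1}"
    using has_integral_affinity[of ?ray _ 1 X 1 1] tri_int_ray[OF c_bulk, of X] by simp
  have F: "(?F has_integral 16 * (integral {0..X - 1} (\<lambda>s. (w s 1)\<^sup>2) + integral {0..X - 1} (\<lambda>s. (wt s 1)\<^sup>2)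
      + 32 * K\<^sup>2 * tri_int (\<lambda>t r. w t r ^ 6 * inverse r ^ 5) X + integral {0..X - 1} (\<lambda>s. (\<delta>\<^sup>2 * X)\<^sup>2))) {0..X - 1}" (is "(_ has_integral ?I) _")
    by (intro has_integral_mult_right has_integral_add sh integrable_integral integrable_continuous_real continuous_intros ray_cont cont)
  have I: "?I \<le> 90000 * K ^ 3"
  proof -
    \<comment> \<open>Since \<open>K \<ge> 3\<close>, the monomial \<open>K ^ 3\<close> dominates
      every other contribution.\<close>
    have K: "K \<le> K ^ 3" "1 \<le> K ^ 3" using K_ge by (auto intro: self_le_power one_le_power)
    have "32 * K\<^sup>2 * tri_int (\<lambda>t r. w t r ^ 6 * inverse r ^ 5) X \<le> 32 * K\<^sup>2 * (100 * K)"
      by (intro mult_left_mono Morawetz) auto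
    also have "\<dots> = 3200 * K ^ 3" by (simp add: power2_eq_square power3_eq_cube)
    finally have 3: "32 * K\<^sup>2 * tri_int (\<lambda>t r. w t r ^ 6 * inverse r ^ 5) X \<le> 3200 * K ^ 3" .
    have "integral {0..X - 1} (\<lambda>s. (\<delta>\<^sup>2 * X)\<^sup>2) = (X - 1) * (\<delta>\<^sup>2 * X)\<^sup>2" using X by simp
    also have "\<dots> \<le> X * (\<delta>\<^sup>2 * X)\<^sup>2" by (intro mult_right_mono) auto
    also have "\<dots> = \<delta>\<^sup>2 * (\<delta> * X) * (\<delta> * X\<^sup>2)" by (simp add: power2_eq_square)
    also have "\<dots> \<le> 1 * 1 * 1" using \<delta> \<delta>_le X by (intro mult_mono power_le_one) auto
    finally have 4: "integral {0..X - 1} (\<lambda>s. (\<delta>\<^sup>2 * X)\<^sup>2) \<le> 1" by simp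
    have "16 * (a + b + c + d) \<le> 90000 * K ^ 3"
      if "a \<le> 100 * K" "b \<le> 1000 * K ^ 3" "c \<le> 3200 * K ^ 3" "d \<le> 1" for a b c d :: real
      using that K by (simp only: distrib_left)
    from this[OF Morawetz(1) boundary_derivative 3 4] show ?thesis .
  qed
  have H: "(?H has_integral 4 * integral {1..X} (\<lambda>y. (wr 0 y)\<^sup>2)) {1..X}"
    by (intro has_integral_mult_right integrable_integral integrable_continuous_real continuous_intros ray_cont(2) cont)
  have H_le: "4 * integral {1..X} (\<lambda>y. (wr 0 y)\<^sup>2) \<le> 10000 * K ^ 3"
  proof -
    have "integral {1..X} (\<lambda>y. (wr 0 y)\<^sup>2) \<le> integral {1..X} (\<lambda>y. 2 * PE 0 y)"
    proof (rule integral_le)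
      show "(\<lambda>y. (wr 0 y)\<^sup>2) integrable_on {1..X}" "(\<lambda>y. 2 * PE 0 y) integrable_on {1..X}"
        by (intro integrable_continuous_real continuous_intros ray_cont(2) cont c_PE)+
      fix y assume "y \<in> {1..X}"
      then have "((wt 0 y)\<^sup>2 + (wr 0 y)\<^sup>2) / 2 \<le> PE 0 y" by (simp add: PE_def)
      then show "(wr 0 y)\<^sup>2 \<le> 2 * PE 0 y" using zero_le_power2[of "wt 0 y"] by argo
    qed
    also have "\<dots> = 2 * integral {1..X} (\<lambda>y. PE 0 y)" by simp
    also have "\<dots> \<le> 2 * K" using init_PE by simp
    finally have "integral {1..X} (\<lambda>y. (wr 0 y)\<^sup>2) \<le> 2 * K" .
    moreover have "K \<le> K ^ 3" "0 \<le> K" using K_ge by (auto intro: self_le_power)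
    ultimately show ?thesis by linarith
  qed
  have le: "(majorant s)\<^sup>2 \<le> ennreal (?F s) * indicator {0..X - 1} s + ennreal (?H (- s)) * indicator {1..X} (- s)" for s
  proof -
    have "(majorant s)\<^sup>2 = ennreal ((2 * Gr s)\<^sup>2)"
      unfolding majorant_def using Gr_nonneg[of s] by (simp add: ennreal_power)
    also have "\<dots> \<le> ennreal (?F s) * indicator {0..X - 1} s + ennreal (?H (- s)) * indicator {1..X} (- s)"
    proof (cases "s \<in> {0..X - 1}")
      case True
      then have Gs: "Gr s = \<bar>w s 1\<bar> + \<bar>wt s 1\<bar> + g (s + 1) + \<delta>\<^sup>2 * X"
        by (simp add: Gr_def \<Gamma>_def)
      have "(2 * Gr s)\<^sup>2 = 4 * (\<bar>w s 1\<bar> + \<bar>wt s 1\<bar> + g (s + 1) + \<delta>\<^sup>2 * X)\<^sup>2"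
        unfolding Gs[symmetric] by (simp only: power_mult_distrib) simp
      also have "\<dots> \<le> 4 * (4 * (\<bar>w s 1\<bar>\<^sup>2 + \<bar>wt s 1\<bar>\<^sup>2 + (g (s + 1))\<^sup>2 + (\<delta>\<^sup>2 * X)\<^sup>2))"
        by (intro mult_left_mono sum4_power2_le) auto
      also have "\<dots> \<le> ?F s"
        using g_power2_le[of "s + 1"] True by simp
      finally show ?thesis using True by (simp add: ennreal_leI)
    next
      case False
      then show ?thesis by (auto simp: Gr_def indicator_def power_mult_distrib)
    qed
    finally show ?thesis .
  qed
  have F0: "?F s \<ge> 0" for s using ray_nonneg[of "s + 1"] by simp
  have meas: "(\<lambda>s. ennreal (?F s) * indicator {0..X - 1} s) \<in> borel_measurable lborel"
    using ray_integral_measurable[OF c_bulk] by measurable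
  have "(\<integral>\<^sup>+s. (majorant s)\<^sup>2 \<partial>lborel) \<le> (\<integral>\<^sup>+s. ennreal (?F s) * indicator {0..X - 1} s + ennreal (?H (max 1 (- s))) * indicator {1..X} (- s) \<partial>lborel)"
    by (intro nn_integral_mono order_trans[OF le]) (auto simp: indicator_def)
  also have "\<dots> = (\<integral>\<^sup>+s. ennreal (?F s) * indicator {0..X - 1} s \<partial>lborel) + (\<integral>\<^sup>+s. ennreal (?H (max 1 (- s))) * indicator {1..X} (- s) \<partial>lborel)"
    by (rule nn_integral_add[OF meas]) measurable
  also have "(\<integral>\<^sup>+s. ennreal (?F s) * indicator {0..X - 1} s \<partial>lborel) = ennreal ?I"
    by (rule nn_integral_has_integral_lebesgue'[OF _ F]) (rule F0)
  also have "(\<integral>\<^sup>+s. ennreal (?H (max 1 (- s))) * indicator {1..X} (- s) \<partial>lborel) = (\<integral>\<^sup>+y. ennreal (?H (max 1 y)) * indicator {1..X} y \<partial>lborel)"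
    by (subst (2) nn_integral_real_affine[where c = "-1" and t = 0]) simp_all
  also have "\<dots> = (\<integral>\<^sup>+y. ennreal (?H y) * indicator {1..X} y \<partial>lborel)"
    by (intro nn_integral_cong) (auto simp: indicator_def max_def)
  also have "\<dots> = ennreal (4 * integral {1..X} (\<lambda>y. (wr 0 y)\<^sup>2))"
    by (rule nn_integral_has_integral_lebesgue'[OF _ H]) simp
  also have "ennreal ?I + ennreal (4 * integral {1..X} (\<lambda>y. (wr 0 y)\<^sup>2)) \<le> ennreal (90000 * K ^ 3) + ennreal (10000 * K ^ 3)"
    by (intro add_mono ennreal_leI I H_le)
  also have "\<dots> = ennreal (10 ^ 5 * K ^ 3)"
    using K_ge by (subst ennreal_plus[symmetric]) auto
  finally show ?thesis .
qed

text \<open>Along the incoming ray the derivative of \<open>wt + wr\<close> is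
  \<open>wrr - wtt\<close>, that is, \<open>w^5 / r^4 - e\<close>, and at \<open>r = 1\<close> the
  Robin condition gives \<open>wt + w\<close>. The foot of the ray has the later time
  \<open>s + y - 1\<close>, so traces from the future of the point are involved.\<close>

lemma incoming_bound:
  assumes s: "0 \<le> s" "1 \<le> y" "s + y \<le> X"
  shows "\<bar>wt s y + wr s y\<bar> \<le> \<Gamma> (s + y - 1)"
proof -
  define x where "x = s + y"
  have x: "1 \<le> x" "x \<le> X" "y \<le> x" using s by (auto simp: x_def)
  let ?p = "\<lambda>r. wt (x - r) r + wr (x - r) r" and ?p' = "\<lambda>r. wrr (x - r) r - wtt (x - r) r"
  have d: "((\<lambda>r. x - r) has_real_derivative - 1) (at r within {1..x})" "((\<lambda>r. r) has_real_derivative 1) (at r within {1..x})" for r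
    by (auto intro!: derivative_eq_intros)
  have dp: "(?p has_real_derivative ?p' r) (at r within {1..x})" if "r \<in> {1..x}" for r
    using DERIV_add[OF has_real_derivative_ray[OF cont(5) wt_t wt_r d] has_real_derivative_ray[OF cont(6) wr_t wr_r d]] that x by auto
  have cp': "continuous_on {1..x} ?p'" by (intro continuous_intros ray_cont cont)
  have "(?p' has_integral ?p y - ?p 1) {1..y}"
    using s x by (intro FTC_within[where S = "{1..x}"] dp) auto
  from integral_unique[OF this] have "\<bar>?p y - ?p 1\<bar> = \<bar>integral {1..y} ?p'\<bar>" by simp
  also have "\<dots> \<le> integral {1..y} (\<lambda>r. \<bar>w (x - r) r\<bar> ^ 5 * inverse r ^ 4 + \<delta>\<^sup>2)"
  proof (rule integral_norm_bound_integral[where 'a = real, unfolded real_norm_def])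
    show "?p' integrable_on {1..y}"
      using x by (intro integrable_continuous_real continuous_on_subset[OF cp']) auto
    show "(\<lambda>r. \<bar>w (x - r) r\<bar> ^ 5 * inverse r ^ 4 + \<delta>\<^sup>2) integrable_on {1..y}"
      using x by (intro integrable_continuous_real continuous_intros continuous_on_subset[OF ray_cont(1)[OF c_abs5]]) auto
    fix r assume r: "r \<in> {1..y}"
    have "?p' r = w (x - r) r ^ 5 * inverse r ^ 4 - e (x - r) r" by (simp add: e_def)
    then have "\<bar>?p' r\<bar> \<le> \<bar>w (x - r) r ^ 5 * inverse r ^ 4\<bar> + \<bar>e (x - r) r\<bar>" by (simp only: abs_triangle_ineq4)
    also have "\<bar>w (x - r) r ^ 5 * inverse r ^ 4\<bar> = \<bar>w (x - r) r\<bar> ^ 5 * inverse r ^ 4"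
      using r by (simp add: abs_mult power_abs)
    also have "\<bar>e (x - r) r\<bar> \<le> \<delta>\<^sup>2" using r x by (intro e_bound) auto
    finally show "\<bar>?p' r\<bar> \<le> \<bar>w (x - r) r\<bar> ^ 5 * inverse r ^ 4 + \<delta>\<^sup>2" by simp
  qed
  also have "\<dots> = integral {1..y} (\<lambda>r. \<bar>w (x - r) r\<bar> ^ 5 * inverse r ^ 4) + integral {1..y} (\<lambda>r. \<delta>\<^sup>2)"
    using x by (intro integral_add integrable_continuous_real continuous_intros continuous_on_subset[OF ray_cont(1)[OF c_abs5]]) auto
  also have "integral {1..y} (\<lambda>r. \<bar>w (x - r) r\<bar> ^ 5 * inverse r ^ 4) \<le> g x"
    unfolding g_def using x
    by (intro integral_subset_le ray_int(1)[OF c_abs5] integrable_continuous_real continuous_on_subset[OF ray_cont(1)[OF c_abs5]]) auto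
  also have "integral {1..y} (\<lambda>r. \<delta>\<^sup>2) \<le> \<delta>\<^sup>2 * X"
    using s by (simp add: mult_right_mono mult.commute[of _ X])
  finally have "\<bar>?p y - ?p 1\<bar> \<le> g x + \<delta>\<^sup>2 * X" by simp
  moreover have "?p 1 = wt (x - 1) 1 + w (x - 1) 1" using robin[of "x - 1"] x by simp
  ultimately have "\<bar>?p y\<bar> \<le> \<bar>w (x - 1) 1\<bar> + \<bar>wt (x - 1) 1\<bar> + g x + \<delta>\<^sup>2 * X" by linarith
  then show ?thesis by (simp add: \<Gamma>_def x_def)
qed

text \<open>Along an outgoing ray the derivative of \<open>w\<close> is \<open>wt + wr\<close>, and
  the incoming ray through its point at time \<open>s\<close> reaches the boundary at time
  \<open>r - t - 1 + 2 * s\<close>. That substitution has Jacobian 2; the resulting gain of a factor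
  1/2 is given away.\<close>

lemma outgoing_increment:
  assumes s0: "0 \<le> s0" "s0 \<le> t" "1 \<le> r - t + s0" and r: "t + r \<le> X"
  shows "ennreal \<bar>w t r - w s0 (r - t + s0)\<bar> \<le> (\<integral>\<^sup>+s. ennreal (Gr s) * indicator {r - t - 1 + 2 * s0..t + r - 1} s \<partial>lborel)"
proof -
  let ?v = "\<lambda>s. w s (r - t + s)" and ?v' = "\<lambda>s. wt s (r - t + s) + wr s (r - t + s)"
  have dv: "(?v has_real_derivative ?v' s) (at s within {s0..t})" if s: "s \<in> {s0..t}" for s
  proof -
    have "((\<lambda>s. s) has_real_derivative 1) (at s within {s0..t})" "((\<lambda>s. r - t + s) has_real_derivative 1) (at s within {s0..t})"
      by (auto intro!: derivative_eq_intros)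
    from has_real_derivative_ray[OF cont(3) w_t w_r this] s0 r s show ?thesis by auto
  qed
  have cv: "continuous_on {s0..t} ?v'"
    using s0 by (intro continuous_intros cont2_compose[OF cont(2)] cont2_compose[OF cont(3)]) auto
  have "ennreal \<bar>?v t - ?v s0\<bar> \<le> (\<integral>\<^sup>+s. ennreal \<bar>?v' s\<bar> * indicator {s0..t} s \<partial>lborel)"
    by (rule abs_increment_le_nn_integral[OF s0(2) dv cv])
  also have "\<dots> \<le> (\<integral>\<^sup>+s. ennreal (Gr (r - t - 1 + 2 * s)) * indicator {s0..t} s \<partial>lborel)"
  proof (intro nn_integral_mono)
    fix s
    have "\<bar>?v' s\<bar> \<le> Gr (r - t - 1 + 2 * s)" if s: "s \<in> {s0..t}"
    proof -
      have "\<bar>?v' s\<bar> \<le> \<Gamma> (s + (r - t + s) - 1)" using s s0 r by (intro incoming_bound) auto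
      also have "s + (r - t + s) - 1 = r - t - 1 + 2 * s" by simp
      also have "\<Gamma> (r - t - 1 + 2 * s) = Gr (r - t - 1 + 2 * s)" using s s0 r by (simp add: Gr_def)
      finally show ?thesis .
    qed
    then show "ennreal \<bar>?v' s\<bar> * indicator {s0..t} s \<le> ennreal (Gr (r - t - 1 + 2 * s)) * indicator {s0..t} s"
      by (auto simp: indicator_def ennreal_leI)
  qed
  also have "\<dots> = 1 * (\<integral>\<^sup>+s. ennreal (Gr (r - t - 1 + 2 * s)) * indicator {r - t - 1 + 2 * s0..t + r - 1} (r - t - 1 + 2 * s) \<partial>lborel)"
    by (simp, intro nn_integral_cong) (auto simp: indicator_def)
  also have "\<dots> \<le> ennreal \<bar>2\<bar> * (\<integral>\<^sup>+s. ennreal (Gr (r - t - 1 + 2 * s)) * indicator {r - t - 1 + 2 * s0..t + r - 1} (r - t - 1 + 2 * s) \<partial>lborel)"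
    by (intro mult_right_mono) auto
  also have "\<dots> = (\<integral>\<^sup>+s. ennreal (Gr s) * indicator {r - t - 1 + 2 * s0..t + r - 1} s \<partial>lborel)"
    by (rule nn_integral_real_affine[symmetric]) auto
  finally show ?thesis by simp
qed

text \<open>The Sobolev inequality on a unit interval of later times, which must stay below
  \<open>X - 1\<close>; both of its terms are summands of \<open>\<Gamma>\<close>.\<close>

lemma boundary_value_le:
  assumes s: "0 \<le> s" "s + 1 \<le> X - 1"
  shows "ennreal \<bar>w s 1\<bar> \<le> (\<integral>\<^sup>+y. ennreal (Gr y) * indicator {s..s + 1} y \<partial>lborel)"
proof -
  have "ennreal \<bar>w s 1\<bar> \<le> (\<integral>\<^sup>+x. ennreal (\<bar>w x 1\<bar> + \<bar>wt x 1\<bar>) * indicator {s..s + 1} x \<partial>lborel)"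
    using s by (intro abs_value_le_nn_integral cont2_compose[OF cont(2)] continuous_intros DERIV_subset[OF w_t]) auto
  also have "\<dots> \<le> (\<integral>\<^sup>+y. ennreal (Gr y) * indicator {s..s + 1} y \<partial>lborel)"
  proof (intro nn_integral_mono)
    fix y
    have "\<bar>w y 1\<bar> + \<bar>wt y 1\<bar> \<le> Gr y" if "y \<in> {s..s + 1}"
      using that s g_nonneg[of "y + 1"] X by (simp add: Gr_def \<Gamma>_def)
    then show "ennreal (\<bar>w y 1\<bar> + \<bar>wt y 1\<bar>) * indicator {s..s + 1} y \<le> ennreal (Gr y) * indicator {s..s + 1} y"
      by (auto simp: indicator_def ennreal_leI simp del: ennreal_plus)
  qed
  finally show ?thesis .
qed

text \<open>Reflection identifies the initial slope with \<open>Gr\<close> on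
  \<open>[- y, -1]\<close>, and the value at the corner \<open>t = 0\<close>, \<open>r = 1\<close>
  costs the interval \<open>[0, 1]\<close>.\<close>

lemma initial_value_le:
  assumes y: "1 \<le> y" "y \<le> X"
  shows "ennreal \<bar>w 0 y\<bar> \<le> (\<integral>\<^sup>+s. ennreal (Gr s) * indicator {- y..1} s \<partial>lborel)"
proof -
  have d: "((\<lambda>y. w 0 y) has_real_derivative wr 0 x) (at x within {1..y})" if "x \<in> {1..y}" for x
    using that X by (intro DERIV_subset[OF w_r]) auto
  have "ennreal \<bar>w 0 y - w 0 1\<bar> \<le> (\<integral>\<^sup>+x. ennreal \<bar>wr 0 x\<bar> * indicator {1..y} x \<partial>lborel)"
    using y by (intro abs_increment_le_nn_integral[OF _ d] ray_cont(2) cont) auto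
  also have "\<dots> \<le> (\<integral>\<^sup>+x. ennreal (Gr (- x)) * indicator {1..y} x \<partial>lborel)"
    using y by (intro nn_integral_mono) (auto simp: indicator_def Gr_def intro!: ennreal_leI)
  also have "\<dots> = (\<integral>\<^sup>+s. ennreal (Gr s) * indicator {- y..-1} s \<partial>lborel)"
  proof -
    have "(\<integral>\<^sup>+s. ennreal (Gr s) * indicator {- y..-1} s \<partial>lborel) = ennreal \<bar>- 1\<bar> * (\<integral>\<^sup>+x. ennreal (Gr (0 + (- 1) * x)) * indicator {- y..-1} (0 + (- 1) * x) \<partial>lborel)"
      by (rule nn_integral_real_affine) auto
    also have "\<dots> = (\<integral>\<^sup>+x. ennreal (Gr (- x)) * indicator {1..y} x \<partial>lborel)"
      by (simp, intro nn_integral_cong) (auto simp: indicator_def)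
    finally show ?thesis by simp
  qed
  finally have 1: "ennreal \<bar>w 0 y - w 0 1\<bar> \<le> (\<integral>\<^sup>+s. ennreal (Gr s) * indicator {- y..-1} s \<partial>lborel)" .
  have 2: "ennreal \<bar>w 0 1\<bar> \<le> (\<integral>\<^sup>+s. ennreal (Gr s) * indicator {0..0 + 1} s \<partial>lborel)"
    using X by (intro boundary_value_le) auto
  have "ennreal \<bar>w 0 y\<bar> \<le> ennreal (\<bar>w 0 y - w 0 1\<bar> + \<bar>w 0 1\<bar>)" by (intro ennreal_leI) auto
  also have "\<dots> = ennreal \<bar>w 0 y - w 0 1\<bar> + ennreal \<bar>w 0 1\<bar>" by simp
  also have "\<dots> \<le> (\<integral>\<^sup>+s. ennreal (Gr s) * indicator {- y..-1} s \<partial>lborel) + (\<integral>\<^sup>+s. ennreal (Gr s) * indicator {0..0 + 1} s \<partial>lborel)"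
    by (intro add_mono 1 2)
  also have "\<dots> = (\<integral>\<^sup>+s. ennreal (Gr s) * indicator {- y..-1} s + ennreal (Gr s) * indicator {0..0 + 1} s \<partial>lborel)"
    by (rule nn_integral_add[symmetric]) auto
  also have "\<dots> \<le> (\<integral>\<^sup>+s. ennreal (Gr s) * indicator {- y..1} s \<partial>lborel)"
    using y by (intro nn_integral_mono) (auto simp: indicator_def)
  finally show ?thesis .
qed

text \<open>Follow the outgoing ray backwards from \<open>(t, r)\<close> until it leaves the region,
  through the initial line if \<open>t - r + 1 \<le> 0\<close> and through the boundary otherwise;
  \<open>s0\<close> is the time of exit. The increment along the ray and the value at the exit are
  each bounded by the integral of \<open>Gr\<close> over \<open>[t - r, t + r]\<close>, whence the
  factor 2 in \<open>majorant\<close>.\<close>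

lemma le_cone_integral:
  assumes tr: "0 \<le> t" "1 \<le> r" "t + r \<le> X - 1"
  shows "ennreal \<bar>w t r\<bar> \<le> cone_integral majorant t r"
proof -
  let ?J = "\<integral>\<^sup>+s. ennreal (Gr s) * indicator {t - r..t + r} s \<partial>lborel"
  define s0 where "s0 = max 0 (t - r + 1)"
  have s0: "0 \<le> s0" "s0 \<le> t" "1 \<le> r - t + s0" using tr by (auto simp: s0_def)
  have mono: "(\<integral>\<^sup>+s. ennreal (Gr s) * indicator {a..b} s \<partial>lborel) \<le> ?J" if "t - r \<le> a" "b \<le> t + r" for a b
    using that by (intro nn_integral_mono) (auto simp: indicator_def)
  have 1: "ennreal \<bar>w t r - w s0 (r - t + s0)\<bar> \<le> ?J"
    using tr by (intro order_trans[OF outgoing_increment[OF s0] mono]) (auto simp: s0_def max_def)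
  have 2: "ennreal \<bar>w s0 (r - t + s0)\<bar> \<le> ?J"
  proof (cases "t - r + 1 \<le> 0")
    case True
    then have "s0 = 0" by (simp add: s0_def)
    then show ?thesis using tr True by (auto intro!: order_trans[OF initial_value_le mono])
  next
    case False
    then have "r - t + s0 = 1" "s0 = t - r + 1" by (auto simp: s0_def)
    then show ?thesis using tr False by (auto intro!: order_trans[OF boundary_value_le mono])
  qed
  have "ennreal \<bar>w t r\<bar> \<le> ennreal (\<bar>w t r - w s0 (r - t + s0)\<bar> + \<bar>w s0 (r - t + s0)\<bar>)" by (intro ennreal_leI) auto
  also have "\<dots> = ennreal \<bar>w t r - w s0 (r - t + s0)\<bar> + ennreal \<bar>w s0 (r - t + s0)\<bar>" by simp
  also have "\<dots> \<le> ?J + ?J" by (intro add_mono 1 2)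
  also have "\<dots> = 2 * ?J" by (simp add: mult_2)
  also have "\<dots> = (\<integral>\<^sup>+s. 2 * (ennreal (Gr s) * indicator {t - r..t + r} s) \<partial>lborel)"
    by (rule nn_integral_cmult[symmetric]) auto
  also have "\<dots> = cone_integral majorant t r"
    unfolding cone_integral_def majorant_def using Gr_nonneg
    by (intro nn_integral_cong) (simp add: ennreal_mult mult.assoc)
  finally show ?thesis .
qed

text \<open>Bounds the supremum over \<open>r\<close> of \<open>w^4 / r^3\<close>, which in the
  original unknown is \<open>u^4 * r\<close>.\<close>

definition N where
  "N t = 3 * (\<integral>\<^sup>+x. (cone_integral majorant t x) ^ 4 * ennreal (1 / x ^ 4) * indicator {1..} x \<partial>lborel)"

lemma N_measurable [measurable]: "N \<in> borel_measurable borel"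
  unfolding N_def by measurable

lemma sup_power4_le:
  assumes tr: "0 \<le> t" "1 \<le> r" "t + r \<le> X - 1"
  shows "ennreal (w t r ^ 4 / r ^ 3) \<le> N t"
proof -
  have "ennreal (w t r ^ 4 / r ^ 3) = ennreal (\<bar>w t r\<bar> ^ 4 * (1 / r ^ 3))" by (simp add: power_even_abs)
  also have "\<dots> = (ennreal \<bar>w t r\<bar>) ^ 4 * ennreal (1 / r ^ 3)"
    using tr by (subst ennreal_mult) (auto simp: ennreal_power)
  also have "\<dots> \<le> (cone_integral majorant t r) ^ 4 * ennreal (1 / r ^ 3)"
    by (intro mult_right_mono power_mono le_cone_integral[OF tr]) auto
  also have "\<dots> \<le> N t"
    unfolding N_def by (rule cone_integral_sup_le[OF majorant_measurable tr(2)])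
  finally show ?thesis .
qed

lemma N_integral: "(\<integral>\<^sup>+t. N t \<partial>lborel) \<le> ennreal (432 * (10 ^ 5 * K ^ 3)\<^sup>2)"
proof -
  have "(\<integral>\<^sup>+t. N t \<partial>lborel) = 3 * (\<integral>\<^sup>+t. (\<integral>\<^sup>+x. (cone_integral majorant t x) ^ 4 * ennreal (1 / x ^ 4) * indicator {1..} x \<partial>lborel) \<partial>lborel)"
    unfolding N_def by (rule nn_integral_cmult) measurable
  also have "\<dots> \<le> 3 * (144 * (\<integral>\<^sup>+y. (majorant y)\<^sup>2 \<partial>lborel)\<^sup>2)"
    by (intro mult_left_mono cone_integral_spacetime_bound) auto
  also have "\<dots> \<le> 3 * (144 * (ennreal (10 ^ 5 * K ^ 3))\<^sup>2)"
    by (intro mult_left_mono power_mono majorant_L2) auto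
  also have "\<dots> = ennreal (3 * (144 * (10 ^ 5 * K ^ 3)\<^sup>2))"
    using K_ge by (simp add: ennreal_mult ennreal_power)
  finally show ?thesis by simp
qed

end

section \<open>Mollification in time\<close>

text \<open>Only the point 0 is delicate; there \<open>n \<ge> 2\<close> bounds the difference
  quotient by \<open>\<bar>h\<bar>\<close>.\<close>

lemma has_real_derivative_pospart_power:
  assumes n: "n \<ge> 2"
  shows "((\<lambda>y. max 0 y ^ n) has_real_derivative real n * max 0 y ^ (n - 1)) (at (y::real))"
proof -
  consider "y > 0" | "y < 0" | "y = 0" by linarith
  then show ?thesis
  proof cases
    case 1
    have "((\<lambda>y. y ^ n) has_real_derivative real n * y ^ (n - 1)) (at y)"
      by (auto intro!: derivative_eq_intros)
    moreover have ev: "\<forall>\<^sub>F x in nhds y. max 0 x ^ n = x ^ n"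
      using eventually_nhds_in_open[of "{0<..}" y] 1 by (auto elim!: eventually_mono)
    ultimately show ?thesis using DERIV_cong_ev[OF refl ev refl] 1 by simp
  next
    case 2
    have ev: "\<forall>\<^sub>F x in nhds y. max 0 x ^ n = 0"
      using eventually_nhds_in_open[of "{..<0}" y] 2 n by (auto elim!: eventually_mono)
    have "((\<lambda>y. max 0 y ^ n) has_real_derivative 0) (at y)"
      using DERIV_cong_ev[OF refl ev refl, of 0] DERIV_const[of 0 "at y"] by blast
    then show ?thesis using 2 n by (simp add: power_0_left)
  next
    case 3
    have "((\<lambda>h::real. max 0 h ^ n / h) \<longlongrightarrow> 0) (at 0)"
    proof (rule Lim_null_comparison)
      show "\<forall>\<^sub>F h::real in at 0. norm (max 0 h ^ n / h) \<le> \<bar>h\<bar>"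
      proof (rule eventually_at_topological[THEN iffD2], intro exI[of _ "{-1<..<1}"] conjI ballI impI)
        fix h :: real assume h: "h \<in> {-1<..<1}" "h \<noteq> 0"
        have "max 0 h ^ n \<le> max 0 h ^ 2" using h n by (intro power_decreasing) auto
        also have "\<dots> \<le> \<bar>h\<bar> * \<bar>h\<bar>" by (auto simp: max_def power2_eq_square)
        finally show "norm (max 0 h ^ n / h) \<le> \<bar>h\<bar>"
          using h by (simp add: field_simps)
      qed auto
      show "((\<lambda>h::real. \<bar>h\<bar>) \<longlongrightarrow> 0) (at 0)"
        using tendsto_rabs[OF tendsto_ident_at[of "0::real" UNIV]] by simp
    qed
    then show ?thesis using 3 n by (simp add: has_field_derivative_iff power_0_left)
  qed
qed

text \<open>A kernel is carried together with its first three derivatives. The third enters through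
  the equation for the time derivative of the mollified function, which contains \<open>k 3\<close>
  as the second derivative of \<open>k 1\<close>.\<close>

definition kernel :: "real \<Rightarrow> (nat \<Rightarrow> real \<Rightarrow> real) \<Rightarrow> bool" where
  "kernel \<epsilon> k \<longleftrightarrow> (\<forall>i<3. \<forall>s. (k i has_real_derivative k (Suc i) s) (at s)) \<and> (\<forall>i\<le>3. continuous_on UNIV (k i)) \<and>
     (\<forall>i\<le>3. \<forall>s. \<bar>s\<bar> \<ge> \<epsilon> \<longrightarrow> k i s = 0) \<and> (\<forall>s. k 0 s \<ge> 0) \<and> integral {-\<epsilon>..\<epsilon>} (k 0) = 1"

lemma kernel_exists:
  assumes \<epsilon>: "\<epsilon> > 0"
  shows "\<exists>k. kernel \<epsilon> k"
proof -
  \<comment> \<open>The bump is a multiple of the fifth power of the positive part of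
    \<open>\<epsilon>^2 - s^2\<close>: three differentiations still leave the continuous factor
    \<open>m s ^ 2\<close>, and all derivatives are explicit.\<close>
  define m where "m s = max 0 (\<epsilon>\<^sup>2 - s\<^sup>2)" for s
  have cm: "continuous_on S m" for S unfolding m_def by (intro continuous_intros)
  have dm: "((\<lambda>s. m s ^ n) has_real_derivative - (2 * real n * s * m s ^ (n - 1))) (at s)" if "n \<ge> 2" for n s
  proof -
    have "((\<lambda>s. \<epsilon>\<^sup>2 - s\<^sup>2) has_real_derivative - (2 * s)) (at s)" by (auto intro!: derivative_eq_intros)
    from DERIV_chain2[OF has_real_derivative_pospart_power[OF that] this] show ?thesis
      unfolding m_def by (simp add: mult_ac)
  qed
  have m0: "m s = 0" if "\<bar>s\<bar> \<ge> \<epsilon>" for s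
    using that \<epsilon> abs_le_square_iff[of \<epsilon> s] by (simp add: m_def)
  define I where "I = integral {-\<epsilon>..\<epsilon>} (\<lambda>s. m s ^ 5)"
  have "I > 0"
  proof -
    have "(\<lambda>s. m s ^ 5) integrable_on {-\<epsilon>..\<epsilon>}" by (intro integrable_continuous_real continuous_intros cm)
    moreover have "0 \<le> I" unfolding I_def by (intro integral_nonneg calculation) (auto simp: m_def)
    moreover have "I \<noteq> 0"
    proof
      assume "I = 0"
      then have "((\<lambda>s. m s ^ 5) has_integral 0) (cbox (-\<epsilon>) \<epsilon>)"
        using calculation(1) unfolding I_def by (simp add: has_integral_integral)
      then have "m 0 ^ 5 = 0"
        using \<epsilon> by (intro has_integral_0_cbox_imp_0[of "-\<epsilon>" \<epsilon>]) (auto intro!: continuous_intros cm simp: m_def)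
      then show False using \<epsilon> by (simp add: m_def)
    qed
    ultimately show ?thesis by simp
  qed
  define c where "c = 1 / I"
  have c: "c > 0" "c * I = 1" using \<open>I > 0\<close> by (simp_all add: c_def)
  define k0 where "k0 s = c * m s ^ 5" for s
  define k1 where "k1 s = - (10 * c) * (s * m s ^ 4)" for s
  define k2 where "k2 s = 80 * c * (s\<^sup>2 * m s ^ 3) - 10 * c * m s ^ 4" for s
  define k3 where "k3 s = 240 * c * (s * m s ^ 3) - 480 * c * (s ^ 3 * m s ^ 2)" for s
  define k where "k i = (if i = 0 then k0 else if i = 1 then k1 else if i = 2 then k2 else k3)" for i :: nat
  have m4: "((\<lambda>s. m s ^ 4) has_real_derivative - (8 * s * m s ^ 3)) (at s)"
    and m3: "((\<lambda>s. m s ^ 3) has_real_derivative - (6 * s * m s ^ 2)) (at s)" for s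
    using dm[of 4 s] dm[of 3 s] by simp_all
  have d0: "(k0 has_real_derivative k1 s) (at s)" for s
    using DERIV_cmult[OF dm[of 5 s], of c] by (simp add: k0_def[abs_def] k1_def mult_ac)
  have d1: "(k1 has_real_derivative k2 s) (at s)" for s
    unfolding k1_def[abs_def]
    by (rule DERIV_cong[OF DERIV_cmult[OF DERIV_mult[OF DERIV_ident m4]]])
      (simp add: k2_def power2_eq_square algebra_simps)
  have d2: "(k2 has_real_derivative k3 s) (at s)" for s
    unfolding k2_def[abs_def]
    by (rule DERIV_cong[OF DERIV_diff[OF DERIV_cmult[OF DERIV_mult[OF DERIV_power[OF DERIV_ident] m3]] DERIV_cmult[OF m4]]])
      (simp add: k3_def power2_eq_square power3_eq_cube algebra_simps)
  have "kernel \<epsilon> k"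
    unfolding kernel_def
  proof (intro conjI allI impI)
    fix i :: nat and s :: real assume "i < 3"
    then consider "i = 0" | "i = 1" | "i = 2" by linarith
    then show "(k i has_real_derivative k (Suc i) s) (at s)"
      by cases (simp_all add: k_def d0 d1 d2)
  next
    fix i :: nat show "continuous_on UNIV (k i)"
      unfolding k_def k0_def[abs_def] k1_def[abs_def] k2_def[abs_def] k3_def[abs_def]
      by (auto intro!: continuous_intros cm)
  next
    fix i :: nat and s assume "\<epsilon> \<le> \<bar>s\<bar>"
    then show "k i s = 0" by (simp add: k_def k0_def k1_def k2_def k3_def m0)
  next
    fix s show "0 \<le> k 0 s" using c by (simp add: k_def k0_def m_def)
  next
    show "integral {-\<epsilon>..\<epsilon>} (k 0) = 1" using c by (simp add: k_def k0_def[abs_def] I_def)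
  qed
  then show ?thesis by blast
qed

text \<open>Only time is averaged, so the boundary \<open>r = 1\<close> is left untouched and
  product test functions are enough. The window \<open>{-B..B}\<close> keeps the domain compact; it
  contains the support of the kernel around \<open>t\<close> as soon as
  \<open>\<bar>t\<bar> + \<epsilon> \<le> B\<close>.\<close>

definition conv :: "real \<Rightarrow> (real \<Rightarrow> real) \<Rightarrow> (real \<Rightarrow> real \<Rightarrow> real) \<Rightarrow> real \<Rightarrow> real \<Rightarrow> real" where
  "conv B k f t r = integral {-B..B} (\<lambda>s. k (t - s) * f s r)"

lemma conv_cont2:
  assumes k: "continuous_on UNIV k" and f: "cont2 f"
  shows "cont2 (conv B k f)"
proof -
  have "continuous_on ((UNIV \<times> {1..}) \<times> cbox (-B) B) (\<lambda>(z, s). k (fst z - s) * f s (snd z))"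
    unfolding split_beta'
    by (intro continuous_intros continuous_on_compose2[OF k] cont2_compose[OF f]) auto
  from integral_continuous_on_param[OF this] show ?thesis
    by (simp add: cont2_def conv_def)
qed

lemma conv_t:
  assumes k': "continuous_on UNIV k'" and d: "\<And>s. (k has_real_derivative k' s) (at s)" and f: "cont2 f" and r: "1 \<le> r"
  shows "((\<lambda>t. conv B k f t r) has_real_derivative conv B k' f t r) (at t within S)"
proof -
  have k: "continuous_on UNIV k" using d by (intro DERIV_continuous_on) 
  have "((\<lambda>t. integral (cbox (-B) B) (\<lambda>s. k (t - s) * f s r)) has_real_derivative integral (cbox (-B) B) (\<lambda>s. k' (t - s) * f s r)) (at t within UNIV)"
  proof (rule leibniz_rule_field_derivative)
    show "((\<lambda>t. k (t - s) * f s r) has_real_derivative k' (t - s) * f s r) (at t within UNIV)" for t s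
    proof -
      have "((\<lambda>t. t - s) has_real_derivative 1) (at t)" by (auto intro!: derivative_eq_intros)
      from DERIV_cmult_right[OF DERIV_chain2[OF d this], of "f s r"] show ?thesis by simp
    qed
    show "(\<lambda>s. k (t - s) * f s r) integrable_on cbox (- B) B" for t
      using r by (intro integrable_continuous continuous_intros continuous_on_compose2[OF k] cont2_compose[OF f]) auto
    show "continuous_on (UNIV \<times> cbox (- B) B) (\<lambda>(t, s). k' (t - s) * f s r)"
      unfolding split_beta' using r by (intro continuous_intros continuous_on_compose2[OF k'] cont2_compose[OF f]) auto
  qed auto
  then show ?thesis unfolding conv_def by (auto intro: DERIV_subset)
qed

lemma kernel_mass:
  assumes k: "kernel \<epsilon> k" and B: "\<bar>t\<bar> + \<epsilon> \<le> B"
  shows "integral {-B..B} (\<lambda>s. k 0 (t - s)) = 1"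
proof -
  have k0: "continuous_on UNIV (k 0)" "\<And>s. k 0 s \<ge> 0" "\<And>s. \<bar>s\<bar> \<ge> \<epsilon> \<Longrightarrow> k 0 s = 0" "integral {-\<epsilon>..\<epsilon>} (k 0) = 1"
    using k by (auto simp: kernel_def)
  have ck: "continuous_on S (\<lambda>s. k 0 (t - s))" for S
    by (intro continuous_on_compose2[OF k0(1)] continuous_intros) auto
  have "integral {-B..B} (\<lambda>s. k 0 (t - s)) = (LINT s|lborel. indicator {-B..B} s * k 0 (t - s))"
    by (rule integral_Icc_lborel[symmetric]) (rule ck)
  also have "\<dots> = (LINT s|lborel. indicator {-\<epsilon>..\<epsilon>} (t + (-1) * s) * k 0 (t + (-1) * s))"
  proof (rule Bochner_Integration.integral_cong[OF refl])
    fix s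
    show "indicator {-B..B} s * k 0 (t - s) = indicator {-\<epsilon>..\<epsilon>} (t + (-1) * s) * k 0 (t + (-1) * s)"
      using k0(3)[of "t - s"] B by (cases "\<bar>t - s\<bar> \<ge> \<epsilon>") (auto simp: indicator_def)
  qed
  also have "\<dots> = (LINT s|lborel. indicator {-\<epsilon>..\<epsilon>} s * k 0 s)"
    using lborel_integral_real_affine[of "-1" "\<lambda>s. indicator {-\<epsilon>..\<epsilon>} s * k 0 s" t] by simp
  also have "\<dots> = integral {-\<epsilon>..\<epsilon>} (k 0)"
    by (rule integral_Icc_lborel) (rule continuous_on_subset[OF k0(1)], simp)
  finally show ?thesis using k0(4) by simp
qed

text \<open>Serves twice: it gives uniform convergence of the mollification, and it carries bounds
  valid for times near 0 over to the mollified data.\<close>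

lemma kernel_average:
  assumes k: "kernel \<epsilon> k" and B: "\<bar>t\<bar> + \<epsilon> \<le> B" and \<phi>: "continuous_on {-B..B} \<phi>"
    and le: "\<And>s. \<bar>s - t\<bar> \<le> \<epsilon> \<Longrightarrow> \<bar>\<phi> s\<bar> \<le> M"
  shows "\<bar>integral {-B..B} (\<lambda>s. k 0 (t - s) * \<phi> s)\<bar> \<le> M"
proof -
  have k0: "continuous_on UNIV (k 0)" "\<And>s. k 0 s \<ge> 0" "\<And>s. \<bar>s\<bar> \<ge> \<epsilon> \<Longrightarrow> k 0 s = 0"
    using k by (auto simp: kernel_def)
  have ck: "continuous_on S (\<lambda>s. k 0 (t - s))" for S
    by (intro continuous_on_compose2[OF k0(1)] continuous_intros) auto
  have "\<bar>integral {-B..B} (\<lambda>s. k 0 (t - s) * \<phi> s)\<bar> \<le> integral {-B..B} (\<lambda>s. M * k 0 (t - s))"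
  proof (rule integral_norm_bound_integral[where 'a = real, unfolded real_norm_def])
    show "(\<lambda>s. k 0 (t - s) * \<phi> s) integrable_on {-B..B}" "(\<lambda>s. M * k 0 (t - s)) integrable_on {-B..B}"
      by (intro integrable_continuous_real continuous_intros ck \<phi>)+
    fix s
    show "\<bar>k 0 (t - s) * \<phi> s\<bar> \<le> M * k 0 (t - s)"
    proof (cases "\<bar>t - s\<bar> \<ge> \<epsilon>")
      case False
      then have "\<bar>\<phi> s\<bar> \<le> M" by (intro le) auto
      then show ?thesis using k0(2)[of "t - s"] by (simp add: abs_mult mult.commute mult_right_mono)
    qed (simp add: k0(3))
  qed
  also have "\<dots> = M" using kernel_mass[OF k B] by simp
  finally show "\<bar>integral {-B..B} (\<lambda>s. k 0 (t - s) * \<phi> s)\<bar> \<le> M" .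
qed

text \<open>Uniform continuity on a box enlarged by 1 in time. The threshold
  \<open>\<epsilon>0\<close> is fixed before kernel and window, so it serves every kernel of smaller
  width.\<close>

lemma conv_close:
  assumes f: "cont2 f" and X: "X \<ge> 1" and \<eta>: "\<eta> > 0"
  shows "\<exists>\<epsilon>0>0. \<forall>\<epsilon> k B t r. kernel \<epsilon> k \<longrightarrow> \<epsilon> \<le> \<epsilon>0 \<longrightarrow> \<bar>t\<bar> \<le> X \<longrightarrow> 1 \<le> r \<longrightarrow> r \<le> X \<longrightarrow> X + \<epsilon> \<le> B \<longrightarrow>
     \<bar>conv B (k 0) f t r - f t r\<bar> \<le> \<eta>"
proof -
  let ?K = "cbox (- X - 1, 1) (X + 1, X) :: (real \<times> real) set"
  have "continuous_on ?K (\<lambda>z. f (fst z) (snd z))"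
    by (intro cont2_compose[OF f] continuous_intros) (auto simp: cbox_Pair_eq)
  from compact_uniformly_continuous[OF this compact_cbox, unfolded uniformly_continuous_on_def, rule_format, OF \<eta>]
  obtain d where d: "d > 0" "\<And>z z'. z \<in> ?K \<Longrightarrow> z' \<in> ?K \<Longrightarrow> dist z' z < d \<Longrightarrow> dist (f (fst z') (snd z')) (f (fst z) (snd z)) < \<eta>"
    by blast
  show ?thesis
  proof (intro exI[of _ "min 1 (d / 2)"] conjI allI impI)
    show "0 < min 1 (d / 2)" using d by simp
    fix \<epsilon> k B t r
    assume k: "kernel \<epsilon> k" and e: "\<epsilon> \<le> min 1 (d / 2)" and tr: "\<bar>t\<bar> \<le> X" "1 \<le> r" "r \<le> X" and B: "X + \<epsilon> \<le> B"
    have cf: "continuous_on {-B..B} (\<lambda>s. f s r)" using tr by (intro cont2_compose[OF f] continuous_intros) auto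
    have ck: "continuous_on {-B..B} (\<lambda>s. k 0 (t - s))"
    proof -
      have "continuous_on UNIV (k 0)" using k by (simp add: kernel_def)
      then show ?thesis by (rule continuous_on_compose2) (auto intro!: continuous_intros)
    qed
    have tB: "\<bar>t\<bar> + \<epsilon> \<le> B" using tr B by auto
    have "\<bar>f s r - f t r\<bar> \<le> \<eta>" if "\<bar>s - t\<bar> \<le> \<epsilon>" for s
    proof -
      have "dist (s, r) (t, r) < d" using that e d by (simp add: dist_Pair_Pair dist_real_def)
      moreover have "t \<le> X + 1" "- X - 1 \<le> t" "s \<le> X + 1" "- X - 1 \<le> s"
        using tr that e by linarith+
      then have "(t, r) \<in> ?K" "(s, r) \<in> ?K" using tr by (auto simp: cbox_Pair_eq)
      ultimately have "dist (f s r) (f t r) < \<eta>"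
        using d(2)[of "(t, r)" "(s, r)"] by simp
      then show ?thesis by (simp add: dist_real_def)
    qed
    then have "\<bar>integral {-B..B} (\<lambda>s. k 0 (t - s) * (f s r - f t r))\<bar> \<le> \<eta>"
      by (intro kernel_average[OF k tB] continuous_intros cf)
    also have "integral {-B..B} (\<lambda>s. k 0 (t - s) * (f s r - f t r))
        = integral {-B..B} (\<lambda>s. k 0 (t - s) * f s r) - integral {-B..B} (\<lambda>s. k 0 (t - s) * f t r)"
      unfolding right_diff_distrib by (intro integral_diff integrable_continuous_real continuous_intros ck cf)
    also have "integral {-B..B} (\<lambda>s. k 0 (t - s) * f t r) = f t r"
      using kernel_mass[OF k tB] by simp
    finally show "\<bar>conv B (k 0) f t r - f t r\<bar> \<le> \<eta>" unfolding conv_def .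
  qed
qed

lemma integral_swap_Icc:
  fixes f :: "real \<Rightarrow> real \<Rightarrow> real"
  assumes "continuous_on ({a..b} \<times> {c..d}) (\<lambda>z. f (fst z) (snd z))"
  shows "integral {a..b} (\<lambda>x. integral {c..d} (\<lambda>y. f x y)) = integral {c..d} (\<lambda>y. integral {a..b} (\<lambda>x. f x y))"
proof -
  have 1: "continuous_on (cbox (a, c) (b, d)) (\<lambda>(x, y). f x y)"
    using assms by (simp add: cbox_Pair_eq split_beta')
  have 2: "continuous_on (cbox (c, a) (d, b)) (\<lambda>(y, x). f x y)"
    unfolding cbox_Pair_eq split_beta'
    by (rule continuous_on_compose2[OF assms, of _ "\<lambda>z. (snd z, fst z)", simplified]) (auto intro!: continuous_intros)
  show ?thesis
    using integral_prod_continuous[OF 1] integral_prod_continuous[OF 2] integral_swap_2dim[OF 1] by simp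
qed

text \<open>Rescaling to \<open>{0..1}\<close> turns the moving endpoint into a parameter of the
  integrand; joint continuity in \<open>cont2_integral\<close> then follows from continuity of
  parameter integrals.\<close>

lemma integral_Icc_scale:
  fixes f :: "real \<Rightarrow> real"
  assumes r: "1 \<le> r" and f: "continuous_on {1..r} f"
  shows "integral {1..r} f = (r - 1) * integral {0..1} (\<lambda>y. f (1 + (r - 1) * y))"
proof (cases "r = 1")
  case False
  with r have r1: "r - 1 > 0" by simp
  have *: "(1 + (r - 1) * y \<in> {1..r}) = (y \<in> {0..1})" for y
  proof -
    define p where "p = (r - 1) * y"
    have "0 \<le> p \<longleftrightarrow> 0 \<le> y" "p \<le> r - 1 \<longleftrightarrow> y \<le> 1"
      using r1 mult_le_cancel_left_pos[OF r1, of y 1] by (simp_all add: p_def zero_le_mult_iff)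
    then show ?thesis unfolding p_def[symmetric] by auto
  qed
  have c: "continuous_on {0..1} (\<lambda>y. f (1 + (r - 1) * y))"
    by (intro continuous_on_compose2[OF f] continuous_intros) (use * in blast)
  have "integral {1..r} f = (LINT x|lborel. indicator {1..r} x * f x)" by (rule integral_Icc_lborel[OF f, symmetric])
  also have "\<dots> = \<bar>r - 1\<bar> *\<^sub>R (LINT y|lborel. indicator {1..r} (1 + (r - 1) * y) * f (1 + (r - 1) * y))"
    using r1 by (intro lborel_integral_real_affine) auto
  also have "(LINT y|lborel. indicator {1..r} (1 + (r - 1) * y) * f (1 + (r - 1) * y)) = (LINT y|lborel. indicator {0..1} y * f (1 + (r - 1) * y))"
    using * by (intro Bochner_Integration.integral_cong refl) (simp add: indicator_def)
  also have "\<dots> = integral {0..1} (\<lambda>y. f (1 + (r - 1) * y))" by (rule integral_Icc_lborel[OF c])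
  finally show ?thesis using r1 by simp
qed simp

lemma cont2_integral:
  assumes f: "cont2 f"
  shows "cont2 (\<lambda>t r. integral {1..r} (\<lambda>y. f t y))"
proof -
  have "continuous_on ((UNIV \<times> {1..}) \<times> cbox 0 1) (\<lambda>(z, y). f (fst z) (1 + (snd z - 1) * y))"
    unfolding split_beta' by (intro cont2_compose[OF f] continuous_intros) auto
  from integral_continuous_on_param[OF this]
  have "continuous_on (UNIV \<times> {1..}) (\<lambda>z. (snd z - 1) * integral {0..1} (\<lambda>y. f (fst z) (1 + (snd z - 1) * y)))"
    by (intro continuous_intros) simp
  moreover have "(snd z - 1) * integral {0..1} (\<lambda>y. f (fst z) (1 + (snd z - 1) * y)) = integral {1..snd z} (\<lambda>y. f (fst z) y)"
    if "z \<in> UNIV \<times> {1..}" for z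
    using that by (intro integral_Icc_scale[symmetric] cont2_compose[OF f] continuous_intros) auto
  ultimately show ?thesis unfolding cont2_def by (simp cong: continuous_on_cong)
qed

lemma integral_has_derivative_ge:
  fixes f :: "real \<Rightarrow> real"
  assumes f: "continuous_on {1..} f" and r: "1 \<le> r"
  shows "((\<lambda>r. integral {1..r} f) has_real_derivative f r) (at r within {1..})"
proof -
  have "((\<lambda>r. integral {1..r} f) has_real_derivative f r) (at r within {1..r + 1})"
    using r by (intro integral_has_real_derivative continuous_on_subset[OF f]) auto
  moreover have "at r within {1..r + 1} = at r within {1..}"
    by (rule at_within_nhd[of _ "{..<r + 1}"]) auto
  ultimately show ?thesis by simp
qed

text \<open>Taylor's formula with integral remainder for \<open>y'' = f\<close> with
  \<open>y 1 = a\<close> and \<open>y' 1 = a\<close>; the common value \<open>a\<close> encodes the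
  Robin condition.\<close>

lemma second_antiderivative:
  fixes f :: "real \<Rightarrow> real"
  assumes f: "continuous_on {1..} f" and r: "1 \<le> r"
  shows "((\<lambda>r. r * a + integral {1..r} (\<lambda>y. (r - y) * f y)) has_real_derivative a + integral {1..r} f) (at r within {1..})"
proof -
  have c: "continuous_on {1..} (\<lambda>y. y * f y)" by (intro continuous_intros f)
  have eq: "integral {1..r} (\<lambda>y. (r - y) * f y) = r * integral {1..r} f - integral {1..r} (\<lambda>y. y * f y)" if "1 \<le> r" for r
  proof -
    have "integral {1..r} (\<lambda>y. r * f y - y * f y) = integral {1..r} (\<lambda>y. r * f y) - integral {1..r} (\<lambda>y. y * f y)"
      by (intro integral_diff integrable_continuous_real continuous_intros continuous_on_subset[OF f] continuous_on_subset[OF c]) auto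
    then show ?thesis by (simp add: left_diff_distrib)
  qed
  have "((\<lambda>r. r * a + (r * integral {1..r} f - integral {1..r} (\<lambda>y. y * f y))) has_real_derivative a + integral {1..r} f) (at r within {1..})"
    using r by (auto intro!: derivative_eq_intros integral_has_derivative_ge f c)
  then show ?thesis
    by (rule has_field_derivative_transform_within[OF _ zero_less_one]) (use r in \<open>auto simp: eq\<close>)
qed

section \<open>From weak solutions to approximate waves\<close>

text \<open>A continuous function that solves \<open>W'' = H\<close> with
  \<open>W'(1) = W(1)\<close> merely against test functions is the classical solution
  \<open>Y\<close>. The hypothesis is the identity left by two integrations by parts; for a test
  function with second derivative \<open>(W - Y) * (R - y)\<close> it makes the integral of
  \<open>(W - Y)^2 * (R - y)\<close> vanish.\<close>

lemma second_order_unique: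
  fixes W H :: "real \<Rightarrow> real"
  assumes W: "continuous_on {1..} W" and H: "continuous_on {1..} H"
    and weak: "\<And>R z z1 z2. R > 1 \<Longrightarrow> (\<And>r. r \<in> {1..R} \<Longrightarrow> (z has_real_derivative z1 r) (at r within {1..R})) \<Longrightarrow>
        (\<And>r. r \<in> {1..R} \<Longrightarrow> (z1 has_real_derivative z2 r) (at r within {1..R})) \<Longrightarrow> continuous_on {1..R} z2 \<Longrightarrow>
        z R = 0 \<Longrightarrow> z1 R = 0 \<Longrightarrow>
        integral {1..R} (\<lambda>r. z r * H r) = integral {1..R} (\<lambda>r. z2 r * W r) + W 1 * (z1 1 - z 1)"
    and r: "1 \<le> r"
  shows "W r = r * W 1 + integral {1..r} (\<lambda>y. (r - y) * H y)"
proof -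
  define V where "V x = W 1 + integral {1..x} H" for x
  define Y where "Y x = x * W 1 + integral {1..x} (\<lambda>y. (x - y) * H y)" for x
  define R where "R = r + 1"
  have R: "R > 1" "r \<in> {1..R}" using r by (auto simp: R_def)
  have sub: "{1..R} \<subseteq> {1..}" by auto
  have dY: "(Y has_real_derivative V x) (at x within {1..R})" if "x \<in> {1..R}" for x
    unfolding Y_def V_def using that by (intro DERIV_subset[OF second_antiderivative[OF H] sub]) auto
  have dV: "(V has_real_derivative H x) (at x within {1..R})" if "x \<in> {1..R}" for x
    unfolding V_def using that DERIV_subset[OF integral_has_derivative_ge[OF H] sub, of x]
    by (auto intro!: derivative_eq_intros)
  have cW: "continuous_on {1..R} W" "continuous_on {1..R} H" using W H by (auto intro: continuous_on_subset)
  have cY: "continuous_on {1..R} Y" "continuous_on {1..R} V"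
    by (rule DERIV_continuous_on[OF dY], assumption) (rule DERIV_continuous_on[OF dV])
  \<comment> \<open>The constants of integration in \<open>z1\<close> and \<open>z\<close> make both
    vanish at \<open>R\<close>. Since \<open>R = r + 1\<close>, the weight \<open>R - y\<close>
    equals 1 at the point \<open>r\<close> of interest.\<close>
  define z2 where "z2 y = (W y - Y y) * (R - y)" for y
  define z1 where "z1 x = integral {1..x} z2 - integral {1..R} z2" for x
  define z where "z x = integral {1..x} z1 - integral {1..R} z1" for x
  have cz2: "continuous_on {1..R} z2" unfolding z2_def by (intro continuous_intros cW cY)
  have dz1: "(z1 has_real_derivative z2 x) (at x within {1..R})" if "x \<in> {1..R}" for x
    unfolding z1_def using integral_has_real_derivative[OF cz2 that] by (auto intro!: derivative_eq_intros)
  have cz1: "continuous_on {1..R} z1" by (rule DERIV_continuous_on[OF dz1])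
  have dz: "(z has_real_derivative z1 x) (at x within {1..R})" if "x \<in> {1..R}" for x
    unfolding z_def using integral_has_real_derivative[OF cz1 that] by (auto intro!: derivative_eq_intros)
  have cz: "continuous_on {1..R} z" by (rule DERIV_continuous_on[OF dz])
  have 1: "integral {1..R} (\<lambda>r. z r * H r) = integral {1..R} (\<lambda>r. z2 r * W r) + W 1 * (z1 1 - z 1)"
    by (rule weak[OF R(1) dz dz1 cz2]) (auto simp: z_def z1_def)
  have "((\<lambda>x. z x * H x - z2 x * Y x) has_integral (z R * V R - z1 R * Y R) - (z 1 * V 1 - z1 1 * Y 1)) {1..R}"
  proof (rule FTC_within[where S = "{1..R}"])
    fix x assume x: "x \<in> {1..R}"
    show "((\<lambda>x. z x * V x - z1 x * Y x) has_real_derivative z x * H x - z2 x * Y x) (at x within {1..R})"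
      by (auto intro!: derivative_eq_intros dz[OF x] dz1[OF x] dY[OF x] dV[OF x] simp: algebra_simps)
  qed (use R in auto)
  then have "integral {1..R} (\<lambda>x. z x * H x - z2 x * Y x) = W 1 * (z1 1 - z 1)"
    by (subst integral_unique) (auto simp: z_def z1_def V_def Y_def algebra_simps)
  moreover have "integral {1..R} (\<lambda>x. z x * H x - z2 x * Y x) = integral {1..R} (\<lambda>x. z x * H x) - integral {1..R} (\<lambda>x. z2 x * Y x)"
    by (intro integral_diff integrable_continuous_real continuous_intros cz cz2 cW cY)
  moreover have "integral {1..R} (\<lambda>x. z2 x * W x - z2 x * Y x) = integral {1..R} (\<lambda>x. z2 x * W x) - integral {1..R} (\<lambda>x. z2 x * Y x)"
    by (intro integral_diff integrable_continuous_real continuous_intros cz cz2 cW cY)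
  ultimately have "integral {1..R} (\<lambda>x. z2 x * W x - z2 x * Y x) = 0" using 1 by simp
  moreover have "(\<lambda>x. z2 x * W x - z2 x * Y x) = (\<lambda>x. (W x - Y x)\<^sup>2 * (R - x))"
    by (auto simp: fun_eq_iff z2_def power2_eq_square algebra_simps)
  ultimately have "integral {1..R} (\<lambda>x. (W x - Y x)\<^sup>2 * (R - x)) = 0" by simp
  moreover have c: "continuous_on {1..R} (\<lambda>x. (W x - Y x)\<^sup>2 * (R - x))" by (intro continuous_intros cW cY)
  ultimately have "((\<lambda>x. (W x - Y x)\<^sup>2 * (R - x)) has_integral 0) (cbox 1 R)"
    using integrable_integral[OF integrable_continuous_real[OF c]] by simp
  then have "(W r - Y r)\<^sup>2 * (R - r) = 0"
    using c R by (intro has_integral_0_cbox_imp_0[of 1 R "\<lambda>x. (W x - Y x)\<^sup>2 * (R - x)"]) auto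
  then show ?thesis by (simp add: R_def Y_def)
qed

lemma conv_pairing:
  assumes k: "continuous_on UNIV k" and f: "cont2 f" and g: "continuous_on {1..R} g"
  shows "integral {-B..B} (\<lambda>s. k (t - s) * integral {1..R} (\<lambda>r. g r * f s r)) = integral {1..R} (\<lambda>r. g r * conv B k f t r)"
proof -
  have "integral {-B..B} (\<lambda>s. k (t - s) * integral {1..R} (\<lambda>r. g r * f s r))
      = integral {-B..B} (\<lambda>s. integral {1..R} (\<lambda>r. g r * (k (t - s) * f s r)))"
    by (simp add: mult.left_commute flip: integral_mult_right)
  also have "\<dots> = integral {1..R} (\<lambda>r. integral {-B..B} (\<lambda>s. g r * (k (t - s) * f s r)))"
    by (intro integral_swap_Icc continuous_intros continuous_on_compose2[OF g] continuous_on_compose2[OF k] cont2_compose[OF f]) auto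
  also have "\<dots> = integral {1..R} (\<lambda>r. g r * conv B k f t r)"
    by (simp add: conv_def)
  finally show ?thesis .
qed

text \<open>The closing step of the duality arguments: testing a function against itself bounds its
  squared norm \<open>Q\<close> by \<open>A\<close> times a norm that is at most
  \<open>sqrt Q\<close>.\<close>

lemma le_mult_sqrt_imp_le_power2:
  fixes Q A :: real
  assumes "Q \<le> A * sqrt P" "P \<le> Q" "0 \<le> P" "0 \<le> A"
  shows "Q \<le> A\<^sup>2"
proof -
  have "Q \<le> A * sqrt Q" using assms by (meson mult_left_mono order_trans real_sqrt_le_mono)
  moreover have "sqrt Q * sqrt Q = Q" using assms by simp
  ultimately have "sqrt Q * sqrt Q \<le> A * sqrt Q" by simp
  then have "sqrt Q \<le> A"
    using mult_right_le_imp_le[of "sqrt Q" "sqrt Q" A] assms(4) by (cases "sqrt Q > 0") linarith+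
  then have "(sqrt Q)\<^sup>2 \<le> A\<^sup>2" using assms by (intro power_mono) auto
  then show ?thesis using assms by simp
qed

lemma power_uniformly_close:
  assumes "e > 0"
  shows "\<exists>d>0. \<forall>a b::real. \<bar>a\<bar> \<le> M \<longrightarrow> \<bar>b\<bar> \<le> M \<longrightarrow> \<bar>a - b\<bar> \<le> d \<longrightarrow> \<bar>a ^ n - b ^ n\<bar> \<le> e"
proof -
  have "uniformly_continuous_on {-M..M} (\<lambda>x::real. x ^ n)"
    by (intro compact_uniformly_continuous continuous_intros) auto
  from this[unfolded uniformly_continuous_on_def, rule_format, OF assms]
  obtain d where d: "d > 0" "\<And>x y. x \<in> {-M..M} \<Longrightarrow> y \<in> {-M..M} \<Longrightarrow> dist y x < d \<Longrightarrow> dist (y ^ n) (x ^ n) < e" by blast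
  show ?thesis
  proof (intro exI[of _ "d / 2"] conjI allI impI)
    fix a b :: real assume "\<bar>a\<bar> \<le> M" "\<bar>b\<bar> \<le> M" "\<bar>a - b\<bar> \<le> d / 2"
    moreover from this have "a \<in> {-M..M}" "b \<in> {-M..M}" by (simp_all add: abs_le_iff)
    ultimately show "\<bar>a ^ n - b ^ n\<bar> \<le> e" using d(2)[of b a] d(1) by (simp add: dist_real_def)
  qed (use d in auto)
qed

text \<open>Interface between the weak formulation and the multiplier estimates, phrased with
  continuous \<open>u\<close> and one-variable integrals. In \<open>weak\<close> the test function
  is \<open>\<rho> s * z r / r\<close>, with all derivatives moved onto it. The bounds on
  \<open>u_t\<close> and \<open>u_r\<close> near time 0 stand in dual form in \<open>time\<close>
  and \<open>space\<close>, because these derivatives need not exist pointwise. The whole interface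
  is invariant under time reversal.\<close>

locale weak_wave =
  fixes u :: "real \<Rightarrow> real \<Rightarrow> real" and A L \<epsilon>0 :: real
  assumes cu: "cont2 u" and A: "A \<ge> 0" and \<epsilon>0: "\<epsilon>0 > 0"
    and weak: "\<And>B \<rho> \<rho>1 \<rho>2 R z z1 z2. R > 1 \<Longrightarrow> (\<And>s. (\<rho> has_real_derivative \<rho>1 s) (at s)) \<Longrightarrow>
      (\<And>s. (\<rho>1 has_real_derivative \<rho>2 s) (at s)) \<Longrightarrow> continuous_on UNIV \<rho>2 \<Longrightarrow>
      (\<And>s. \<bar>s\<bar> \<ge> B \<Longrightarrow> \<rho> s = 0 \<and> \<rho>1 s = 0 \<and> \<rho>2 s = 0) \<Longrightarrow>
      (\<And>r. r \<in> {1..R} \<Longrightarrow> (z has_real_derivative z1 r) (at r within {1..R})) \<Longrightarrow>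
      (\<And>r. r \<in> {1..R} \<Longrightarrow> (z1 has_real_derivative z2 r) (at r within {1..R})) \<Longrightarrow> continuous_on {1..R} z2 \<Longrightarrow>
      z R = 0 \<Longrightarrow> z1 R = 0 \<Longrightarrow>
      integral {-B..B} (\<lambda>s. \<rho>2 s * integral {1..R} (\<lambda>r. z r * (r * u s r)) +
        \<rho> s * (integral {1..R} (\<lambda>r. z r * ((r * u s r) ^ 5 * inverse r ^ 4)) - integral {1..R} (\<lambda>r. z2 r * (r * u s r))
          - u s 1 * (z1 1 - z 1))) = 0"
    and time: "\<And>B \<epsilon> \<rho> \<rho>1 R \<zeta> \<zeta>1. 0 < \<epsilon> \<Longrightarrow> \<epsilon> \<le> \<epsilon>0 \<Longrightarrow> \<epsilon> \<le> B \<Longrightarrow> R > 1 \<Longrightarrow> (\<And>s. (\<rho> has_real_derivative \<rho>1 s) (at s)) \<Longrightarrow>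
      continuous_on UNIV \<rho>1 \<Longrightarrow> (\<And>s. \<rho> s \<ge> 0) \<Longrightarrow> (\<And>s. \<bar>s\<bar> \<ge> \<epsilon> \<Longrightarrow> \<rho> s = 0 \<and> \<rho>1 s = 0) \<Longrightarrow> integral {-B..B} \<rho> = 1 \<Longrightarrow>
      (\<And>r. r \<in> {1..R} \<Longrightarrow> (\<zeta> has_real_derivative \<zeta>1 r) (at r within {1..R})) \<Longrightarrow> continuous_on {1..R} \<zeta>1 \<Longrightarrow>
      \<zeta> R = 0 \<Longrightarrow> \<zeta>1 R = 0 \<Longrightarrow>
      \<bar>integral {-B..B} (\<lambda>s. \<rho>1 s * integral {1..R} (\<lambda>r. r * \<zeta> r * (r * u s r)))\<bar> \<le> A * sqrt (integral {1..R} (\<lambda>r. (r * \<zeta> r)\<^sup>2))"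
    and space: "\<And>s R m m'. \<bar>s\<bar> \<le> \<epsilon>0 \<Longrightarrow> R > 1 \<Longrightarrow> (\<And>r. r \<in> {1..R} \<Longrightarrow> (m has_real_derivative m' r) (at r within {1..R})) \<Longrightarrow>
      continuous_on {1..R} m' \<Longrightarrow>
      \<bar>u s R * m R - u s 1 * m 1 - integral {1..R} (\<lambda>r. m' r * u s r)\<bar> \<le> A * sqrt (integral {1..R} (\<lambda>r. (m r * inverse r)\<^sup>2))"
    and point: "\<And>s r. \<bar>s\<bar> \<le> \<epsilon>0 \<Longrightarrow> 1 \<le> r \<Longrightarrow> r * (u s r)\<^sup>2 \<le> A\<^sup>2"
    and six: "\<And>R. 1 \<le> R \<Longrightarrow> integral {1..R} (\<lambda>r. (u 0 r) ^ 6 * r\<^sup>2) \<le> L"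
begin

definition w where "w t r = r * u t r"
definition F where "F t r = (w t r) ^ 5 * inverse r ^ 4"

lemma cw: "cont2 w" and cF: "cont2 F"
proof -
  show cw: "cont2 w" using cu unfolding cont2_def w_def by (intro continuous_intros)
  have "continuous_on (UNIV \<times> {1..}) (\<lambda>z::real \<times> real. inverse (snd z))" by (intro continuous_intros) auto
  then show "cont2 F" using cw unfolding cont2_def F_def by (intro continuous_on_mult continuous_on_power)
qed

text \<open>Testing with \<open>k i (t - s)\<close> moves the time derivatives onto the kernel, so
  that for fixed \<open>t\<close> the mollified function solves weakly an ordinary differential
  equation in \<open>r\<close>, which \<open>second_order_unique\<close> makes classical. The case
  \<open>i = 0\<close> gives regularity of \<open>W\<close>, the case \<open>i = 1\<close> that of
  its time derivative.\<close>

lemma kernel_representation: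
  assumes k: "kernel \<epsilon> k" and B: "\<bar>t\<bar> + \<epsilon> \<le> B" and i: "i < 2" and r: "1 \<le> r"
  shows "conv B (k i) w t r = r * conv B (k i) w t 1
     + integral {1..r} (\<lambda>y. (r - y) * (conv B (k (i + 2)) w t y + conv B (k i) F t y))"
proof (rule second_order_unique[OF _ _ _ r])
  have ck: "continuous_on UNIV (k j)" if "j \<le> 3" for j using k that by (auto simp: kernel_def)
  have dk: "(k j has_real_derivative k (Suc j) s) (at s)" if "j < 3" for j s using k that by (auto simp: kernel_def)
  have c2: "cont2 (conv B (k j) f)" if "j \<le> 3" "cont2 f" for j f using conv_cont2[OF ck[OF that(1)] that(2)] .
  show "continuous_on {1..} (conv B (k i) w t)"
    using i by (intro cont2_compose[OF c2[OF _ cw]] continuous_intros) auto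
  show "continuous_on {1..} (\<lambda>y. conv B (k (i + 2)) w t y + conv B (k i) F t y)"
    using i by (intro continuous_intros cont2_compose[OF c2[OF _ cw]] cont2_compose[OF c2[OF _ cF]]) auto
  fix R z z1 z2
  assume R: "(R::real) > 1" and dz: "\<And>r. r \<in> {1..R} \<Longrightarrow> (z has_real_derivative z1 r) (at r within {1..R})"
    and dz1: "\<And>r. r \<in> {1..R} \<Longrightarrow> (z1 has_real_derivative z2 r) (at r within {1..R})" and cz2: "continuous_on {1..R} z2"
    and zR: "z R = 0" "z1 R = 0"
  have cz: "continuous_on {1..R} z" by (rule DERIV_continuous_on[OF dz])
  have "integral {-B..B} (\<lambda>s. k (i + 2) (t - s) * integral {1..R} (\<lambda>r. z r * (r * u s r)) +
        k i (t - s) * (integral {1..R} (\<lambda>r. z r * ((r * u s r) ^ 5 * inverse r ^ 4)) - integral {1..R} (\<lambda>r. z2 r * (r * u s r))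
          - u s 1 * (z1 1 - z 1))) = 0"
  proof (rule weak[OF R _ _ _ _ dz dz1 cz2 zR])
    fix s
    have d: "((\<lambda>s. t - s) has_real_derivative - 1) (at s)" by (auto intro!: derivative_eq_intros)
    show "((\<lambda>s. k i (t - s)) has_real_derivative - k (i + 1) (t - s)) (at s)"
      using DERIV_chain2[OF dk d, of i] i by simp
    show "((\<lambda>s. - k (i + 1) (t - s)) has_real_derivative k (i + 2) (t - s)) (at s)"
      using DERIV_minus[OF DERIV_chain2[OF dk d, of "i + 1"]] i by (simp add: numeral_2_eq_2)
    show "continuous_on UNIV (\<lambda>s. k (i + 2) (t - s))"
      using i by (intro continuous_on_compose2[OF ck] continuous_intros) auto
    assume "B \<le> \<bar>s\<bar>"
    then have "\<epsilon> \<le> \<bar>t - s\<bar>" using B by linarith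
    then show "k i (t - s) = 0 \<and> - k (i + 1) (t - s) = 0 \<and> k (i + 2) (t - s) = 0"
      using k i by (auto simp: kernel_def)
  qed
  then have 0: "integral {-B..B} (\<lambda>s. k (i + 2) (t - s) * integral {1..R} (\<lambda>r. z r * w s r) +
      (k i (t - s) * integral {1..R} (\<lambda>r. z r * F s r) - k i (t - s) * integral {1..R} (\<lambda>r. z2 r * w s r)
       - k i (t - s) * w s 1 * (z1 1 - z 1))) = 0"
    by (simp add: w_def F_def algebra_simps)
  have cs: "continuous_on {-B..B} (\<lambda>s. k j (t - s))" if "j \<le> 3" for j
    using that by (intro continuous_on_compose2[OF ck] continuous_intros) auto
  have cI: "continuous_on {-B..B} (\<lambda>s. integral {1..R} (\<lambda>r. g r * f s r))" if "cont2 f" "continuous_on {1..R} g" for f g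
  proof -
    have "continuous_on ({-B..B} \<times> cbox 1 R) (\<lambda>(s, r). g r * f s r)"
      unfolding split_beta' using that by (intro continuous_intros continuous_on_compose2[OF that(2)] cont2_compose[OF that(1)]) auto
    from integral_continuous_on_param[OF this] show ?thesis by simp
  qed
  have cw1: "continuous_on {-B..B} (\<lambda>s. w s 1)" by (intro cont2_compose[OF cw] continuous_intros) auto
  let ?a = "\<lambda>s. k (i + 2) (t - s) * integral {1..R} (\<lambda>r. z r * w s r)"
  let ?b = "\<lambda>s. k i (t - s) * integral {1..R} (\<lambda>r. z r * F s r)"
  let ?c = "\<lambda>s. k i (t - s) * integral {1..R} (\<lambda>r. z2 r * w s r)"
  let ?d = "\<lambda>s. k i (t - s) * w s 1 * (z1 1 - z 1)"
  have ca: "continuous_on {-B..B} ?a" "continuous_on {-B..B} ?b" "continuous_on {-B..B} ?c" "continuous_on {-B..B} ?d"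
    using i by (intro continuous_intros cs cI cw cF cz cz2 cw1; simp)+
  note ia = ca[THEN integrable_continuous_real]
  have "integral {-B..B} (\<lambda>s. ?a s + (?b s - ?c s - ?d s)) = integral {-B..B} ?a + (integral {-B..B} ?b - integral {-B..B} ?c - integral {-B..B} ?d)"
    using ia by (simp add: integral_add integral_diff integrable_diff)
  with 0 have "integral {-B..B} ?a + (integral {-B..B} ?b - integral {-B..B} ?c - integral {-B..B} ?d) = 0" by simp
  moreover have "integral {-B..B} ?a = integral {1..R} (\<lambda>r. z r * conv B (k (i + 2)) w t r)"
    using i by (intro conv_pairing ck cw cz) auto
  moreover have "integral {-B..B} ?b = integral {1..R} (\<lambda>r. z r * conv B (k i) F t r)"
    using i by (intro conv_pairing ck cF cz) auto
  moreover have "integral {-B..B} ?c = integral {1..R} (\<lambda>r. z2 r * conv B (k i) w t r)"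
    using i by (intro conv_pairing ck cw cz2) auto
  moreover have "integral {-B..B} ?d = conv B (k i) w t 1 * (z1 1 - z 1)"
    by (simp add: conv_def)
  moreover have "integral {1..R} (\<lambda>r. z r * (conv B (k (i + 2)) w t r + conv B (k i) F t r))
      = integral {1..R} (\<lambda>r. z r * conv B (k (i + 2)) w t r) + integral {1..R} (\<lambda>r. z r * conv B (k i) F t r)"
    unfolding distrib_left using i
    by (intro integral_add integrable_continuous_real continuous_intros cz cont2_compose[OF c2[OF _ cw]] cont2_compose[OF c2[OF _ cF]]) auto
  ultimately show "integral {1..R} (\<lambda>r. z r * (conv B (k (i + 2)) w t r + conv B (k i) F t r))
      = integral {1..R} (\<lambda>r. z2 r * conv B (k i) w t r) + conv B (k i) w t 1 * (z1 1 - z 1)"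
    by linarith
qed

end

context weak_wave
begin

text \<open>The summand \<open>3 * A^2\<close> is half of \<open>2 * A^2 + 4 * A^2\<close>, the
  bounds for the \<open>r\<close>- and \<open>t\<close>-derivatives of the mollified data; the 1 in
  \<open>L + 1\<close> allows for the mollification error in the sixth power.\<close>

definition C0 where "C0 = A\<^sup>2 / 2 + 3 * A\<^sup>2 + (L + 1) / 6"

text \<open>The point is uniformity in the width \<open>\<epsilon>\<close>, although the kernel
  \<open>k 1\<close> grows as \<open>\<epsilon>\<close> shrinks. The dual bounds of the locale are
  averaged against \<open>k 0\<close> and tested with the mollified function itself, so the size of
  \<open>k 1\<close> never enters.\<close>

lemma smooth_initial_bounds:
  assumes k: "kernel \<epsilon> k" and \<epsilon>: "0 < \<epsilon>" "\<epsilon> \<le> \<epsilon>0" "\<epsilon> \<le> B" and X: "X > 1"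
    and Wr: "\<And>r. 1 \<le> r \<Longrightarrow> ((\<lambda>r. conv B (k 0) w 0 r) has_real_derivative Wr r) (at r within {1..})"
    and Wrr: "\<And>r. 1 \<le> r \<Longrightarrow> (Wr has_real_derivative Wrr r) (at r within {1..})"
    and cWrr: "continuous_on {1..} Wrr"
    and Wtr: "\<And>r. 1 \<le> r \<Longrightarrow> ((\<lambda>r. conv B (k 1) w 0 r) has_real_derivative Wtr r) (at r within {1..})"
    and cWtr: "continuous_on {1..} Wtr"
  shows "\<And>r. 1 \<le> r \<Longrightarrow> (conv B (k 0) w 0 r)\<^sup>2 \<le> A\<^sup>2 * r"
    and "integral {1..X} (\<lambda>r. (Wr r)\<^sup>2) \<le> 2 * A\<^sup>2"
    and "integral {1..X} (\<lambda>r. (conv B (k 1) w 0 r)\<^sup>2) \<le> 4 * A\<^sup>2"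
proof -
  let ?W = "\<lambda>r. conv B (k 0) w 0 r" and ?V = "\<lambda>r. conv B (k 1) w 0 r"
  have ck: "continuous_on UNIV (k j)" if "j \<le> 3" for j using k that by (auto simp: kernel_def)
  have dk: "(k j has_real_derivative k (Suc j) s) (at s)" if "j < 3" for j s using k that by (auto simp: kernel_def)
  have B: "\<bar>0\<bar> + \<epsilon> \<le> B" using \<epsilon> by simp
  have cu': "continuous_on S (\<lambda>s. u s r)" if "1 \<le> r" for S r
    using that by (intro cont2_compose[OF cu] continuous_intros) auto
  have sub: "{1..R} \<subseteq> {1..}" for R :: real by auto
  have cW: "continuous_on {1..R} ?W" for R using Wr by (intro DERIV_continuous_on DERIV_subset[OF _ sub]) auto
  have cV: "continuous_on {1..R} ?V" for R using Wtr by (intro DERIV_continuous_on DERIV_subset[OF _ sub]) auto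
  have cWr: "continuous_on {1..R} Wr" for R using Wrr by (intro DERIV_continuous_on DERIV_subset[OF _ sub]) auto
  have cWrr': "continuous_on {1..R} Wrr" and cWtr': "continuous_on {1..R} Wtr" for R
    using cWrr cWtr by (auto intro: continuous_on_subset)
  have ci: "continuous_on {1..R} (\<lambda>r::real. inverse r)" for R by (intro continuous_intros) auto
  show W2: "(?W r)\<^sup>2 \<le> A\<^sup>2 * r" if r: "1 \<le> r" for r
  proof -
    have "\<bar>?W r\<bar> \<le> A * sqrt r"
      unfolding conv_def
    proof (rule kernel_average[OF k B])
      show "continuous_on {- B..B} (\<lambda>s. w s r)" using r by (intro cont2_compose[OF cw] continuous_intros) auto
      fix s assume "\<bar>s - 0\<bar> \<le> \<epsilon>"
      then have "r * (u s r)\<^sup>2 \<le> A\<^sup>2" using \<epsilon> r by (intro point) auto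
      then have "r * (r * (u s r)\<^sup>2) \<le> r * A\<^sup>2" using r by (intro mult_left_mono) auto
      then have "(w s r)\<^sup>2 \<le> (A * sqrt r)\<^sup>2" using r by (simp add: w_def power_mult_distrib power2_eq_square mult_ac)
      then show "\<bar>w s r\<bar> \<le> A * sqrt r" using A r by (simp add: abs_le_square_iff[symmetric])
    qed
    then have "\<bar>?W r\<bar>\<^sup>2 \<le> (A * sqrt r)\<^sup>2" by (intro power_mono) auto
    then show ?thesis using r by (simp add: power_mult_distrib)
  qed
  text \<open>Testing against \<open>m = r\<^sup>2 U\<^sub>r\<close> itself bounds \<open>U\<^sub>r\<close>, for \<open>U = W/r\<close>, by duality.\<close>
  define m where "m r = r * Wr r - ?W r" for r
  have dm: "(m has_real_derivative r * Wrr r) (at r within {1..X})" if "r \<in> {1..X}" for r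
    unfolding m_def using that DERIV_subset[OF Wr sub, of r X] DERIV_subset[OF Wrr sub, of r X]
    by (auto intro!: derivative_eq_intros)
  have cm: "continuous_on {1..X} m" by (rule DERIV_continuous_on[OF dm])
  define U where "U r = inverse r * ?W r" for r
  have dU: "(U has_real_derivative m r * inverse r ^ 2) (at r within {1..X})" if "r \<in> {1..X}" for r
    unfolding U_def m_def using that DERIV_subset[OF Wr sub, of r X]
    by (auto intro!: derivative_eq_intros simp: field_simps power2_eq_square)
  have cU: "continuous_on {1..X} U" by (rule DERIV_continuous_on[OF dU])
  let ?Q = "integral {1..X} (\<lambda>r. (m r * inverse r)\<^sup>2)"
  have "((\<lambda>r. (m r * inverse r)\<^sup>2 + r * Wrr r * U r) has_integral U X * m X - U 1 * m 1) {1..X}"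
  proof (rule FTC_within[where S = "{1..X}"])
    fix r assume r: "r \<in> {1..X}"
    show "((\<lambda>r. U r * m r) has_real_derivative (m r * inverse r)\<^sup>2 + r * Wrr r * U r) (at r within {1..X})"
      by (auto intro!: derivative_eq_intros dU[OF r] dm[OF r] simp: power2_eq_square algebra_simps)
  qed (use X in auto)
  from integral_unique[OF this]
  have "integral {1..X} (\<lambda>r. (m r * inverse r)\<^sup>2 + r * Wrr r * U r) = U X * m X - U 1 * m 1" .
  moreover have "integral {1..X} (\<lambda>r. (m r * inverse r)\<^sup>2 + r * Wrr r * U r) = ?Q + integral {1..X} (\<lambda>r. r * Wrr r * U r)"
    by (intro integral_add integrable_continuous_real continuous_intros cm ci cWrr' cU)
  ultimately have Q: "?Q = U X * m X - U 1 * m 1 - integral {1..X} (\<lambda>r. r * Wrr r * U r)" by simp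
  have U_conv: "U r = conv B (k 0) u 0 r" if "1 \<le> r" for r
    using that by (simp add: U_def conv_def w_def flip: integral_mult_right) (simp add: field_simps)
  have "?Q = integral {-B..B} (\<lambda>s. k 0 (0 - s) * (u s X * m X - u s 1 * m 1 - integral {1..X} (\<lambda>r. r * Wrr r * u s r)))"
  proof -
    have cs: "continuous_on {-B..B} (\<lambda>s. k 0 (0 - s))"
      by (intro continuous_on_compose2[OF ck] continuous_intros) auto
    have cg: "continuous_on {1..X} (\<lambda>r. r * Wrr r)" by (intro continuous_intros cWrr')
    have cI: "continuous_on {-B..B} (\<lambda>s. integral {1..X} (\<lambda>r. r * Wrr r * u s r))"
    proof -
      have "continuous_on ({-B..B} \<times> cbox 1 X) (\<lambda>(s, r). r * Wrr r * u s r)"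
        unfolding split_beta' by (intro continuous_intros continuous_on_compose2[OF cWrr] cont2_compose[OF cu]) auto
      from integral_continuous_on_param[OF this] show ?thesis by simp
    qed
    have i: "(\<lambda>s. k 0 (0 - s) * (u s X * m X)) integrable_on {-B..B}" "(\<lambda>s. k 0 (0 - s) * (u s 1 * m 1)) integrable_on {-B..B}"
      "(\<lambda>s. k 0 (0 - s) * integral {1..X} (\<lambda>r. r * Wrr r * u s r)) integrable_on {-B..B}"
      using X by (intro integrable_continuous_real continuous_intros cs cI cu'; simp)+
    have "integral {-B..B} (\<lambda>s. k 0 (0 - s) * (u s X * m X)) = U X * m X" "integral {-B..B} (\<lambda>s. k 0 (0 - s) * (u s 1 * m 1)) = U 1 * m 1"
      using X by (simp_all add: U_conv conv_def mult.assoc[symmetric])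
    moreover have "integral {-B..B} (\<lambda>s. k 0 (0 - s) * integral {1..X} (\<lambda>r. r * Wrr r * u s r)) = integral {1..X} (\<lambda>r. r * Wrr r * U r)"
    proof -
      have "integral {1..X} (\<lambda>r. r * Wrr r * conv B (k 0) u 0 r) = integral {1..X} (\<lambda>r. r * Wrr r * U r)"
        by (intro integral_cong) (simp add: U_conv)
      then show ?thesis using conv_pairing[OF ck cu cg, of 0 B 0] by simp
    qed
    ultimately show ?thesis
      unfolding Q using i by (simp only: right_diff_distrib integral_diff integrable_diff)
  qed
  also have "\<dots> \<le> A * sqrt ?Q"
  proof (rule abs_le_D1, rule kernel_average[OF k B])
    have "continuous_on ({-B..B} \<times> cbox 1 X) (\<lambda>(s, r). r * Wrr r * u s r)"
      unfolding split_beta' by (intro continuous_intros continuous_on_compose2[OF cWrr] cont2_compose[OF cu]) auto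
    from integral_continuous_on_param[OF this]
    show "continuous_on {- B..B} (\<lambda>s. u s X * m X - u s 1 * m 1 - integral {1..X} (\<lambda>r. r * Wrr r * u s r))"
      using X by (intro continuous_intros cu') auto
    fix s assume "\<bar>s - 0\<bar> \<le> \<epsilon>"
    then show "\<bar>u s X * m X - u s 1 * m 1 - integral {1..X} (\<lambda>r. r * Wrr r * u s r)\<bar> \<le> A * sqrt ?Q"
      using \<epsilon> X by (intro space[where m' = "\<lambda>r. r * Wrr r"] dm continuous_intros cWrr') auto
  qed
  finally have Q_le: "?Q \<le> A\<^sup>2"
    using A by (intro le_mult_sqrt_imp_le_power2[of ?Q A ?Q]) (auto intro!: integral_nonneg integrable_continuous_real continuous_intros cm ci)
  show "integral {1..X} (\<lambda>r. (Wr r)\<^sup>2) \<le> 2 * A\<^sup>2"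
  proof -
    \<comment> \<open>\<open>Wr^2\<close> differs from \<open>(m / r)^2\<close> by the exact
      derivative of \<open>W^2 / r\<close>, whose value at \<open>X\<close> is at most
      \<open>A^2\<close> by the first claim.\<close>
    have "((\<lambda>r. (Wr r)\<^sup>2 - (m r * inverse r)\<^sup>2) has_integral (?W X)\<^sup>2 * inverse X - (?W 1)\<^sup>2 * inverse 1) {1..X}"
    proof (rule FTC_within[where S = "{1..X}"])
      fix r assume r: "r \<in> {1..X}"
      show "((\<lambda>r. (?W r)\<^sup>2 * inverse r) has_real_derivative (Wr r)\<^sup>2 - (m r * inverse r)\<^sup>2) (at r within {1..X})"
        using r DERIV_subset[OF Wr sub, of r X]
        by (auto intro!: derivative_eq_intros simp: m_def field_simps power2_eq_square)
    qed (use X in auto)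
    from integral_unique[OF this]
    have "integral {1..X} (\<lambda>r. (Wr r)\<^sup>2 - (m r * inverse r)\<^sup>2) = (?W X)\<^sup>2 * inverse X - (?W 1)\<^sup>2" by simp
    moreover have "integral {1..X} (\<lambda>r. (Wr r)\<^sup>2 - (m r * inverse r)\<^sup>2) = integral {1..X} (\<lambda>r. (Wr r)\<^sup>2) - ?Q"
      by (intro integral_diff integrable_continuous_real continuous_intros cm ci cWr)
    moreover have "(?W X)\<^sup>2 * inverse X \<le> A\<^sup>2"
      using W2[of X] X by (simp add: field_simps)
    moreover have "0 \<le> (?W 1)\<^sup>2" by simp
    ultimately show ?thesis using Q_le by linarith
  qed
  show "integral {1..X} (\<lambda>r. (?V r)\<^sup>2) \<le> 4 * A\<^sup>2"
  proof -
    \<comment> \<open>The cutoff vanishes to second order at \<open>R = 2 * X\<close>, because the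
      test function must vanish there with its derivative. On \<open>{1..X}\<close> it is at least
      1/4, whence the final factor 4.\<close>
    define R where "R = 2 * X"
    have R: "R > 1" "X \<le> R" using X by (auto simp: R_def)
    define cut where "cut r = (1 - r / R)\<^sup>2" for r
    define cut1 where "cut1 r = - ((2 - 2 * r / R) / R)" for r
    have dcut: "(cut has_real_derivative cut1 r) (at r within S)" for r S
      unfolding cut_def cut1_def using R by (auto intro!: derivative_eq_intros)
    have ccut: "continuous_on S cut" "continuous_on S cut1" for S
      unfolding cut_def cut1_def using R by (auto intro!: continuous_intros)
    \<comment> \<open>With this choice the pairing becomes the integral of \<open>cut * V^2\<close>,
      where \<open>V\<close> is the mollified time derivative, and \<open>(r * \<zeta>)^2\<close> is
      at most the same integrand since \<open>cut \<le> 1\<close>.\<close>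
    define \<zeta> where "\<zeta> r = cut r * inverse r * ?V r" for r
    define \<zeta>1 where "\<zeta>1 r = cut1 r * inverse r * ?V r - cut r * inverse r ^ 2 * ?V r + cut r * inverse r * Wtr r" for r
    have d\<zeta>: "(\<zeta> has_real_derivative \<zeta>1 r) (at r within {1..R})" if "r \<in> {1..R}" for r
      unfolding \<zeta>_def \<zeta>1_def using that DERIV_subset[OF Wtr sub, of r R]
      by (auto intro!: derivative_eq_intros dcut simp: power2_eq_square algebra_simps)
    have c\<zeta>1: "continuous_on {1..R} \<zeta>1"
      unfolding \<zeta>1_def by (intro continuous_intros ccut ci cV cWtr')
    have c\<zeta>: "continuous_on {1..R} (\<lambda>r. r * \<zeta> r)"
      by (intro continuous_intros DERIV_continuous_on[OF d\<zeta>])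
    have T: "\<bar>integral {-B..B} (\<lambda>s. - k 1 (0 - s) * integral {1..R} (\<lambda>r. r * \<zeta> r * (r * u s r)))\<bar> \<le> A * sqrt (integral {1..R} (\<lambda>r. (r * \<zeta> r)\<^sup>2))"
    proof (rule time[OF \<epsilon> R(1) _ _ _ _ _ d\<zeta> c\<zeta>1])
      fix s
      have "((\<lambda>s. 0 - s) has_real_derivative - 1) (at s)" by (auto intro!: derivative_eq_intros)
      from DERIV_chain2[OF dk this, of 0] show "((\<lambda>s. k 0 (0 - s)) has_real_derivative - k 1 (0 - s)) (at s)" by simp
      show "continuous_on UNIV (\<lambda>s. - k 1 (0 - s))"
        by (intro continuous_intros continuous_on_compose2[OF ck]) auto
      show "0 \<le> k 0 (0 - s)" using k by (auto simp: kernel_def)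
      show "k 0 (0 - s) = 0 \<and> - k 1 (0 - s) = 0" if "\<epsilon> \<le> \<bar>s\<bar>"
        using k that by (auto simp: kernel_def)
      show "integral {- B..B} (\<lambda>s. k 0 (0 - s)) = 1" by (rule kernel_mass[OF k B])
      show "\<zeta> R = 0" "\<zeta>1 R = 0" using R by (auto simp: \<zeta>_def \<zeta>1_def cut_def cut1_def)
    qed
    let ?P = "integral {1..R} (\<lambda>r. (r * \<zeta> r)\<^sup>2)" and ?Z = "integral {1..R} (\<lambda>r. cut r * (?V r)\<^sup>2)"
    have "integral {-B..B} (\<lambda>s. - k 1 (0 - s) * integral {1..R} (\<lambda>r. r * \<zeta> r * (r * u s r)))
        = - integral {-B..B} (\<lambda>s. k 1 (0 - s) * integral {1..R} (\<lambda>r. r * \<zeta> r * w s r))"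
      by (simp add: w_def)
    also have "\<dots> = - integral {1..R} (\<lambda>r. r * \<zeta> r * ?V r)"
      by (subst conv_pairing[OF ck cw c\<zeta>]) auto
    also have "integral {1..R} (\<lambda>r. r * \<zeta> r * ?V r) = ?Z"
      by (intro integral_cong) (auto simp: \<zeta>_def power2_eq_square)
    finally have Z: "?Z \<le> A * sqrt ?P" using T by simp
    have cut01: "0 \<le> cut r" "cut r \<le> 1" if "r \<in> {1..R}" for r
      using that R by (auto simp: cut_def power_le_one)
    have PZ: "?P \<le> ?Z"
    proof (rule integral_le)
      show "(\<lambda>r. (r * \<zeta> r)\<^sup>2) integrable_on {1..R}" "(\<lambda>r. cut r * (?V r)\<^sup>2) integrable_on {1..R}"
        by (intro integrable_continuous_real continuous_intros c\<zeta> ccut cV)+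
      fix r assume r: "r \<in> {1..R}"
      then have "(r * \<zeta> r)\<^sup>2 = cut r * (cut r * (?V r)\<^sup>2)" by (simp add: \<zeta>_def power2_eq_square)
      also have "\<dots> \<le> 1 * (cut r * (?V r)\<^sup>2)" using cut01[OF r] by (intro mult_right_mono) auto
      finally show "(r * \<zeta> r)\<^sup>2 \<le> cut r * (?V r)\<^sup>2" by simp
    qed
    have "?Z \<le> A\<^sup>2"
      using A by (intro le_mult_sqrt_imp_le_power2[OF Z PZ]) (auto intro!: integral_nonneg integrable_continuous_real continuous_intros c\<zeta>)
    moreover have "integral {1..X} (\<lambda>r. (?V r)\<^sup>2) \<le> integral {1..X} (\<lambda>r. 4 * (cut r * (?V r)\<^sup>2))"
    proof (rule integral_le)
      show "(\<lambda>r. (?V r)\<^sup>2) integrable_on {1..X}" "(\<lambda>r. 4 * (cut r * (?V r)\<^sup>2)) integrable_on {1..X}"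
        by (intro integrable_continuous_real continuous_intros ccut cV)+
      fix r assume r: "r \<in> {1..X}"
      then have "1 / 2 \<le> 1 - r / R" using X by (simp add: R_def field_simps)
      then have "(1 / 2)\<^sup>2 \<le> cut r" unfolding cut_def by (intro power_mono) auto
      then have "1 * (?V r)\<^sup>2 \<le> (4 * cut r) * (?V r)\<^sup>2" by (intro mult_right_mono) (auto simp: power2_eq_square)
      then show "(?V r)\<^sup>2 \<le> 4 * (cut r * (?V r)\<^sup>2)" by simp
    qed
    moreover have "integral {1..X} (\<lambda>r. cut r * (?V r)\<^sup>2) \<le> ?Z"
      using R X cut01 by (intro integral_subset_le integrable_continuous_real continuous_intros ccut cV) auto
    ultimately show ?thesis by simp
  qed
qed

text \<open>The second \<open>r\<close>-derivative is not computed but prescribed: \<open>H\<close>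
  is what the mollified equation says it is, and \<open>Wr\<close> is its primitive with the Robin
  value at \<open>r = 1\<close>. The defect of the nonlinear equation is the difference between the
  mollified fifth power and the fifth power of \<open>W\<close>; half of \<open>\<delta>^2\<close>
  is spent on each of the two comparisons with \<open>F\<close>.\<close>

lemma approximation:
  assumes X: "X \<ge> 2" and \<delta>: "0 < \<delta>" "\<delta> * X\<^sup>2 \<le> 1" and \<eta>: "\<eta> > 0"
  shows "\<exists>W Wt Wr Wtt Wtr Wrr. approx_wave W Wt Wr Wtt Wtr Wrr X \<delta> C0 \<and>
     (\<forall>t r. 0 \<le> t \<longrightarrow> t \<le> X \<longrightarrow> 1 \<le> r \<longrightarrow> r \<le> X \<longrightarrow> \<bar>W t r - r * u t r\<bar> \<le> \<eta>)"
proof -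
  have X1: "X \<ge> 1" "X > 1" using X by auto
  let ?K = "cbox (0, 1) (X, X) :: (real \<times> real) set"
  have "continuous_on ?K (\<lambda>z. w (fst z) (snd z))"
    by (intro cont2_compose[OF cw] continuous_intros) (auto simp: cbox_Pair_eq)
  then have "bounded ((\<lambda>z. w (fst z) (snd z)) ` ?K)"
    by (intro compact_imp_bounded compact_continuous_image compact_cbox)
  then obtain M0 where M0: "\<And>z. z \<in> ?K \<Longrightarrow> \<bar>w (fst z) (snd z)\<bar> \<le> M0" unfolding bounded_iff by auto
  \<comment> \<open>One unit of room beyond the maximum of \<open>\<bar>w\<bar>\<close> on the box,
    since \<open>W\<close> stays within \<open>\<eta>' \<le> 1\<close> of \<open>w\<close>.\<close>
  define M where "M = M0 + 1"
  have M: "\<bar>w t r\<bar> \<le> M0" if "0 \<le> t" "t \<le> X" "1 \<le> r" "r \<le> X" for t r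
    using M0[of "(t, r)"] that by (auto simp: cbox_Pair_eq)
  obtain d5 where d5: "d5 > 0" "\<And>a b. \<bar>a\<bar> \<le> M \<Longrightarrow> \<bar>b\<bar> \<le> M \<Longrightarrow> \<bar>a - b\<bar> \<le> d5 \<Longrightarrow> \<bar>a ^ 5 - b ^ 5\<bar> \<le> \<delta>\<^sup>2 / 2"
    using power_uniformly_close[of "\<delta>\<^sup>2 / 2" M 5] \<delta> by auto
  \<comment> \<open>The tolerance \<open>1 / X\<close> integrates over \<open>{1..X}\<close> to at
    most 1, which is the 1 in \<open>C0\<close>.\<close>
  obtain d6 where d6: "d6 > 0" "\<And>a b. \<bar>a\<bar> \<le> M \<Longrightarrow> \<bar>b\<bar> \<le> M \<Longrightarrow> \<bar>a - b\<bar> \<le> d6 \<Longrightarrow> \<bar>a ^ 6 - b ^ 6\<bar> \<le> 1 / X"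
    using power_uniformly_close[of "1 / X" M 6] X by auto
  define \<eta>' where "\<eta>' = min (min \<eta> 1) (min d5 d6)"
  have \<eta>': "\<eta>' > 0" using \<eta> d5 d6 by (simp add: \<eta>'_def)
  obtain e1 where e1: "e1 > 0" "\<And>\<epsilon> k B t r. kernel \<epsilon> k \<Longrightarrow> \<epsilon> \<le> e1 \<Longrightarrow> \<bar>t\<bar> \<le> X \<Longrightarrow> 1 \<le> r \<Longrightarrow> r \<le> X \<Longrightarrow> X + \<epsilon> \<le> B \<Longrightarrow>
     \<bar>conv B (k 0) w t r - w t r\<bar> \<le> \<eta>'"
    using conv_close[OF cw X1(1) \<eta>'] by blast
  obtain e2 where e2: "e2 > 0" "\<And>\<epsilon> k B t r. kernel \<epsilon> k \<Longrightarrow> \<epsilon> \<le> e2 \<Longrightarrow> \<bar>t\<bar> \<le> X \<Longrightarrow> 1 \<le> r \<Longrightarrow> r \<le> X \<Longrightarrow> X + \<epsilon> \<le> B \<Longrightarrow>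
     \<bar>conv B (k 0) F t r - F t r\<bar> \<le> \<delta>\<^sup>2 / 2"
    using conv_close[OF cF X1(1), of "\<delta>\<^sup>2 / 2"] \<delta> by auto
  define \<epsilon> where "\<epsilon> = min \<epsilon>0 (min e1 e2)"
  have \<epsilon>: "0 < \<epsilon>" "\<epsilon> \<le> \<epsilon>0" "\<epsilon> \<le> e1" "\<epsilon> \<le> e2" using \<epsilon>0 e1(1) e2(1) by (auto simp: \<epsilon>_def)
  obtain k where k: "kernel \<epsilon> k" using kernel_exists[OF \<epsilon>(1)] by blast
  define B where "B = X + \<epsilon>"
  have ck: "continuous_on UNIV (k j)" if "j \<le> 3" for j using k that by (auto simp: kernel_def)
  have dk: "(k j has_real_derivative k (Suc j) s) (at s)" if "j < 3" for j s using k that by (auto simp: kernel_def)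
  have c2: "cont2 (conv B (k j) f)" if "j \<le> 3" "cont2 f" for j f using conv_cont2[OF ck[OF that(1)] that(2)] .
  define W where "W = conv B (k 0) w"
  define Wt where "Wt = conv B (k 1) w"
  define Wtt where "Wtt = conv B (k 2) w"
  \<comment> \<open>\<open>H\<close> will be the second \<open>r\<close>-derivative of
    \<open>W\<close>, and \<open>H1\<close> is its time derivative; their primitives give
    \<open>Wr\<close> and the mixed derivative.\<close>
  define H where "H t r = conv B (k 2) w t r + conv B (k 0) F t r" for t r
  define H1 where "H1 t r = conv B (k 3) w t r + conv B (k 1) F t r" for t r
  define Wr where "Wr t r = W t 1 + integral {1..r} (\<lambda>y. H t y)" for t r
  define Wtr where "Wtr t r = Wt t 1 + integral {1..r} (\<lambda>y. H1 t y)" for t r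
  have cH: "cont2 H" "cont2 H1"
    using c2[OF _ cw, of 2] c2[OF _ cw, of 3] c2[OF _ cF, of 0] c2[OF _ cF, of 1]
    unfolding H_def[abs_def] H1_def[abs_def] cont2_def by (auto intro!: continuous_on_add)
  have cH': "continuous_on {1..} (H t)" "continuous_on {1..} (H1 t)" for t
    by (intro cont2_compose[OF cH(1)] cont2_compose[OF cH(2)] continuous_intros; simp)+
  have cW: "cont2 W" "cont2 Wt" "cont2 Wtt"
    unfolding W_def Wt_def Wtt_def using c2[OF _ cw] by auto
  have c1: "continuous_on (UNIV \<times> {1..}) (\<lambda>z. f (fst z) 1)" if "cont2 f" for f :: "real \<Rightarrow> real \<Rightarrow> real"
    by (intro cont2_compose[OF that] continuous_intros) auto
  have cWr: "cont2 Wr" "cont2 Wtr"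
    using cont2_integral[OF cH(1)] cont2_integral[OF cH(2)] c1[OF cW(1)] c1[OF cW(2)]
    unfolding Wr_def[abs_def] Wtr_def[abs_def] cont2_def by (auto intro!: continuous_on_add)
  have tB: "\<bar>t\<bar> + \<epsilon> \<le> B" if "0 \<le> t" "t \<le> X" for t using that by (simp add: B_def)
  have W_repr: "W t r = r * W t 1 + integral {1..r} (\<lambda>y. (r - y) * H t y)"
    and Wt_repr: "Wt t r = r * Wt t 1 + integral {1..r} (\<lambda>y. (r - y) * H1 t y)" if "0 \<le> t" "t \<le> X" "1 \<le> r" for t r
    using kernel_representation[OF k tB[OF that(1,2)] _ that(3), of 0] kernel_representation[OF k tB[OF that(1,2)] _ that(3), of 1]
    unfolding W_def Wt_def H_def H1_def by (simp_all add: numeral_3_eq_3 numeral_2_eq_2)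
  have W_r: "((\<lambda>r. W t r) has_real_derivative Wr t r) (at r within {1..})"
    and Wt_r: "((\<lambda>r. Wt t r) has_real_derivative Wtr t r) (at r within {1..})" if "0 \<le> t" "t \<le> X" "1 \<le> r" for t r
  proof -
    show "((\<lambda>r. W t r) has_real_derivative Wr t r) (at r within {1..})"
      unfolding Wr_def
    proof (rule has_field_derivative_transform_within[OF second_antiderivative[OF cH'(1) that(3)] zero_less_one])
      fix x :: real assume "x \<in> {1..}"
      then show "x * W t 1 + integral {1..x} (\<lambda>y. (x - y) * H t y) = W t x"
        using W_repr[OF that(1,2), of x] by simp
    qed (use that in simp)
    show "((\<lambda>r. Wt t r) has_real_derivative Wtr t r) (at r within {1..})"
      unfolding Wtr_def
    proof (rule has_field_derivative_transform_within[OF second_antiderivative[OF cH'(2) that(3)] zero_less_one])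
      fix x :: real assume "x \<in> {1..}"
      then show "x * Wt t 1 + integral {1..x} (\<lambda>y. (x - y) * H1 t y) = Wt t x"
        using Wt_repr[OF that(1,2), of x] by simp
    qed (use that in simp)
  qed
  have Wr_r: "((\<lambda>r. Wr t r) has_real_derivative H t r) (at r within {1..})" if "1 \<le> r" for t r
    unfolding Wr_def using that integral_has_derivative_ge[OF cH'(1), of r t] by (auto intro!: derivative_eq_intros)
  have W_t: "((\<lambda>t. W t r) has_real_derivative Wt t r) (at t within S)"
    and Wt_t: "((\<lambda>t. Wt t r) has_real_derivative Wtt t r) (at t within S)" if "1 \<le> r" for t r S
    unfolding W_def Wt_def Wtt_def using dk[of 0] dk[of 1] that
    by (auto intro!: conv_t ck cw simp: numeral_2_eq_2)
  have H_t: "((\<lambda>t. H t r) has_real_derivative H1 t r) (at t within S)" if "1 \<le> r" for t r S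
    unfolding H_def H1_def using dk[of 0] dk[of 2] that
    by (intro DERIV_add conv_t ck cw cF) (auto simp: numeral_3_eq_3)
  \<comment> \<open>Differentiation under the integral sign identifies the time derivative of
    \<open>Wr\<close> with the \<open>r\<close>-derivative of \<open>Wt\<close>, both being
    \<open>Wtr\<close>.\<close>
  have Wr_t: "((\<lambda>t. Wr t r) has_real_derivative Wtr t r) (at t within {0..X})" if "1 \<le> r" for t r
  proof -
    have "((\<lambda>t. integral (cbox 1 r) (H t)) has_real_derivative integral (cbox 1 r) (H1 t)) (at t within UNIV)"
    proof (rule leibniz_rule_field_derivative)
      show "((\<lambda>t. H t y) has_real_derivative H1 t y) (at t within UNIV)" if "y \<in> cbox 1 r" for t y
        using that by (intro H_t) auto
      show "H t integrable_on cbox 1 r" for t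
        by (intro integrable_continuous continuous_on_subset[OF cH'(1)]) auto
      show "continuous_on (UNIV \<times> cbox 1 r) (\<lambda>(t, y). H1 t y)"
        unfolding split_beta' by (intro cont2_compose[OF cH(2)] continuous_intros) auto
    qed auto
    then have "((\<lambda>t. integral {1..r} (H t)) has_real_derivative integral {1..r} (H1 t)) (at t within {0..X})"
      by (auto intro: DERIV_subset)
    then show ?thesis unfolding Wr_def Wtr_def by (intro DERIV_add W_t) auto
  qed
  have close: "\<bar>W t r - w t r\<bar> \<le> \<eta>'" if "0 \<le> t" "t \<le> X" "1 \<le> r" "r \<le> X" for t r
    unfolding W_def using that \<epsilon> by (intro e1(2)[OF k]) (auto simp: B_def)
  have WM: "\<bar>W t r\<bar> \<le> M" "\<bar>w t r\<bar> \<le> M" if "0 \<le> t" "t \<le> X" "1 \<le> r" "r \<le> X" for t r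
    using close[OF that] M[OF that] by (auto simp: M_def \<eta>'_def)
  have "approx_wave W Wt Wr Wtt Wtr H X \<delta> C0"
  proof unfold_locales
    show "cont2 W" "cont2 Wt" "cont2 Wr" "cont2 Wtt" "cont2 Wtr" "cont2 H" by (fact cW cWr cH)+
    show "Wr t 1 = W t 1" for t by (simp add: Wr_def)
    show "2 \<le> X" "0 < \<delta>" "\<delta> * X\<^sup>2 \<le> 1" by (fact X \<delta>)+
    fix t r :: real assume tr: "0 \<le> t" "1 \<le> r" "t + r \<le> X"
    then have tr': "0 \<le> t" "t \<le> X" "1 \<le> r" "r \<le> X" by auto
    have "inverse r \<le> 1" using tr by (auto simp: inverse_le_1_iff)
    then have i: "0 \<le> inverse r ^ 4" "inverse r ^ 4 \<le> 1" using tr by (simp, intro power_le_one) auto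
    have "\<bar>(W t r) ^ 5 - (w t r) ^ 5\<bar> \<le> \<delta>\<^sup>2 / 2"
      using close[OF tr'] by (intro d5(2) WM tr') (auto simp: \<eta>'_def)
    then have "\<bar>(W t r) ^ 5 - (w t r) ^ 5\<bar> * inverse r ^ 4 \<le> \<delta>\<^sup>2 / 2 * 1"
      using i by (intro mult_mono) auto
    then have 1: "\<bar>(W t r) ^ 5 * inverse r ^ 4 - F t r\<bar> \<le> \<delta>\<^sup>2 / 2"
      using i by (simp add: F_def abs_mult flip: left_diff_distrib)
    have 2: "\<bar>conv B (k 0) F t r - F t r\<bar> \<le> \<delta>\<^sup>2 / 2"
      using tr' \<epsilon> by (intro e2(2)[OF k]) (auto simp: B_def)
    have "Wtt t r - H t r = - conv B (k 0) F t r" by (simp add: Wtt_def H_def)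
    then show "\<bar>Wtt t r - H t r + W t r ^ 5 * inverse r ^ 4\<bar> \<le> \<delta>\<^sup>2" using 1 2 by linarith
  next
    have eB: "\<epsilon> \<le> B" using X1 by (simp add: B_def)
    have c0: "continuous_on {1..} (\<lambda>r. Wtr 0 r)" by (intro cont2_compose[OF cWr(2)] continuous_intros) auto
    note sib = smooth_initial_bounds[OF k \<epsilon>(1,2) eB X1(2), of "Wr 0" "H 0" "Wtr 0", folded W_def Wt_def]
    have b: "\<And>r. 1 \<le> r \<Longrightarrow> (W 0 r)\<^sup>2 \<le> A\<^sup>2 * r" "integral {1..X} (\<lambda>r. (Wr 0 r)\<^sup>2) \<le> 2 * A\<^sup>2"
      "integral {1..X} (\<lambda>r. (Wt 0 r)\<^sup>2) \<le> 4 * A\<^sup>2"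
      using X by (intro sib W_r Wr_r Wt_r cH' c0; simp)+
    have cc: "continuous_on {1..X} (\<lambda>r. W 0 r)" "continuous_on {1..X} (\<lambda>r. Wt 0 r)" "continuous_on {1..X} (\<lambda>r. Wr 0 r)"
       "continuous_on {1..X} (\<lambda>r. u 0 r)"
      by (intro cont2_compose[OF cW(1)] cont2_compose[OF cW(2)] cont2_compose[OF cWr(1)] cont2_compose[OF cu] continuous_intros; simp)+
    have ci: "continuous_on {1..X} (\<lambda>r::real. inverse r)" by (intro continuous_intros) auto
    have six': "integral {1..X} (\<lambda>r. (W 0 r) ^ 6 * inverse r ^ 4) \<le> L + 1"
    proof -
      have "integral {1..X} (\<lambda>r. (W 0 r) ^ 6 * inverse r ^ 4) \<le> integral {1..X} (\<lambda>r. (u 0 r) ^ 6 * r\<^sup>2 + 1 / X)"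
      proof (rule integral_le)
        show "(\<lambda>r. (W 0 r) ^ 6 * inverse r ^ 4) integrable_on {1..X}" "(\<lambda>r. (u 0 r) ^ 6 * r\<^sup>2 + 1 / X) integrable_on {1..X}"
          by (intro integrable_continuous_real continuous_intros cc ci)+
        fix r assume r: "r \<in> {1..X}"
        have "inverse r \<le> 1" using r by (auto simp: inverse_le_1_iff)
    then have i: "0 \<le> inverse r ^ 4" "inverse r ^ 4 \<le> 1" using r by (simp, intro power_le_one) auto
        have "\<bar>(W 0 r) ^ 6 - (w 0 r) ^ 6\<bar> \<le> 1 / X"
          using close[of 0 r] r X by (intro d6(2) WM) (auto simp: \<eta>'_def)
        then have "(W 0 r) ^ 6 \<le> (w 0 r) ^ 6 + 1 / X" by linarith
        then have "(W 0 r) ^ 6 * inverse r ^ 4 \<le> ((w 0 r) ^ 6 + 1 / X) * inverse r ^ 4"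
          using i by (intro mult_right_mono) auto
        also have "\<dots> \<le> (w 0 r) ^ 6 * inverse r ^ 4 + 1 / X"
          using i X mult_left_mono[OF i(2), of "1 / X"] by (simp add: distrib_right)
        also have "(w 0 r) ^ 6 * inverse r ^ 4 = (u 0 r) ^ 6 * r\<^sup>2"
          using r by (simp add: w_def power_mult_distrib field_simps eval_nat_numeral)
        finally show "(W 0 r) ^ 6 * inverse r ^ 4 \<le> (u 0 r) ^ 6 * r\<^sup>2 + 1 / X" .
      qed
      also have "\<dots> = integral {1..X} (\<lambda>r. (u 0 r) ^ 6 * r\<^sup>2) + integral {1..X} (\<lambda>r. 1 / X)"
        by (intro integral_add integrable_continuous_real continuous_intros cc)
      also have "integral {1..X} (\<lambda>r. 1 / X) \<le> 1" using X by (simp add: field_simps)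
      finally show ?thesis using six[OF X1(1)] by simp
    qed
    have "integral {1..X} (\<lambda>r. ((Wt 0 r)\<^sup>2 + (Wr 0 r)\<^sup>2) / 2 + (W 0 r) ^ 6 * inverse r ^ 4 / 6)
      = integral {1..X} (\<lambda>r. 1 / 2 * (Wt 0 r)\<^sup>2 + 1 / 2 * (Wr 0 r)\<^sup>2 + 1 / 6 * ((W 0 r) ^ 6 * inverse r ^ 4))"
      by (intro integral_cong) (simp add: add_divide_distrib)
    also have "\<dots> = integral {1..X} (\<lambda>r. 1 / 2 * (Wt 0 r)\<^sup>2 + 1 / 2 * (Wr 0 r)\<^sup>2) + integral {1..X} (\<lambda>r. 1 / 6 * ((W 0 r) ^ 6 * inverse r ^ 4))"
      by (intro integral_add integrable_continuous_real continuous_intros cc ci)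
    also have "integral {1..X} (\<lambda>r. 1 / 2 * (Wt 0 r)\<^sup>2 + 1 / 2 * (Wr 0 r)\<^sup>2) = integral {1..X} (\<lambda>r. 1 / 2 * (Wt 0 r)\<^sup>2) + integral {1..X} (\<lambda>r. 1 / 2 * (Wr 0 r)\<^sup>2)"
      by (intro integral_add integrable_continuous_real continuous_intros cc ci)
    finally have "integral {1..X} (\<lambda>r. ((Wt 0 r)\<^sup>2 + (Wr 0 r)\<^sup>2) / 2 + (W 0 r) ^ 6 * inverse r ^ 4 / 6)
      \<le> 3 * A\<^sup>2 + (L + 1) / 6" using b(2,3) six' by (simp add: add_divide_distrib)
    moreover have "(W 0 1)\<^sup>2 \<le> A\<^sup>2" using b(1)[of 1] by simp
    ultimately show "(W 0 1)\<^sup>2 / 2 + integral {1..X} (\<lambda>r. ((Wt 0 r)\<^sup>2 + (Wr 0 r)\<^sup>2) / 2 + (W 0 r) ^ 6 * inverse r ^ 4 / 6) \<le> C0"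
      unfolding C0_def by linarith
  qed (intro W_t Wt_t Wr_t W_r Wt_r Wr_r; assumption)+
  moreover have "\<bar>W t r - r * u t r\<bar> \<le> \<eta>" if "0 \<le> t" "t \<le> X" "1 \<le> r" "r \<le> X" for t r
    using close[OF that] by (simp add: w_def \<eta>'_def)
  ultimately show ?thesis by blast
qed

end

section \<open>Radial functions of finite energy\<close>

text \<open>A derivative in the sense of \<open>radial_deriv\<close> is measurable for the completed
  measure only. Passing to the completion does not change the value and restores the rules of
  integration for such functions.\<close>

lemma rint_lebesgue: "rint h = (\<integral>\<^sup>+ r. ennreal (4 * pi * r\<^sup>2 * h r) * indicator {1..} r \<partial>lebesgue)"
  unfolding rint_def nn_integral_completion ..

lemma rint_cong_AE:
  assumes "AE r in lborel. 1 \<le> r \<longrightarrow> h r = h' r"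
  shows "rint h = rint h'"
  unfolding rint_def using assms by (intro nn_integral_cong_AE) (auto simp: indicator_def)

definition lmeas :: "rfun \<Rightarrow> bool" where
  "lmeas a \<longleftrightarrow> (\<lambda>r. indicator {1..} r * a r) \<in> borel_measurable lebesgue"

lemma lmeas_mult: "lmeas a \<Longrightarrow> lmeas b \<Longrightarrow> lmeas (\<lambda>r. a r * b r)"
proof -
  assume l: "lmeas a" "lmeas b"
  have "(\<lambda>r. (indicator {1..} r * a r) * (indicator {1..} r * b r)) \<in> borel_measurable lebesgue"
    by (rule borel_measurable_times[OF l[unfolded lmeas_def]])
  also have "(\<lambda>r. (indicator {1..} r * a r) * (indicator {1..} r * b r)) = (\<lambda>r. indicator {1..} r * (a r * b r))"
    by (auto simp: fun_eq_iff indicator_def)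
  finally show ?thesis by (simp add: lmeas_def)
qed

lemma lmeas_diff: "lmeas a \<Longrightarrow> lmeas b \<Longrightarrow> lmeas (\<lambda>r. a r - b r)"
  unfolding lmeas_def right_diff_distrib by (intro borel_measurable_diff)

lemma lmeas_borel: "a \<in> borel_measurable lborel \<Longrightarrow> lmeas a"
  unfolding lmeas_def by (intro borel_measurable_times measurable_completion) auto

lemma lmeas_continuous:
  assumes "continuous_on {1..} a"
  shows "lmeas a"
proof -
  have "(\<lambda>r. indicator {1..} r *\<^sub>R a r) \<in> borel_measurable borel"
    by (intro borel_measurable_continuous_on_indicator assms) auto
  then show ?thesis unfolding lmeas_def by (simp add: measurable_completion)
qed

lemma lmeas_radial_deriv:
  assumes "radial_deriv f f'"
  shows "lmeas f'"
  unfolding lmeas_def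
proof (rule borel_measurable_LIMSEQ_real)
  fix n :: nat
  have "(f' has_integral f (1 + real n) - f 1) {1..1 + real n}" using assms by (simp add: radial_deriv_def)
  from has_integral_implies_lebesgue_measurable[OF this]
  show "(\<lambda>r. indicator {1..1 + real n} r * f' r) \<in> borel_measurable lebesgue" by simp
next
  fix r :: real
  obtain n where n: "r \<le> real n" using real_arch_simple by blast
  have "\<forall>\<^sub>F n in sequentially. indicator {1..1 + real n} r * f' r = indicator {1..} r * f' r"
    using eventually_ge_at_top[of n] by eventually_elim (use n in \<open>auto simp: indicator_def\<close>)
  then show "(\<lambda>n. indicator {1..1 + real n} r * f' r) \<longlonglongrightarrow> indicator {1..} r * f' r"
    by (rule tendsto_eventually)
qed

lemma radial_deriv_diff: "radial_deriv f f' \<Longrightarrow> radial_deriv g g' \<Longrightarrow> radial_deriv (\<lambda>r. f r - g r) (\<lambda>r. f' r - g' r)"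
  unfolding radial_deriv_def
proof (intro allI impI)
  fix r :: real
  assume "\<forall>r\<ge>1. (f' has_integral f r - f 1) {1..r}" "\<forall>r\<ge>1. (g' has_integral g r - g 1) {1..r}" "1 \<le> r"
  then have "((\<lambda>r. f' r - g' r) has_integral (f r - f 1) - (g r - g 1)) {1..r}" by (intro has_integral_diff) auto
  then show "((\<lambda>r. f' r - g' r) has_integral f r - g r - (f 1 - g 1)) {1..r}" by (simp add: algebra_simps)
qed

lemma radial_deriv_integral:
  assumes "radial_deriv f f'" "1 \<le> a" "a \<le> b"
  shows "(f' has_integral f b - f a) {a..b}"
proof -
  have ib: "(f' has_integral f b - f 1) {1..b}" and ia: "(f' has_integral f a - f 1) {1..a}"
    using assms by (auto simp: radial_deriv_def)
  have "f' integrable_on {a..b}"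
    by (rule integrable_on_subinterval[OF has_integral_integrable[OF ib]]) (use assms in auto)
  moreover have "integral {1..a} f' + integral {a..b} f' = integral {1..b} f'"
    by (rule Henstock_Kurzweil_Integration.integral_combine[OF assms(2,3) has_integral_integrable[OF ib]])
  ultimately show ?thesis
    using integral_unique[OF ia] integral_unique[OF ib] by (simp add: has_integral_iff)
qed

text \<open>At the outset \<open>h\<close> is only Henstock-Kurzweil integrable. Its indefinite
  integral has variation 0, so it is absolutely integrable; then the positive and negative parts of
  a Borel version \<open>H\<close> are densities of measures that agree on all half-lines, hence
  everywhere, and uniqueness of densities gives \<open>H = 0\<close> almost everywhere.\<close>

lemma null_integral_AE:
  fixes h :: "real \<Rightarrow> real"
  assumes h: "\<And>r. 1 \<le> r \<Longrightarrow> (h has_integral 0) {1..r}"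
  shows "AE r in lborel. 1 \<le> r \<longrightarrow> h r = 0"
proof -
  have "AE r in lborel. 1 \<le> r \<and> r \<le> 1 + real n \<longrightarrow> h r = 0" for n :: nat
  proof -
    define b where "b = 1 + real n"
    have b: "1 \<le> b" by (simp add: b_def)
    have rd: "radial_deriv (\<lambda>_. 0) h" using h by (simp add: radial_deriv_def)
    have sub: "integral {c..d} h = 0" if "1 \<le> c" "c \<le> d" for c d
      using integral_unique[OF radial_deriv_integral[OF rd that]] by simp
    have habs: "h absolutely_integrable_on cbox 1 b"
    proof (rule bounded_variation_absolutely_integrable_interval)
      show "h integrable_on cbox 1 b" using h[OF b] by auto
      fix d assume d: "d division_of cbox 1 b"
      have "norm (integral K h) = 0" if K': "K \<in> d" for K
      proof -
        obtain x y where K: "K = cbox x y" "K \<noteq> {}" "K \<subseteq> cbox 1 b"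
          using cbox_division_memE[OF K' d] by blast
        then show ?thesis using sub[of x y] by auto
      qed
      then show "(\<Sum>K\<in>d. norm (integral K h)) \<le> 0" by (simp add: sum_nonpos)
    qed
    from habs have ih: "integrable lebesgue (\<lambda>r. indicator {1..b} r * h r)" by (simp add: set_integrable_def)
    obtain H where H: "H \<in> borel_measurable borel" and eq: "AE r in lborel. indicator {1..b} r * h r = H r"
      using completion_ex_borel_measurable_real[OF borel_measurable_integrable[OF ih]] by auto
    have eq': "AE r in lebesgue. indicator {1..b} r * h r = H r" using eq by (rule AE_completion)
    have iH: "integrable lborel H"
    proof -
      have "integrable lebesgue H"
        using ih eq' H by (subst integrable_cong_AE[where g = "\<lambda>r. indicator {1..b} r * h r"]) (auto simp: measurable_completion elim: eventually_mono)
      then show ?thesis using H by (simp add: integrable_completion)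
    qed
    have null: "(LINT r|lborel. indicator {x<..} r * H r) = 0" for x
    proof -
      define y where "y = max 1 x"
      have "(LINT r|lborel. indicator {x<..} r * H r) = (LINT r|lebesgue. indicator {x<..} r * H r)"
        using H by (intro integral_completion[symmetric]) measurable
      also have "\<dots> = (LINT r|lebesgue. indicator {x<..} r * (indicator {1..b} r * h r))"
      proof (rule integral_cong_AE)
        show "(\<lambda>r. indicator {x<..} r * H r) \<in> borel_measurable lebesgue"
          by (intro borel_measurable_times measurable_completion H[unfolded measurable_lborel2[symmetric]]) auto
        show "(\<lambda>r. indicator {x<..} r * (indicator {1..b} r * h r)) \<in> borel_measurable lebesgue"
          by (rule borel_measurable_times[OF _ borel_measurable_integrable[OF ih]]) (auto intro: measurable_completion)
        show "AE r in lebesgue. indicator {x<..} r * H r = indicator {x<..} r * (indicator {1..b} r * h r)"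
          using eq' by eventually_elim simp
      qed
      also have "\<dots> = (LINT r|lebesgue. indicator {y..b} r * h r)"
      proof (rule integral_cong_AE)
        have "AE r in lborel. r \<noteq> x" by (rule AE_lborel_singleton)
        then have "AE r in lebesgue. r \<noteq> x" by (rule AE_completion)
        then show "AE r in lebesgue. indicator {x<..} r * (indicator {1..b} r * h r) = indicator {y..b} r * h r"
          by eventually_elim (auto simp: indicator_def y_def)
        show "(\<lambda>r. indicator {x<..} r * (indicator {1..b} r * h r)) \<in> borel_measurable lebesgue"
          by (rule borel_measurable_times[OF _ borel_measurable_integrable[OF ih]]) (auto intro: measurable_completion)
        have "(\<lambda>r. indicator {y..b} r * h r) = (\<lambda>r. indicator {y..} r * (indicator {1..b} r * h r))"
          by (auto simp: fun_eq_iff indicator_def y_def)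
        moreover have "(\<lambda>r. indicator {y..} r * (indicator {1..b} r * h r)) \<in> borel_measurable lebesgue"
          by (rule borel_measurable_times[OF _ borel_measurable_integrable[OF ih]]) (auto intro: measurable_completion)
        ultimately show "(\<lambda>r. indicator {y..b} r * h r) \<in> borel_measurable lebesgue" by simp
      qed
      also have "\<dots> = 0"
      proof (cases "y \<le> b")
        case True
        have "set_integrable lebesgue {y..b} h"
          by (rule absolutely_integrable_on_subinterval[OF habs]) (auto simp: y_def)
        from set_lebesgue_integral_eq_integral(2)[OF this]
        show ?thesis using sub[of y b] True by (simp add: set_lebesgue_integral_def y_def)
      qed simp
      finally show ?thesis .
    qed
    have eqpm: "(\<integral>\<^sup>+r. ennreal (H r) * indicator {x<..} r \<partial>lborel) = (\<integral>\<^sup>+r. ennreal (- H r) * indicator {x<..} r \<partial>lborel)"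
      and fin: "(\<integral>\<^sup>+r. ennreal (H r) * indicator {x<..} r \<partial>lborel) < \<infinity>" for x
    proof -
      have inj: "a = b" if "a \<noteq> \<infinity>" "b \<noteq> \<infinity>" "enn2real a = enn2real b" for a b :: ennreal
        using that by (cases a; cases b) auto
      have i: "integrable lborel (\<lambda>r. indicator {x<..} r * H r)"
        using integrable_mult_indicator[OF _ iH, of "{x<..}"] by simp
      have p: "(\<integral>\<^sup>+r. ennreal (indicator {x<..} r * H r) \<partial>lborel) = (\<integral>\<^sup>+r. ennreal (H r) * indicator {x<..} r \<partial>lborel)"
        "(\<integral>\<^sup>+r. ennreal (- (indicator {x<..} r * H r)) \<partial>lborel) = (\<integral>\<^sup>+r. ennreal (- H r) * indicator {x<..} r \<partial>lborel)"
        by (intro nn_integral_cong; simp add: indicator_def)+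
      have f: "(\<integral>\<^sup>+r. ennreal (indicator {x<..} r * H r) \<partial>lborel) \<noteq> \<infinity>" "(\<integral>\<^sup>+r. ennreal (- (indicator {x<..} r * H r)) \<partial>lborel) \<noteq> \<infinity>"
        using i by (auto simp: real_integrable_def)
      show "(\<integral>\<^sup>+r. ennreal (H r) * indicator {x<..} r \<partial>lborel) < \<infinity>" using f(1) unfolding p by (simp add: less_top)
      have "enn2real (\<integral>\<^sup>+r. ennreal (indicator {x<..} r * H r) \<partial>lborel) = enn2real (\<integral>\<^sup>+r. ennreal (- (indicator {x<..} r * H r)) \<partial>lborel)"
        using null[of x] real_lebesgue_integral_def[OF i] by simp
      then have "(\<integral>\<^sup>+r. ennreal (indicator {x<..} r * H r) \<partial>lborel) = (\<integral>\<^sup>+r. ennreal (- (indicator {x<..} r * H r)) \<partial>lborel)"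
        by (rule inj[OF f])
      then show "(\<integral>\<^sup>+r. ennreal (H r) * indicator {x<..} r \<partial>lborel) = (\<integral>\<^sup>+r. ennreal (- H r) * indicator {x<..} r \<partial>lborel)"
        unfolding p .
    qed
    have "density lborel (\<lambda>r. ennreal (H r)) = density lborel (\<lambda>r. ennreal (- H r))"
      using eqpm fin H by (intro measure_eqI_lessThan) (simp_all add: emeasure_density)
    then have "AE r in lborel. ennreal (H r) = ennreal (- H r)"
      using H by (intro sigma_finite_measure.density_unique[OF lborel.sigma_finite_measure_axioms]) auto
    moreover have Z: "z = 0" if "ennreal z = ennreal (- z)" for z :: real
      using that by (cases z "0::real" rule: linorder_cases) (simp_all add: ennreal_neg)
    ultimately show ?thesis
      using eq
    proof eventually_elim
      case (elim r)
      then show ?case using Z[of "H r"] by (auto simp: b_def)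
    qed
  qed
  then have "AE r in lborel. \<forall>n::nat. 1 \<le> r \<and> r \<le> 1 + real n \<longrightarrow> h r = 0" by (subst AE_all_countable) blast
  then show ?thesis
  proof eventually_elim
    case (elim r)
    obtain n :: nat where "r \<le> real n" using real_arch_simple by blast
    then show ?case using elim[rule_format, of n] by auto
  qed
qed

lemma radial_deriv_AE_unique:
  assumes "radial_deriv f f1" "radial_deriv f f2"
  shows "AE r in lborel. 1 \<le> r \<longrightarrow> f1 r = f2 r"
  using null_integral_AE[of "\<lambda>r. f1 r - f2 r"] radial_deriv_diff[OF assms] by (simp add: radial_deriv_def)

text \<open>Makes the choice in \<open>Dr\<close> immaterial for the energy norm.\<close>

lemma radial_deriv_rint_unique:
  assumes "radial_deriv f f1" "radial_deriv f f2"
  shows "rint (\<lambda>r. (f1 r)\<^sup>2) = rint (\<lambda>r. (f2 r)\<^sup>2)"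
  using radial_deriv_AE_unique[OF assms] by (intro rint_cong_AE) (auto elim: eventually_mono)

lemma radial_deriv_Dr: "radial_deriv f f' \<Longrightarrow> radial_deriv f (Dr f)"
  unfolding Dr_def by (rule someI[of "radial_deriv f"])

lemma radial_deriv_continuous:
  assumes "radial_deriv f f'"
  shows "continuous_on {1..} f"
proof -
  have "continuous_on {1..b} f" for b
  proof (cases "1 \<le> b")
    case True
    then have "f' integrable_on {1..b}" using assms by (auto simp: radial_deriv_def)
    from indefinite_integral_continuous_1[OF this]
    have "continuous_on {1..b} (\<lambda>x. f 1 + integral {1..x} f')" by (intro continuous_intros)
    moreover have "f 1 + integral {1..x} f' = f x" if "x \<in> {1..b}" for x
      using assms that integral_unique[of f' "f x - f 1" "{1..x}"] by (auto simp: radial_deriv_def)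
    ultimately show ?thesis
      using continuous_on_cong[of "{1..b}" "{1..b}" "\<lambda>x. f 1 + integral {1..x} f'" f] by simp
  qed simp
  then show ?thesis
    unfolding continuous_on_eq_continuous_within
  proof (intro ballI)
    fix x :: real assume c: "\<And>b. \<forall>x\<in>{1..b}. continuous (at x within {1..b}) f" and x: "x \<in> {1..}"
    have "at x within {1..x + 1} = at x within {1..}"
      by (rule at_within_nhd[of _ "{..<x + 1}"]) auto
    moreover have "continuous (at x within {1..x + 1}) f" using bspec[OF c[of "x + 1"], of x] x by simp
    ultimately show "continuous (at x within {1..}) f" by simp
  qed
qed

section \<open>Weighted Cauchy-Schwarz, pointwise decay and integration by parts\<close>

lemma ennreal_power2_le_imp_le:
  assumes "x\<^sup>2 \<le> (ennreal c)\<^sup>2" "0 \<le> c"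
  shows "x \<le> ennreal c"
proof (cases x rule: ennreal_cases)
  case (real z)
  then have "ennreal (z\<^sup>2) \<le> ennreal (c\<^sup>2)" using assms by (simp add: ennreal_power)
  then have "z\<^sup>2 \<le> c\<^sup>2" by simp
  then have "z \<le> c" using assms(2) by (rule power2_le_imp_le)
  then show ?thesis using real by (simp add: ennreal_leI)
next
  case top
  then show ?thesis using assms by (simp add: ennreal_power top_power_ennreal top_unique)
qed

text \<open>The norm for the measure \<open>r^2 dr\<close> on \<open>[1, \<infinity>)\<close>,
  without the factor \<open>4 * pi\<close> of \<open>rint\<close>.\<close>

definition l2 :: "rfun \<Rightarrow> real" where
  "l2 a = sqrt (enn2real (rint (\<lambda>r. (a r)\<^sup>2)) / (4 * pi))"

lemma l2_nonneg: "0 \<le> l2 a"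
  by (simp add: l2_def)

text \<open>Split \<open>a * g\<close> into \<open>r * a\<close> and \<open>g / r\<close>; the first
  factor has norm \<open>l2 a\<close>. As \<open>a\<close> is measurable for the completion only,
  integrability over \<open>lebesgue\<close> is obtained from the same inequality.\<close>

lemma weighted_Cauchy_Schwarz:
  assumes a: "lmeas a" "rint (\<lambda>r. (a r)\<^sup>2) < \<infinity>" and g: "continuous_on {p..q} g" and p: "1 \<le> p"
  shows "integrable lebesgue (\<lambda>r. indicator {p..q} r * (a r * g r))"
    and "(\<lambda>r. a r * g r) integrable_on {p..q}"
    and "\<bar>integral {p..q} (\<lambda>r. a r * g r)\<bar> \<le> l2 a * sqrt (integral {p..q} (\<lambda>r. (g r * inverse r)\<^sup>2))"
proof -
  define \<alpha> where "\<alpha> r = r * (indicator {1..} r * a r)" for r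
  define \<gamma> where "\<gamma> r = indicator {p..q} r *\<^sub>R (g r * inverse r)" for r
  have cg: "continuous_on {p..q} (\<lambda>r. g r * inverse r)" using p by (intro continuous_intros g) auto
  have \<alpha>m: "\<alpha> \<in> borel_measurable lebesgue"
    unfolding \<alpha>_def by (rule borel_measurable_times[OF _ a(1)[unfolded lmeas_def]]) (auto intro: measurable_completion)
  have "\<gamma> \<in> borel_measurable borel"
    unfolding \<gamma>_def by (intro borel_measurable_continuous_on_indicator cg) auto
  then have \<gamma>m: "\<gamma> \<in> borel_measurable lebesgue" by (simp add: measurable_completion)
  have prod: "\<alpha> r * \<gamma> r = indicator {p..q} r * (a r * g r)" for r
    using p by (auto simp: \<alpha>_def \<gamma>_def indicator_def)
  have A: "(\<integral>\<^sup>+r. (ennreal \<bar>\<alpha> r\<bar>)\<^sup>2 \<partial>lebesgue) = ennreal ((l2 a)\<^sup>2)"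
  proof -
    have "rint (\<lambda>r. (a r)\<^sup>2) = (\<integral>\<^sup>+r. ennreal (4 * pi) * (ennreal \<bar>\<alpha> r\<bar>)\<^sup>2 \<partial>lebesgue)"
      unfolding rint_lebesgue
      by (intro nn_integral_cong) (auto simp: \<alpha>_def indicator_def ennreal_power power_mult_distrib mult_ac simp flip: ennreal_mult)
    also have "\<dots> = ennreal (4 * pi) * (\<integral>\<^sup>+r. (ennreal \<bar>\<alpha> r\<bar>)\<^sup>2 \<partial>lebesgue)"
      using \<alpha>m by (intro nn_integral_cmult) measurable
    finally have R: "rint (\<lambda>r. (a r)\<^sup>2) = ennreal (4 * pi) * (\<integral>\<^sup>+r. (ennreal \<bar>\<alpha> r\<bar>)\<^sup>2 \<partial>lebesgue)" .
    then have "(\<integral>\<^sup>+r. (ennreal \<bar>\<alpha> r\<bar>)\<^sup>2 \<partial>lebesgue) < \<infinity>"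
      using a(2) by (auto simp: ennreal_mult_less_top)
    then obtain x where x: "(\<integral>\<^sup>+r. (ennreal \<bar>\<alpha> r\<bar>)\<^sup>2 \<partial>lebesgue) = ennreal x" "0 \<le> x"
      by (metis ennreal_cases infinity_ennreal_def less_irrefl)
    with R have "rint (\<lambda>r. (a r)\<^sup>2) = ennreal (4 * pi * x)" by (simp add: ennreal_mult)
    with x show ?thesis by (simp add: l2_def)
  qed
  have G: "(\<integral>\<^sup>+r. (ennreal \<bar>\<gamma> r\<bar>)\<^sup>2 \<partial>lebesgue) = ennreal (integral {p..q} (\<lambda>r. (g r * inverse r)\<^sup>2))"
  proof -
    have "(\<integral>\<^sup>+r. (ennreal \<bar>\<gamma> r\<bar>)\<^sup>2 \<partial>lebesgue) = (\<integral>\<^sup>+r. ennreal ((g r * inverse r)\<^sup>2) * indicator {p..q} r \<partial>lborel)"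
      unfolding nn_integral_completion by (intro nn_integral_cong) (auto simp: \<gamma>_def indicator_def ennreal_power)
    also have "\<dots> = ennreal (integral {p..q} (\<lambda>r. (g r * inverse r)\<^sup>2))"
      by (rule nn_integral_has_integral_lebesgue') (auto intro!: integrable_integral integrable_continuous_real continuous_intros cg)
    finally show ?thesis .
  qed
  have G0: "0 \<le> integral {p..q} (\<lambda>r. (g r * inverse r)\<^sup>2)"
    by (intro integral_nonneg integrable_continuous_real continuous_intros cg) auto
  have "(\<integral>\<^sup>+r. ennreal \<bar>\<alpha> r\<bar> * ennreal \<bar>\<gamma> r\<bar> \<partial>lebesgue)\<^sup>2 \<le> (\<integral>\<^sup>+r. (ennreal \<bar>\<alpha> r\<bar>)\<^sup>2 \<partial>lebesgue) * (\<integral>\<^sup>+r. (ennreal \<bar>\<gamma> r\<bar>)\<^sup>2 \<partial>lebesgue)"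
    using \<alpha>m \<gamma>m by (intro Cauchy_Schwarz_nn_integral; measurable)
  also have "\<dots> = ennreal ((l2 a * sqrt (integral {p..q} (\<lambda>r. (g r * inverse r)\<^sup>2)))\<^sup>2)"
    unfolding A G using G0 by (simp add: ennreal_mult[symmetric] power_mult_distrib)
  also have "\<dots> = (ennreal (l2 a * sqrt (integral {p..q} (\<lambda>r. (g r * inverse r)\<^sup>2))))\<^sup>2"
    using G0 l2_nonneg by (simp add: ennreal_power)
  finally have "(\<integral>\<^sup>+r. ennreal \<bar>\<alpha> r\<bar> * ennreal \<bar>\<gamma> r\<bar> \<partial>lebesgue) \<le> ennreal (l2 a * sqrt (integral {p..q} (\<lambda>r. (g r * inverse r)\<^sup>2)))"
    using G0 l2_nonneg by (intro ennreal_power2_le_imp_le) auto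
  moreover have "(\<integral>\<^sup>+r. ennreal \<bar>\<alpha> r\<bar> * ennreal \<bar>\<gamma> r\<bar> \<partial>lebesgue) = (\<integral>\<^sup>+r. ennreal (norm (indicator {p..q} r * (a r * g r))) \<partial>lebesgue)"
    by (intro nn_integral_cong) (simp add: prod[symmetric] abs_mult ennreal_mult)
  ultimately have N: "(\<integral>\<^sup>+r. ennreal (norm (indicator {p..q} r * (a r * g r))) \<partial>lebesgue) \<le> ennreal (l2 a * sqrt (integral {p..q} (\<lambda>r. (g r * inverse r)\<^sup>2)))"
    by simp
  have m: "(\<lambda>r. indicator {p..q} r * (a r * g r)) \<in> borel_measurable lebesgue"
    unfolding prod[symmetric] by (rule borel_measurable_times[OF \<alpha>m \<gamma>m])
  show int: "integrable lebesgue (\<lambda>r. indicator {p..q} r * (a r * g r))"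
    using m N by (intro integrableI_bounded) (auto intro: le_less_trans)
  then have s: "set_integrable lebesgue {p..q} (\<lambda>r. a r * g r)" by (simp add: set_integrable_def)
  show "(\<lambda>r. a r * g r) integrable_on {p..q}" by (rule set_lebesgue_integral_eq_integral(1)[OF s])
  have "\<bar>integral {p..q} (\<lambda>r. a r * g r)\<bar> = \<bar>LINT r|lebesgue. indicator {p..q} r * (a r * g r)\<bar>"
    using set_lebesgue_integral_eq_integral(2)[OF s] by (simp add: set_lebesgue_integral_def)
  then have "ennreal \<bar>integral {p..q} (\<lambda>r. a r * g r)\<bar> \<le> (\<integral>\<^sup>+r. ennreal (norm (indicator {p..q} r * (a r * g r))) \<partial>lebesgue)"
    using integral_norm_bound_ennreal[OF int] by simp
  then have "ennreal \<bar>integral {p..q} (\<lambda>r. a r * g r)\<bar> \<le> ennreal (l2 a * sqrt (integral {p..q} (\<lambda>r. (g r * inverse r)\<^sup>2)))"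
    using N by (rule order_trans)
  then show "\<bar>integral {p..q} (\<lambda>r. a r * g r)\<bar> \<le> l2 a * sqrt (integral {p..q} (\<lambda>r. (g r * inverse r)\<^sup>2))"
    using G0 l2_nonneg by (subst (asm) ennreal_le_iff) auto
qed

lemma emeasure_lborel_atLeast: "emeasure lborel {a::real..} = \<infinity>"
proof -
  have "of_nat n \<le> emeasure lborel {a..}" for n :: nat
    using emeasure_mono[of "{a..a + real n}" "{a..}" lborel] by (simp add: ennreal_of_nat_eq_real_of_nat)
  then show ?thesis
    by (metis ennreal_Ex_less_of_nat infinity_ennreal_def leD less_top)
qed

lemma radial_increment_le:
  assumes f: "radial_deriv f f'" "rint (\<lambda>r. (f' r)\<^sup>2) < \<infinity>" and ab: "1 \<le> a" "a \<le> b"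
  shows "\<bar>f b - f a\<bar> \<le> l2 f' * sqrt (inverse a - inverse b)"
proof -
  have "((\<lambda>r. inverse r ^ 2) has_integral - inverse b - (- inverse a)) {a..b}"
  proof (rule FTC_within[where S = "{1..}"])
    fix r :: real assume "r \<in> {a..b}"
    then show "((\<lambda>r. - inverse r) has_real_derivative inverse r ^ 2) (at r within {1..})"
      using ab by (auto intro!: derivative_eq_intros simp: power2_eq_square)
  qed (use ab in auto)
  from integral_unique[OF this] have "integral {a..b} (\<lambda>r. (1 * inverse r)\<^sup>2) = inverse a - inverse b" by simp
  moreover have "integral {a..b} (\<lambda>r. f' r * 1) = f b - f a"
    using integral_unique[OF radial_deriv_integral[OF f(1) ab]] by simp
  ultimately show ?thesis
    using weighted_Cauchy_Schwarz(3)[OF lmeas_radial_deriv[OF f(1)] f(2) continuous_on_const[of _ 1] ab(1), of b] by simp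
qed

text \<open>If \<open>\<bar>f a\<bar>\<close> exceeded \<open>l2 f' / sqrt a\<close>, the increment
  bound would keep \<open>\<bar>f\<bar>\<close> above a positive constant on all of
  \<open>[a, \<infinity>)\<close>, against the finiteness of the \<open>L^6\<close> integral. Here a
  nonzero limit at infinity is excluded.\<close>

lemma radial_pointwise:
  assumes f: "radial_deriv f f'" "rint (\<lambda>r. (f' r)\<^sup>2) < \<infinity>" and six: "rint (\<lambda>r. \<bar>f r\<bar> ^ 6) < \<infinity>" and a: "1 \<le> a"
  shows "a * (f a)\<^sup>2 \<le> (l2 f')\<^sup>2"
proof -
  have "\<bar>f a\<bar> \<le> l2 f' * sqrt (inverse a)"
  proof (rule ccontr)
    assume *: "\<not> \<bar>f a\<bar> \<le> l2 f' * sqrt (inverse a)"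
    define c where "c = \<bar>f a\<bar> - l2 f' * sqrt (inverse a)"
    have c: "c > 0" using * by (simp add: c_def)
    have fc: "c \<le> \<bar>f b\<bar>" if "a \<le> b" for b
    proof -
      have "\<bar>f b - f a\<bar> \<le> l2 f' * sqrt (inverse a - inverse b)" by (rule radial_increment_le[OF f a that])
      also have "\<dots> \<le> l2 f' * sqrt (inverse a)"
        using that a l2_nonneg[of f'] by (intro mult_left_mono) auto
      finally show ?thesis unfolding c_def by linarith
    qed
    have "\<infinity> = (\<integral>\<^sup>+r. ennreal (c ^ 6) * indicator {a..} r \<partial>lborel)"
      using c by (subst nn_integral_cmult_indicator) (auto simp: ennreal_mult_top emeasure_lborel_atLeast)
    also have "\<dots> \<le> rint (\<lambda>r. \<bar>f r\<bar> ^ 6)"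
      unfolding rint_def
    proof (intro nn_integral_mono)
      fix r
      show "ennreal (c ^ 6) * indicator {a..} r \<le> ennreal (4 * pi * r\<^sup>2 * \<bar>f r\<bar> ^ 6) * indicator {1..} r"
      proof (cases "a \<le> r")
        case True
        have "1 * c ^ 6 \<le> (4 * pi * r\<^sup>2) * \<bar>f r\<bar> ^ 6"
        proof (intro mult_mono power_mono)
          have "1 \<le> r\<^sup>2" using True a by simp
          moreover have "1 \<le> 4 * pi" using pi_gt3 by simp
          ultimately have "1 * 1 \<le> (4 * pi) * r\<^sup>2" by (intro mult_mono) auto
          then show "1 \<le> 4 * pi * r\<^sup>2" by simp
        qed (use fc[OF True] c in auto)
        then show ?thesis using True a by (simp add: ennreal_leI)
      qed simp
    qed
    finally show False using six by simp
  qed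
  then have "(\<bar>f a\<bar>)\<^sup>2 \<le> (l2 f' * sqrt (inverse a))\<^sup>2" by (intro power_mono) auto
  then show ?thesis using a by (simp add: power_mult_distrib field_simps)
qed

text \<open>There is no pointwise product rule, since \<open>f'\<close> is merely square integrable.
  The defect \<open>\<phi>\<close> of the formula satisfies a bound of order 3/2 in the length of
  the interval, because \<open>m\<close> is Lipschitz and \<open>f\<close> has Hoelder exponent 1/2;
  such a function has derivative 0 and is constant.\<close>

lemma radial_by_parts:
  assumes f: "radial_deriv f f'" "rint (\<lambda>r. (f' r)\<^sup>2) < \<infinity>" and R: "1 < R"
    and m: "\<And>r. r \<in> {1..R} \<Longrightarrow> (m has_real_derivative m' r) (at r within {1..R})" and cm': "continuous_on {1..R} m'"
  shows "integral {1..R} (\<lambda>r. f' r * m r) = f R * m R - f 1 * m 1 - integral {1..R} (\<lambda>r. m' r * f r)"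
proof -
  have cf: "continuous_on {1..R} f" by (rule continuous_on_subset[OF radial_deriv_continuous[OF f(1)]]) auto
  have cm: "continuous_on {1..R} m" by (rule DERIV_continuous_on[OF m])
  obtain M where M: "M \<ge> 0" "\<And>r. r \<in> {1..R} \<Longrightarrow> \<bar>m' r\<bar> \<le> M"
  proof -
    have "bounded (m' ` {1..R})" by (intro compact_imp_bounded compact_continuous_image cm') auto
    then obtain M where "\<forall>x\<in>m' ` {1..R}. norm x \<le> M" unfolding bounded_iff by blast
    then have "\<And>r. r \<in> {1..R} \<Longrightarrow> \<bar>m' r\<bar> \<le> M" by simp
    with that[of "max M 0"] show ?thesis by (meson max.cobounded2 max.coboundedI1)
  qed
  have Lip: "\<bar>m r - m b\<bar> \<le> M * (b - a)" if "1 \<le> a" "a \<le> r" "r \<le> b" "b \<le> R" for a r b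
  proof -
    have "(m' has_integral m b - m r) {r..b}"
      using that by (intro FTC_within[where S = "{1..R}"] m) auto
    from has_integral_bound_real[OF M(1) finite.emptyI this] M(2) that
    have "\<bar>m b - m r\<bar> \<le> M * (b - r)" by auto
    also have "\<dots> \<le> M * (b - a)" using that M by (intro mult_left_mono) auto
    finally show ?thesis by (simp add: abs_minus_commute)
  qed
  have lm: "lmeas f'" by (rule lmeas_radial_deriv[OF f(1)])
  define S where "S = l2 f'"
  have S: "S \<ge> 0" by (simp add: S_def l2_nonneg)
  have i1: "(\<lambda>r. f' r * m r) integrable_on {1..R}"
    by (rule weighted_Cauchy_Schwarz(2)[OF lm f(2) cm]) simp
  have i2: "(\<lambda>r. m' r * f r) integrable_on {1..R}" by (intro integrable_continuous_real continuous_intros cm' cf)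
  define \<phi> where "\<phi> x = integral {1..x} (\<lambda>r. f' r * m r) + integral {1..x} (\<lambda>r. m' r * f r) - f x * m x" for x
  have H: "\<bar>\<phi> b - \<phi> a\<bar> \<le> 2 * S * M * ((b - a) * sqrt (b - a))" if ab: "1 \<le> a" "a \<le> b" "b \<le> R" for a b
  proof -
    have sub: "{a..b} \<subseteq> {1..R}" using ab by auto
    have j1: "(\<lambda>r. f' r * m r) integrable_on {1..b}" "(\<lambda>r. m' r * f r) integrable_on {1..b}"
      using integrable_on_subinterval[OF i1, of 1 b] integrable_on_subinterval[OF i2, of 1 b] ab by auto
    have j2: "(\<lambda>r. f' r * m r) integrable_on {a..b}" "(\<lambda>r. m' r * f r) integrable_on {a..b}"
      using integrable_on_subinterval[OF i1 sub] integrable_on_subinterval[OF i2 sub] by auto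
    have c1: "integral {1..b} (\<lambda>r. f' r * m r) = integral {1..a} (\<lambda>r. f' r * m r) + integral {a..b} (\<lambda>r. f' r * m r)"
      and c2: "integral {1..b} (\<lambda>r. m' r * f r) = integral {1..a} (\<lambda>r. m' r * f r) + integral {a..b} (\<lambda>r. m' r * f r)"
      using Henstock_Kurzweil_Integration.integral_combine[OF ab(1,2) j1(1)] Henstock_Kurzweil_Integration.integral_combine[OF ab(1,2) j1(2)] by simp_all
    have f'i: "(f' has_integral f b - f a) {a..b}" by (rule radial_deriv_integral[OF f(1) ab(1,2)])
    have m'i: "(m' has_integral m b - m a) {a..b}" using ab by (intro FTC_within[where S = "{1..R}"] m) auto
    have e1: "integral {a..b} (\<lambda>r. f' r * (m r - m b)) = integral {a..b} (\<lambda>r. f' r * m r) - (f b - f a) * m b"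
    proof -
      have "((\<lambda>r. f' r * m r - f' r * m b) has_integral integral {a..b} (\<lambda>r. f' r * m r) - (f b - f a) * m b) {a..b}"
        by (intro has_integral_diff integrable_integral j2 has_integral_mult_left f'i)
      then show ?thesis by (simp add: integral_unique right_diff_distrib)
    qed
    have e2: "integral {a..b} (\<lambda>r. m' r * (f r - f a)) = integral {a..b} (\<lambda>r. m' r * f r) - (m b - m a) * f a"
    proof -
      have "((\<lambda>r. m' r * f r - m' r * f a) has_integral integral {a..b} (\<lambda>r. m' r * f r) - (m b - m a) * f a) {a..b}"
        by (intro has_integral_diff integrable_integral j2 has_integral_mult_left m'i)
      then show ?thesis by (simp add: integral_unique right_diff_distrib)
    qed
    \<comment> \<open>Subtracting \<open>m b\<close> in one integral and \<open>f a\<close> in the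
      other accounts exactly for the increment of \<open>f * m\<close>, so only products with small
      increments are left.\<close>
    have "\<phi> b - \<phi> a = integral {a..b} (\<lambda>r. f' r * (m r - m b)) + integral {a..b} (\<lambda>r. m' r * (f r - f a))"
      unfolding \<phi>_def c1 c2 e1 e2 by (simp add: algebra_simps)
    moreover have "\<bar>integral {a..b} (\<lambda>r. f' r * (m r - m b))\<bar> \<le> S * (M * ((b - a) * sqrt (b - a)))"
    proof -
      have cmb: "continuous_on {a..b} (\<lambda>r. m r - m b)" by (intro continuous_intros continuous_on_subset[OF cm sub])
      have cmi: "continuous_on {a..b} (\<lambda>r. (m r - m b) * inverse r)" using ab by (intro continuous_intros cmb) auto
      have "integral {a..b} (\<lambda>r. ((m r - m b) * inverse r)\<^sup>2) \<le> integral {a..b} (\<lambda>r. (M * (b - a))\<^sup>2)"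
      proof (rule integral_le)
        show "(\<lambda>r. ((m r - m b) * inverse r)\<^sup>2) integrable_on {a..b}" by (intro integrable_continuous_real continuous_intros cmi)
        show "(\<lambda>r. (M * (b - a))\<^sup>2) integrable_on {a..b}" by (rule integrable_const_ivl)
        fix r assume r: "r \<in> {a..b}"
        have "\<bar>m r - m b\<bar> * inverse r \<le> (M * (b - a)) * 1"
          using Lip[of a r b] r ab M by (intro mult_mono) (auto simp: inverse_le_1_iff)
        then have "\<bar>(m r - m b) * inverse r\<bar> \<le> M * (b - a)" using r ab by (simp add: abs_mult)
        then show "((m r - m b) * inverse r)\<^sup>2 \<le> (M * (b - a))\<^sup>2" by (rule power2_le_iff_abs_le[THEN iffD2, rotated]) (use M ab in auto)
      qed
      also have "\<dots> = (M * (b - a))\<^sup>2 * (b - a)" using ab by (simp add: mult.commute)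
      finally have "sqrt (integral {a..b} (\<lambda>r. ((m r - m b) * inverse r)\<^sup>2)) \<le> sqrt ((M * (b - a))\<^sup>2 * (b - a))" by (rule real_sqrt_le_mono)
      also have "\<dots> = M * ((b - a) * sqrt (b - a))" using M ab by (simp add: real_sqrt_mult)
      finally have "S * sqrt (integral {a..b} (\<lambda>r. ((m r - m b) * inverse r)\<^sup>2)) \<le> S * (M * ((b - a) * sqrt (b - a)))"
        using S by (intro mult_left_mono)
      then show ?thesis using weighted_Cauchy_Schwarz(3)[OF lm f(2) cmb ab(1)] unfolding S_def by (rule order_trans[rotated])
    qed
    moreover have "\<bar>integral {a..b} (\<lambda>r. m' r * (f r - f a))\<bar> \<le> S * (M * ((b - a) * sqrt (b - a)))"
    proof -
      have "\<bar>integral {a..b} (\<lambda>r. m' r * (f r - f a))\<bar> \<le> integral {a..b} (\<lambda>r. M * (S * sqrt (b - a)))"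
      proof (rule integral_norm_bound_integral[where 'a = real, unfolded real_norm_def])
        show "(\<lambda>r. m' r * (f r - f a)) integrable_on {a..b}"
          by (intro integrable_continuous_real continuous_intros continuous_on_subset[OF cm' sub] continuous_on_subset[OF cf sub])
        show "(\<lambda>r. M * (S * sqrt (b - a))) integrable_on {a..b}" by (rule integrable_const_ivl)
        fix r assume r: "r \<in> {a..b}"
        have "\<bar>f r - f a\<bar> \<le> S * sqrt (inverse a - inverse r)"
          unfolding S_def using r ab by (intro radial_increment_le[OF f]) auto
        also have "\<dots> \<le> S * sqrt (b - a)"
        proof (intro mult_left_mono real_sqrt_le_mono S)
          have "inverse a - inverse r = (r - a) * (inverse a * inverse r)" using r ab by (simp add: field_simps)
          also have "\<dots> \<le> (r - a) * (1 * 1)" using r ab by (intro mult_left_mono mult_mono) (auto simp: inverse_le_1_iff)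
          also have "\<dots> \<le> b - a" using r by simp
          finally show "inverse a - inverse r \<le> b - a" .
        qed
        finally show "\<bar>m' r * (f r - f a)\<bar> \<le> M * (S * sqrt (b - a))"
          unfolding abs_mult using M(2)[of r] r ab S M(1) by (intro mult_mono) auto
      qed
      also have "\<dots> = S * (M * ((b - a) * sqrt (b - a)))" using ab by simp
      finally show ?thesis .
    qed
    ultimately show ?thesis by (simp add: algebra_simps)
  qed
  have "\<exists>c. \<forall>x\<in>{1..R}. \<phi> x = c"
  proof (rule has_field_derivative_zero_constant)
    fix x assume x: "x \<in> {1..R}"
    show "(\<phi> has_real_derivative 0) (at x within {1..R})"
      unfolding has_field_derivative_iff
    proof (rule Lim_null_comparison)
      show "\<forall>\<^sub>F y in at x within {1..R}. norm ((\<phi> y - \<phi> x) / (y - x)) \<le> 2 * S * M * sqrt \<bar>y - x\<bar>"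
        unfolding eventually_at_topological
      proof (intro exI[of _ UNIV] conjI ballI impI)
        fix y assume y: "y \<noteq> x" "y \<in> {1..R}"
        have "\<bar>\<phi> y - \<phi> x\<bar> \<le> 2 * S * M * (\<bar>y - x\<bar> * sqrt \<bar>y - x\<bar>)"
        proof (cases "x \<le> y")
          case True then show ?thesis using H[of x y] x y by simp
        next
          case False then show ?thesis using H[of y x] x y by (simp add: abs_minus_commute)
        qed
        then show "norm ((\<phi> y - \<phi> x) / (y - x)) \<le> 2 * S * M * sqrt \<bar>y - x\<bar>"
          using y by (simp add: abs_divide field_simps)
      qed auto
      have "((\<lambda>y. 2 * S * M * sqrt \<bar>y - x\<bar>) \<longlongrightarrow> 2 * S * M * sqrt \<bar>x - x\<bar>) (at x within {1..R})"
        by (intro tendsto_intros)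
      then show "((\<lambda>y. 2 * S * M * sqrt \<bar>y - x\<bar>) \<longlongrightarrow> 0) (at x within {1..R})" by simp
    qed
  qed simp
  then have "\<phi> R = \<phi> 1" using R by auto
  then show ?thesis by (simp add: \<phi>_def)
qed

section \<open>Weak formulation along separated test functions\<close>

lemma rint_le_add:
  assumes "lmeas p" "lmeas q" "0 \<le> c" "\<And>r. 1 \<le> r \<Longrightarrow> 0 \<le> p r" "\<And>r. 1 \<le> r \<Longrightarrow> 0 \<le> q r"
    and h: "\<And>r. 1 \<le> r \<Longrightarrow> h r \<le> c * p r + c * q r"
  shows "rint h \<le> ennreal c * rint p + ennreal c * rint q"
proof -
  have m: "(\<lambda>r. ennreal (4 * pi * r\<^sup>2 * f r) * indicator {1..} r) \<in> borel_measurable lebesgue" if "lmeas f" for f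
  proof -
    have "(\<lambda>r. (4 * pi * r\<^sup>2) * (indicator {1..} r * f r)) \<in> borel_measurable lebesgue"
      by (rule borel_measurable_times[OF _ that[unfolded lmeas_def]]) (auto intro: measurable_completion)
    then have "(\<lambda>r. ennreal ((4 * pi * r\<^sup>2) * (indicator {1..} r * f r))) \<in> borel_measurable lebesgue"
      by measurable
    moreover have "(\<lambda>r. ennreal ((4 * pi * r\<^sup>2) * (indicator {1..} r * f r))) = (\<lambda>r. ennreal (4 * pi * r\<^sup>2 * f r) * indicator {1..} r)"
      by (auto simp: fun_eq_iff indicator_def)
    ultimately show ?thesis by simp
  qed
  have E: "ennreal (c * x + c * y) = ennreal c * ennreal x + ennreal c * ennreal y" if "0 \<le> x" "0 \<le> y" for x y
    using that assms(3) by (simp add: ennreal_mult)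
  have "rint h \<le> (\<integral>\<^sup>+r. ennreal c * (ennreal (4 * pi * r\<^sup>2 * p r) * indicator {1..} r) + ennreal c * (ennreal (4 * pi * r\<^sup>2 * q r) * indicator {1..} r) \<partial>lebesgue)"
    unfolding rint_lebesgue
  proof (rule nn_integral_mono)
    fix r
    show "ennreal (4 * pi * r\<^sup>2 * h r) * indicator {1..} r \<le> ennreal c * (ennreal (4 * pi * r\<^sup>2 * p r) * indicator {1..} r) + ennreal c * (ennreal (4 * pi * r\<^sup>2 * q r) * indicator {1..} r)"
    proof (cases "1 \<le> r")
      case True
      have "4 * pi * r\<^sup>2 * h r \<le> 4 * pi * r\<^sup>2 * (c * p r + c * q r)" by (intro mult_left_mono h True) auto
      also have "\<dots> = c * (4 * pi * r\<^sup>2 * p r) + c * (4 * pi * r\<^sup>2 * q r)" by (simp add: algebra_simps)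
      finally have "ennreal (4 * pi * r\<^sup>2 * h r) \<le> ennreal (c * (4 * pi * r\<^sup>2 * p r) + c * (4 * pi * r\<^sup>2 * q r))" by (rule ennreal_leI)
      also have "\<dots> = ennreal c * ennreal (4 * pi * r\<^sup>2 * p r) + ennreal c * ennreal (4 * pi * r\<^sup>2 * q r)"
        using assms(4,5)[OF True] by (intro E mult_nonneg_nonneg) auto
      finally show ?thesis using True by simp
    qed simp
  qed
  also have "\<dots> = ennreal c * rint p + ennreal c * rint q"
    unfolding rint_lebesgue using m[OF assms(1)] m[OF assms(2)]
    by (subst nn_integral_add; (subst nn_integral_cmult)?; (subst nn_integral_cmult)?; simp)
  finally show ?thesis .
qed

lemma lmeas_power2: "lmeas a \<Longrightarrow> lmeas (\<lambda>r. (a r)\<^sup>2)"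
  unfolding power2_eq_square by (rule lmeas_mult)

lemma rint_power2_diff:
  assumes "lmeas a" "lmeas b" "rint (\<lambda>r. (a r)\<^sup>2) < \<infinity>" "rint (\<lambda>r. (b r)\<^sup>2) < \<infinity>"
  shows "rint (\<lambda>r. (a r - b r)\<^sup>2) < \<infinity>" and "(l2 a)\<^sup>2 \<le> 2 * (l2 (\<lambda>r. a r - b r))\<^sup>2 + 2 * (l2 b)\<^sup>2"
proof -
  have i: "(x - y)\<^sup>2 \<le> 2 * x\<^sup>2 + 2 * y\<^sup>2" for x y :: real
    using zero_le_power2[of "x + y"] by (simp add: power2_eq_square algebra_simps)
  have "rint (\<lambda>r. (a r - b r)\<^sup>2) \<le> ennreal 2 * rint (\<lambda>r. (a r)\<^sup>2) + ennreal 2 * rint (\<lambda>r. (b r)\<^sup>2)"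
    using assms i by (intro rint_le_add lmeas_power2) auto
  also have "\<dots> < \<infinity>" using assms by (simp add: ennreal_mult_less_top)
  finally show fin: "rint (\<lambda>r. (a r - b r)\<^sup>2) < \<infinity>" .
  have j: "x\<^sup>2 \<le> 2 * (x - y)\<^sup>2 + 2 * y\<^sup>2" for x y :: real
    using zero_le_power2[of "x - 2 * y"] by (simp add: power2_eq_square algebra_simps)
  have "rint (\<lambda>r. (a r)\<^sup>2) \<le> ennreal 2 * rint (\<lambda>r. (a r - b r)\<^sup>2) + ennreal 2 * rint (\<lambda>r. (b r)\<^sup>2)"
    using assms j by (intro rint_le_add lmeas_power2 lmeas_diff) auto
  from enn2real_mono[OF this] fin assms
  have "enn2real (rint (\<lambda>r. (a r)\<^sup>2)) \<le> 2 * enn2real (rint (\<lambda>r. (a r - b r)\<^sup>2)) + 2 * enn2real (rint (\<lambda>r. (b r)\<^sup>2))"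
    by (simp add: enn2real_plus enn2real_mult ennreal_mult_less_top)
  from divide_right_mono[OF this, of "4 * pi"]
  show "(l2 a)\<^sup>2 \<le> 2 * (l2 (\<lambda>r. a r - b r))\<^sup>2 + 2 * (l2 b)\<^sup>2"
    by (simp add: l2_def add_divide_distrib)
qed

lemma rint_power6_diff:
  assumes "continuous_on {1..} a" "continuous_on {1..} b" "rint (\<lambda>r. \<bar>a r\<bar> ^ 6) < \<infinity>" "rint (\<lambda>r. \<bar>b r\<bar> ^ 6) < \<infinity>"
  shows "rint (\<lambda>r. \<bar>a r - b r\<bar> ^ 6) < \<infinity>"
proof -
  have i: "\<bar>x - y\<bar> ^ 6 \<le> 64 * \<bar>x\<bar> ^ 6 + 64 * \<bar>y\<bar> ^ 6" for x y :: real
  proof -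
    have "\<bar>x - y\<bar> ^ 6 \<le> (2 * max \<bar>x\<bar> \<bar>y\<bar>) ^ 6" by (intro power_mono) auto
    also have "\<dots> = 64 * max \<bar>x\<bar> \<bar>y\<bar> ^ 6" by (simp add: power_mult_distrib)
    also have "\<dots> \<le> 64 * \<bar>x\<bar> ^ 6 + 64 * \<bar>y\<bar> ^ 6" by (cases "\<bar>x\<bar> \<le> \<bar>y\<bar>") (auto simp: max_def)
    finally show ?thesis .
  qed
  have "rint (\<lambda>r. \<bar>a r - b r\<bar> ^ 6) \<le> ennreal 64 * rint (\<lambda>r. \<bar>a r\<bar> ^ 6) + ennreal 64 * rint (\<lambda>r. \<bar>b r\<bar> ^ 6)"
    using i by (intro rint_le_add lmeas_continuous continuous_intros assms(1,2)) auto
  also have "\<dots> < \<infinity>" using assms by (simp add: ennreal_mult_less_top)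
  finally show ?thesis .
qed

lemma in_H_D:
  assumes "in_H (a, b)" "radial_deriv a f"
  shows "lmeas f" "lmeas b" "continuous_on {1..} a" "rint (\<lambda>r. (f r)\<^sup>2) < \<infinity>" "rint (\<lambda>r. (b r)\<^sup>2) < \<infinity>" "rint (\<lambda>r. \<bar>a r\<bar> ^ 6) < \<infinity>"
proof -
  obtain g where g: "radial_deriv a g" "rint (\<lambda>r. (g r)\<^sup>2) < \<infinity>" using assms(1) by (auto simp: in_H_def)
  show "rint (\<lambda>r. (f r)\<^sup>2) < \<infinity>" using g(2) radial_deriv_rint_unique[OF g(1) assms(2)] by simp
  show "lmeas f" "continuous_on {1..} a" using lmeas_radial_deriv[OF assms(2)] radial_deriv_continuous[OF assms(2)] by auto
  show "lmeas b" "rint (\<lambda>r. (b r)\<^sup>2) < \<infinity>" "rint (\<lambda>r. \<bar>a r\<bar> ^ 6) < \<infinity>"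
    using assms(1) by (auto simp: in_H_def intro: lmeas_borel)
qed

text \<open>Transfers closeness in the energy norm, which is defined through \<open>Dr\<close>, to
  any given derivatives of the two functions; \<open>4 * pi \<ge> 1\<close> absorbs the
  normalisation.\<close>

lemma l2_le_Hnorm_Hdiff:
  assumes "radial_deriv a f" "radial_deriv a' f'"
  shows "l2 (\<lambda>r. f r - f' r) \<le> Hnorm (Hdiff (a, b) (a', b'))" "l2 (\<lambda>r. b r - b' r) \<le> Hnorm (Hdiff (a, b) (a', b'))"
proof -
  have d: "radial_deriv (\<lambda>r. a r - a' r) (\<lambda>r. f r - f' r)" by (rule radial_deriv_diff[OF assms])
  have H: "Hnorm (Hdiff (a, b) (a', b')) = sqrt (enn2real (rint (\<lambda>r. (f r - f' r)\<^sup>2)) + enn2real (rint (\<lambda>r. (b r - b' r)\<^sup>2)))"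
    using radial_deriv_rint_unique[OF d radial_deriv_Dr[OF d]] by (simp add: Hnorm_def Hdiff_def)
  have p: "x / (4 * pi) \<le> x" if "0 \<le> x" for x :: real
  proof -
    have "x / (4 * pi) \<le> x / 1" using pi_gt3 that by (intro divide_left_mono) auto
    then show ?thesis by simp
  qed
  have s: "x / (4 * pi) \<le> x + y" if "0 \<le> x" "0 \<le> y" for x y :: real using p[OF that(1)] that by linarith
  show "l2 (\<lambda>r. f r - f' r) \<le> Hnorm (Hdiff (a, b) (a', b'))"
    unfolding H l2_def by (intro real_sqrt_le_mono s enn2real_nonneg)
  show "l2 (\<lambda>r. b r - b' r) \<le> Hnorm (Hdiff (a, b) (a', b'))"
    unfolding H l2_def by (subst add.commute, intro real_sqrt_le_mono s enn2real_nonneg)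
qed

lemma continuous_real_antiderivative:
  fixes k :: "real \<Rightarrow> real"
  assumes "continuous_on UNIV k"
  obtains F where "\<And>x. (F has_real_derivative k x) (at x)"
proof -
  have "\<exists>F. \<forall>x::real. (-\<infinity>::ereal) < x \<longrightarrow> x < (\<infinity>::ereal) \<longrightarrow> (F has_vector_derivative k x) (at x)"
    using assms by (intro einterval_antiderivative) (auto simp: continuous_on_eq_continuous_at)
  then show ?thesis using that by (auto simp: has_real_derivative_iff_has_vector_derivative)
qed

text \<open>The extension to the left of 1 is by the cubic that matches value and slope at 1 and vanishes to second order at 0.\<close>

lemma C1_compact_extension:
  fixes \<zeta> \<zeta>1 :: "real \<Rightarrow> real"
  assumes R: "1 < R" and d: "\<And>r. r \<in> {1..R} \<Longrightarrow> (\<zeta> has_real_derivative \<zeta>1 r) (at r within {1..R})"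
    and c: "continuous_on {1..R} \<zeta>1" and 0: "\<zeta> R = 0" "\<zeta>1 R = 0"
  shows "\<exists>Z Z1. (\<forall>r. (Z has_real_derivative Z1 r) (at r)) \<and> continuous_on UNIV Z1 \<and>
    (\<forall>r\<in>{1..R}. Z r = \<zeta> r \<and> Z1 r = \<zeta>1 r) \<and> (\<forall>r. R \<le> r \<or> r \<le> 0 \<longrightarrow> Z r = 0 \<and> Z1 r = 0)"
proof -
  define a where "a = \<zeta> 1"
  define b where "b = \<zeta>1 1"
  define q where "q x = a * (3 - 2 * x) + b * (x - 1)" for x
  define P where "P x = x\<^sup>2 * q x" for x
  define P1 where "P1 x = 2 * x * q x + x\<^sup>2 * (b - 2 * a)" for x
  \<comment> \<open>Clamping the arguments makes each piece constant outside its own interval, and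
    \<open>b\<close> is the value both share at 1, so \<open>k\<close> equals \<open>P1\<close> on
    \<open>[0, 1]\<close>, \<open>\<zeta>1\<close> on \<open>[1, R]\<close> and 0 elsewhere.\<close>
  define k where "k r = P1 (max 0 (min r 1)) + (\<zeta>1 (max 1 (min r R)) - b)" for r
  have dP: "(P has_real_derivative P1 x) (at x within S)" for x S
    unfolding P_def P1_def q_def by (auto intro!: derivative_eq_intros simp: power2_eq_square algebra_simps)
  have P1: "P1 0 = 0" "P1 1 = b" "P 0 = 0" "P 1 = a" by (simp_all add: P1_def P_def q_def)
  have ck: "continuous_on UNIV k"
  proof -
    have "continuous_on UNIV (\<lambda>r. \<zeta>1 (max 1 (min r R)))"
      using R by (intro continuous_on_compose2[OF c] continuous_intros) auto
    then show ?thesis unfolding k_def P1_def q_def by (intro continuous_intros)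
  qed
  have k0: "k r = 0" if "R \<le> r \<or> r \<le> 0" for r
    using that R P1 0 by (auto simp: k_def max_def min_def b_def)
  have k1: "k r = P1 r" if "0 \<le> r" "r \<le> 1" for r using that R by (auto simp: k_def max_def min_def b_def)
  have k2: "k r = \<zeta>1 r" if "1 \<le> r" "r \<le> R" for r using that R P1 by (auto simp: k_def max_def min_def)
  obtain F where F: "\<And>x. (F has_real_derivative k x) (at x)" using continuous_real_antiderivative[OF ck] by blast
  have FT: "F y - F x = G y - G x" if "x \<le> y" "\<And>r. r \<in> {x..y} \<Longrightarrow> (G has_real_derivative k r) (at r within {x..y})" for x y G
  proof -
    have "(k has_integral F y - F x) {x..y}" using that(1) F by (intro FTC_within[where S = UNIV]) auto
    moreover have "(k has_integral G y - G x) {x..y}" using that by (intro FTC_within[where S = "{x..y}"]) auto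
    ultimately show ?thesis by (rule has_integral_unique)
  qed
  have F1: "F 1 - F 0 = a"
    using FT[of 0 1 P] dP by (simp add: k1 P1)
  have F2: "F r - F 0 = \<zeta> r" if "1 \<le> r" "r \<le> R" for r
  proof -
    have "F r - F 1 = \<zeta> r - \<zeta> 1"
    proof (rule FT[OF that(1)])
      fix y assume y: "y \<in> {1..r}"
      then have "(\<zeta> has_real_derivative \<zeta>1 y) (at y within {1..r})" using that by (intro DERIV_subset[OF d]) auto
      then show "(\<zeta> has_real_derivative k y) (at y within {1..r})" using y that by (simp add: k2)
    qed
    then show ?thesis using F1 by (simp add: a_def)
  qed
  have F3: "F r - F 0 = 0" if r: "R \<le> r \<or> r \<le> 0" for r
  proof (cases "r \<le> 0")
    case True
    have "F 0 - F r = (\<lambda>_. 0) 0 - (\<lambda>_. 0) r" by (rule FT[OF True]) (simp add: k0)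
    then show ?thesis by simp
  next
    case False
    then have "R \<le> r" using r by simp
    then have "F r - F R = (\<lambda>_. 0) r - (\<lambda>_. 0) R" by (rule FT) (simp add: k0)
    then show ?thesis using F2[of R] R 0 by simp
  qed
  show ?thesis
  proof (rule exI[of _ "\<lambda>r. F r - F 0"], rule exI[of _ k], intro conjI allI ballI impI)
    show "((\<lambda>r. F r - F 0) has_real_derivative k r) (at r)" for r using DERIV_diff[OF F[of r] DERIV_const, of "F 0"] by simp
    show "continuous_on UNIV k" by (rule ck)
    show "F r - F 0 = \<zeta> r" "k r = \<zeta>1 r" if "r \<in> {1..R}" for r using F2[of r] k2[of r] that by simp_all
    show "F r - F 0 = 0" "k r = 0" if "R \<le> r \<or> r \<le> 0" for r using F3[OF that] k0[OF that] by simp_all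
  qed
qed

text \<open>Products of a function of \<open>t\<close> and one of \<open>r\<close> are the test
  functions used throughout. The profile in \<open>r\<close> has to be extended below 1 because test
  functions live on the whole plane.\<close>

lemma test_fun_product:
  assumes \<rho>: "\<And>s. (\<rho> has_real_derivative \<rho>1 s) (at s)" "continuous_on UNIV \<rho>1" "\<And>s. B \<le> \<bar>s\<bar> \<Longrightarrow> \<rho> s = 0"
    and \<zeta>: "\<And>r. (\<zeta> has_real_derivative \<zeta>1 r) (at r)" "continuous_on UNIV \<zeta>1" "\<And>r. R \<le> r \<or> r \<le> 0 \<Longrightarrow> \<zeta> r = 0"
  shows "test_fun (\<lambda>t r. \<rho> t * \<zeta> r) (\<lambda>t r. \<rho>1 t * \<zeta> r) (\<lambda>t r. \<rho> t * \<zeta>1 r)"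
  unfolding test_fun_def
proof (intro conjI allI)
  have c: "continuous_on UNIV \<rho>" "continuous_on UNIV \<zeta>"
    by (rule DERIV_continuous_on[OF \<rho>(1)] DERIV_continuous_on[OF \<zeta>(1)])+
  show "continuous_on UNIV (\<lambda>(t, r). \<rho>1 t * \<zeta> r)" "continuous_on UNIV (\<lambda>(t, r). \<rho> t * \<zeta>1 r)"
    unfolding split_beta'
    by (intro continuous_intros continuous_on_compose2[OF \<rho>(2)] continuous_on_compose2[OF c(1)]
        continuous_on_compose2[OF \<zeta>(2)] continuous_on_compose2[OF c(2)]; simp)+
  fix t r :: real
  have "((\<lambda>z. \<rho> (fst z)) has_derivative (\<lambda>x. \<rho>1 t * fst x)) (at (t, r))"
    using has_derivative_compose[OF has_derivative_fst[OF has_derivative_ident] \<rho>(1)[of "fst (t, r)", unfolded has_field_derivative_def], of UNIV] by simp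
  moreover have "((\<lambda>z. \<zeta> (snd z)) has_derivative (\<lambda>x. \<zeta>1 r * snd x)) (at (t, r))"
    using has_derivative_compose[OF has_derivative_snd[OF has_derivative_ident] \<zeta>(1)[of "snd (t, r)", unfolded has_field_derivative_def], of UNIV] by simp
  ultimately have "((\<lambda>z. \<rho> (fst z) * \<zeta> (snd z)) has_derivative (\<lambda>x. \<rho> (fst (t, r)) * (\<zeta>1 r * snd x) + \<rho>1 t * fst x * \<zeta> (snd (t, r)))) (at (t, r))"
    by (rule has_derivative_mult)
  then show "((\<lambda>(s, x). \<rho> s * \<zeta> x) has_derivative (\<lambda>(a, b). \<rho>1 t * \<zeta> r * a + \<rho> t * \<zeta>1 r * b)) (at (t, r))"
    by (simp add: split_beta' algebra_simps)
next
  show "\<exists>R. \<forall>t r. R < \<bar>t\<bar> \<or> R < \<bar>r\<bar> \<longrightarrow> \<rho> t * \<zeta> r = 0"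
  proof (intro exI[of _ "max \<bar>B\<bar> \<bar>R\<bar>"] allI impI)
    fix t r :: real assume "max \<bar>B\<bar> \<bar>R\<bar> < \<bar>t\<bar> \<or> max \<bar>B\<bar> \<bar>R\<bar> < \<bar>r\<bar>"
    then have "B \<le> \<bar>t\<bar> \<or> R \<le> r \<or> r \<le> 0" by linarith
    then show "\<rho> t * \<zeta> r = 0" using \<rho>(3) \<zeta>(3) by auto
  qed
qed

text \<open>Bridge from the iterated integral over \<open>lborel\<close> to a one-variable integral:
  the section is Borel as part of a Borel function of two variables, while \<open>h\<close> contains
  a factor that is only Lebesgue measurable.\<close>

lemma lborel_section_integral:
  assumes G: "G \<in> borel_measurable borel" and i: "integrable lebesgue (\<lambda>r. indicator {1..R} r * h r :: real)"
    and e: "\<And>r. G r = indicator {1..R} r * h r"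
  shows "(LINT r|lborel. G r) = integral {1..R} h"
proof -
  have "(LINT r|lborel. G r) = (LINT r|lebesgue. G r)" using G by (intro integral_completion[symmetric]) simp
  moreover have "set_integrable lebesgue {1..R} h" using i by (simp add: set_integrable_def)
  from set_lebesgue_integral_eq_integral(2)[OF this]
  have "(LINT r|lebesgue. G r) = integral {1..R} h" by (simp add: e set_lebesgue_integral_def)
  ultimately show ?thesis by simp
qed

lemma integrable_lebesgue_continuous_Icc:
  fixes h :: "real \<Rightarrow> real"
  assumes "continuous_on {p..q} h"
  shows "integrable lebesgue (\<lambda>r. indicator {p..q} r * h r)"
proof -
  have "integrable lborel (\<lambda>r. indicator {p..q} r * h r)"
    using borel_integrable_compact[OF compact_Icc assms] by simp
  then show ?thesis by (subst integrable_completion) auto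
qed

lemma borel_section:
  assumes "integrable lborel (f :: real \<times> real \<Rightarrow> real)"
  shows "(\<lambda>r. f (t, r)) \<in> borel_measurable borel"
proof (rule measurable_compose[of "\<lambda>r. (t, r)" borel borel f])
  show "(\<lambda>r. (t, r)) \<in> borel_measurable borel" by (intro borel_measurable_continuous_onI continuous_intros)
  show "f \<in> borel_measurable borel" using borel_measurable_integrable[OF assms] by simp
qed

lemma integral_supported:
  fixes J :: "real \<Rightarrow> real"
  assumes "continuous_on {-B..B} J" "\<And>s. B \<le> \<bar>s\<bar> \<Longrightarrow> J s = 0"
  shows "(LINT s|lborel. J s) = integral {-B..B} J" and "integrable lborel J"
proof -
  have e: "J s = indicator {-B..B} s * J s" for s
  proof (cases "s \<in> {-B..B}")
    case False
    then have "B \<le> \<bar>s\<bar>" by auto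
    then show ?thesis using assms(2) by simp
  qed simp
  have "(LINT s|lborel. J s) = (LINT s|lborel. indicator {-B..B} s * J s)"
    by (intro Bochner_Integration.integral_cong refl e)
  then show "(LINT s|lborel. J s) = integral {-B..B} J" using integral_Icc_lborel[OF assms(1)] by simp
  have "integrable lborel (\<lambda>s. indicator {-B..B} s * J s)"
    using borel_integrable_compact[OF compact_Icc assms(1)] by simp
  moreover have "(\<lambda>s. indicator {-B..B} s * J s) = J" by (rule ext) (rule e[symmetric])
  ultimately show "integrable lborel J" by simp
qed

lemma cont2_pairing_continuous:
  assumes "cont2 f" "continuous_on {1..R} g"
  shows "continuous_on S (\<lambda>s. integral {1..R} (\<lambda>r. g r * f s r))"
proof -
  have "continuous_on (S \<times> cbox 1 R) (\<lambda>(s, r). g r * f s r)"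
    unfolding split_beta' using assms(2)
    by (intro continuous_intros continuous_on_compose2[OF assms(2)] cont2_compose[OF assms(1)]) auto
  from integral_continuous_on_param[OF this] show ?thesis by simp
qed

section \<open>Solutions of finite energy: joint continuity and separated test functions\<close>

locale nlw =
  fixes u v ux :: "real \<Rightarrow> rfun"
  assumes H: "\<And>t. in_H (u t, v t)"
    and cH: "\<And>t. ((\<lambda>s. Hnorm (Hdiff (u s, v s) (u t, v t))) \<longlongrightarrow> 0) (at t)"
    and rd: "\<And>t. radial_deriv (u t) (ux t)"
    and W1: "\<And>\<psi> \<psi>t \<psi>r. test_fun \<psi> \<psi>t \<psi>r \<Longrightarrow>
           integrable (lborel :: (real \<times> real) measure)
              (\<lambda>(t,r). indicator {1..} r * r\<^sup>2 * (u t r * \<psi>t t r + v t r * \<psi> t r)) \<and>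
           (\<integral>(t,r). indicator {1..} r * r\<^sup>2 * (u t r * \<psi>t t r + v t r * \<psi> t r) \<partial>lborel) = 0"
    and W2: "\<And>\<psi> \<psi>t \<psi>r. test_fun \<psi> \<psi>t \<psi>r \<Longrightarrow>
           integrable (lborel :: (real \<times> real) measure)
              (\<lambda>(t,r). indicator {1..} r * r\<^sup>2 *
                 (- v t r * \<psi>t t r + ux t r * \<psi>r t r + (u t r) ^ 5 * \<psi> t r)) \<and>
           (\<integral>(t,r). indicator {1..} r * r\<^sup>2 *
                 (- v t r * \<psi>t t r + ux t r * \<psi>r t r + (u t r) ^ 5 * \<psi> t r) \<partial>lborel) = 0"
begin

lemmas HD = in_H_D[OF H rd]

text \<open>The decay estimate applied to the difference of two time slices turns convergence in
  energy into uniform convergence on \<open>{1..}\<close>.\<close>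

lemma close:
  assumes "1 \<le> r"
  shows "\<bar>u s r - u t r\<bar> \<le> l2 (\<lambda>r. ux s r - ux t r)"
proof -
  have "r * (u s r - u t r)\<^sup>2 \<le> (l2 (\<lambda>r. ux s r - ux t r))\<^sup>2"
    by (intro radial_pointwise radial_deriv_diff rd rint_power2_diff rint_power6_diff HD assms)
  moreover have "1 * (u s r - u t r)\<^sup>2 \<le> r * (u s r - u t r)\<^sup>2" using assms by (intro mult_right_mono) auto
  ultimately have "\<bar>u s r - u t r\<bar>\<^sup>2 \<le> (l2 (\<lambda>r. ux s r - ux t r))\<^sup>2" by simp
  then show ?thesis using l2_nonneg by (rule power2_le_imp_le)
qed

lemma isCont_l2: "isCont (\<lambda>s. l2 (\<lambda>r. ux s r - ux t r)) t"
proof -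
  have "l2 (\<lambda>r. ux t r - ux t r) = 0" by (simp add: l2_def rint_def)
  moreover have "((\<lambda>s. l2 (\<lambda>r. ux s r - ux t r)) \<longlongrightarrow> 0) (at t)"
    using l2_le_Hnorm_Hdiff(1)[OF rd rd] l2_nonneg by (intro Lim_null_comparison[OF _ cH]) (auto intro!: always_eventually)
  ultimately show ?thesis unfolding isCont_def by simp
qed

lemma cont2_u: "cont2 u"
  unfolding cont2_def continuous_on_def
proof
  fix z :: "real \<times> real" assume z: "z \<in> UNIV \<times> {1..}"
  obtain t r where tr: "z = (t, r)" by (cases z)
  let ?S = "UNIV \<times> {1..} :: (real \<times> real) set"
  have "((\<lambda>z. l2 (\<lambda>r. ux (fst z) r - ux t r)) \<longlongrightarrow> l2 (\<lambda>r. ux t r - ux t r)) (at (t, r) within ?S)"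
    by (rule isCont_tendsto_compose[OF isCont_l2]) (auto intro!: tendsto_eq_intros)
  then have 1: "((\<lambda>z. l2 (\<lambda>r. ux (fst z) r - ux t r)) \<longlongrightarrow> 0) (at (t, r) within ?S)"
    by (simp add: l2_def rint_def)
  have 2: "((\<lambda>z. u (fst z) (snd z) - u t (snd z)) \<longlongrightarrow> 0) (at (t, r) within ?S)"
    by (rule Lim_null_comparison[OF _ 1]) (auto simp: eventually_at_filter intro!: always_eventually close)
  have "continuous_on ?S (\<lambda>z. u t (snd z))"
    by (intro continuous_on_compose2[OF HD(3)] continuous_intros) auto
  then have "((\<lambda>z. u t (snd z)) \<longlongrightarrow> u t r) (at (t, r) within ?S)"
    using z tr by (auto simp: continuous_on_def)
  from tendsto_add[OF 2 this] show "((\<lambda>z. u (fst z) (snd z)) \<longlongrightarrow> u (fst z) (snd z)) (at z within ?S)"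
    by (simp add: tr)
qed

text \<open>Mollified data at time 0 average over times near 0, so a bound on a short interval is
  what they call for; it follows from continuity in the energy norm at 0.\<close>

lemma local_bound: "\<exists>A \<epsilon>. 0 \<le> A \<and> 0 < \<epsilon> \<and> (\<forall>s. \<bar>s\<bar> \<le> \<epsilon> \<longrightarrow> l2 (ux s) \<le> A \<and> l2 (v s) \<le> A)"
proof -
  from order_tendstoD(2)[OF cH[of 0] zero_less_one] obtain d where d: "d > 0"
    "\<And>s. s \<noteq> 0 \<Longrightarrow> \<bar>s\<bar> < d \<Longrightarrow> Hnorm (Hdiff (u s, v s) (u 0, v 0)) < 1"
    by (auto simp: eventually_at dist_real_def)
  define A where "A = sqrt (2 + 2 * (l2 (ux 0))\<^sup>2 + 2 * (l2 (v 0))\<^sup>2)"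
  have A2: "A\<^sup>2 = 2 + 2 * (l2 (ux 0))\<^sup>2 + 2 * (l2 (v 0))\<^sup>2" and A: "A \<ge> 0" by (simp_all add: A_def)
  have "l2 (ux s) \<le> A \<and> l2 (v s) \<le> A" if s: "\<bar>s\<bar> \<le> d / 2" for s
  proof -
    have n: "0 \<le> (l2 (ux 0))\<^sup>2" "0 \<le> (l2 (v 0))\<^sup>2" by simp_all
    have "(l2 (ux s))\<^sup>2 \<le> A\<^sup>2 \<and> (l2 (v s))\<^sup>2 \<le> A\<^sup>2"
    proof (cases "s = 0")
      case True then show ?thesis unfolding A2 using n by simp
    next
      case False
      then have "Hnorm (Hdiff (u s, v s) (u 0, v 0)) < 1" using s d by (intro d(2)) auto
      then have "l2 (\<lambda>r. ux s r - ux 0 r) \<le> 1" "l2 (\<lambda>r. v s r - v 0 r) \<le> 1"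
        using l2_le_Hnorm_Hdiff[OF rd[of s] rd[of 0], of "v s" "v 0"] by auto
      then have "(l2 (\<lambda>r. ux s r - ux 0 r))\<^sup>2 \<le> 1" "(l2 (\<lambda>r. v s r - v 0 r))\<^sup>2 \<le> 1"
        by (auto intro!: power_le_one l2_nonneg)
      then show ?thesis
        using rint_power2_diff(2)[OF HD(1)[of s] HD(1)[of 0] HD(4) HD(4)] rint_power2_diff(2)[OF HD(2)[of s] HD(2)[of 0] HD(5) HD(5)] n
        unfolding A2 by linarith
    qed
    then show ?thesis using A by (auto intro: power2_le_imp_le)
  qed
  then show ?thesis using d A by (intro exI[of _ A] exI[of _ "d / 2"]) auto
qed

text \<open>The first-order system is tested with \<open>\<rho>1 * Z\<close> in the first equation
  and with \<open>\<rho> * Z\<close> in the second, so that the terms with \<open>v\<close> cancel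
  in the sum and a second-order identity for \<open>u\<close> remains. With \<open>Z = z / r\<close>
  the measure \<open>r^2 dr\<close> produces the weights \<open>r * z\<close> and \<open>m\<close>,
  and one integration by parts removes \<open>ux\<close>.\<close>

lemma weak_separated:
  assumes R: "R > 1" and \<rho>: "\<And>s. (\<rho> has_real_derivative \<rho>1 s) (at s)" "\<And>s. (\<rho>1 has_real_derivative \<rho>2 s) (at s)" "continuous_on UNIV \<rho>2"
    "\<And>s. \<bar>s\<bar> \<ge> B \<Longrightarrow> \<rho> s = 0 \<and> \<rho>1 s = 0 \<and> \<rho>2 s = 0"
    and z: "\<And>r. r \<in> {1..R} \<Longrightarrow> (z has_real_derivative z1 r) (at r within {1..R})"
      "\<And>r. r \<in> {1..R} \<Longrightarrow> (z1 has_real_derivative z2 r) (at r within {1..R})" "continuous_on {1..R} z2" "z R = 0" "z1 R = 0"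
  shows "integral {-B..B} (\<lambda>s. \<rho>2 s * integral {1..R} (\<lambda>r. z r * (r * u s r)) +
        \<rho> s * (integral {1..R} (\<lambda>r. z r * ((r * u s r) ^ 5 * inverse r ^ 4)) - integral {1..R} (\<lambda>r. z2 r * (r * u s r))
          - u s 1 * (z1 1 - z 1))) = 0" (is "integral _ ?J = 0")
proof -
  have cz: "continuous_on {1..R} z" by (rule DERIV_continuous_on[OF z(1)])
  have cz1: "continuous_on {1..R} z1" by (rule DERIV_continuous_on[OF z(2)])
  have c\<rho>: "continuous_on S \<rho>" "continuous_on S \<rho>1" "continuous_on S \<rho>2" for S
    using DERIV_continuous_on[OF \<rho>(1)] DERIV_continuous_on[OF \<rho>(2)] \<rho>(3) by (auto intro: continuous_on_subset)
  have ci: "continuous_on {1..R} (\<lambda>r::real. inverse r)" by (intro continuous_intros) auto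
  have cut: "continuous_on {1..R} (u t)" for t by (rule continuous_on_subset[OF HD(3)]) auto
  have "\<exists>Z Z1. (\<forall>r. (Z has_real_derivative Z1 r) (at r)) \<and> continuous_on UNIV Z1 \<and>
    (\<forall>r\<in>{1..R}. Z r = z r * inverse r \<and> Z1 r = z1 r * inverse r - z r * inverse r ^ 2) \<and> (\<forall>r. R \<le> r \<or> r \<le> 0 \<longrightarrow> Z r = 0 \<and> Z1 r = 0)"
  proof (rule C1_compact_extension[OF R, of "\<lambda>r. z r * inverse r" "\<lambda>r. z1 r * inverse r - z r * inverse r ^ 2"])
    fix r assume r: "r \<in> {1..R}"
    then show "((\<lambda>r. z r * inverse r) has_real_derivative z1 r * inverse r - z r * inverse r ^ 2) (at r within {1..R})"
      by (auto intro!: derivative_eq_intros z(1) simp: power2_eq_square)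
  next
    show "continuous_on {1..R} (\<lambda>r. z1 r * inverse r - z r * inverse r ^ 2)" by (intro continuous_intros cz cz1 ci)
  qed (use z in simp_all)
  then obtain Z Z1 where Z': "(\<forall>r. (Z has_real_derivative Z1 r) (at r)) \<and> continuous_on UNIV Z1 \<and>
    (\<forall>r\<in>{1..R}. Z r = z r * inverse r \<and> Z1 r = z1 r * inverse r - z r * inverse r ^ 2) \<and> (\<forall>r. R \<le> r \<or> r \<le> 0 \<longrightarrow> Z r = 0 \<and> Z1 r = 0)" by blast
  have Z: "(Z has_real_derivative Z1 r) (at r)" "continuous_on UNIV Z1" "r \<in> {1..R} \<Longrightarrow> Z r = z r * inverse r" "r \<in> {1..R} \<Longrightarrow> Z1 r = z1 r * inverse r - z r * inverse r ^ 2"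
    "R \<le> r \<or> r \<le> 0 \<Longrightarrow> Z r = 0 \<and> Z1 r = 0" for r using Z' by blast+
  let ?f1 = "\<lambda>(t, r). indicator {1..} r * r\<^sup>2 * (u t r * (\<rho>2 t * Z r) + v t r * (\<rho>1 t * Z r))"
  let ?f2 = "\<lambda>(t, r). indicator {1..} r * r\<^sup>2 * (- v t r * (\<rho>1 t * Z r) + ux t r * (\<rho> t * Z1 r) + (u t r) ^ 5 * (\<rho> t * Z r))"
  have T1: "test_fun (\<lambda>t r. \<rho>1 t * Z r) (\<lambda>t r. \<rho>2 t * Z r) (\<lambda>t r. \<rho>1 t * Z1 r)"
    by (rule test_fun_product[where B = B and R = R]) (use \<rho> Z in auto)
  have T2: "test_fun (\<lambda>t r. \<rho> t * Z r) (\<lambda>t r. \<rho>1 t * Z r) (\<lambda>t r. \<rho> t * Z1 r)"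
    by (rule test_fun_product[where B = B and R = R]) (use \<rho> Z c\<rho> in auto)
  let ?f = "\<lambda>p. ?f1 p + ?f2 p"
  have f: "integrable lborel ?f" "(LINT p|lborel. ?f p) = 0"
    using W1[OF T1] W2[OF T2] by auto
  \<comment> \<open>\<open>m\<close> is \<open>r^2 * Z1\<close>; its value \<open>z1 1 - z 1\<close>
    at 1 is the Robin boundary term.\<close>
  define m where "m r = r * z1 r - z r" for r
  have dm: "(m has_real_derivative r * z2 r) (at r within {1..R})" if "r \<in> {1..R}" for r
    unfolding m_def by (auto intro!: derivative_eq_intros z(1)[OF that] z(2)[OF that])
  have cm: "continuous_on {1..R} m" by (rule DERIV_continuous_on[OF dm])
  define h where "h t r = ux t r * (\<rho> t * m r)" for t r
  define g where "g t r = \<rho>2 t * (z r * (r * u t r)) + \<rho> t * (z r * ((r * u t r) ^ 5 * inverse r ^ 4))" for t r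
  define J where "J = ?J"
  have sec: "?f (t, r) = indicator {1..R} r * (h t r + g t r)" for t r
  proof (cases "r \<in> {1..R}")
    case True
    then have r: "r \<noteq> 0" by auto
    have a: "r\<^sup>2 * Z r = r * z r" using r Z(3)[OF True] by (simp add: power2_eq_square)
    have b: "r\<^sup>2 * Z1 r = m r" using r Z(4)[OF True] by (simp add: m_def power2_eq_square field_simps)
    have c: "(r * u t r) ^ 5 * inverse r ^ 4 = r * (u t r) ^ 5" using r by (simp add: power_mult_distrib field_simps eval_nat_numeral)
    have i: "indicator {1..} r = (1::real)" using True by simp
    have alg: "q * (a * (p2 * Y) + b * (p1 * Y)) + q * (- b * (p1 * Y) + d * (p * Y1) + f * (p * Y)) = a * (p2 * (q * Y)) + d * (p * (q * Y1)) + f * (p * (q * Y))"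
      for q a b d f p p1 p2 Y Y1 :: real by (simp add: algebra_simps)
    have "?f (t, r) = u t r * (\<rho>2 t * (r\<^sup>2 * Z r)) + ux t r * (\<rho> t * (r\<^sup>2 * Z1 r)) + (u t r) ^ 5 * (\<rho> t * (r\<^sup>2 * Z r))"
      unfolding prod.case i mult_1_left by (rule alg)
    also have "\<dots> = h t r + g t r" unfolding a b h_def g_def c by (simp add: algebra_simps)
    finally show ?thesis using True by simp
  next
    case False
    then show ?thesis using Z(5)[of r] by (auto simp: indicator_def)
  qed
  have inner: "(LINT r|lborel. ?f (t, r)) = J t" for t
  proof -
    have cg: "continuous_on {1..R} (g t)" unfolding g_def by (intro continuous_intros cz cut ci)
    have cpm: "continuous_on {1..R} (\<lambda>r. \<rho> t * m r)" by (intro continuous_intros cm)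
    note wcs = weighted_Cauchy_Schwarz[OF HD(1)[of t] HD(4) cpm order_refl, folded h_def]
    have "integrable lebesgue (\<lambda>r. indicator {1..R} r * h t r + indicator {1..R} r * g t r)"
      by (intro Bochner_Integration.integrable_add wcs integrable_lebesgue_continuous_Icc cg)
    then have "(LINT r|lborel. ?f (t, r)) = integral {1..R} (\<lambda>r. h t r + g t r)"
      by (intro lborel_section_integral[OF borel_section[OF f(1)] _ sec]) (simp add: distrib_left)
    also have "\<dots> = integral {1..R} (h t) + integral {1..R} (g t)"
      by (intro integral_add wcs integrable_continuous_real cg)
    also have "integral {1..R} (h t) = u t R * (\<rho> t * m R) - u t 1 * (\<rho> t * m 1) - integral {1..R} (\<lambda>r. \<rho> t * (r * z2 r) * u t r)"
      unfolding h_def using z(3) by (intro radial_by_parts[OF rd HD(4) R] DERIV_cmult dm continuous_intros)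
    also have "integral {1..R} (\<lambda>r. \<rho> t * (r * z2 r) * u t r) = \<rho> t * integral {1..R} (\<lambda>r. z2 r * (r * u t r))"
      by (simp add: mult_ac flip: integral_mult_right)
    also have "integral {1..R} (g t) = \<rho>2 t * integral {1..R} (\<lambda>r. z r * (r * u t r)) + \<rho> t * integral {1..R} (\<lambda>r. z r * ((r * u t r) ^ 5 * inverse r ^ 4))"
      unfolding g_def by (subst integral_add) (auto intro!: integrable_continuous_real continuous_intros cz cut ci)
    finally show ?thesis using z by (simp add: J_def m_def algebra_simps)
  qed
  have cw: "cont2 (\<lambda>s r. r * u s r)" "cont2 (\<lambda>s r. (r * u s r) ^ 5 * inverse r ^ 4)"
    using cont2_u unfolding cont2_def by (auto intro!: continuous_intros)
  have cu1: "continuous_on S (\<lambda>s. u s 1)" for S by (intro cont2_compose[OF cont2_u] continuous_intros) auto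
  have cJ: "continuous_on {-B..B} J"
    unfolding J_def
    by (intro continuous_intros c\<rho> cu1 cont2_pairing_continuous[OF cw(1)] cont2_pairing_continuous[OF cw(2)] cz z(3))
  have J0: "J s = 0" if "B \<le> \<bar>s\<bar>" for s using \<rho>(4)[OF that] by (simp add: J_def)
  have "integral {-B..B} J = (LINT s|lborel. J s)" by (rule integral_supported(1)[OF cJ J0, symmetric])
  also have "\<dots> = (LINT p|lborel. ?f p)" unfolding lborel_prod_integral_fst(1)[OF f(1)] inner ..
  finally have "integral {-B..B} J = 0" unfolding f(2) .
  then show ?thesis unfolding J_def .
qed

text \<open>The first equation says weakly that \<open>v\<close> is the time derivative of
  \<open>u\<close>, which replaces \<open>\<rho>1 * u\<close> by \<open>- \<rho> * v\<close>. Since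
  \<open>\<rho>\<close> is a probability density supported near 0, the bound on \<open>v\<close>
  there passes through the time integral.\<close>

lemma time_separated:
  assumes A: "\<And>s. \<bar>s\<bar> \<le> \<epsilon>0 \<Longrightarrow> l2 (v s) \<le> A"
    and e: "0 < \<epsilon>" "\<epsilon> \<le> \<epsilon>0" "\<epsilon> \<le> B" and R: "R > 1"
    and \<rho>: "\<And>s. (\<rho> has_real_derivative \<rho>1 s) (at s)" "continuous_on UNIV \<rho>1" "\<And>s. \<rho> s \<ge> 0"
      "\<And>s. \<bar>s\<bar> \<ge> \<epsilon> \<Longrightarrow> \<rho> s = 0 \<and> \<rho>1 s = 0" "integral {-B..B} \<rho> = 1"
    and \<zeta>: "\<And>r. r \<in> {1..R} \<Longrightarrow> (\<zeta> has_real_derivative \<zeta>1 r) (at r within {1..R})" "continuous_on {1..R} \<zeta>1" "\<zeta> R = 0" "\<zeta>1 R = 0"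
  shows "\<bar>integral {-B..B} (\<lambda>s. \<rho>1 s * integral {1..R} (\<lambda>r. r * \<zeta> r * (r * u s r)))\<bar> \<le> A * sqrt (integral {1..R} (\<lambda>r. (r * \<zeta> r)\<^sup>2))"
proof -
  have c\<zeta>: "continuous_on {1..R} \<zeta>" by (rule DERIV_continuous_on[OF \<zeta>(1)])
  have c\<rho>: "continuous_on S \<rho>" "continuous_on S \<rho>1" for S
    using DERIV_continuous_on[OF \<rho>(1)] \<rho>(2) by (auto intro: continuous_on_subset)
  have cut: "continuous_on {1..R} (u t)" for t by (rule continuous_on_subset[OF HD(3)]) auto
  have "\<exists>Z Z1. (\<forall>r. (Z has_real_derivative Z1 r) (at r)) \<and> continuous_on UNIV Z1 \<and>
    (\<forall>r\<in>{1..R}. Z r = \<zeta> r \<and> Z1 r = \<zeta>1 r) \<and> (\<forall>r. R \<le> r \<or> r \<le> 0 \<longrightarrow> Z r = 0 \<and> Z1 r = 0)"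
    by (rule C1_compact_extension[OF R, of \<zeta> \<zeta>1]) (simp_all add: \<zeta>)
  then obtain Z Z1 where Z': "(\<forall>r. (Z has_real_derivative Z1 r) (at r)) \<and> continuous_on UNIV Z1 \<and>
    (\<forall>r\<in>{1..R}. Z r = \<zeta> r \<and> Z1 r = \<zeta>1 r) \<and> (\<forall>r. R \<le> r \<or> r \<le> 0 \<longrightarrow> Z r = 0 \<and> Z1 r = 0)" by blast
  have Z: "(Z has_real_derivative Z1 r) (at r)" "continuous_on UNIV Z1" "r \<in> {1..R} \<Longrightarrow> Z r = \<zeta> r" "r \<in> {1..R} \<Longrightarrow> Z1 r = \<zeta>1 r"
    "R \<le> r \<or> r \<le> 0 \<Longrightarrow> Z r = 0 \<and> Z1 r = 0" for r using Z' by blast+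
  have T: "test_fun (\<lambda>t r. \<rho> t * Z r) (\<lambda>t r. \<rho>1 t * Z r) (\<lambda>t r. \<rho> t * Z1 r)"
    by (rule test_fun_product[where B = \<epsilon> and R = R]) (use \<rho> Z in auto)
  let ?f = "\<lambda>(t, r). indicator {1..} r * r\<^sup>2 * (u t r * (\<rho>1 t * Z r) + v t r * (\<rho> t * Z r))"
  have f: "integrable lborel ?f" "(LINT p|lborel. ?f p) = 0" using W1[OF T] by auto
  define a where "a t = integral {1..R} (\<lambda>r. v t r * (r\<^sup>2 * \<zeta> r))" for t
  define c where "c t = \<rho>1 t * integral {1..R} (\<lambda>r. r * \<zeta> r * (r * u t r))" for t
  define q where "q = sqrt (integral {1..R} (\<lambda>r. (r * \<zeta> r)\<^sup>2))"
  have q0: "0 \<le> q" unfolding q_def by (intro real_sqrt_ge_zero integral_nonneg integrable_continuous_real continuous_intros c\<zeta>) auto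
  have cr: "continuous_on {1..R} (\<lambda>r. r\<^sup>2 * \<zeta> r)" by (intro continuous_intros c\<zeta>)
  have inner: "(LINT r|lborel. ?f (t, r)) = \<rho> t * a t + c t" for t
  proof -
    have cg: "continuous_on {1..R} (\<lambda>r. \<rho>1 t * (r * \<zeta> r * (r * u t r)))" by (intro continuous_intros c\<zeta> cut)
    have cpm: "continuous_on {1..R} (\<lambda>r. \<rho> t * (r\<^sup>2 * \<zeta> r))" by (intro continuous_intros cr)
    note wcs = weighted_Cauchy_Schwarz[OF HD(2)[of t] HD(5) cpm order_refl]
    have "integrable lebesgue (\<lambda>r. indicator {1..R} r * (v t r * (\<rho> t * (r\<^sup>2 * \<zeta> r))) + indicator {1..R} r * (\<rho>1 t * (r * \<zeta> r * (r * u t r))))"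
      by (intro Bochner_Integration.integrable_add wcs(1) integrable_lebesgue_continuous_Icc cg)
    moreover have sec: "?f (t, r) = indicator {1..R} r * (v t r * (\<rho> t * (r\<^sup>2 * \<zeta> r)) + \<rho>1 t * (r * \<zeta> r * (r * u t r)))" for r
    proof (cases "r \<in> {1..R}")
      case True then show ?thesis using Z(3)[OF True] by (simp add: algebra_simps power2_eq_square)
    next
      case False then show ?thesis using Z(5)[of r] by (auto simp: indicator_def)
    qed
    ultimately have "(LINT r|lborel. ?f (t, r)) = integral {1..R} (\<lambda>r. v t r * (\<rho> t * (r\<^sup>2 * \<zeta> r)) + \<rho>1 t * (r * \<zeta> r * (r * u t r)))"
      by (intro lborel_section_integral[OF borel_section[OF f(1)] _ sec]) (simp add: distrib_left)
    also have "\<dots> = integral {1..R} (\<lambda>r. v t r * (\<rho> t * (r\<^sup>2 * \<zeta> r))) + integral {1..R} (\<lambda>r. \<rho>1 t * (r * \<zeta> r * (r * u t r)))"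
      by (intro integral_add wcs(2) integrable_continuous_real cg)
    also have "(\<lambda>r. v t r * (\<rho> t * (r\<^sup>2 * \<zeta> r))) = (\<lambda>r. \<rho> t * (v t r * (r\<^sup>2 * \<zeta> r)))" by (simp add: fun_eq_iff)
    finally show ?thesis by (simp add: a_def c_def)
  qed
  have a_le: "\<bar>\<rho> t * a t\<bar> \<le> \<rho> t * (A * q)" for t
  proof (cases "\<bar>t\<bar> \<le> \<epsilon>")
    case True
    have "\<bar>a t\<bar> \<le> l2 (v t) * sqrt (integral {1..R} (\<lambda>r. (r\<^sup>2 * \<zeta> r * inverse r)\<^sup>2))"
      unfolding a_def by (rule weighted_Cauchy_Schwarz(3)[OF HD(2) HD(5) cr order_refl])
    also have "integral {1..R} (\<lambda>r. (r\<^sup>2 * \<zeta> r * inverse r)\<^sup>2) = integral {1..R} (\<lambda>r. (r * \<zeta> r)\<^sup>2)"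
      by (intro integral_cong) (simp add: power2_eq_square)
    also have "l2 (v t) * sqrt (integral {1..R} (\<lambda>r. (r * \<zeta> r)\<^sup>2)) \<le> A * q"
      unfolding q_def[symmetric] using A[of t] True e q0 by (intro mult_right_mono) auto
    finally show ?thesis using \<rho>(3)[of t] by (simp add: abs_mult mult_left_mono)
  next
    case False
    then show ?thesis using \<rho>(4)[of t] by simp
  qed
  have cw: "cont2 (\<lambda>s r. r * u s r)" using cont2_u unfolding cont2_def by (auto intro!: continuous_intros)
  have cc: "continuous_on {-B..B} c"
    unfolding c_def by (intro continuous_intros c\<rho> cont2_pairing_continuous[OF cw] c\<zeta>)
  have c0: "c s = 0" and \<rho>0: "\<rho> s = 0" if "B \<le> \<bar>s\<bar>" for s using \<rho>(4)[of s] e that by (auto simp: c_def)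
  note ic = integral_supported[OF cc c0] and i\<rho> = integral_supported[OF c\<rho>(1) \<rho>0]
  have iI: "integrable lborel (\<lambda>t. \<rho> t * a t + c t)" "(LINT t|lborel. \<rho> t * a t + c t) = 0"
    using lborel_prod_integral_fst[OF f(1)] f(2) unfolding inner by auto
  \<comment> \<open>Integrability of \<open>\<rho> * a\<close> in time is read off from Fubini: the
    sum is integrable, and \<open>c\<close> is continuous with compact support.\<close>
  have ia: "integrable lborel (\<lambda>t. \<rho> t * a t)"
    using Bochner_Integration.integrable_diff[OF iI(1) ic(2)] by simp
  have "(LINT t|lborel. \<rho> t * a t) + integral {-B..B} c = 0"
    using Bochner_Integration.integral_add[OF ia ic(2)] iI(2) ic(1) by simp
  moreover have "\<bar>LINT t|lborel. \<rho> t * a t\<bar> \<le> (LINT t|lborel. \<rho> t * (A * q))"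
  proof (rule order_trans[OF integral_abs_bound integral_mono])
    show "integrable lborel (\<lambda>t. \<bar>\<rho> t * a t\<bar>)" using ia by (rule integrable_abs)
    show "integrable lborel (\<lambda>t. \<rho> t * (A * q))" using i\<rho>(2) by (intro integrable_mult_left) auto
  qed (use a_le in simp)
  moreover have "(LINT t|lborel. \<rho> t * (A * q)) = A * q" using i\<rho> \<rho>(5) by simp
  ultimately show ?thesis unfolding c_def q_def by linarith
qed

lemma weak_wave: "\<exists>A L \<epsilon>0. weak_wave u A L \<epsilon>0"
proof -
  obtain A \<epsilon> where A: "0 \<le> A" "0 < \<epsilon>" and Axv: "\<forall>s. \<bar>s\<bar> \<le> \<epsilon> \<longrightarrow> l2 (ux s) \<le> A \<and> l2 (v s) \<le> A"
    using local_bound by blast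
  have Ax: "l2 (ux s) \<le> A" and Av: "l2 (v s) \<le> A" if "\<bar>s\<bar> \<le> \<epsilon>" for s using Axv that by auto
  define L where "L = enn2real (rint (\<lambda>r. \<bar>u 0 r\<bar> ^ 6))"
  have "weak_wave u A L \<epsilon>"
  proof (rule weak_wave.intro, goal_cases)
    case 1 show ?case by (rule cont2_u)
  next
    case 2 show ?case by (rule A)
  next
    case 3 show ?case by (rule A)
  next
    case (4 B \<rho> \<rho>1 \<rho>2 R z z1 z2)
    then show ?case by (rule weak_separated)
  next
    case (5 B \<epsilon>' \<rho> \<rho>1 R \<zeta> \<zeta>1)
    with Av show ?case by (rule time_separated)
  next
    \<comment> \<open>The dual bound in \<open>space\<close> is the pairing of \<open>ux\<close>
      with \<open>m\<close>, rewritten by parts so that \<open>ux\<close> disappears.\<close>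
    case (6 s R m m')
    have cm: "continuous_on {1..R} m" by (rule DERIV_continuous_on[OF 6(3)])
    have I: "\<bar>integral {1..R} (\<lambda>r. ux s r * m r)\<bar> \<le> l2 (ux s) * sqrt (integral {1..R} (\<lambda>r. (m r * inverse r)\<^sup>2))"
      by (rule weighted_Cauchy_Schwarz(3)[OF HD(1) HD(4) cm order_refl])
    have "continuous_on {1..R} (\<lambda>r::real. inverse r)" by (intro continuous_intros) auto
    then have "l2 (ux s) * sqrt (integral {1..R} (\<lambda>r. (m r * inverse r)\<^sup>2)) \<le> A * sqrt (integral {1..R} (\<lambda>r. (m r * inverse r)\<^sup>2))"
      using Ax[OF 6(1)] cm by (intro mult_right_mono real_sqrt_ge_zero integral_nonneg integrable_continuous_real continuous_intros) auto
    with I have "\<bar>integral {1..R} (\<lambda>r. ux s r * m r)\<bar> \<le> A * sqrt (integral {1..R} (\<lambda>r. (m r * inverse r)\<^sup>2))" by linarith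
    moreover have bp: "integral {1..R} (\<lambda>r. ux s r * m r) = u s R * m R - u s 1 * m 1 - integral {1..R} (\<lambda>r. m' r * u s r)"
      by (rule radial_by_parts[OF rd HD(4) 6(2) _ 6(4)]) (rule 6(3))
    ultimately show ?case by (simp only: bp)
  next
    case (7 s r)
    have "r * (u s r)\<^sup>2 \<le> (l2 (ux s))\<^sup>2" using radial_pointwise[OF rd[of s] HD(4)[of s] HD(6)[of s] 7(2)] .
    also have "\<dots> \<le> A\<^sup>2" using Ax[OF 7(1)] l2_nonneg by (intro power_mono)
    finally show ?case .
  next
    case (8 R)
    have cu0: "continuous_on {1..R} (\<lambda>r. (u 0 r) ^ 6 * r\<^sup>2)" by (intro continuous_intros continuous_on_subset[OF HD(3)]) auto
    have "ennreal (integral {1..R} (\<lambda>r. (u 0 r) ^ 6 * r\<^sup>2)) = (\<integral>\<^sup>+r. ennreal ((u 0 r) ^ 6 * r\<^sup>2) * indicator {1..R} r \<partial>lborel)"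
      by (rule nn_integral_has_integral_lebesgue'[symmetric]) (auto intro!: integrable_integral integrable_continuous_real cu0)
    also have "\<dots> \<le> rint (\<lambda>r. \<bar>u 0 r\<bar> ^ 6)"
      unfolding rint_def
    proof (rule nn_integral_mono)
      fix r
      have "1 * ((u 0 r) ^ 6 * r\<^sup>2) \<le> (4 * pi) * ((u 0 r) ^ 6 * r\<^sup>2)" using pi_gt3 by (intro mult_right_mono) auto
      then have "ennreal ((u 0 r) ^ 6 * r\<^sup>2) \<le> ennreal (4 * pi * r\<^sup>2 * \<bar>u 0 r\<bar> ^ 6)" by (intro ennreal_leI) (simp add: mult_ac)
      then show "ennreal ((u 0 r) ^ 6 * r\<^sup>2) * indicator {1..R} r \<le> ennreal (4 * pi * r\<^sup>2 * \<bar>u 0 r\<bar> ^ 6) * indicator {1..} r"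
        by (auto simp: indicator_def)
    qed
    also have "\<dots> = ennreal L" using HD(6)[of 0] by (simp add: L_def)
    finally show ?case by (simp add: L_def ennreal_le_iff)
  qed
  then show ?thesis by blast
qed

end

text \<open>The equation is of second order in time: reflection changes the sign of
  \<open>\<rho>1\<close> but not of \<open>\<rho>\<close> and \<open>\<rho>2\<close>, and the bound
  on \<open>u_t\<close> concerns an absolute value. So the estimates for positive times also cover
  negative ones.\<close>

lemma weak_wave_reflect:
  assumes "weak_wave u A L \<epsilon>0"
  shows "weak_wave (\<lambda>t. u (- t)) A L \<epsilon>0"
proof -
  interpret weak_wave u A L \<epsilon>0 by fact
  have d: "((\<lambda>s. f (- s)) has_real_derivative - f' (- s)) (at s)" if "\<And>s. (f has_real_derivative f' s) (at s)" for f f' :: "real \<Rightarrow> real" and s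
  proof -
    have "(uminus has_real_derivative - 1) (at s)" by (auto intro!: derivative_eq_intros)
    from DERIV_chain2[where f = f and g = uminus, OF that this] show ?thesis by simp
  qed
  have r: "integral {-B..B} (\<lambda>s. f (- s)) = integral {-B..B} f" for B and f :: "real \<Rightarrow> real"
    using Henstock_Kurzweil_Integration.integral_reflect_real[of B "-B" f] by simp
  have cm: "continuous_on UNIV (\<lambda>s. f (- s))" if "continuous_on UNIV f" for f :: "real \<Rightarrow> real"
    by (intro continuous_on_compose2[OF that] continuous_intros) auto
  show ?thesis
  proof (rule weak_wave.intro, goal_cases)
    case 1
    show ?case unfolding cont2_def by (intro cont2_compose[OF cu] continuous_intros) auto
  next
    case 2 show ?case by (rule A)
  next
    case 3 show ?case by (rule \<epsilon>0)
  next
    case (4 B \<rho> \<rho>1 \<rho>2 R z z1 z2)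
    have "integral {-B..B} (\<lambda>s. \<rho>2 (- s) * integral {1..R} (\<lambda>r. z r * (r * u s r)) +
        \<rho> (- s) * (integral {1..R} (\<lambda>r. z r * ((r * u s r) ^ 5 * inverse r ^ 4)) - integral {1..R} (\<lambda>r. z2 r * (r * u s r))
          - u s 1 * (z1 1 - z 1))) = 0"
    proof (rule weak[OF 4(1) _ _ _ _ 4(6-10)])
      show "((\<lambda>s. \<rho> (- s)) has_real_derivative - \<rho>1 (- s)) (at s)" for s by (rule d[OF 4(2)])
      show "((\<lambda>s. - \<rho>1 (- s)) has_real_derivative \<rho>2 (- s)) (at s)" for s using DERIV_minus[OF d[OF 4(3), of s]] by simp
      show "continuous_on UNIV (\<lambda>s. \<rho>2 (- s))" by (rule cm[OF 4(4)])
      show "\<rho> (- s) = 0 \<and> - \<rho>1 (- s) = 0 \<and> \<rho>2 (- s) = 0" if "B \<le> \<bar>s\<bar>" for s using 4(5)[of "- s"] that by simp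
    qed
    then show ?case by (subst (asm) r[symmetric]) simp
  next
    case (5 B \<epsilon> \<rho> \<rho>1 R \<zeta> \<zeta>1)
    have "\<bar>integral {-B..B} (\<lambda>s. - \<rho>1 (- s) * integral {1..R} (\<lambda>r. r * \<zeta> r * (r * u s r)))\<bar> \<le> A * sqrt (integral {1..R} (\<lambda>r. (r * \<zeta> r)\<^sup>2))"
    proof (rule time[OF 5(1-4) _ _ _ _ _ 5(10-13)])
      show "((\<lambda>s. \<rho> (- s)) has_real_derivative - \<rho>1 (- s)) (at s)" for s by (rule d[OF 5(5)])
      show "continuous_on UNIV (\<lambda>s. - \<rho>1 (- s))" by (intro continuous_intros cm 5(6))
      show "0 \<le> \<rho> (- s)" for s by (rule 5(7))
      show "\<rho> (- s) = 0 \<and> - \<rho>1 (- s) = 0" if "\<epsilon> \<le> \<bar>s\<bar>" for s using 5(8)[of "- s"] that by simp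
      show "integral {-B..B} (\<lambda>s. \<rho> (- s)) = 1" using 5(9) r by simp
    qed
    then show ?case by (subst (asm) r[symmetric]) simp
  next
    case (6 s R m m') then show ?case by (intro space) auto
  next
    case (7 s r) then show ?case by (intro point) auto
  next
    case (8 R) then show ?case using six by simp
  qed
qed

section \<open>Scattering\<close>

context weak_wave
begin

text \<open>The right-hand side depends on \<open>T\<close> and \<open>R\<close> in no way: the size
  of the triangle and all tolerances are chosen after them. Its three summands come from
  \<open>N_integral\<close>, from the Morawetz bulk and from the approximation errors.\<close>

lemma truncated_bound:
  assumes T: "0 \<le> T" and R: "1 \<le> R"
  shows "(\<integral>\<^sup>+t. ennreal (sqrt (integral {1..R} (\<lambda>r. (u t r) ^ 10 * r\<^sup>2))) * indicator {0..T} t \<partial>lborel)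
    \<le> ennreal (432 * (10 ^ 5 * (3 * (C0 + 1)) ^ 3)\<^sup>2 + 100 * (3 * (C0 + 1)) + 2)"
proof -
  \<comment> \<open>The rectangle \<open>[0, T] \<times> [1, R]\<close> then lies in
    \<open>t + r \<le> X - 1\<close>, where the cone majorant applies.\<close>
  define X where "X = T + R + 2"
  have X: "X \<ge> 2" using T R by (simp add: X_def)
  define \<delta> where "\<delta> = inverse (X\<^sup>2)"
  have \<delta>: "0 < \<delta>" "\<delta> * X\<^sup>2 \<le> 1" using X by (auto simp: \<delta>_def)
  \<comment> \<open>Chosen so that \<open>T * e\<close> and \<open>T * (e * R)\<close>, the errors
    in the supremum and in the sixth-power integral, are at most 1 each.\<close>
  define e where "e = inverse ((T + 1) * R)"
  have e: "0 < e" using T R by (simp add: e_def)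
  have eTR: "T * (e * R) \<le> 1" and eT: "T * e \<le> 1"
  proof -
    have eR: "e * R = inverse (T + 1)" using R by (simp add: e_def)
    have "T * (e * R) = T / (T + 1)" unfolding eR by (simp add: divide_inverse)
    then show 1: "T * (e * R) \<le> 1" using T by simp
    have "e * 1 \<le> e * R" using R e by (intro mult_left_mono) auto
    then have "T * e \<le> T * (e * R)" using T by (intro mult_left_mono) auto
    with 1 show "T * e \<le> 1" by linarith
  qed
  let ?K = "cbox (0, 1) (X, X) :: (real \<times> real) set"
  have "continuous_on ?K (\<lambda>z. w (fst z) (snd z))"
    by (intro cont2_compose[OF cw] continuous_intros) (auto simp: cbox_Pair_eq)
  then have "bounded ((\<lambda>z. w (fst z) (snd z)) ` ?K)"
    by (intro compact_imp_bounded compact_continuous_image compact_cbox)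
  then obtain M0 where M0: "\<And>z. z \<in> ?K \<Longrightarrow> \<bar>w (fst z) (snd z)\<bar> \<le> M0" unfolding bounded_iff by auto
  define M where "M = M0 + 1"
  obtain d4 where d4: "d4 > 0" "\<And>a b. \<bar>a\<bar> \<le> M \<Longrightarrow> \<bar>b\<bar> \<le> M \<Longrightarrow> \<bar>a - b\<bar> \<le> d4 \<Longrightarrow> \<bar>a ^ 4 - b ^ 4\<bar> \<le> e"
    using power_uniformly_close[OF e, of M 4] by auto
  obtain d6 where d6: "d6 > 0" "\<And>a b. \<bar>a\<bar> \<le> M \<Longrightarrow> \<bar>b\<bar> \<le> M \<Longrightarrow> \<bar>a - b\<bar> \<le> d6 \<Longrightarrow> \<bar>a ^ 6 - b ^ 6\<bar> \<le> e"
    using power_uniformly_close[OF e, of M 6] by auto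
  define \<eta> where "\<eta> = min 1 (min d4 d6)"
  have \<eta>: "\<eta> > 0" using d4 d6 by (simp add: \<eta>_def)
  from approximation[OF X \<delta> \<eta>] obtain W Wt Wr Wtt Wtr Wrr where aw: "approx_wave W Wt Wr Wtt Wtr Wrr X \<delta> C0"
    and cl: "\<And>t r. 0 \<le> t \<Longrightarrow> t \<le> X \<Longrightarrow> 1 \<le> r \<Longrightarrow> r \<le> X \<Longrightarrow> \<bar>W t r - r * u t r\<bar> \<le> \<eta>" by blast
  interpret a: approx_wave W Wt Wr Wtt Wtr Wrr X \<delta> C0 by (rule aw)
  have K: "a.K = 3 * (C0 + 1)" by (rule a.K_def)
  have close: "w t r ^ 4 \<le> W t r ^ 4 + e" "w t r ^ 6 \<le> W t r ^ 6 + e" if tr: "0 \<le> t" "t \<le> T" "1 \<le> r" "r \<le> R" for t r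
  proof -
    have in_box: "0 \<le> t" "t \<le> X" "1 \<le> r" "r \<le> X" using tr T R by (auto simp: X_def)
    then have wM: "\<bar>w t r\<bar> \<le> M0" using M0[of "(t, r)"] by (auto simp: cbox_Pair_eq)
    have c: "\<bar>W t r - w t r\<bar> \<le> \<eta>" using cl[OF in_box] by (simp add: w_def)
    then have "\<bar>w t r\<bar> \<le> M" "\<bar>W t r\<bar> \<le> M" "\<bar>w t r - W t r\<bar> \<le> d4" "\<bar>w t r - W t r\<bar> \<le> d6"
      using wM by (auto simp: M_def \<eta>_def)
    then have "\<bar>w t r ^ 4 - W t r ^ 4\<bar> \<le> e" "\<bar>w t r ^ 6 - W t r ^ 6\<bar> \<le> e" using d4(2) d6(2) by blast+
    then show "w t r ^ 4 \<le> W t r ^ 4 + e" "w t r ^ 6 \<le> W t r ^ 6 + e" by linarith+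
  qed
  have ci: "continuous_on {1..S} (\<lambda>r::real. inverse r)" for S by (intro continuous_intros) auto
  have cu': "continuous_on {1..S} (u t)" for S t by (intro cont2_compose[OF cu] continuous_intros) auto
  have cW: "continuous_on {1..S} (W t)" for S t by (intro cont2_compose[OF a.cont(1)] continuous_intros) auto
  have inv1: "0 \<le> inverse r ^ n" "inverse r ^ n \<le> 1" if "1 \<le> r" for r :: real and n
  proof -
    have "inverse r \<le> 1" using that by (simp add: inverse_le_1_iff)
    then show "inverse r ^ n \<le> 1" using that by (intro power_le_one) auto
    show "0 \<le> inverse r ^ n" using that by (intro zero_le_power) auto
  qed
  define b where "b t = integral {1..R} (\<lambda>r. (u t r) ^ 6 * r)" for t
  define c where "c t = integral {1..X - t} (\<lambda>r. W t r ^ 6 * inverse r ^ 5)" for t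
  have cu6: "continuous_on {1..R} (\<lambda>r. (u t r) ^ 6 * r)" for t by (intro continuous_intros cu')
  have b0: "0 \<le> b t" for t
    unfolding b_def by (intro integral_nonneg integrable_continuous_real cu6) auto
  have cW6: "cont2 (\<lambda>t r. W t r ^ 6 * inverse r ^ 5)"
    using a.cont(1) unfolding cont2_def by (intro continuous_intros) auto
  have c0: "0 \<le> c t" for t
    unfolding c_def by (intro integral_nonneg integrable_continuous_real continuous_intros cW ci) (auto intro!: mult_nonneg_nonneg)
  have b_le: "b t \<le> c t + e * R" if t: "0 \<le> t" "t \<le> T" for t
  proof -
    have "b t \<le> integral {1..R} (\<lambda>r. W t r ^ 6 * inverse r ^ 5 + e)"
      unfolding b_def
    proof (rule integral_le)
      show "(\<lambda>r. (u t r) ^ 6 * r) integrable_on {1..R}" by (intro integrable_continuous_real cu6)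
      show "(\<lambda>r. W t r ^ 6 * inverse r ^ 5 + e) integrable_on {1..R}" by (intro integrable_continuous_real continuous_intros cW ci)
      fix r assume r: "r \<in> {1..R}"
      then have "(u t r) ^ 6 * r = w t r ^ 6 * inverse r ^ 5"
        by (simp add: w_def power_mult_distrib field_simps eval_nat_numeral)
      also have "\<dots> \<le> (W t r ^ 6 + e) * inverse r ^ 5"
        using close(2)[OF t] inv1 r by (intro mult_right_mono) auto
      also have "\<dots> \<le> W t r ^ 6 * inverse r ^ 5 + e"
        using mult_left_mono[OF inv1(2)[of r 5], of e] r e by (simp add: distrib_right)
      finally show "(u t r) ^ 6 * r \<le> W t r ^ 6 * inverse r ^ 5 + e" .
    qed
    also have "\<dots> = integral {1..R} (\<lambda>r. W t r ^ 6 * inverse r ^ 5) + integral {1..R} (\<lambda>r. e)"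
      by (intro integral_add integrable_continuous_real continuous_intros cW ci)
    also have "integral {1..R} (\<lambda>r. W t r ^ 6 * inverse r ^ 5) \<le> c t"
      unfolding c_def using t by (intro integral_subset_le integrable_continuous_real continuous_intros cW ci) (auto simp: X_def intro!: mult_nonneg_nonneg)
    also have "integral {1..R} (\<lambda>r. e) \<le> e * R" using R e by (simp add: algebra_simps)
    finally show ?thesis by linarith
  qed
  \<comment> \<open>Where \<open>a.N t\<close> is infinite the bound is trivial. Elsewhere
    \<open>n + e\<close> bounds \<open>u^4 * r\<close> on \<open>[1, R]\<close>, and a product of
    nonnegative numbers is at most the square of their sum.\<close>
  have point: "ennreal (sqrt (integral {1..R} (\<lambda>r. (u t r) ^ 10 * r\<^sup>2))) * indicator {0..T} t
      \<le> a.N t + ennreal (c t) * indicator {0..X - 1} t + ennreal (e + e * R) * indicator {0..T} t" for t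
  proof (cases "t \<in> {0..T}")
    case True
    then have t: "0 \<le> t" "t \<le> T" by auto
    have "ennreal (sqrt (integral {1..R} (\<lambda>r. (u t r) ^ 10 * r\<^sup>2))) \<le> a.N t + ennreal (c t + (e + e * R))"
    proof (cases "a.N t" rule: ennreal_cases)
      case (real n)
      have u4: "(u t r) ^ 4 * r \<le> n + e" if r: "1 \<le> r" "r \<le> R" for r
      proof -
        have "ennreal (W t r ^ 4 / r ^ 3) \<le> ennreal n"
          using a.sup_power4_le[of t r] r t T R real by (simp add: X_def)
        then have Wn: "W t r ^ 4 * inverse r ^ 3 \<le> n" using real by (simp add: ennreal_le_iff divide_inverse power_inverse)
        have "(u t r) ^ 4 * r = w t r ^ 4 * inverse r ^ 3"
          using r by (simp add: w_def power_mult_distrib field_simps eval_nat_numeral)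
        also have "\<dots> \<le> (W t r ^ 4 + e) * inverse r ^ 3"
          using close(1)[OF t r] inv1 r by (intro mult_right_mono) auto
        also have "\<dots> \<le> W t r ^ 4 * inverse r ^ 3 + e"
          using mult_left_mono[OF inv1(2)[of r 3], of e] r e by (simp add: distrib_right)
        finally show ?thesis using Wn by linarith
      qed
      have "integral {1..R} (\<lambda>r. (u t r) ^ 10 * r\<^sup>2) \<le> integral {1..R} (\<lambda>r. (n + e) * ((u t r) ^ 6 * r))"
      proof (rule integral_le)
        show "(\<lambda>r. (u t r) ^ 10 * r\<^sup>2) integrable_on {1..R}" "(\<lambda>r. (n + e) * ((u t r) ^ 6 * r)) integrable_on {1..R}"
          by (intro integrable_continuous_real continuous_intros cu')+
        fix r assume r: "r \<in> {1..R}"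
        have "(u t r) ^ 10 * r\<^sup>2 = ((u t r) ^ 4 * r) * ((u t r) ^ 6 * r)" by (simp add: power2_eq_square eval_nat_numeral)
        also have "\<dots> \<le> (n + e) * ((u t r) ^ 6 * r)" using u4[of r] r by (intro mult_right_mono) auto
        finally show "(u t r) ^ 10 * r\<^sup>2 \<le> (n + e) * ((u t r) ^ 6 * r)" .
      qed
      also have "\<dots> = (n + e) * b t" by (simp add: b_def)
      also have "\<dots> \<le> ((n + e) + b t)\<^sup>2"
      proof -
        have "0 \<le> (n + e) * b t" using real e b0[of t] by (intro mult_nonneg_nonneg) auto
        moreover have "2 * (n + e) * b t = 2 * ((n + e) * b t)" by simp
        moreover have "0 \<le> (n + e)\<^sup>2" "0 \<le> (b t)\<^sup>2" by simp_all
        ultimately show ?thesis unfolding power2_sum[of "n + e" "b t"] by linarith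
      qed
      finally have "sqrt (integral {1..R} (\<lambda>r. (u t r) ^ 10 * r\<^sup>2)) \<le> (n + e) + b t"
        using real e b0[of t] by (intro real_le_lsqrt) auto
      also have "\<dots> \<le> n + (c t + (e + e * R))" using b_le[OF t] by linarith
      finally have "ennreal (sqrt (integral {1..R} (\<lambda>r. (u t r) ^ 10 * r\<^sup>2))) \<le> ennreal (n + (c t + (e + e * R)))" by (rule ennreal_leI)
      also have "\<dots> = a.N t + ennreal (c t + (e + e * R))" using real c0[of t] e R by (subst ennreal_plus) auto
      finally show ?thesis .
    qed simp
    also have "ennreal (c t + (e + e * R)) = ennreal (c t) + ennreal (e + e * R)" using c0[of t] e R by (subst ennreal_plus) auto
    finally show ?thesis using True R by (simp add: X_def add.assoc)
  qed simp
  have cc: "(c has_integral tri_int (\<lambda>t r. W t r ^ 6 * inverse r ^ 5) X) {0..X - 1}"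
    unfolding c_def by (rule tri_int_t[OF cW6])
  have cc_nn: "(\<integral>\<^sup>+t. ennreal (c t) * indicator {0..X - 1} t \<partial>lborel) = ennreal (tri_int (\<lambda>t r. W t r ^ 6 * inverse r ^ 5) X)"
    by (rule nn_integral_has_integral_lebesgue'[OF _ cc]) (rule c0)
  \<comment> \<open>\<open>c\<close> is known as a Henstock-Kurzweil integrable function of time;
    being nonnegative it is absolutely integrable, hence measurable for the completion, over which
    the sum is then integrated.\<close>
  have cm: "(\<lambda>t. ennreal (c t) * indicator {0..X - 1} t) \<in> borel_measurable lebesgue"
  proof -
    have "c integrable_on {0..X - 1}" using cc by blast
    then have "(\<lambda>t. c t) absolutely_integrable_on {0..X - 1}" by (rule nonnegative_absolutely_integrable_1) (rule c0)
    then have "(\<lambda>t. indicator {0..X - 1} t * c t) \<in> borel_measurable lebesgue"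
      unfolding set_integrable_def using borel_measurable_integrable by fastforce
    then have "(\<lambda>t. ennreal (indicator {0..X - 1} t * c t)) \<in> borel_measurable lebesgue" by measurable
    moreover have "(\<lambda>t. ennreal (indicator {0..X - 1} t * c t)) = (\<lambda>t. ennreal (c t) * indicator {0..X - 1} t)"
      by (auto simp: fun_eq_iff indicator_def)
    ultimately show ?thesis by simp
  qed
  have Nm: "a.N \<in> borel_measurable lebesgue" by (rule measurable_completion) (simp add: a.N_measurable)
  have im: "(\<lambda>t. ennreal (e + e * R) * indicator {0..T} t) \<in> borel_measurable lebesgue"
    by (rule measurable_completion) measurable
  have "(\<integral>\<^sup>+t. ennreal (sqrt (integral {1..R} (\<lambda>r. (u t r) ^ 10 * r\<^sup>2))) * indicator {0..T} t \<partial>lborel)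
      \<le> (\<integral>\<^sup>+t. a.N t + ennreal (c t) * indicator {0..X - 1} t + ennreal (e + e * R) * indicator {0..T} t \<partial>lebesgue)"
    unfolding nn_integral_completion by (rule nn_integral_mono) (rule point)
  also have "\<dots> = (\<integral>\<^sup>+t. a.N t \<partial>lborel) + ennreal (tri_int (\<lambda>t r. W t r ^ 6 * inverse r ^ 5) X) + (\<integral>\<^sup>+t. ennreal (e + e * R) * indicator {0..T} t \<partial>lborel)"
  proof -
    have 1: "(\<lambda>t. a.N t + ennreal (c t) * indicator {0..X - 1} t) \<in> borel_measurable lebesgue"
      using Nm cm by (rule borel_measurable_add)
    show ?thesis
      unfolding nn_integral_add[OF 1 im] nn_integral_add[OF Nm cm]
      unfolding nn_integral_completion cc_nn ..
  qed
  also have "\<dots> \<le> ennreal (432 * (10 ^ 5 * a.K ^ 3)\<^sup>2) + ennreal (100 * a.K) + ennreal 2"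
  proof (intro add_mono a.N_integral ennreal_leI a.Morawetz(2))
    have "(\<integral>\<^sup>+t. ennreal (e + e * R) * indicator {0..T} t \<partial>lborel) = ennreal ((e + e * R) * T)"
      using T e R by (subst nn_integral_cmult_indicator) (auto simp: ennreal_mult)
    also have "\<dots> \<le> ennreal 2" using eTR eT by (intro ennreal_leI) (simp add: algebra_simps)
    finally show "(\<integral>\<^sup>+t. ennreal (e + e * R) * indicator {0..T} t \<partial>lborel) \<le> ennreal 2" .
  qed
  also have "\<dots> = ennreal (432 * (10 ^ 5 * a.K ^ 3)\<^sup>2 + 100 * a.K + 2)"
    using a.K_ge by (simp add: ennreal_plus)
  finally show ?thesis unfolding K .
qed

text \<open>The uniform truncated bound with \<open>T = n\<close> and \<open>R = 1 + n\<close>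
  passes to the limit by Fatou's lemma. Measurability in time is that of a limit of continuous
  functions.\<close>

lemma half_line_bound:
  assumes fin: "\<And>t. rint (\<lambda>r. \<bar>u t r\<bar> ^ 10) < \<infinity>"
  shows "(\<lambda>t. sqrt (enn2real (rint (\<lambda>r. \<bar>u t r\<bar> ^ 10)))) \<in> borel_measurable borel"
    and "(\<integral>\<^sup>+t. ennreal (sqrt (enn2real (rint (\<lambda>r. \<bar>u t r\<bar> ^ 10)))) * indicator {0..} t \<partial>lborel) < \<infinity>"
proof -
  define J where "J n t = integral {1..1 + real n} (\<lambda>r. (u t r) ^ 10 * r\<^sup>2)" for n t
  define g where "g = (\<lambda>t. sqrt (enn2real (rint (\<lambda>r. \<bar>u t r\<bar> ^ 10))))"
  have cu': "continuous_on {1..S} (u t)" for S t by (intro cont2_compose[OF cu] continuous_intros) auto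
  have J0: "0 \<le> J n t" for n t
    unfolding J_def by (intro integral_nonneg integrable_continuous_real continuous_intros cu') auto
  have cJ: "continuous_on UNIV (J n)" for n
  proof -
    have "cont2 (\<lambda>t r. (u t r) ^ 10)" using cu unfolding cont2_def by (intro continuous_intros)
    from cont2_pairing_continuous[OF this, of "1 + real n" "\<lambda>r. r\<^sup>2" UNIV] show ?thesis
      by (simp add: J_def mult.commute continuous_intros)
  qed
  have lim: "(\<lambda>n. sqrt (4 * pi * J n t)) \<longlonglongrightarrow> g t" for t
  proof -
    have J_eq: "ennreal (4 * pi * J n t) = (\<integral>\<^sup>+r. ennreal (4 * pi * r\<^sup>2 * \<bar>u t r\<bar> ^ 10) * indicator {1..1 + real n} r \<partial>lborel)" for n
    proof -
      have "((\<lambda>r. 4 * pi * ((u t r) ^ 10 * r\<^sup>2)) has_integral 4 * pi * J n t) {1..1 + real n}"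
        unfolding J_def by (intro has_integral_mult_right integrable_integral integrable_continuous_real continuous_intros cu')
      from nn_integral_has_integral_lebesgue'[OF _ this]
      show ?thesis by (simp add: mult_ac power_even_abs)
    qed
    have "(\<lambda>n. \<integral>\<^sup>+r. ennreal (4 * pi * r\<^sup>2 * \<bar>u t r\<bar> ^ 10) * indicator {1..1 + real n} r \<partial>lborel) \<longlonglongrightarrow> rint (\<lambda>r. \<bar>u t r\<bar> ^ 10)"
      unfolding rint_def
    proof (rule nn_integral_LIMSEQ)
      show "incseq (\<lambda>n r. ennreal (4 * pi * r\<^sup>2 * \<bar>u t r\<bar> ^ 10) * indicator {1..1 + real n} r)"
        by (auto simp: incseq_def le_fun_def indicator_def)
      show "(\<lambda>r. ennreal (4 * pi * r\<^sup>2 * \<bar>u t r\<bar> ^ 10) * indicator {1..1 + real n} r) \<in> borel_measurable lborel" for n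
      proof -
        have "(\<lambda>r. indicator {1..1 + real n} r *\<^sub>R (4 * pi * r\<^sup>2 * \<bar>u t r\<bar> ^ 10)) \<in> borel_measurable borel"
          by (intro borel_measurable_continuous_on_indicator continuous_intros cu') auto
        then have "(\<lambda>r. ennreal (indicator {1..1 + real n} r *\<^sub>R (4 * pi * r\<^sup>2 * \<bar>u t r\<bar> ^ 10))) \<in> borel_measurable borel" by measurable
        moreover have "(\<lambda>r. ennreal (indicator {1..1 + real n} r *\<^sub>R (4 * pi * r\<^sup>2 * \<bar>u t r\<bar> ^ 10))) = (\<lambda>r. ennreal (4 * pi * r\<^sup>2 * \<bar>u t r\<bar> ^ 10) * indicator {1..1 + real n} r)"
          by (auto simp: fun_eq_iff indicator_def)
        ultimately show ?thesis by (simp only: measurable_lborel1 measurable_lborel2)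
      qed
      fix r :: real
      obtain m where m: "r \<le> real m" using real_arch_simple by blast
      have "\<forall>\<^sub>F n in sequentially. ennreal (4 * pi * r\<^sup>2 * \<bar>u t r\<bar> ^ 10) * indicator {1..1 + real n} r = ennreal (4 * pi * r\<^sup>2 * \<bar>u t r\<bar> ^ 10) * indicator {1..} r"
        using eventually_ge_at_top[of m] by eventually_elim (use m in \<open>auto simp: indicator_def\<close>)
      then show "(\<lambda>n. ennreal (4 * pi * r\<^sup>2 * \<bar>u t r\<bar> ^ 10) * indicator {1..1 + real n} r) \<longlonglongrightarrow> ennreal (4 * pi * r\<^sup>2 * \<bar>u t r\<bar> ^ 10) * indicator {1..} r"
        by (rule tendsto_eventually)
    qed
    then have "(\<lambda>n. ennreal (4 * pi * J n t)) \<longlonglongrightarrow> ennreal (enn2real (rint (\<lambda>r. \<bar>u t r\<bar> ^ 10)))"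
      unfolding J_eq using fin[of t] by simp
    then have "(\<lambda>n. 4 * pi * J n t) \<longlonglongrightarrow> enn2real (rint (\<lambda>r. \<bar>u t r\<bar> ^ 10))"
      by (subst (asm) tendsto_ennreal_iff) (auto intro!: always_eventually mult_nonneg_nonneg J0)
    then show ?thesis unfolding g_def by (rule tendsto_real_sqrt)
  qed
  have mJ: "(\<lambda>t. sqrt (4 * pi * J n t)) \<in> borel_measurable borel" for n
    by (intro borel_measurable_continuous_onI continuous_intros cJ)
  have "g \<in> borel_measurable borel" by (rule borel_measurable_LIMSEQ_real[OF lim mJ])
  then show "(\<lambda>t. sqrt (enn2real (rint (\<lambda>r. \<bar>u t r\<bar> ^ 10)))) \<in> borel_measurable borel" unfolding g_def .
  define C where "C = 432 * (10 ^ 5 * (3 * (C0 + 1)) ^ 3)\<^sup>2 + 100 * (3 * (C0 + 1)) + 2"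
  define f where "f n t = ennreal (sqrt (4 * pi * J n t)) * indicator {0..real n} t" for n t
  have flim: "liminf (\<lambda>n. f n t) = ennreal (g t) * indicator {0..} t" for t
  proof (rule lim_imp_Liminf)
    show "(\<lambda>n. f n t) \<longlonglongrightarrow> ennreal (g t) * indicator {0..} t"
    proof (cases "0 \<le> t")
      case True
      obtain m where m: "t \<le> real m" using real_arch_simple by blast
      have "\<forall>\<^sub>F n in sequentially. ennreal (sqrt (4 * pi * J n t)) = f n t"
        using eventually_ge_at_top[of m] by eventually_elim (use m True in \<open>auto simp: f_def indicator_def\<close>)
      then have "(\<lambda>n. f n t) \<longlonglongrightarrow> ennreal (g t)"
        by (rule Lim_transform_eventually[OF tendsto_ennrealI[OF lim]])
      then show ?thesis using True by simp
    qed (simp add: f_def)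
  qed simp
  have fint: "(\<integral>\<^sup>+t. f n t \<partial>lborel) \<le> 4 * ennreal C" for n
  proof -
    \<comment> \<open>The factor 4 covers the normalisation \<open>4 * pi\<close> of
      \<open>rint\<close>, since \<open>4 * pi \<le> 16\<close>.\<close>
    have "sqrt (4 * pi * x) \<le> 4 * sqrt x" if "0 \<le> x" for x
    proof -
      have "4 * pi * x \<le> 16 * x" using pi_less_4 that by (intro mult_right_mono) auto
      then have "sqrt (4 * pi * x) \<le> sqrt (16 * x)" by (rule real_sqrt_le_mono)
      also have "sqrt (16 * x) = 4 * sqrt x" by (simp add: real_sqrt_mult)
      finally show ?thesis .
    qed
    then have "ennreal (sqrt (4 * pi * J n t)) \<le> 4 * ennreal (sqrt (J n t))" for t
      using ennreal_leI[of "sqrt (4 * pi * J n t)" "4 * sqrt (J n t)"] J0[of n t] by (simp add: ennreal_mult)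
    then have "(\<integral>\<^sup>+t. f n t \<partial>lborel) \<le> (\<integral>\<^sup>+t. 4 * (ennreal (sqrt (J n t)) * indicator {0..real n} t) \<partial>lborel)"
      unfolding f_def by (intro nn_integral_mono) (auto simp: indicator_def)
    also have "\<dots> = 4 * (\<integral>\<^sup>+t. ennreal (sqrt (J n t)) * indicator {0..real n} t \<partial>lborel)"
    proof (rule nn_integral_cmult)
      have "(\<lambda>t. sqrt (J n t)) \<in> borel_measurable borel" by (intro borel_measurable_continuous_onI continuous_intros cJ)
      then show "(\<lambda>t. ennreal (sqrt (J n t)) * indicator {0..real n} t) \<in> borel_measurable lborel" by measurable
    qed
    also have "\<dots> \<le> 4 * ennreal C"
      unfolding C_def J_def by (intro mult_left_mono truncated_bound) auto
    finally show ?thesis .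
  qed
  have "(\<integral>\<^sup>+t. ennreal (g t) * indicator {0..} t \<partial>lborel) = (\<integral>\<^sup>+t. liminf (\<lambda>n. f n t) \<partial>lborel)"
    by (simp add: flim)
  also have "\<dots> \<le> liminf (\<lambda>n. \<integral>\<^sup>+t. f n t \<partial>lborel)"
  proof (rule nn_integral_liminf)
    show "f n \<in> borel_measurable lborel" for n using mJ[of n] unfolding f_def by measurable
  qed
  also have "\<dots> \<le> 4 * ennreal C"
    using Liminf_mono[of "\<lambda>n. \<integral>\<^sup>+t. f n t \<partial>lborel" "\<lambda>_. 4 * ennreal C" sequentially] fint
    by (simp add: Liminf_const)
  also have "\<dots> < \<infinity>" by (simp add: ennreal_mult_less_top)
  finally show "(\<integral>\<^sup>+t. ennreal (sqrt (enn2real (rint (\<lambda>r. \<bar>u t r\<bar> ^ 10)))) * indicator {0..} t \<partial>lborel) < \<infinity>" by (simp add: g_def)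
qed

end

text \<open>The two half-lines are treated by the same bound, the negative one through reflection.
  At each single time the inner integral is finite because \<open>u^4\<close> is bounded by the
  pointwise decay and \<open>u^6\<close> is integrable.\<close>

lemma NLW_sol_scatters:
  assumes "NLW_sol u v U0"
  shows "in_L5L10 UNIV u"
proof -
  obtain ux where "nlw u v ux" using assms unfolding NLW_sol_def nlw_def by blast
  then interpret nlw u v ux .
  have fin: "rint (\<lambda>r. \<bar>u t r\<bar> ^ 10) < \<infinity>" for t
  proof -
    have c: "(u t r) ^ 4 \<le> (l2 (ux t)) ^ 4" if "1 \<le> r" for r
    proof -
      have "1 * (u t r)\<^sup>2 \<le> r * (u t r)\<^sup>2" using that by (intro mult_right_mono) auto
      also have "\<dots> \<le> (l2 (ux t))\<^sup>2" by (rule radial_pointwise[OF rd HD(4) HD(6) that])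
      finally have "(u t r)\<^sup>2 \<le> (l2 (ux t))\<^sup>2" by simp
      then have "((u t r)\<^sup>2)\<^sup>2 \<le> ((l2 (ux t))\<^sup>2)\<^sup>2" by (rule power_mono) simp
      then show ?thesis by simp
    qed
    \<comment> \<open>Both summands are taken equal, so that \<open>rint_le_add\<close> acts as
      comparison with a multiple of one function.\<close>
    have "rint (\<lambda>r. \<bar>u t r\<bar> ^ 10) \<le> ennreal ((l2 (ux t)) ^ 4) * rint (\<lambda>r. \<bar>u t r\<bar> ^ 6) + ennreal ((l2 (ux t)) ^ 4) * rint (\<lambda>r. \<bar>u t r\<bar> ^ 6)"
    proof (rule rint_le_add)
      show "lmeas (\<lambda>r. \<bar>u t r\<bar> ^ 6)" "lmeas (\<lambda>r. \<bar>u t r\<bar> ^ 6)" by (intro lmeas_continuous continuous_intros HD(3))+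
      fix r :: real assume r: "1 \<le> r"
      have "\<bar>u t r\<bar> ^ 10 = (u t r) ^ 4 * \<bar>u t r\<bar> ^ 6" by (simp add: power_even_abs flip: power_add)
      also have "\<dots> \<le> (l2 (ux t)) ^ 4 * \<bar>u t r\<bar> ^ 6" using c[OF r] by (intro mult_right_mono) auto
      also have "\<dots> \<le> \<dots> + \<dots>" by simp
      finally show "\<bar>u t r\<bar> ^ 10 \<le> (l2 (ux t)) ^ 4 * \<bar>u t r\<bar> ^ 6 + (l2 (ux t)) ^ 4 * \<bar>u t r\<bar> ^ 6" .
    qed auto
    also have "\<dots> < \<infinity>" using HD(6)[of t] by (simp add: ennreal_mult_less_top)
    finally show ?thesis .
  qed
  obtain A L \<epsilon>0 where ww: "weak_wave u A L \<epsilon>0" using weak_wave by blast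
  define g where "g = (\<lambda>t. sqrt (enn2real (rint (\<lambda>r. \<bar>u t r\<bar> ^ 10))))"
  have gm: "g \<in> borel_measurable borel" and pos: "(\<integral>\<^sup>+t. ennreal (g t) * indicator {0..} t \<partial>lborel) < \<infinity>"
    using weak_wave.half_line_bound[OF ww fin] unfolding g_def by auto
  have neg: "(\<integral>\<^sup>+t. ennreal (g (- t)) * indicator {0..} t \<partial>lborel) < \<infinity>"
    using weak_wave.half_line_bound(2)[OF weak_wave_reflect[OF ww] fin] by (simp add: g_def)
  have refl: "(\<integral>\<^sup>+t. ennreal (g t) * indicator {..0} t \<partial>lborel) = (\<integral>\<^sup>+t. ennreal (g (- t)) * indicator {0..} t \<partial>lborel)"
  proof -
    have "(\<integral>\<^sup>+t. ennreal (g t) * indicator {..0} t \<partial>lborel) = (\<integral>\<^sup>+t. ennreal (g (- t)) * indicator {..0} (- t) \<partial>lborel)"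
      using gm by (subst nn_integral_real_affine[where c = "-1" and t = 0]) (simp_all, measurable)
    also have "\<dots> = (\<integral>\<^sup>+t. ennreal (g (- t)) * indicator {0..} t \<partial>lborel)"
      by (intro nn_integral_cong) (simp add: indicator_def)
    finally show ?thesis .
  qed
  have "(\<integral>\<^sup>+t. indicator UNIV t * ennreal (g t) \<partial>lborel) \<le> (\<integral>\<^sup>+t. ennreal (g t) * indicator {0..} t + ennreal (g t) * indicator {..0} t \<partial>lborel)"
    by (rule nn_integral_mono) (auto simp: indicator_def)
  also have "\<dots> = (\<integral>\<^sup>+t. ennreal (g t) * indicator {0..} t \<partial>lborel) + (\<integral>\<^sup>+t. ennreal (g t) * indicator {..0} t \<partial>lborel)"
    using gm by (intro nn_integral_add; measurable)
  also have "\<dots> < \<infinity>" using pos neg refl by simp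
  finally show ?thesis using fin by (simp add: in_L5L10_def g_def)
qed

theorem theorem5p1:
  fixes S :: "real \<Rightarrow> hpair \<Rightarrow> hpair"
  assumes "NLW_Neumann_flow S"
    and "critical_energy S < \<infinity>"
  shows "\<exists>Uc. in_H Uc \<and> Hnorm Uc \<noteq> 0 \<and>
           (\<forall>tn :: nat \<Rightarrow> real. \<exists>\<sigma> W. strict_mono \<sigma> \<and> in_H W \<and>
              (\<lambda>n. Hnorm (Hdiff (S (tn (\<sigma> n)) Uc) W)) \<longlonglongrightarrow> 0)"
proof -
  have scatter: "in_L5L10 UNIV (\<lambda>t. fst (S t U))" if "in_H U" for U
    using assms(1) that NLW_sol_scatters unfolding NLW_Neumann_flow_def by blast
  \<comment> \<open>No smallness enters \<open>scatter\<close>, so every positive threshold belongs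
    to the set defining the critical energy.\<close>
  have "ereal x \<le> critical_energy S" if "0 < x" for x
    unfolding critical_energy_def using that scatter by (intro Sup_upper) auto
  then have large: "ereal (max x 1) \<le> critical_energy S" for x by (simp del: ereal_max)
  \<comment> \<open>A real number strictly above the supremum would also lie below it, after
    replacing it by \<open>max x 1\<close> to make it positive. The assumption on the critical
    energy is thus contradictory, and the existence claim follows from it.\<close>
  obtain x where "critical_energy S < ereal x" using ereal_dense2[OF assms(2)] by blast
  also have "ereal x \<le> ereal (max x 1)" by simp
  also have "\<dots> \<le> critical_energy S" by (rule large)
  finally show ?thesis by simp
qed

end
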